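(* Let $\tau\in\mathbb{C}$ with $\mathrm{Im}\,\tau>0$, let $n,m$ be positive integers and $a,b$ integers with $bn-am=1$ (so that $\frac an<\frac bm$ and $\dim\mathrm{Ext}^1(E_{(\frac bm,\frac\nu m)},E_{(\frac an,\frac\mu n)})=1$), and let $\mu,\nu\in\mathbb{C}$. Let $\psi'$ be a degree one morphism from $E_{(\frac bm,\frac\nu m)}$ to $E_{(\frac an,\frac\mu n)}$ whose class in $\mathrm{Ext}^1(E_{(\frac bm,\frac\nu m)},E_{(\frac an,\frac\mu n)})$ is non-trivial, with mapping cone $C(\psi')$. Then, for $\eta\in\mathbb{C}$, $C(\psi')\cong E_{(\frac{a+b}{m+n},\frac{\eta}{m+n})}$ as holomorphic vector bundles if and only if $\eta\equiv\mu+\nu+\pi+\pi\tau\pmod{2\pi(\mathbb{Z}\oplus\tau\mathbb{Z})}$.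
   Context: Notation: $i=\sqrt{-1}$; $\check T^2=\mathbb{C}/2\pi(\mathbb{Z}\oplus\tau\mathbb{Z})$ with real coordinates $(x,y)$, $x\sim x+2\pi$, $y\sim y+2\pi$, and complex coordinate $z=x+\tau y$, so $\bar\partial f=\frac{\tau\partial_xf-\partial_yf}{\tau-\bar\tau}\,d\bar z$. For relatively prime $n\in\mathbb{N}$ ($n\ge1$), $a\in\mathbb{Z}$ and $\mu\in\mathbb{C}$, $E_{(\frac an,\frac\mu n)}$ is the holomorphic vector bundle of rank $n$ and degree $a$ on $\check T^2$ defined as follows. Let $\omega=e^{2\pi i/n}$, $U=\mathrm{diag}(1,\omega,\dots,\omega^{n-1})$, and let $V$ be the $n\times n$ matrix with $V_{j,j+1}=1$ for $1\le j\le n-1$, $V_{n,1}=1$ and all other entries $0$ ($U=V=1$ if $n=1$). Smooth sections are smooth $f:\mathbb{R}^2\to\mathbb{C}^n$ with $f(x+2\pi,y)=e^{\frac aniy}Vf(x,y)$ and $f(x,y+2\pi)=U^{-a}f(x,y)$. The connection is $D=d-\frac{i}{2\pi}\left(\frac anx+\frac\mu n\right)dy\cdot I_n$, and the holomorphic structure is given by $d_{\frac an}:=2D^{(0,1)}=\left(2\bar\partial-\frac{i}{\pi(\bar\tau-\tau)}\left(\frac anx+\frac\mu n\right)d\bar z\right)I_n$. A degree one morphism $\psi'$ from $E_{(\frac bm,\frac\nu m)}$ to $E_{(\frac an,\frac\mu n)}$ is $\psi'=\tilde\psi'\,d\bar z$ with $\tilde\psi'$ a smooth bundle map; its class in $\mathrm{Ext}^1(E_{(\frac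 bm,\frac\nu m)},E_{(\frac an,\frac\mu n)})=H^1$ is non-trivial if $\psi'$ is not of the form $d_{\frac an}f-fd_{\frac bm}$ with $f$ a smooth bundle map $E_{(\frac bm,\frac\nu m)}\to E_{(\frac an,\frac\mu n)}$. The mapping cone $C(\psi')$ is the smooth bundle $E_{(\frac an,\frac\mu n)}\oplus E_{(\frac bm,\frac\nu m)}$ with holomorphic structure given by the operator $\begin{pmatrix}d_{\frac an}&\psi'\\0&d_{\frac bm}\end{pmatrix}$. *)

theory Defs
  imports "HOL-Analysis.Derivative" "Jordan_Normal_Form.Matrix"
begin

definition partial_x :: "(real \<times> real \<Rightarrow> complex) \<Rightarrow> real \<times> real \<Rightarrow> complex" where
  "partial_x f p = frechet_derivative f (at p) (1, 0)"

definition partial_y :: "(real \<times> real \<Rightarrow> complex) \<Rightarrow> real \<times> real \<Rightarrow> complex" where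
  "partial_y f p = frechet_derivative f (at p) (0, 1)"

primrec times_diff :: "nat \<Rightarrow> (real \<times> real \<Rightarrow> complex) \<Rightarrow> bool" where
  "times_diff 0 f \<longleftrightarrow> continuous_on UNIV f"
| "times_diff (Suc k) f \<longleftrightarrow> (\<forall>p. f differentiable (at p)) \<and>
     times_diff k (partial_x f) \<and> times_diff k (partial_y f)"

definition smooth :: "(real \<times> real \<Rightarrow> complex) \<Rightarrow> bool" where
  "smooth f \<longleftrightarrow> (\<forall>k. times_diff k f)"

definition smooth_vec :: "nat \<Rightarrow> (real \<times> real \<Rightarrow> complex vec) \<Rightarrow> bool" where
  "smooth_vec n s \<longleftrightarrow> (\<forall>p. s p \<in> carrier_vec n) \<and> (\<forall>j<n. smooth (\<lambda>p. vec_index (s p) j))"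

definition smooth_mat :: "nat \<Rightarrow> nat \<Rightarrow> (real \<times> real \<Rightarrow> complex mat) \<Rightarrow> bool" where
  "smooth_mat n m \<Phi> \<longleftrightarrow> (\<forall>p. \<Phi> p \<in> carrier_mat n m) \<and>
     (\<forall>i<n. \<forall>j<m. smooth (\<lambda>p. \<Phi> p $$ (i, j)))"

text \<open>The coefficient of \<open>d (cnj z)\<close> in the Dolbeault operator in the coordinate \<open>z = x + \<tau> y\<close>.\<close>

definition delbar :: "complex \<Rightarrow> (real \<times> real \<Rightarrow> complex) \<Rightarrow> real \<times> real \<Rightarrow> complex" where
  "delbar \<tau> f p = (\<tau> * partial_x f p - partial_y f p) / (\<tau> - cnj \<tau>)"

definition delbar_vec ::
  "complex \<Rightarrow> (real \<times> real \<Rightarrow> complex vec) \<Rightarrow> real \<times> real \<Rightarrow> complex vec" where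
  "delbar_vec \<tau> s p = vec (dim_vec (s p)) (\<lambda>j. delbar \<tau> (\<lambda>q. vec_index (s q) j) p)"

text \<open>
  A smooth vector bundle on the torus is given by its rank and its two factors of automorphy
  (for the translations by \<open>2\<pi>\<close> in \<open>x\<close> and in \<open>y\<close>); a holomorphic structure on it is given by an
  operator on smooth sections with values in (0,1)-forms. A (0,1)-form is represented by its
  coefficient with respect to the global frame \<open>d (cnj z)\<close>.
\<close>

record torus_bundle =
  rank :: nat
  fac_x :: "real \<times> real \<Rightarrow> complex mat"
  fac_y :: "real \<times> real \<Rightarrow> complex mat"
  hol_op :: "(real \<times> real \<Rightarrow> complex vec) \<Rightarrow> real \<times> real \<Rightarrow> complex vec"

definition sections :: "torus_bundle \<Rightarrow> (real \<times> real \<Rightarrow> complex vec) set" where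
  "sections E = {s. smooth_vec (rank E) s \<and>
     (\<forall>x y. s (x + 2 * pi, y) = fac_x E (x, y) *\<^sub>v s (x, y)) \<and>
     (\<forall>x y. s (x, y + 2 * pi) = fac_y E (x, y) *\<^sub>v s (x, y))}"

definition bundle_map :: "torus_bundle \<Rightarrow> torus_bundle \<Rightarrow> (real \<times> real \<Rightarrow> complex mat) \<Rightarrow> bool" where
  "bundle_map E F \<Phi> \<longleftrightarrow> smooth_mat (rank F) (rank E) \<Phi> \<and>
     (\<forall>x y. \<Phi> (x + 2 * pi, y) * fac_x E (x, y) = fac_x F (x, y) * \<Phi> (x, y)) \<and>
     (\<forall>x y. \<Phi> (x, y + 2 * pi) * fac_y E (x, y) = fac_y F (x, y) * \<Phi> (x, y))"

definition hol_isomorphic :: "torus_bundle \<Rightarrow> torus_bundle \<Rightarrow> bool" where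
  "hol_isomorphic E F \<longleftrightarrow> (\<exists>\<Phi>. bundle_map E F \<Phi> \<and> (\<forall>p. invertible_mat (\<Phi> p)) \<and>
     (\<forall>s \<in> sections E. \<forall>p. hol_op F (\<lambda>q. \<Phi> q *\<^sub>v s q) p = \<Phi> p *\<^sub>v hol_op E s p))"

text \<open>
  A degree one morphism \<open>\<psi>\<close> from \<open>E\<close> to \<open>F\<close> is represented by its coefficient of \<open>d (cnj z)\<close>, which is
  a smooth bundle map from \<open>E\<close> to \<open>F\<close>.
\<close>

definition ext1_trivial :: "torus_bundle \<Rightarrow> torus_bundle \<Rightarrow> (real \<times> real \<Rightarrow> complex mat) \<Rightarrow> bool" where
  "ext1_trivial E F \<psi> \<longleftrightarrow> (\<exists>f. bundle_map E F f \<and>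
     (\<forall>s \<in> sections E. \<forall>p.
        \<psi> p *\<^sub>v s p = hol_op F (\<lambda>q. f q *\<^sub>v s q) p - f p *\<^sub>v hol_op E s p))"

definition mapping_cone ::
  "torus_bundle \<Rightarrow> torus_bundle \<Rightarrow> (real \<times> real \<Rightarrow> complex mat) \<Rightarrow> torus_bundle" where
  "mapping_cone E F \<psi> =
     \<lparr> rank = rank F + rank E,
       fac_x = (\<lambda>p. four_block_mat (fac_x F p) (0\<^sub>m (rank F) (rank E))
                                   (0\<^sub>m (rank E) (rank F)) (fac_x E p)),
       fac_y = (\<lambda>p. four_block_mat (fac_y F p) (0\<^sub>m (rank F) (rank E))
                                   (0\<^sub>m (rank E) (rank F)) (fac_y E p)),
       hol_op = (\<lambda>s p.
         (hol_op F (\<lambda>q. vec_first (s q) (rank F)) p + \<psi> p *\<^sub>v vec_last (s p) (rank E))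
         @\<^sub>v hol_op E (\<lambda>q. vec_last (s q) (rank E)) p) \<rparr>"

text \<open>
  \<open>clock_pow n k\<close> is the \<open>k\<close>-th power of the diagonal matrix \<open>diag (1, w, \<dots>, w ^ (n - 1))\<close>
  with \<open>w = exp (2 \<pi> \<i> / n)\<close>; indices start at 0.
\<close>

definition clock_pow :: "nat \<Rightarrow> int \<Rightarrow> complex mat" where
  "clock_pow n k = mat n n (\<lambda>(i, j). if i = j then (cis (2 * pi / real n) ^ i) powi k else 0)"

definition shift_mat :: "nat \<Rightarrow> complex mat" where
  "shift_mat n = mat n n (\<lambda>(i, j). if j = (i + 1) mod n then 1 else 0)"

text \<open>
  \<open>E_bundle \<tau> n a \<mu>\<close> is the bundle of slope \<open>a / n\<close> with parameter \<open>\<mu> / n\<close>, where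
  \<open>a\<close> and \<open>n \<ge> 1\<close> are coprime.
\<close>

definition E_bundle :: "complex \<Rightarrow> nat \<Rightarrow> int \<Rightarrow> complex \<Rightarrow> torus_bundle" where
  "E_bundle \<tau> n a \<mu> =
     \<lparr> rank = n,
       fac_x = (\<lambda>(x, y). cis (real_of_int a / real n * y) \<cdot>\<^sub>m shift_mat n),
       fac_y = (\<lambda>_. clock_pow n (- a)),
       hol_op = (\<lambda>s (x, y).
         2 \<cdot>\<^sub>v delbar_vec \<tau> s (x, y)
         - (\<i> / (of_real pi * (cnj \<tau> - \<tau>))
              * (of_int a / of_nat n * of_real x + \<mu> / of_nat n)) \<cdot>\<^sub>v s (x, y)) \<rparr>"

end

theory Submission
  imports Defs "HOL-Complex_Analysis.Cauchy_Integral_Formula" "Jordan_Normal_Form.Determinant"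
begin

text \<open>A bundle map between two of these bundles whose slopes \<open>b / m\<close> and \<open>a / n\<close> are Farey neighbours
  is the Zak transform of one Schwartz function on the line, and under this transform the Dolbeault
  operator becomes a first order ordinary differential operator with Gaussian integrating factor.
  Hence a (0,1)-form with values in the maps of negative degree is a coboundary iff one integral
  vanishes, and there are no holomorphic maps of negative degree.

  For the right parameters \<open>\<eta>\<close>, Gaussians give holomorphic maps \<open>\<alpha>\<close> and \<open>\<beta>\<close> between the outer
  bundles and the bundle of the mediant slope. Theta functions of degree \<open>n\<close> cannot vanish at \<open>M > n\<close>
  points, so \<open>\<alpha>\<close> is injective and \<open>\<beta>\<close> is surjective in every fibre, and \<open>\<beta> \<alpha> = 0\<close> because the terms of
  the product cancel in pairs. The class of this exact sequence is nonzero, so every nontrivial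
  extension is a multiple of it up to a coboundary, and its cone is the mediant bundle.

  Conversely, the determinant \<open>g\<close> of an isomorphism is antiperiodic in both directions and nowhere zero, and
  it solves \<open>2 delbar g = const (\<eta> - \<mu> - \<nu>) g\<close>; its Fourier coefficients then pin down
  \<open>\<eta> - \<mu> - \<nu>\<close>.\<close>

text \<open>A sign decides everything. For maps between bundles the equation on the line is h' + (2
  A x + B) h = rho up to a constant factor, where A is i/(4 pi \<tau>) times the slope of the target
  minus the slope of the source. If this difference is negative, the integrating factor decays:
  homogeneous solutions grow, and one integral obstructs solvability. If it is positive, the
  homogeneous solution itself is a decaying Gaussian. The mediant lies between the two outer slopes
  and is a Farey neighbour of both, so both maps of the exact sequence go up in slope and exist. A
  holomorphic splitting of the sequence would go down in slope and hence vanish, which is why the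
  class is nonzero. The half periods come from parity. With \<eta> - \<mu> - \<nu> = - pi c + pi
  \<tau> d, the terms of \<beta> \<alpha> are paired by reflecting an integer k about c/2. For odd c
  no term is paired with itself, and then the sign of a pair is (-1)^d. Holomorphy of an isomorphism
  is tested on global sections only, so the converse also requires sections that span every
  fibre.\<close>

section \<open>Partial derivatives and smooth functions on the plane\<close>

lemma partial_xI: "(f has_derivative D) (at p) \<Longrightarrow> partial_x f p = D (1, 0)"
  unfolding partial_x_def using frechet_derivative_at by metis

lemma partial_yI: "(f has_derivative D) (at p) \<Longrightarrow> partial_y f p = D (0, 1)"
  unfolding partial_y_def using frechet_derivative_at by metis

lemma has_derivative_partials:
  assumes "f differentiable (at p)"
  shows "(f has_derivative (\<lambda>v. fst v *\<^sub>R partial_x f p + snd v *\<^sub>R partial_y f p)) (at p)"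
proof -
  from assms obtain D where D: "(f has_derivative D) (at p)"
    by (auto simp: differentiable_def)
  have lin: "linear D" using D has_derivative_linear by blast
  have "D v = fst v *\<^sub>R D (1,0) + snd v *\<^sub>R D (0,1)" for v
  proof -
    have "v = fst v *\<^sub>R (1,0) + snd v *\<^sub>R (0,1)" by (cases v) auto
    then have "D v = D (fst v *\<^sub>R (1,0) + snd v *\<^sub>R (0,1))" by simp
    also have "\<dots> = fst v *\<^sub>R D (1,0) + snd v *\<^sub>R D (0,1)"
      unfolding linear_add[OF lin] linear_scale[OF lin] ..
    finally show ?thesis .
  qed
  then have "D = (\<lambda>v. fst v *\<^sub>R D (1,0) + snd v *\<^sub>R D (0,1))" by blast
  then show ?thesis using D partial_xI[OF D] partial_yI[OF D] by metis
qed

lemma partial_add: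
  assumes "f differentiable (at p)" "g differentiable (at p)"
  shows "partial_x (\<lambda>q. f q + g q) p = partial_x f p + partial_x g p"
    and "partial_y (\<lambda>q. f q + g q) p = partial_y f p + partial_y g p"
  using has_derivative_add[OF has_derivative_partials[OF assms(1)] has_derivative_partials[OF assms(2)]]
  by (auto dest: partial_xI partial_yI)

lemma partial_mult:
  assumes "f differentiable (at p)" "g differentiable (at p)"
  shows "partial_x (\<lambda>q. f q * g q) p = f p * partial_x g p + partial_x f p * g p"
    and "partial_y (\<lambda>q. f q * g q) p = f p * partial_y g p + partial_y f p * g p"
  using has_derivative_mult[OF has_derivative_partials[OF assms(1)] has_derivative_partials[OF assms(2)]]
  by (auto dest: partial_xI partial_yI)

lemma partial_const [simp]: "partial_x (\<lambda>q. c) p = 0" "partial_y (\<lambda>q. c) p = 0"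
  using partial_xI[OF has_derivative_const[of c "at p"]] partial_yI[OF has_derivative_const[of c "at p"]]
  by simp_all

lemma partial_sum:
  assumes "\<And>i. i \<in> I \<Longrightarrow> f i differentiable (at p)"
  shows "partial_x (\<lambda>q. \<Sum>i\<in>I. f i q) p = (\<Sum>i\<in>I. partial_x (f i) p)"
    and "partial_y (\<lambda>q. \<Sum>i\<in>I. f i q) p = (\<Sum>i\<in>I. partial_y (f i) p)"
  using has_derivative_sum[of I f, OF has_derivative_partials[OF assms]]
  by (auto dest: partial_xI partial_yI)

lemma partial_inverse:
  assumes "f differentiable (at p)" "f p \<noteq> 0"
  shows "partial_x (\<lambda>q. inverse (f q)) p = - (inverse (f p) * partial_x f p * inverse (f p))"
    and "partial_y (\<lambda>q. inverse (f q)) p = - (inverse (f p) * partial_y f p * inverse (f p))"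
  using Deriv.has_derivative_inverse[OF assms(2) has_derivative_partials[OF assms(1)]]
  by (auto dest: partial_xI partial_yI)

lemma differentiable_cnj:
  assumes "f differentiable (at p)"
  shows "(\<lambda>q. cnj (f q)) differentiable (at p)"
    "partial_x (\<lambda>q. cnj (f q)) p = cnj (partial_x f p)"
    "partial_y (\<lambda>q. cnj (f q)) p = cnj (partial_y f p)"
  using has_derivative_cnj[OF has_derivative_partials[OF assms]]
  by (auto dest: partial_xI partial_yI simp: differentiable_def)

text \<open>The recursion asks for continuity only of the last derivatives; continuity of f itself
  has to be recovered from differentiability.\<close>

lemma times_diff_Suc_imp: "times_diff (Suc k) f \<Longrightarrow> times_diff k f"
proof (induction k arbitrary: f)
  case 0
  then show ?case
    by (auto intro!: differentiable_imp_continuous_on simp: differentiable_on_def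
        intro: differentiable_at_withinI)
next
  case (Suc k)
  then show ?case by (metis times_diff.simps(2))
qed

lemma times_diff_const: "times_diff k (\<lambda>q. c)"
proof (induction k arbitrary: c)
  case 0
  then show ?case by simp
next
  case (Suc k)
  have "partial_x (\<lambda>q. c) = (\<lambda>q. 0)" "partial_y (\<lambda>q. c) = (\<lambda>q. 0)"
    by (simp_all add: fun_eq_iff)
  then show ?case using Suc by simp
qed

lemma times_diff_add: "times_diff k f \<Longrightarrow> times_diff k g \<Longrightarrow> times_diff k (\<lambda>q. f q + g q)"
proof (induction k arbitrary: f g)
  case 0
  then show ?case by (simp add: continuous_on_add continuous_on_mult continuous_on_inverse continuous_on_cnj)
next
  case (Suc k)
  then have "partial_x (\<lambda>q. f q + g q) = (\<lambda>p. partial_x f p + partial_x g p)"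
    "partial_y (\<lambda>q. f q + g q) = (\<lambda>p. partial_y f p + partial_y g p)"
    by (auto simp: partial_add)
  then show ?case using Suc by auto
qed

lemma times_diff_mult: "times_diff k f \<Longrightarrow> times_diff k g \<Longrightarrow> times_diff k (\<lambda>q. f q * g q)"
proof (induction k arbitrary: f g)
  case 0
  then show ?case by (simp add: continuous_on_add continuous_on_mult continuous_on_inverse continuous_on_cnj)
next
  case (Suc k)
  then have "partial_x (\<lambda>q. f q * g q) = (\<lambda>p. f p * partial_x g p + partial_x f p * g p)"
    "partial_y (\<lambda>q. f q * g q) = (\<lambda>p. f p * partial_y g p + partial_y f p * g p)"
    by (auto simp: partial_mult)
  moreover have "times_diff k f" "times_diff k g"
    using Suc.prems[THEN times_diff_Suc_imp] by simp_all
  ultimately show ?case using Suc by (auto intro!: times_diff_add)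
qed

lemma times_diff_inverse:
  "times_diff k f \<Longrightarrow> (\<And>p. f p \<noteq> 0) \<Longrightarrow> times_diff k (\<lambda>q. inverse (f q))"
proof (induction k arbitrary: f)
  case 0
  then show ?case by (simp add: continuous_on_add continuous_on_mult continuous_on_inverse continuous_on_cnj)
next
  case (Suc k)
  \<comment> \<open>Writing the sign as a factor -1 lets closure under products and constants finish
    the induction.\<close>
  then have "partial_x (\<lambda>q. inverse (f q)) = (\<lambda>p. (-1) * (inverse (f p) * partial_x f p * inverse (f p)))"
    "partial_y (\<lambda>q. inverse (f q)) = (\<lambda>p. (-1) * (inverse (f p) * partial_y f p * inverse (f p)))"
    by (auto simp: partial_inverse)
  moreover have "times_diff k (\<lambda>q. inverse (f q))"
    using Suc.IH Suc.prems(1)[THEN times_diff_Suc_imp] Suc.prems(2) by simp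
  moreover have "(\<lambda>q. inverse (f q)) differentiable (at p)" for p
    using Suc.prems by (intro differentiable_inverse) (auto simp del: split_paired_All)
  moreover have "times_diff k (\<lambda>p. (-1) * (inverse (f p) * g p * inverse (f p)))"
    if "times_diff k g" for g
    by (intro times_diff_mult times_diff_const calculation that)
  ultimately show ?case using Suc.prems(1) by simp
qed

lemma times_diff_cnj: "times_diff k f \<Longrightarrow> times_diff k (\<lambda>q. cnj (f q))"
proof (induction k arbitrary: f)
  case 0
  then show ?case by (simp add: continuous_on_add continuous_on_mult continuous_on_inverse continuous_on_cnj)
next
  case (Suc k)
  then have "partial_x (\<lambda>q. cnj (f q)) = (\<lambda>p. cnj (partial_x f p))"
    "partial_y (\<lambda>q. cnj (f q)) = (\<lambda>p. cnj (partial_y f p))"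
    by (auto simp: differentiable_cnj(2,3))
  then show ?case using Suc by (auto intro: differentiable_cnj(1))
qed

named_theorems smooth_intros

lemma smooth_const [smooth_intros]: "smooth (\<lambda>q. c)"
  by (simp add: smooth_def times_diff_const)

lemma smooth_add [smooth_intros]: "smooth f \<Longrightarrow> smooth g \<Longrightarrow> smooth (\<lambda>q. f q + g q)"
  by (simp add: smooth_def times_diff_add)

lemma smooth_mult [smooth_intros]: "smooth f \<Longrightarrow> smooth g \<Longrightarrow> smooth (\<lambda>q. f q * g q)"
  by (simp add: smooth_def times_diff_mult)

lemma smooth_minus [smooth_intros]: "smooth f \<Longrightarrow> smooth (\<lambda>q. - f q)"
  using smooth_mult[OF smooth_const[of "-1"], of f] by simp

lemma smooth_diff [smooth_intros]: "smooth f \<Longrightarrow> smooth g \<Longrightarrow> smooth (\<lambda>q. f q - g q)"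
  using smooth_add[of f "\<lambda>q. - g q"] smooth_minus[of g] by simp

lemma smooth_inverse: "smooth f \<Longrightarrow> (\<And>p. f p \<noteq> 0) \<Longrightarrow> smooth (\<lambda>q. inverse (f q))"
  by (simp add: smooth_def times_diff_inverse)

lemma smooth_cnj [smooth_intros]: "smooth f \<Longrightarrow> smooth (\<lambda>q. cnj (f q))"
  by (simp add: smooth_def times_diff_cnj)

lemma smooth_sum [smooth_intros]:
  "(\<And>i. i \<in> I \<Longrightarrow> smooth (f i)) \<Longrightarrow> smooth (\<lambda>q. \<Sum>i\<in>I. f i q)"
  by (induction I rule: infinite_finite_induct) (auto intro: smooth_intros)

lemma smooth_prod [smooth_intros]:
  "(\<And>i. i \<in> I \<Longrightarrow> smooth (f i)) \<Longrightarrow> smooth (\<lambda>q. \<Prod>i\<in>I. f i q)"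
  by (induction I rule: infinite_finite_induct) (auto intro: smooth_intros)

lemma smooth_imp_differentiable: "smooth f \<Longrightarrow> f differentiable (at p)"
  unfolding smooth_def using times_diff.simps(2) by blast

lemma smooth_imp_continuous: "smooth f \<Longrightarrow> continuous_on UNIV f"
  unfolding smooth_def using times_diff.simps(1) by blast

lemma smooth_partial_x [smooth_intros]: "smooth f \<Longrightarrow> smooth (partial_x f)"
  unfolding smooth_def using times_diff.simps(2) by blast

lemma smooth_partial_y [smooth_intros]: "smooth f \<Longrightarrow> smooth (partial_y f)"
  unfolding smooth_def using times_diff.simps(2) by blast

lemma smooth_delbar [smooth_intros]: "smooth f \<Longrightarrow> smooth (delbar \<tau> f)"
proof -
  assume "smooth f"
  then have "smooth (\<lambda>p. (\<tau> * partial_x f p + (-1) * partial_y f p) * (1 / (\<tau> - cnj \<tau>)))"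
    by (intro smooth_intros)
  moreover have "(\<lambda>p. (\<tau> * partial_x f p + (-1) * partial_y f p) * (1 / (\<tau> - cnj \<tau>))) = delbar \<tau> f"
    by (auto simp: delbar_def)
  ultimately show ?thesis by simp
qed

lemma has_derivative_fst_snd:
  "((\<lambda>q::real \<times> real. complex_of_real (fst q)) has_derivative (\<lambda>v. complex_of_real (fst v))) (at p)"
  "((\<lambda>q::real \<times> real. complex_of_real (snd q)) has_derivative (\<lambda>v. complex_of_real (snd v))) (at p)"
  by (auto intro!: derivative_eq_intros)

lemma smooth_fst: "smooth (\<lambda>q. complex_of_real (fst q))"
proof -
  have e: "partial_x (\<lambda>q. complex_of_real (fst q)) = (\<lambda>q. 1)"
    "partial_y (\<lambda>q. complex_of_real (fst q)) = (\<lambda>q. 0)"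
    using partial_xI[OF has_derivative_fst_snd(1)] partial_yI[OF has_derivative_fst_snd(1)]
    by (simp_all add: fun_eq_iff)
  have "times_diff k (\<lambda>q. complex_of_real (fst q))" for k
    by (cases k) (use has_derivative_fst_snd(1) in \<open>auto simp: e times_diff_const differentiable_def
       intro!: continuous_intros\<close>)
  then show ?thesis by (simp add: smooth_def)
qed

text \<open>Arbitrary complex exponents cover both the factors of automorphy
  \<open>cis (c * y)\<close> and the half-integer characters that turn antiperiodic functions into
  periodic ones.\<close>

lemma partial_character:
  fixes a b :: complex
  defines "f \<equiv> \<lambda>q::real \<times> real. exp (a * of_real (fst q) + b * of_real (snd q))"
  shows "f differentiable (at p)" "partial_x f p = a * f p" "partial_y f p = b * f p"
proof -
  have "(f has_derivative (\<lambda>v. (a * of_real (fst v) + b * of_real (snd v)) * f p)) (at p)"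
  proof -
    have "((\<lambda>q::real \<times> real. a * of_real (fst q) + b * of_real (snd q)) has_derivative
      (\<lambda>v. a * of_real (fst v) + b * of_real (snd v))) (at p)"
      by (intro has_derivative_add has_derivative_mult_right has_derivative_fst_snd)
    from has_derivative_compose[OF this DERIV_exp[unfolded has_field_derivative_def]]
    show ?thesis unfolding f_def by (simp add: mult.commute)
  qed
  then show "f differentiable (at p)" "partial_x f p = a * f p" "partial_y f p = b * f p"
    by (auto dest: partial_xI partial_yI simp: differentiable_def)
qed

lemma smooth_character: "smooth (\<lambda>q. exp (a * of_real (fst q) + b * of_real (snd q)))"
proof -
  let ?f = "\<lambda>q::real \<times> real. exp (a * of_real (fst q) + b * of_real (snd q))"
  have e: "partial_x ?f = (\<lambda>q. a * ?f q)" "partial_y ?f = (\<lambda>q. b * ?f q)"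
    using partial_character[of a b] by auto
  have "times_diff k ?f" for k
  proof (induction k)
    case 0 then show ?case by (auto intro!: continuous_intros)
  next
    case (Suc k) then show ?case
      using partial_character(1)[of a b] by (auto simp: e times_diff_mult times_diff_const)
  qed
  then show ?thesis by (simp add: smooth_def)
qed

lemma has_vector_derivative_partial_x:
  assumes "f differentiable (at (x, y))"
  shows "((\<lambda>t. f (t, y)) has_vector_derivative partial_x f (x, y)) (at x)"
proof -
  have "((\<lambda>t::real. (t, y)) has_derivative (\<lambda>h. (h, 0))) (at x)"
    by (auto intro!: derivative_eq_intros)
  from has_derivative_compose[OF this has_derivative_partials[OF assms]]
  show ?thesis by (simp add: has_vector_derivative_def)
qed

lemma has_vector_derivative_partial_y:
  assumes "f differentiable (at (x, y))"
  shows "((\<lambda>t. f (x, t)) has_vector_derivative partial_y f (x, y)) (at y)"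
proof -
  have "((\<lambda>t::real. (x, t)) has_derivative (\<lambda>h. (0, h))) (at y)"
    by (auto intro!: derivative_eq_intros)
  from has_derivative_compose[OF this has_derivative_partials[OF assms]]
  show ?thesis by (simp add: has_vector_derivative_def)
qed

text \<open>This is how quasi-periodicity of a function passes to its partial derivatives.\<close>

lemma partial_translate:
  assumes "\<And>p. f differentiable (at p)"
  shows "(\<lambda>q. f (q + c)) differentiable (at p)"
    "partial_x (\<lambda>q. f (q + c)) p = partial_x f (p + c)"
    "partial_y (\<lambda>q. f (q + c)) p = partial_y f (p + c)"
proof -
  have 1: "((\<lambda>q. q + c) has_derivative (\<lambda>v. v)) (at p)" by (auto intro!: derivative_eq_intros)
  from has_derivative_compose[OF 1 has_derivative_partials[OF assms]]
  show "(\<lambda>q. f (q + c)) differentiable (at p)"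
    "partial_x (\<lambda>q. f (q + c)) p = partial_x f (p + c)"
    "partial_y (\<lambda>q. f (q + c)) p = partial_y f (p + c)"
    by (auto dest: partial_xI partial_yI simp: differentiable_def)
qed

section \<open>Schwartz functions and their Zak transforms\<close>

text \<open>One summable majorant for the terms and both their partials makes the two series of
  partials converge uniformly on S. The total derivative of the sum is assembled from these two
  limits, and since S is open the derivative within S is the full derivative.\<close>

lemma series_partials:
  fixes f :: "nat \<Rightarrow> real \<times> real \<Rightarrow> complex"
  assumes S: "open S" "convex S" "p \<in> S"
    and diff: "\<And>n q. q \<in> S \<Longrightarrow> f n differentiable (at q)"
    and bd0: "\<And>n q. q \<in> S \<Longrightarrow> norm (f n q) \<le> M n"
    and bdx: "\<And>n q. q \<in> S \<Longrightarrow> norm (partial_x (f n) q) \<le> M n"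
    and bdy: "\<And>n q. q \<in> S \<Longrightarrow> norm (partial_y (f n) q) \<le> M n"
    and M: "summable M"
  shows "(\<lambda>q. \<Sum>n. f n q) differentiable (at p)"
    "partial_x (\<lambda>q. \<Sum>n. f n q) p = (\<Sum>n. partial_x (f n) p)"
    "partial_y (\<lambda>q. \<Sum>n. f n q) p = (\<Sum>n. partial_y (f n) p)"
proof -
  define D where "D n q v = fst v *\<^sub>R partial_x (f n) q + snd v *\<^sub>R partial_y (f n) q"
    for n and q v :: "real \<times> real"
  define G where "G q v = fst v *\<^sub>R (\<Sum>n. partial_x (f n) q) + snd v *\<^sub>R (\<Sum>n. partial_y (f n) q)"
    for q v :: "real \<times> real"
  have ux: "uniform_limit S (\<lambda>n q. \<Sum>i<n. partial_x (f i) q) (\<lambda>q. \<Sum>i. partial_x (f i) q) sequentially"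
    by (rule Weierstrass_m_test[where M = M]) (use bdx M in auto)
  have uy: "uniform_limit S (\<lambda>n q. \<Sum>i<n. partial_y (f i) q) (\<lambda>q. \<Sum>i. partial_y (f i) q) sequentially"
    by (rule Weierstrass_m_test[where M = M]) (use bdy M in auto)
  have "\<exists>g. \<forall>x\<in>S. (\<lambda>n. f n x) sums (g x) \<and> (g has_derivative G x) (at x within S)"
  proof (rule has_derivative_series[where f' = D and x = p and l = "\<Sum>n. f n p"])
    show "(f n has_derivative D n x) (at x within S)" if "x \<in> S" for n x
      unfolding D_def by (rule has_derivative_at_withinI[OF has_derivative_partials[OF diff[OF that]]])
    show "\<forall>\<^sub>F n in sequentially. \<forall>x\<in>S. \<forall>h. norm ((\<Sum>i<n. D i x h) - G x h) \<le> e * norm h"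
      if "e > 0" for e
    proof -
      have "e / 2 > 0" using that by simp
      from uniform_limitD[OF ux this] uniform_limitD[OF uy this]
      show ?thesis
      proof eventually_elim
        case (elim n)
        show ?case
        proof (intro ballI allI)
          fix x and h :: "real \<times> real" assume x: "x \<in> S"
          let ?X = "(\<Sum>i<n. partial_x (f i) x) - (\<Sum>i. partial_x (f i) x)"
          let ?Y = "(\<Sum>i<n. partial_y (f i) x) - (\<Sum>i. partial_y (f i) x)"
          have "(\<Sum>i<n. D i x h) =
              fst h *\<^sub>R (\<Sum>i<n. partial_x (f i) x) + snd h *\<^sub>R (\<Sum>i<n. partial_y (f i) x)"
            unfolding D_def sum.distrib scaleR_sum_right ..
          then have eq: "(\<Sum>i<n. D i x h) - G x h = fst h *\<^sub>R ?X + snd h *\<^sub>R ?Y"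
            unfolding G_def scaleR_diff_right by simp
          have "norm (fst h *\<^sub>R ?X + snd h *\<^sub>R ?Y) \<le> \<bar>fst h\<bar> * norm ?X + \<bar>snd h\<bar> * norm ?Y"
            using norm_triangle_ineq[of "fst h *\<^sub>R ?X" "snd h *\<^sub>R ?Y"] by simp
          also have "\<dots> \<le> norm h * (e / 2) + norm h * (e / 2)"
          proof (intro add_mono mult_mono)
            show "\<bar>fst h\<bar> \<le> norm h" "\<bar>snd h\<bar> \<le> norm h"
              using norm_fst_le[of "fst h" "snd h"] norm_snd_le[of "snd h" "fst h"] by simp_all
            show "norm ?X \<le> e / 2" "norm ?Y \<le> e / 2"
              using elim x by (simp_all add: dist_norm less_imp_le)
          qed auto
          also have "\<dots> = e * norm h" by simp
          finally show "norm ((\<Sum>i<n. D i x h) - G x h) \<le> e * norm h" using eq by simp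
        qed
      qed
    qed
    show "(\<lambda>n. f n p) sums (\<Sum>n. f n p)"
      by (intro summable_sums summable_comparison_test'[OF M]) (rule bd0[OF S(3)])
  qed (use S in auto)
  then obtain g where "\<forall>x\<in>S. (\<lambda>n. f n x) sums (g x) \<and> (g has_derivative G x) (at x within S)" ..
  then have g: "\<And>x. x \<in> S \<Longrightarrow> (\<lambda>n. f n x) sums (g x)"
    "\<And>x. x \<in> S \<Longrightarrow> (g has_derivative G x) (at x within S)" by simp_all
  have gd: "(g has_derivative G p) (at p)"
    using g(2)[OF S(3)] at_within_open[OF S(3) S(1)] by simp
  have "((\<lambda>q. \<Sum>n. f n q) has_derivative G p) (at p)"
    by (rule has_derivative_transform_within_open[OF gd S(1,3)]) (simp add: sums_unique[OF g(1)])
  from partial_xI[OF this] partial_yI[OF this] this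
  show "(\<lambda>q. \<Sum>n. f n q) differentiable (at p)"
    "partial_x (\<lambda>q. \<Sum>n. f n q) p = (\<Sum>n. partial_x (f n) p)"
    "partial_y (\<lambda>q. \<Sum>n. f n q) p = (\<Sum>n. partial_y (f n) p)"
    by (auto simp: differentiable_def G_def)
qed

section \<open>Rapidly decreasing and Schwartz functions on the line\<close>

text \<open>The weight 1 + x^2 is at least 1 and dominates |x|, so a factor x is absorbed by raising
  the exponent by one.\<close>

definition rapid :: "(real \<Rightarrow> complex) \<Rightarrow> bool" where
  "rapid f \<longleftrightarrow> (\<forall>a::nat. \<exists>B. \<forall>x. norm (f x) * (1 + x\<^sup>2) ^ a \<le> B)"

lemma rapid_add: "rapid f \<Longrightarrow> rapid g \<Longrightarrow> rapid (\<lambda>x. f x + g x)"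
  unfolding rapid_def
proof
  fix a :: nat
  assume "\<forall>a. \<exists>B. \<forall>x. norm (f x) * (1 + x\<^sup>2) ^ a \<le> B" "\<forall>a. \<exists>B. \<forall>x. norm (g x) * (1 + x\<^sup>2) ^ a \<le> B"
  then obtain B C where B: "\<And>x. norm (f x) * (1 + x\<^sup>2) ^ a \<le> B" "\<And>x. norm (g x) * (1 + x\<^sup>2) ^ a \<le> C"
    by meson
  have "norm (f x + g x) * (1 + x\<^sup>2) ^ a \<le> B + C" for x
  proof -
    have "norm (f x + g x) * (1 + x\<^sup>2) ^ a \<le> (norm (f x) + norm (g x)) * (1 + x\<^sup>2) ^ a"
      by (intro mult_right_mono norm_triangle_ineq) auto
    also have "\<dots> \<le> B + C" using B[of x] by (simp add: distrib_right)
    finally show ?thesis .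
  qed
  then show "\<exists>B. \<forall>x. norm (f x + g x) * (1 + x\<^sup>2) ^ a \<le> B" by blast
qed

lemma rapid_cmult: "rapid f \<Longrightarrow> rapid (\<lambda>x. c * f x)"
  unfolding rapid_def
proof
  fix a :: nat
  assume "\<forall>a. \<exists>B. \<forall>x. norm (f x) * (1 + x\<^sup>2) ^ a \<le> B"
  then obtain B where B: "\<And>x. norm (f x) * (1 + x\<^sup>2) ^ a \<le> B" by meson
  have "norm (c * f x) * (1 + x\<^sup>2) ^ a \<le> norm c * B" for x
    using mult_left_mono[OF B[of x], of "norm c"] by (simp add: norm_mult mult_ac)
  then show "\<exists>B. \<forall>x. norm (c * f x) * (1 + x\<^sup>2) ^ a \<le> B" by blast
qed

lemma rapid_times_x: "rapid f \<Longrightarrow> rapid (\<lambda>x. of_real x * f x)"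
  unfolding rapid_def
proof
  fix a :: nat
  assume "\<forall>a. \<exists>B. \<forall>x. norm (f x) * (1 + x\<^sup>2) ^ a \<le> B"
  then obtain B where B: "\<And>x. norm (f x) * (1 + x\<^sup>2) ^ Suc a \<le> B" by meson
  have "norm (of_real x * f x) * (1 + x\<^sup>2) ^ a \<le> B" for x
  proof -
    have "0 \<le> (\<bar>x\<bar> - 1)\<^sup>2 + \<bar>x\<bar> * \<bar>x\<bar>" by simp
    then have "\<bar>x\<bar> \<le> 1 + x\<^sup>2" by (auto simp: power2_eq_square algebra_simps)
    then have "norm (of_real x * f x) * (1 + x\<^sup>2) ^ a \<le> (1 + x\<^sup>2) * norm (f x) * (1 + x\<^sup>2) ^ a"
      unfolding norm_mult by (intro mult_right_mono) auto
    also have "\<dots> \<le> B" using B[of x] by (simp add: mult_ac)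
    finally show ?thesis .
  qed
  then show "\<exists>B. \<forall>x. norm (of_real x * f x) * (1 + x\<^sup>2) ^ a \<le> B" by blast
qed

text \<open>Coinduction encodes that all iterated derivatives are rapidly decreasing. To prove a
  function Schwartz it suffices to place it in a class of rapidly decreasing functions that is
  closed under differentiation.\<close>

coinductive schwartz :: "(real \<Rightarrow> complex) \<Rightarrow> bool" where
  schwartzI: "(\<And>x. (h has_vector_derivative h' x) (at x)) \<Longrightarrow> rapid h \<Longrightarrow> schwartz h' \<Longrightarrow> schwartz h"

lemma schwartz_coinduct:
  assumes "P h"
    and "\<And>h. P h \<Longrightarrow> rapid h \<and> (\<exists>h'. (\<forall>x. (h has_vector_derivative h' x) (at x)) \<and> P h')"
  shows "schwartz h"
  using assms(1) by (coinduction arbitrary: h rule: schwartz.coinduct) (use assms(2) in blast)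

definition vderiv :: "(real \<Rightarrow> complex) \<Rightarrow> real \<Rightarrow> complex" where
  "vderiv h x = vector_derivative h (at x)"

lemma vderivI: "(\<And>x. (h has_vector_derivative h' x) (at x)) \<Longrightarrow> vderiv h = h'"
  unfolding vderiv_def by (auto simp: fun_eq_iff intro: vector_derivative_at)

lemma schwartzD:
  assumes "schwartz h"
  shows "rapid h" "schwartz (vderiv h)" "\<And>x. (h has_vector_derivative vderiv h x) (at x)"
  using assms by (cases; use vderivI in metis)+

lemma schwartz_add:
  assumes "schwartz f" "schwartz g"
  shows "schwartz (\<lambda>x. f x + g x)"
proof (rule schwartz_coinduct[where P = "\<lambda>h. \<exists>f g. schwartz f \<and> schwartz g \<and> h = (\<lambda>x. f x + g x)"])
  fix h assume "\<exists>f g. schwartz f \<and> schwartz g \<and> h = (\<lambda>x. f x + g x)"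
  then obtain f g where "schwartz f" "schwartz g" and h: "h = (\<lambda>x. f x + g x)" by blast
  note f = schwartzD[OF this(1)] and g = schwartzD[OF this(2)]
  have "(h has_vector_derivative vderiv f x + vderiv g x) (at x)" for x
    unfolding h by (intro has_vector_derivative_add f g)
  then show "rapid h \<and> (\<exists>h'. (\<forall>x. (h has_vector_derivative h' x) (at x)) \<and>
      (\<exists>f g. schwartz f \<and> schwartz g \<and> h' = (\<lambda>x. f x + g x)))"
    using f g rapid_add unfolding h
    by (intro conjI, blast) (rule exI[of _ "\<lambda>x. vderiv f x + vderiv g x"], blast)
qed (use assms in blast)

lemma schwartz_cmult:
  assumes "schwartz f"
  shows "schwartz (\<lambda>x. c * f x)"
proof (rule schwartz_coinduct[where P = "\<lambda>h. \<exists>f. schwartz f \<and> h = (\<lambda>x. c * f x)"])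
  fix h assume "\<exists>f. schwartz f \<and> h = (\<lambda>x. c * f x)"
  then obtain f where "schwartz f" and h: "h = (\<lambda>x. c * f x)" by blast
  note f = schwartzD[OF this(1)]
  have "(h has_vector_derivative c * vderiv f x) (at x)" for x
    unfolding h by (intro has_vector_derivative_mult_right f)
  then show "rapid h \<and> (\<exists>h'. (\<forall>x. (h has_vector_derivative h' x) (at x)) \<and>
      (\<exists>f. schwartz f \<and> h' = (\<lambda>x. c * f x)))"
    using f rapid_cmult unfolding h
    by (intro conjI, blast) (rule exI[of _ "\<lambda>x. c * vderiv f x"], blast)
qed (use assms in blast)

lemma has_vector_derivative_times_x:
  assumes "(f has_vector_derivative f') (at x)"
  shows "((\<lambda>x. complex_of_real x * f x) has_vector_derivative of_real x * f' + f x) (at x)"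
proof -
  have "((\<lambda>x. complex_of_real x) has_vector_derivative 1) (at x)"
    using has_vector_derivative_of_real[OF DERIV_ident] by simp
  from has_vector_derivative_mult[OF this assms] show ?thesis by simp
qed

text \<open>Products x f alone are not closed under differentiation, but sums are: (x f + g)' = x f'
  + (f + g').\<close>

lemma schwartz_times_x_add:
  assumes "schwartz f" "schwartz g"
  shows "schwartz (\<lambda>x. of_real x * f x + g x)"
proof (rule schwartz_coinduct[where P =
    "\<lambda>h. \<exists>f g. schwartz f \<and> schwartz g \<and> h = (\<lambda>x. of_real x * f x + g x)"])
  fix h assume "\<exists>f g. schwartz f \<and> schwartz g \<and> h = (\<lambda>x. of_real x * f x + g x)"
  then obtain f g where fg: "schwartz f" "schwartz g" and h: "h = (\<lambda>x. of_real x * f x + g x)" by blast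
  note f = schwartzD[OF fg(1)] and g = schwartzD[OF fg(2)]
  let ?h' = "\<lambda>x. of_real x * vderiv f x + (f x + vderiv g x)"
  have "(h has_vector_derivative ?h' x) (at x)" for x
    using has_vector_derivative_add[OF has_vector_derivative_times_x[OF f(3)] g(3)]
    unfolding h by (simp add: add.assoc)
  moreover have "rapid h" unfolding h using f g by (intro rapid_add rapid_times_x)
  moreover have "schwartz (\<lambda>x. f x + vderiv g x)" using fg g schwartz_add by blast
  ultimately show "rapid h \<and> (\<exists>h'. (\<forall>x. (h has_vector_derivative h' x) (at x)) \<and>
      (\<exists>f g. schwartz f \<and> schwartz g \<and> h' = (\<lambda>x. of_real x * f x + g x)))"
    using f(2) by - (rule conjI, assumption, rule exI[of _ ?h'], blast)
qed (use assms in blast)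

lemma schwartz_0: "schwartz (\<lambda>x. 0)"
proof -
  have "rapid (\<lambda>x. 0)" by (auto simp: rapid_def)
  then show ?thesis
    by (intro schwartz_coinduct[where P = "\<lambda>h. h = (\<lambda>x. 0)"]) auto
qed

lemma schwartz_times_x: "schwartz f \<Longrightarrow> schwartz (\<lambda>x. of_real x * f x)"
  using schwartz_times_x_add[OF _ schwartz_0] by simp

lemma rapid_poly:
  assumes "rapid f"
  shows "rapid (\<lambda>x. poly p (of_real x) * f x)"
proof (induction p)
  case 0
  then show ?case by (auto simp: rapid_def)
next
  case (pCons c p)
  have "(\<lambda>x. poly (pCons c p) (of_real x) * f x) =
      (\<lambda>x. c * f x + of_real x * (poly p (of_real x) * f x))"
    by (simp add: algebra_simps)
  then show ?case using pCons assms by (auto intro: rapid_add rapid_cmult rapid_times_x)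
qed

text \<open>With c = - Re A, half of the Gaussian decay pays for the weight, through t^k <= k! exp t
  at t = (c/2)(1 + x^2). The other half pays for the linear term B x, by completing the
  square.\<close>

lemma rapid_gaussian:
  assumes "Re A < 0"
  shows "rapid (\<lambda>x. exp (A * (of_real x)\<^sup>2 + B * of_real x))"
  unfolding rapid_def
proof
  fix k :: nat
  define c where "c = - Re A"
  have c: "c > 0" using assms by (simp add: c_def)
  have "norm (exp (A * (of_real x)\<^sup>2 + B * of_real x)) * (1 + x\<^sup>2) ^ k
     \<le> fact k * (2/c)^k * exp ((Re B)\<^sup>2 / (2 * c) + c / 2)" for x
  proof -
    have t: "(t::real) ^ k \<le> fact k * exp t" if "t \<ge> 0" for t
    proof -
      have "t ^ k /\<^sub>R fact k \<le> exp t"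
      proof -
        have "(\<Sum>i\<in>{k}. t ^ i /\<^sub>R fact i) \<le> (\<Sum>i. t ^ i /\<^sub>R fact i)"
          by (intro sum_le_suminf summable_exp_generic) (use that in auto)
        then show ?thesis by (simp add: exp_def)
      qed
      then show ?thesis by (simp add: field_simps)
    qed
    have "(1 + x\<^sup>2) ^ k = (2/c)^k * (c/2 * (1 + x\<^sup>2)) ^ k"
      using c unfolding power_mult_distrib[symmetric] by (intro arg_cong[where f = "\<lambda>t. t ^ k"]) simp
    also have "\<dots> \<le> (2/c)^k * (fact k * exp (c/2 * (1 + x\<^sup>2)))"
      using c by (intro mult_left_mono t) auto
    finally have 1: "(1 + x\<^sup>2) ^ k \<le> fact k * (2/c)^k * exp (c/2 * (1 + x\<^sup>2))" by (simp add: mult_ac)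
    have "Re B * x \<le> (Re B)\<^sup>2 / (2 * c) + c / 2 * x\<^sup>2"
    proof -
      have "0 \<le> (Re B - c * x)\<^sup>2 / (2 * c)" using c by simp
      then show ?thesis using c by (simp add: power2_eq_square field_simps)
    qed
    then have 2: "- c * x\<^sup>2 + Re B * x + c/2 * (1 + x\<^sup>2) \<le> (Re B)\<^sup>2 / (2 * c) + c / 2"
      by (simp add: algebra_simps)
    have "norm (exp (A * (of_real x)\<^sup>2 + B * of_real x)) = exp (- c * x\<^sup>2 + Re B * x)"
      by (simp add: c_def norm_exp_eq_Re power2_eq_square)
    then have "norm (exp (A * (of_real x)\<^sup>2 + B * of_real x)) * (1 + x\<^sup>2) ^ k
       \<le> exp (- c * x\<^sup>2 + Re B * x) * (fact k * (2/c)^k * exp (c/2 * (1 + x\<^sup>2)))"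
      using 1 by (simp only:) (intro mult_left_mono, auto)
    also have "\<dots> = fact k * (2/c)^k * exp (- c * x\<^sup>2 + Re B * x + c/2 * (1 + x\<^sup>2))"
      by (simp add: exp_add mult_ac)
    also have "\<dots> \<le> fact k * (2/c)^k * exp ((Re B)\<^sup>2 / (2 * c) + c / 2)"
      using 2 c by (intro mult_left_mono) auto
    finally show ?thesis .
  qed
  then show "\<exists>C. \<forall>x. norm (exp (A * (of_real x)\<^sup>2 + B * of_real x)) * (1 + x\<^sup>2) ^ k \<le> C" by blast
qed

lemma gaussian_deriv:
  fixes A B :: complex
  shows "((\<lambda>x. poly p (of_real x) * exp (A * (of_real x)\<^sup>2 + B * of_real x)) has_vector_derivative
     poly (pderiv p + p * [:B, 2 * A:]) (of_real x) * exp (A * (of_real x)\<^sup>2 + B * of_real x)) (at x)"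
proof -
  have "((\<lambda>z::complex. poly p z * exp (A * z\<^sup>2 + B * z)) has_field_derivative
     poly (pderiv p + p * [:B, 2 * A:]) z * exp (A * z\<^sup>2 + B * z)) (at z)" for z
    by (auto intro!: derivative_eq_intros poly_DERIV simp: algebra_simps power2_eq_square)
  from has_vector_derivative_real_field[OF this[of "of_real x"]] show ?thesis .
qed

text \<open>Polynomials times one fixed Gaussian form a class closed under differentiation, by
  \<open>gaussian_deriv\<close>, so coinduction applies to all p at once.\<close>

lemma schwartz_poly_gaussian:
  fixes A B :: complex
  assumes "Re A < 0"
  shows "schwartz (\<lambda>x. poly p (of_real x) * exp (A * (of_real x)\<^sup>2 + B * of_real x))"
proof (rule schwartz_coinduct[where P =
    "\<lambda>h. \<exists>p. h = (\<lambda>x. poly p (of_real x) * exp (A * (of_real x)\<^sup>2 + B * of_real x))"])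
  let ?G = "\<lambda>p x. poly p (of_real x) * exp (A * (of_real x)\<^sup>2 + B * of_real x)"
  fix h assume "\<exists>p. h = ?G p"
  then obtain p where h: "h = ?G p" by blast
  have "rapid h" unfolding h by (intro rapid_poly rapid_gaussian assms)
  moreover have "\<forall>x. (h has_vector_derivative ?G (pderiv p + p * [:B, 2 * A:]) x) (at x)"
    unfolding h by (intro allI gaussian_deriv)
  ultimately show "rapid h \<and> (\<exists>h'. (\<forall>x. (h has_vector_derivative h' x) (at x)) \<and> (\<exists>p. h' = ?G p))"
    by - (rule conjI, assumption, rule exI[of _ "?G (pderiv p + p * [:B, 2 * A:])"], blast)
qed blast

lemma schwartz_gaussian:
  assumes "Re A < 0"
  shows "schwartz (\<lambda>x. exp (A * (of_real x)\<^sup>2 + B * of_real x))"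
  using schwartz_poly_gaussian[OF assms, of 1 B] by simp

section \<open>Zak transforms: summability, derivatives and quasi-periodicity\<close>

text \<open>The index set A will be a class of residues, one for each matrix entry, and c will be
  the slope of the source minus the slope of the target.\<close>

definition zak :: "real \<Rightarrow> int set \<Rightarrow> (real \<Rightarrow> complex) \<Rightarrow> real \<times> real \<Rightarrow> complex" where
  "zak c A h p = (\<Sum>\<^sub>\<infinity>s\<in>A. h (fst p + 2 * pi * of_int s) * cis (c * of_int s * snd p))"

text \<open>The enumeration satisfies n <= 2 |int_decode n| + 1, so the series compares with the sum
  of 1/n^2. Enumerating the integers turns unordered sums into ordinary series, to which
  \<open>Weierstrass_m_test\<close> applies.\<close>

lemma summable_int_decode: "summable (\<lambda>n. 1 / (1 + (of_int (int_decode n))\<^sup>2 :: real))"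
proof (rule summable_comparison_test')
  show "summable (\<lambda>n. 9 * (1 / real n ^ 2))"
    by (intro summable_mult inverse_power_summable[of 2, unfolded inverse_eq_divide]) auto
  fix n :: nat assume n: "n \<ge> 1"
  have "real n \<le> 2 * \<bar>of_int (int_decode n)\<bar> + 1"
  proof -
    have "int n \<le> 2 * \<bar>int_decode n\<bar> + 1"
      unfolding int_decode_def sum_decode_def by (auto split: if_splits)
    then have "of_int (int n) \<le> (of_int (2 * \<bar>int_decode n\<bar> + 1) :: real)" by linarith
    then show ?thesis by simp
  qed
  then have "(real n)\<^sup>2 \<le> (2 * \<bar>of_int (int_decode n)\<bar> + 1)\<^sup>2" by (intro power_mono) auto
  also have "\<dots> \<le> 9 * (1 + (of_int (int_decode n))\<^sup>2)"
  proof -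
    have *: "(2 * \<bar>t\<bar> + 1)\<^sup>2 \<le> 9 * (1 + t\<^sup>2)" for t :: real
    proof -
      have "0 \<le> 5 * (\<bar>t\<bar> - 2/5)\<^sup>2" by simp
      then show ?thesis by (simp add: power2_eq_square algebra_simps)
    qed
    show ?thesis by (rule *)
  qed
  finally show "norm (1 / (1 + (of_int (int_decode n))\<^sup>2 :: real)) \<le> 9 * (1 / real n ^ 2)"
    using n by (simp add: field_simps add_pos_nonneg)
qed

lemma summable_on_inverse_square_int: "(\<lambda>s::int. 1 / (1 + (of_int s)\<^sup>2 :: real)) summable_on A"
proof -
  have "(\<lambda>n. 1 / (1 + (of_int (int_decode n))\<^sup>2 :: real)) summable_on UNIV"
    using summable_int_decode by (intro norm_summable_imp_summable_on) simp
  then have "(\<lambda>s::int. 1 / (1 + (of_int s)\<^sup>2 :: real)) summable_on UNIV"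
    using summable_on_reindex_bij_betw[OF bij_int_decode] by fast
  then show ?thesis by (rule summable_on_subset_banach) simp
qed

text \<open>Decay in s, uniform for bounded x: with X = x + 2 pi s one has 2 s^2 <= (X - x)^2 <= 2
  X^2 + 2 x^2, hence 1 + s^2 <= (1 + R^2)(1 + X^2), and powers of the last factor are absorbed by
  h.\<close>

lemma rapid_shift_bound:
  assumes "rapid h"
  shows "\<exists>B. \<forall>x s. \<bar>x\<bar> \<le> R \<longrightarrow> norm (h (x + 2 * pi * of_int s)) * (1 + (of_int s)\<^sup>2) ^ a \<le> B"
proof -
  obtain B where B: "\<And>x. norm (h x) * (1 + x\<^sup>2) ^ a \<le> B" using assms unfolding rapid_def by meson
  have "norm (h (x + 2 * pi * of_int s)) * (1 + (of_int s)\<^sup>2) ^ a \<le> (1 + R\<^sup>2) ^ a * B"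
    if x: "\<bar>x\<bar> \<le> R" for x and s :: int
  proof -
    define X where "X = x + 2 * pi * of_int s"
    have "(of_int s)\<^sup>2 * 2 \<le> (2 * pi * of_int s :: real)\<^sup>2"
    proof -
      have "1 * 1 \<le> pi * pi" using pi_gt3 by (intro mult_mono) auto
      then have "2 * (of_int s :: real)\<^sup>2 \<le> (4 * (pi * pi)) * (of_int s)\<^sup>2" by (intro mult_right_mono) auto
      then show ?thesis by (simp add: power2_eq_square algebra_simps)
    qed
    also have "\<dots> = (X - x)\<^sup>2" by (simp add: X_def)
    also have "\<dots> \<le> 2 * X\<^sup>2 + 2 * x\<^sup>2"
      using zero_le_power2[of "X + x"] by (simp add: power2_eq_square algebra_simps)
    also have "x\<^sup>2 \<le> R\<^sup>2" using x abs_le_square_iff[of x R] by auto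
    finally have "1 + (of_int s)\<^sup>2 \<le> 1 + X\<^sup>2 + R\<^sup>2" by simp
    also have "\<dots> \<le> (1 + R\<^sup>2) * (1 + X\<^sup>2)" by (simp add: algebra_simps)
    finally have "(1 + (of_int s)\<^sup>2) ^ a \<le> ((1 + R\<^sup>2) * (1 + X\<^sup>2)) ^ a" by (intro power_mono) auto
    then have "norm (h X) * (1 + (of_int s)\<^sup>2) ^ a \<le> norm (h X) * ((1 + R\<^sup>2) * (1 + X\<^sup>2)) ^ a"
      by (intro mult_left_mono) auto
    also have "\<dots> = (1 + R\<^sup>2) ^ a * (norm (h X) * (1 + X\<^sup>2) ^ a)" by (simp add: power_mult_distrib mult_ac)
    also have "\<dots> \<le> (1 + R\<^sup>2) ^ a * B" by (intro mult_left_mono B) auto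
    finally show ?thesis by (simp add: X_def)
  qed
  then show ?thesis by blast
qed

text \<open>The second bound serves the y-derivative, which brings down a factor s. The weight with
  exponent 2 leaves 1/(1 + s^2) after paying for that factor.\<close>

lemma zak_term_bound:
  assumes "rapid h"
  shows "\<exists>B. \<forall>x s. \<bar>x\<bar> \<le> R \<longrightarrow>
    norm (h (x + 2 * pi * of_int s)) \<le> B * (1 / (1 + (of_int s)\<^sup>2)) \<and>
    norm (of_int s * h (x + 2 * pi * of_int s)) \<le> B * (1 / (1 + (of_int s)\<^sup>2))"
proof -
  obtain B where B: "\<And>x s. \<bar>x\<bar> \<le> R \<Longrightarrow> norm (h (x + 2 * pi * of_int s)) * (1 + (of_int s)\<^sup>2) ^ 2 \<le> B"
    using rapid_shift_bound[OF assms, of R 2] by meson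
  have "norm (h (x + 2 * pi * of_int s)) \<le> B * (1 / (1 + (of_int s)\<^sup>2)) \<and>
    norm (of_int s * h (x + 2 * pi * of_int s)) \<le> B * (1 / (1 + (of_int s)\<^sup>2))"
    if x: "\<bar>x\<bar> \<le> R" for x and s :: int
  proof -
    let ?t = "of_int s :: real" and ?n = "norm (h (x + 2 * pi * of_int s))"
    have "0 \<le> (\<bar>?t\<bar> - 1)\<^sup>2 + \<bar>?t\<bar> * \<bar>?t\<bar>" by simp
    then have t: "\<bar>?t\<bar> \<le> 1 + ?t\<^sup>2" by (auto simp: power2_eq_square algebra_simps)
    have p: "1 + ?t\<^sup>2 > 0" by (simp add: add_pos_nonneg)
    have 1: "?n * (1 + ?t\<^sup>2) * (1 + ?t\<^sup>2) \<le> B" using B[OF x, of s] by (simp add: power2_eq_square mult.assoc)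
    have "?n * 1 \<le> ?n * (1 + ?t\<^sup>2)" by (intro mult_left_mono) auto
    then have "?n * (1 + ?t\<^sup>2) \<le> ?n * (1 + ?t\<^sup>2) * (1 + ?t\<^sup>2)" using p by (intro mult_right_mono) auto
    then have "?n * (1 + ?t\<^sup>2) \<le> B" using 1 by linarith
    moreover have "?n * \<bar>?t\<bar> * (1 + ?t\<^sup>2) \<le> ?n * (1 + ?t\<^sup>2) * (1 + ?t\<^sup>2)"
      using p t by (intro mult_right_mono mult_left_mono) auto
    ultimately show ?thesis using 1 p by (auto simp: field_simps norm_mult)
  qed
  then show ?thesis by blast
qed

lemma zak_abs_summable:
  assumes "rapid h"
  shows "(\<lambda>s. norm (h (x + 2 * pi * of_int s) * cis (c * of_int s * y))) summable_on A"
proof -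
  obtain B where B: "\<And>s. norm (h (x + 2 * pi * of_int s)) \<le> B * (1 / (1 + (of_int s)\<^sup>2))"
    using zak_term_bound[OF assms, of "\<bar>x\<bar>"] by (meson order_refl)
  show ?thesis
    by (rule Infinite_Sum.abs_summable_on_comparison_test'[OF summable_on_cmult_right[OF summable_on_inverse_square_int]])
      (use B in \<open>simp add: norm_mult\<close>)
qed

lemma zak_summable:
  assumes "rapid h"
  shows "(\<lambda>s. h (x + 2 * pi * of_int s) * cis (c * of_int s * y)) summable_on A"
  using abs_summable_summable[OF zak_abs_summable[OF assms]] .

lemma infsum_eq_suminf_int_decode:
  fixes g :: "int \<Rightarrow> complex"
  assumes "(\<lambda>s. norm (g s)) summable_on A"
  shows "infsum g A = (\<Sum>n. if int_decode n \<in> A then g (int_decode n) else 0)"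
proof -
  let ?g = "\<lambda>s. if s \<in> A then g s else 0"
  have 1: "infsum g A = infsum ?g UNIV" by (rule infsum_cong_neutral) auto
  have "(\<lambda>s. norm (?g s)) summable_on UNIV \<longleftrightarrow> (\<lambda>s. norm (g s)) summable_on A"
    by (rule summable_on_cong_neutral) auto
  then have "(\<lambda>n. norm (?g (int_decode n))) summable_on UNIV"
    using assms summable_on_reindex_bij_betw[OF bij_int_decode, of "\<lambda>s. norm (?g s)"] by simp
  then have s: "summable (\<lambda>n. norm (?g (int_decode n)))"
    by (rule summable_on_imp_summable)
  have "infsum ?g UNIV = infsum (\<lambda>n. ?g (int_decode n)) UNIV"
    by (rule infsum_reindex_bij_betw[OF bij_int_decode, symmetric])
  also have "\<dots> = (\<Sum>n. ?g (int_decode n))"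
    using norm_summable_imp_has_sum[OF s summable_sums[OF summable_norm_cancel[OF s]]]
    by (rule infsumI)
  finally show ?thesis using 1 by simp
qed

lemma zak_add: "rapid f \<Longrightarrow> rapid g \<Longrightarrow> zak c A (\<lambda>x. f x + g x) p = zak c A f p + zak c A g p"
  unfolding zak_def distrib_right by (intro infsum_add zak_summable)

lemma zak_cmult: "zak c A (\<lambda>x. d * f x) p = d * zak c A f p"
  unfolding zak_def mult.assoc by (rule infsum_cmult_right')

lemma has_derivative_cis_snd:
  "((\<lambda>q::real \<times> real. cis (r * snd q)) has_derivative
     (\<lambda>v. snd v *\<^sub>R (\<i> * of_real r * cis (r * snd p)))) (at p)"
proof -
  have *: "((\<lambda>t. cis (r * t)) has_vector_derivative (\<i> * of_real r * cis (r * t))) (at t)" for t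
  proof -
    have "((\<lambda>z. exp (\<i> * of_real r * z)) has_field_derivative
        (\<i> * of_real r * exp (\<i> * of_real r * z))) (at z)" for z
      by (auto intro!: derivative_eq_intros)
    from has_vector_derivative_real_field[OF this, of t] show ?thesis
      by (simp add: cis_conv_exp mult.assoc)
  qed
  show ?thesis
    by (rule has_derivative_compose[OF has_derivative_snd[OF has_derivative_ident]
        *[unfolded has_vector_derivative_def]])
qed

lemma has_derivative_zak_term:
  assumes "schwartz h"
  shows "((\<lambda>q. h (fst q + t) * cis (r * snd q)) has_derivative
    (\<lambda>v. fst v *\<^sub>R (vderiv h (fst p + t) * cis (r * snd p)) +
         snd v *\<^sub>R (\<i> * of_real r * h (fst p + t) * cis (r * snd p)))) (at p)"
proof -
  have *: "((\<lambda>q::real \<times> real. fst q + t) has_derivative fst) (at p)"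
    using has_derivative_add_const[OF has_derivative_fst[OF has_derivative_ident]] .
  have "((\<lambda>q::real \<times> real. h (fst q + t)) has_derivative (\<lambda>v. fst v *\<^sub>R vderiv h (fst p + t))) (at p)"
    by (rule has_derivative_compose[OF * schwartzD(3)[OF assms, unfolded has_vector_derivative_def]])
  from has_derivative_mult[OF this has_derivative_cis_snd[of r p]]
  show ?thesis
    by (rule has_derivative_eq_rhs) (simp add: fun_eq_iff algebra_simps)
qed

text \<open>The y-derivative multiplies the term of index s by i c s. Since 2 pi s is the argument x
  + 2 pi s of h minus x, this factor becomes multiplication of h by its argument, minus the outer
  coordinate x. So the partials stay within Zak transforms, up to multiplication by x.\<close>

lemma zak_partials:
  assumes h: "schwartz h"
  shows "zak c A h differentiable (at p)"
    and "partial_x (zak c A h) p = zak c A (vderiv h) p"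
    and "partial_y (zak c A h) p =
      \<i> * c / (2 * pi) * (zak c A (\<lambda>x. of_real x * h x) p - of_real (fst p) * zak c A h p)"
proof -
  define R where "R = \<bar>fst p\<bar> + 1"
  define S where "S = {- R<..<R} \<times> (UNIV :: real set)"
  have S: "open S" "convex S" "p \<in> S"
    unfolding S_def R_def by (auto intro!: open_Times convex_Times simp: mem_Times_iff)
  note hD = schwartzD[OF h]
  define f where "f n q = (if int_decode n \<in> A then h (fst q + 2 * pi * of_int (int_decode n)) *
     cis (c * of_int (int_decode n) * snd q) else 0)" for n and q :: "real \<times> real"
  have fd: "(f n has_derivative (\<lambda>v. fst v *\<^sub>R (if int_decode n \<in> A then vderiv h (fst q + 2 * pi * of_int (int_decode n)) *
       cis (c * of_int (int_decode n) * snd q) else 0) + snd v *\<^sub>R (if int_decode n \<in> A then \<i> * of_real (c * of_int (int_decode n)) *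
       h (fst q + 2 * pi * of_int (int_decode n)) * cis (c * of_int (int_decode n) * snd q) else 0))) (at q)" for n q
  proof (cases "int_decode n \<in> A")
    case True
    then show ?thesis unfolding f_def
      using has_derivative_zak_term[OF h, of "2 * pi * of_int (int_decode n)"
        "c * of_int (int_decode n)" q] by (simp only: if_True)
  next
    case False
    then show ?thesis unfolding f_def by simp
  qed
  have fD: "f n differentiable (at q)"
    "partial_x (f n) q = (if int_decode n \<in> A then vderiv h (fst q + 2 * pi * of_int (int_decode n)) *
       cis (c * of_int (int_decode n) * snd q) else 0)"
    "partial_y (f n) q = (if int_decode n \<in> A then \<i> * of_real (c * of_int (int_decode n)) *
       h (fst q + 2 * pi * of_int (int_decode n)) * cis (c * of_int (int_decode n) * snd q) else 0)" for n q
    using partial_xI[OF fd[of n q]] partial_yI[OF fd[of n q]] differentiableI[OF fd[of n q]]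
    by simp_all
  obtain B where B: "\<And>x s. \<bar>x\<bar> \<le> R \<Longrightarrow>
    norm (h (x + 2 * pi * of_int s)) \<le> B * (1 / (1 + (of_int s)\<^sup>2)) \<and>
    norm (of_int s * h (x + 2 * pi * of_int s)) \<le> B * (1 / (1 + (of_int s)\<^sup>2))"
    using zak_term_bound[OF hD(1)] by meson
  obtain B' where B': "\<And>x s. \<bar>x\<bar> \<le> R \<Longrightarrow>
    norm (vderiv h (x + 2 * pi * of_int s)) \<le> B' * (1 / (1 + (of_int s)\<^sup>2))"
    using zak_term_bound[OF schwartzD(1)[OF hD(2)]] by meson
  define C where "C = \<bar>B\<bar> + \<bar>B'\<bar> + \<bar>c\<bar> * \<bar>B\<bar>"
  define M where "M n = C * (1 / (1 + (of_int (int_decode n))\<^sup>2))" for n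
  have M: "summable M" unfolding M_def by (intro summable_mult summable_int_decode)
  have le: "D * (1 / (1 + (of_int (int_decode n))\<^sup>2)) \<le> M n" if "D \<le> C" for D n
    unfolding M_def using that by (intro mult_right_mono) auto
  have M0: "0 \<le> M n" for n unfolding M_def C_def by simp
  have C: "B \<le> C" "B' \<le> C" "\<bar>c\<bar> * B \<le> C" unfolding C_def
    using mult_left_mono[of B "\<bar>B\<bar>" "\<bar>c\<bar>"] by (auto intro: add_increasing add_increasing2)
  have S_bound: "\<bar>fst q\<bar> \<le> R" if "q \<in> S" for q
    using that by (cases q) (auto simp: S_def)
  have bd0: "norm (f n q) \<le> M n" if "q \<in> S" for n q
    using order_trans[OF conjunct1[OF B[OF S_bound[OF that], of "int_decode n"]] le[OF C(1), of n]] M0[of n]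
    by (simp add: f_def norm_mult)
  have bdx: "norm (partial_x (f n) q) \<le> M n" if "q \<in> S" for n q
    using order_trans[OF B'[OF S_bound[OF that], of "int_decode n"] le[OF C(2), of n]] M0[of n]
    by (simp add: fD norm_mult)
  have bdy: "norm (partial_y (f n) q) \<le> M n" if "q \<in> S" for n q
  proof (cases "int_decode n \<in> A")
    case True
    have "norm (of_int (int_decode n) * h (fst q + 2 * pi * of_int (int_decode n)))
      \<le> B * (1 / (1 + (of_int (int_decode n))\<^sup>2))"
      using B[OF S_bound[OF that], of "int_decode n"] by blast
    from mult_left_mono[OF this, of "\<bar>c\<bar>"]
    have "norm (partial_y (f n) q) \<le> \<bar>c\<bar> * B * (1 / (1 + (of_int (int_decode n))\<^sup>2))"
      using True by (simp add: fD norm_mult mult.assoc)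
    then show ?thesis using le[OF C(3), of n] by linarith
  qed (use M0 in \<open>simp add: fD\<close>)
  have z: "zak c A g q = (\<Sum>n. if int_decode n \<in> A then g (fst q + 2 * pi * of_int (int_decode n)) *
     cis (c * of_int (int_decode n) * snd q) else 0)" if "rapid g" for g q
    unfolding zak_def by (rule infsum_eq_suminf_int_decode[OF zak_abs_summable[OF that]])
  have zf: "zak c A h = (\<lambda>q. \<Sum>n. f n q)" by (simp add: fun_eq_iff z[OF hD(1)] f_def)
  show "zak c A h differentiable (at p)"
    unfolding zf by (rule series_partials(1)[OF S fD(1) bd0 bdx bdy M])
  have px: "partial_x (\<lambda>q. \<Sum>n. f n q) p = (\<Sum>n. partial_x (f n) p)"
    by (rule series_partials(2)[OF S fD(1) bd0 bdx bdy M])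
  have py: "partial_y (\<lambda>q. \<Sum>n. f n q) p = (\<Sum>n. partial_y (f n) p)"
    by (rule series_partials(3)[OF S fD(1) bd0 bdx bdy M])
  show "partial_x (zak c A h) p = zak c A (vderiv h) p"
    unfolding zf px z[OF schwartzD(1)[OF hD(2)]] by (simp only: fD)
  have "zak c A (\<lambda>x. of_real x * h x) p =
     zak c A (\<lambda>x. of_real x * h x - of_real (fst p) * h x) p + of_real (fst p) * zak c A h p"
    using zak_add[of "\<lambda>x. of_real x * h x - of_real (fst p) * h x" "\<lambda>x. of_real (fst p) * h x" c A p]
      rapid_add[OF rapid_times_x[OF hD(1)] rapid_cmult[OF hD(1), of "- of_real (fst p)"]]
      rapid_cmult[OF hD(1), of "of_real (fst p)"]
    by (simp add: zak_cmult)
  also have "zak c A (\<lambda>x. of_real x * h x - of_real (fst p) * h x) p = 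
     (\<Sum>\<^sub>\<infinity>s\<in>A. of_real (2 * pi * of_int s) * (h (fst p + 2 * pi * of_int s) * cis (c * of_int s * snd p)))"
    unfolding zak_def by (intro infsum_cong) (simp add: algebra_simps)
  finally have e: "zak c A (\<lambda>x. of_real x * h x) p - of_real (fst p) * zak c A h p =
    (\<Sum>\<^sub>\<infinity>s\<in>A. of_real (2 * pi * of_int s) * (h (fst p + 2 * pi * of_int s) * cis (c * of_int s * snd p)))"
    by simp
  have sm: "(\<lambda>s. norm (\<i> * of_real (c * of_int s) * h (fst p + 2 * pi * of_int s) *
      cis (c * of_int s * snd p))) summable_on A"
  proof (rule Infinite_Sum.abs_summable_on_comparison_test'[OF summable_on_cmult_right[OF summable_on_inverse_square_int]])
    fix s
    have "norm (of_int s * h (fst p + 2 * pi * of_int s)) \<le> B * (1 / (1 + (of_int s)\<^sup>2))"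
      using B[OF S_bound[OF S(3)], of s] by blast
    from mult_left_mono[OF this, of "\<bar>c\<bar>"]
    show "norm (\<i> * of_real (c * of_int s) * h (fst p + 2 * pi * of_int s) * cis (c * of_int s * snd p))
      \<le> (\<bar>c\<bar> * B) * (1 / (1 + (of_int s)\<^sup>2))"
      by (simp add: norm_mult mult.assoc abs_mult)
  qed
  have "partial_y (zak c A h) p = (\<Sum>\<^sub>\<infinity>s\<in>A. \<i> * of_real (c * of_int s) *
      h (fst p + 2 * pi * of_int s) * cis (c * of_int s * snd p))"
    unfolding infsum_eq_suminf_int_decode[OF sm] zf py fD ..
  also have "\<dots> = (\<Sum>\<^sub>\<infinity>s\<in>A. \<i> * c / (2 * pi) * (of_real (2 * pi * of_int s) * (h (fst p + 2 * pi * of_int s) * cis (c * of_int s * snd p))))"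
    by (intro infsum_cong) (simp add: field_simps)
  also have "\<dots> = \<i> * c / (2 * pi) *
      (zak c A (\<lambda>x. of_real x * h x) p - of_real (fst p) * zak c A h p)"
    unfolding e by (rule infsum_cmult_right')
  finally show "partial_y (zak c A h) p =
      \<i> * c / (2 * pi) * (zak c A (\<lambda>x. of_real x * h x) p - of_real (fst p) * zak c A h p)" .
qed

lemma smooth_zak:
  assumes "schwartz h"
  shows "smooth (zak c A h)"
proof -
  have "times_diff k (zak c A h)" if "schwartz h" for k h
    using that
  proof (induction k arbitrary: h)
    case 0
    then show ?case using zak_partials(1)
      unfolding times_diff.simps(1)
      by (intro differentiable_imp_continuous_on) (simp add: differentiable_on_def)
  next
    case (Suc k)
    have e: "partial_x (zak c A h) = zak c A (vderiv h)"
      "partial_y (zak c A h) = (\<lambda>p. \<i> * c / (2 * pi) * (zak c A (\<lambda>x. of_real x * h x) p +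
          (-1) * (of_real (fst p) * zak c A h p)))"
      using zak_partials(2,3)[OF Suc.prems] by (auto simp: fun_eq_iff)
    have "times_diff k (\<lambda>p. of_real (fst p))" using smooth_fst by (simp add: smooth_def)
    then have "times_diff k (partial_y (zak c A h))" unfolding e
      using Suc.prems by (intro times_diff_mult times_diff_add times_diff_const Suc.IH schwartz_times_x)
    moreover have "times_diff k (partial_x (zak c A h))" unfolding e
      using schwartzD(2)[OF Suc.prems] by (rule Suc.IH)
    ultimately show ?case using zak_partials(1)[OF Suc.prems] by simp
  qed
  then show ?thesis using assms by (simp add: smooth_def)
qed

text \<open>The translation replaces s by s - 1 and so trades A for its translate B = A + 1. On
  residue classes this is the cyclic shift of the matrix indices.\<close>

lemma zak_shift_x:
  assumes "\<And>s. s - 1 \<in> A \<longleftrightarrow> s \<in> B"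
  shows "zak c A h (x + 2 * pi, y) = cis (- c * y) * zak c B h (x, y)"
proof -
  have "s + 1 \<in> B" if "s \<in> A" for s using assms[of "s + 1"] that by simp
  then have bij: "bij_betw (\<lambda>s. s - 1) B A"
    using assms by (intro bij_betwI[where g = "\<lambda>s. s + 1"]) auto
  have "zak c A h (x + 2 * pi, y) =
    (\<Sum>\<^sub>\<infinity>s\<in>B. h (x + 2 * pi + 2 * pi * of_int (s - 1)) * cis (c * of_int (s - 1) * y))"
    unfolding zak_def by (simp only: fst_conv snd_conv infsum_reindex_bij_betw[OF bij, symmetric])
  also have "\<dots> = (\<Sum>\<^sub>\<infinity>s\<in>B. cis (- c * y) * (h (x + 2 * pi * of_int s) * cis (c * of_int s * y)))"
    by (intro infsum_cong) (simp add: algebra_simps cis_mult)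
  also have "\<dots> = cis (- c * y) * zak c B h (x, y)"
    unfolding zak_def by (simp add: infsum_cmult_right')
  finally show ?thesis .
qed

lemma zak_shift_y:
  assumes "\<And>s. s \<in> A \<Longrightarrow> cis (2 * pi * c * of_int s) = z"
  shows "zak c A h (x, y + 2 * pi) = z * zak c A h (x, y)"
proof -
  have "h (x + 2 * pi * of_int s) * cis (c * of_int s * (y + 2 * pi)) =
     z * (h (x + 2 * pi * of_int s) * cis (c * of_int s * y))" if "s \<in> A" for s
    using assms[OF that, symmetric] by (simp add: algebra_simps cis_mult)
  then have "zak c A h (x, y + 2 * pi) =
      (\<Sum>\<^sub>\<infinity>s\<in>A. z * (h (x + 2 * pi * of_int s) * cis (c * of_int s * y)))"
    unfolding zak_def fst_conv snd_conv by (intro infsum_cong)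
  then show ?thesis unfolding zak_def by (simp add: infsum_cmult_right')
qed

section \<open>Fourier analysis of quasi-periodic functions\<close>

lemma integral_cis_int:
  "((\<lambda>u. cis (of_int k * u)) has_integral (if k = 0 then 2 * pi else 0)) {-pi..pi}"
proof (cases "k = 0")
  case True
  have "((\<lambda>u::real. 1 :: complex) has_integral (pi - (- pi)) *\<^sub>R 1) {-pi..pi}"
    using has_integral_const_real[of "1::complex" "- pi" pi] by simp
  then show ?thesis using True by (simp add: scaleR_conv_of_real)
next
  case False
  have d: "((\<lambda>u. cis (of_int k * u) / (\<i> * of_int k)) has_vector_derivative cis (of_int k * u)) (at u)" for u
  proof -
    have "((\<lambda>z. exp (\<i> * of_int k * z) / (\<i> * of_int k)) has_field_derivative exp (\<i> * of_int k * z)) (at z)" for z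
      using False by (auto intro!: derivative_eq_intros)
    from has_vector_derivative_real_field[OF this, of u] show ?thesis
      by (simp add: cis_conv_exp mult.assoc)
  qed
  have "((\<lambda>u. cis (of_int k * u)) has_integral
      cis (of_int k * pi) / (\<i> * of_int k) - cis (of_int k * (- pi)) / (\<i> * of_int k)) {-pi..pi}"
    by (rule fundamental_theorem_of_calculus) (auto intro: has_vector_derivative_at_within d)
  moreover have "cis (of_int k * pi) = cis (of_int k * (- pi))"
    by (simp add: cis.ctr sin_int_times_real mult.commute)
  ultimately show ?thesis using False by simp
qed

text \<open>Expand the integral of |g - S|^2 with S the partial Fourier sum. The three products that
  involve S all integrate to the same real number T, so the integral of |g|^2 is at least T.\<close>

lemma bessel_inequality:
  fixes g :: "real \<Rightarrow> complex"
  assumes g: "continuous_on {-pi..pi} g" and K: "finite K"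
  defines "c \<equiv> \<lambda>k::int. integral {-pi..pi} (\<lambda>u. g u * cis (- of_int k * u))"
  shows "(\<Sum>k\<in>K. (norm (c k))\<^sup>2) \<le> 2 * pi * integral {-pi..pi} (\<lambda>u. (norm (g u))\<^sup>2)"
proof -
  define S where "S u = (\<Sum>k\<in>K. c k * cis (of_int k * u) / (2 * pi))" for u
  define T where "T = (\<Sum>k\<in>K. (norm (c k))\<^sup>2) / (2 * pi)"
  have c: "((\<lambda>u. g u * cis (- of_int k * u)) has_integral c k) {-pi..pi}" for k
    unfolding c_def by (intro integrable_integral integrable_continuous_real continuous_intros g)
  have gS: "((\<lambda>u. g u * cnj (S u)) has_integral T) {-pi..pi}"
  proof -
    have "((\<lambda>u. \<Sum>k\<in>K. cnj (c k) / (2 * pi) * (g u * cis (- of_int k * u))) has_integral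
        (\<Sum>k\<in>K. cnj (c k) / (2 * pi) * c k)) {-pi..pi}"
      by (intro has_integral_sum K has_integral_mult_right c)
    moreover have "(\<Sum>k\<in>K. cnj (c k) / (2 * pi) * c k) = T"
      unfolding T_def sum_divide_distrib of_real_sum
      by (intro sum.cong refl) (simp only: of_real_divide complex_norm_square, simp)
    moreover have "(\<Sum>k\<in>K. cnj (c k) / (2 * pi) * (g u * cis (- of_int k * u))) = g u * cnj (S u)" for u
      by (simp add: S_def sum_distrib_left cis_cnj mult_ac)
    ultimately show ?thesis by simp
  qed
  have SS: "((\<lambda>u. S u * cnj (S u)) has_integral T) {-pi..pi}"
  proof -
    have "((\<lambda>u. \<Sum>k\<in>K. \<Sum>l\<in>K. c k * cnj (c l) / (2 * pi)\<^sup>2 * cis (of_int (k - l) * u)) has_integral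
        (\<Sum>k\<in>K. \<Sum>l\<in>K. c k * cnj (c l) / (2 * pi)\<^sup>2 * (if k - l = 0 then 2 * pi else 0))) {-pi..pi}"
      by (intro has_integral_sum K has_integral_mult_right integral_cis_int)
    moreover have "(\<Sum>k\<in>K. \<Sum>l\<in>K. c k * cnj (c l) / (2 * pi)\<^sup>2 * (if k - l = 0 then 2 * pi else 0)) = T"
    proof -
      have "(\<Sum>l\<in>K. c k * cnj (c l) / (2 * pi)\<^sup>2 * (if k - l = 0 then 2 * pi else 0)) =
         (norm (c k))\<^sup>2 / (2 * pi)" if "k \<in> K" for k
      proof -
        have "(\<Sum>l\<in>K. c k * cnj (c l) / (2 * pi)\<^sup>2 * (if k - l = 0 then 2 * pi else 0)) =
          (\<Sum>l\<in>K. if l = k then c k * cnj (c k) / (2 * pi) else 0)"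
          by (intro sum.cong) (auto simp: power2_eq_square divide_simps)
        also have "\<dots> = c k * cnj (c k) / (2 * pi)" using K that by simp
        finally show ?thesis by (simp only: of_real_divide complex_norm_square)
      qed
      then show ?thesis by (simp add: T_def sum_divide_distrib)
    qed
    moreover have "(\<Sum>k\<in>K. \<Sum>l\<in>K. c k * cnj (c l) / (2 * pi)\<^sup>2 * cis (of_int (k - l) * u)) = S u * cnj (S u)" for u
    proof -
      have "cis (of_int (k - l) * u) = cis (of_int k * u) * cis (- (of_int l * u))" for k l
        by (simp add: cis_mult algebra_simps)
      then show ?thesis
        by (simp add: S_def sum_product cis_cnj power2_eq_square mult_ac)
    qed
    ultimately show ?thesis by simp
  qed
  have Sg: "((\<lambda>u. S u * cnj (g u)) has_integral T) {-pi..pi}"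
    using has_integral_cnj[THEN iffD2, OF gS] by (simp add: mult.commute o_def)
  have gg: "((\<lambda>u. (norm (g u))\<^sup>2) has_integral integral {-pi..pi} (\<lambda>u. (norm (g u))\<^sup>2)) {-pi..pi}"
    by (intro integrable_integral integrable_continuous_real continuous_intros g)
  have gg': "((\<lambda>u. g u * cnj (g u)) has_integral
      complex_of_real (integral {-pi..pi} (\<lambda>u. (norm (g u))\<^sup>2))) {-pi..pi}"
    using has_integral_of_real[OF gg, where ?'b = complex] unfolding complex_norm_square .
  have "((\<lambda>u. g u * cnj (g u) - g u * cnj (S u) - S u * cnj (g u) + S u * cnj (S u)) has_integral
      complex_of_real (integral {-pi..pi} (\<lambda>u. (norm (g u))\<^sup>2)) - T - T + T) {-pi..pi}"
    by (intro has_integral_add has_integral_diff gg' gS Sg SS)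
  moreover have "g u * cnj (g u) - g u * cnj (S u) - S u * cnj (g u) + S u * cnj (S u) =
      complex_of_real ((norm (g u - S u))\<^sup>2)" for u
    unfolding complex_norm_square by (simp add: algebra_simps)
  ultimately have "((\<lambda>u. complex_of_real ((norm (g u - S u))\<^sup>2)) has_integral
      complex_of_real (integral {-pi..pi} (\<lambda>u. (norm (g u))\<^sup>2) - T)) {-pi..pi}"
    by (simp del: of_real_power)
  from has_integral_Re[OF this]
  have "((\<lambda>u. (norm (g u - S u))\<^sup>2) has_integral
      (integral {-pi..pi} (\<lambda>u. (norm (g u))\<^sup>2) - T)) {-pi..pi}" by simp
  then have "0 \<le> integral {-pi..pi} (\<lambda>u. (norm (g u))\<^sup>2) - T"
    by (rule has_integral_nonneg) simp
  then show ?thesis by (simp add: T_def field_simps)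
qed

text \<open>By Bessel the squares of the coefficients are summable along any injective sequence of
  frequencies. Sequences tending to plus and to minus infinity are both used.\<close>

lemma fourier_coefficients_tendsto_0:
  fixes g :: "real \<Rightarrow> complex"
  assumes g: "continuous_on {-pi..pi} g" and k: "inj k"
  defines "c \<equiv> \<lambda>k::int. integral {-pi..pi} (\<lambda>u. g u * cis (- of_int k * u))"
  shows "(\<lambda>n::nat. c (k n)) \<longlonglongrightarrow> 0"
proof -
  define B where "B = 2 * pi * integral {-pi..pi} (\<lambda>u. (norm (g u))\<^sup>2)"
  have "summable (\<lambda>n. (norm (c (k n)))\<^sup>2)"
  proof (rule bounded_imp_summable)
    fix n
    have "(\<Sum>i\<le>n. (norm (c (k i)))\<^sup>2) = (\<Sum>j\<in>k ` {..n}. (norm (c j))\<^sup>2)"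
      using k by (subst sum.reindex) (auto intro: inj_on_subset)
    also have "\<dots> \<le> B" unfolding B_def c_def by (rule bessel_inequality[OF g]) simp
    finally show "(\<Sum>i\<le>n. (norm (c (k i)))\<^sup>2) \<le> B" .
  qed simp
  then have "(\<lambda>n. (norm (c (k n)))\<^sup>2) \<longlonglongrightarrow> 0" by (rule summable_LIMSEQ_zero)
  then have "(\<lambda>n. sqrt ((norm (c (k n)))\<^sup>2)) \<longlonglongrightarrow> sqrt 0" by (rule tendsto_real_sqrt)
  then have "(\<lambda>n. norm (c (k n))) \<longlonglongrightarrow> 0" by simp
  then show ?thesis by (rule tendsto_norm_zero_cancel)
qed

lemma difference_quotient_tendsto:
  fixes F :: "real \<Rightarrow> complex"
  assumes "(F has_vector_derivative D) (at 0)"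
  shows "((\<lambda>u. (F u - F 0) / of_real u) \<longlongrightarrow> D) (at 0)"
proof -
  have "((\<lambda>h. norm (F (0 + h) - F 0 - h *\<^sub>R D) / norm h) \<longlongrightarrow> 0) (at 0)"
    using assms unfolding has_vector_derivative_def has_derivative_at by blast
  then have "((\<lambda>u. norm ((F u - F 0) / of_real u - D)) \<longlongrightarrow> 0) (at 0)"
  proof (rule Lim_transform_eventually)
    show "\<forall>\<^sub>F h in at 0. norm (F (0 + h) - F 0 - h *\<^sub>R D) / norm h = norm ((F h - F 0) / of_real h - D)"
      unfolding eventually_at_filter
    proof (intro always_eventually allI impI)
      fix h :: real assume "h \<noteq> 0"
      then have "(F h - F 0) / of_real h - D = (F h - F 0 - h *\<^sub>R D) / of_real h"
        by (simp add: field_simps scaleR_conv_of_real)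
      then show "norm (F (0 + h) - F 0 - h *\<^sub>R D) / norm h = norm ((F h - F 0) / of_real h - D)"
        by (simp add: norm_divide)
    qed
  qed
  then show ?thesis by (rule LIM_zero_cancel[OF tendsto_norm_zero_cancel])
qed

lemma cis_neq_1: "cis u \<noteq> 1" if "u \<noteq> 0" "-pi \<le> u" "u \<le> pi"
proof
  assume "cis u = 1"
  then have "cos u = cos 0" by (metis cis.sel(1) one_complex.sel(1) cos_zero)
  then have "cos \<bar>u\<bar> = cos 0" by simp
  moreover have "\<bar>u\<bar> \<le> pi" using that by (simp add: abs_le_iff)
  ultimately have "\<bar>u\<bar> = 0" using cos_inj_pi[of "\<bar>u\<bar>" 0] by auto
  then show False using that by simp
qed

text \<open>Writing \<open>F u - F 0 = (cis u - 1) * g u\<close> with \<open>g\<close> continuous makes the partial sums of the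
  Fourier series at \<open>0\<close> telescope.\<close>

lemma fourier_series_at_0:
  fixes F :: "real \<Rightarrow> complex"
  assumes F: "continuous_on UNIV F" and D: "(F has_vector_derivative D) (at 0)"
  defines "c \<equiv> \<lambda>k::int. integral {-pi..pi} (\<lambda>u. F u * cis (- of_int k * u)) / (2 * pi)"
  shows "(\<lambda>K::nat. \<Sum>k\<in>{- int K..int K}. c k) \<longlonglongrightarrow> F 0"
proof -
  \<comment> \<open>On [-pi, pi] the denominator vanishes only at 0. The value there is the quotient
    of the derivatives of numerator and denominator, which makes g continuous.\<close>
  define g where "g u = (if u = 0 then D / \<i> else (F u - F 0) / (cis u - 1))" for u
  define G where "G k = integral {-pi..pi} (\<lambda>u. g u * cis (- of_int k * u))" for k :: int
  have eq: "F u - F 0 = (cis u - 1) * g u" if "u \<in> {-pi..pi}" for u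
    using that cis_neq_1[of u] by (auto simp: g_def)
  have lim: "(g \<longlongrightarrow> g 0) (at 0)"
  proof -
    have "((\<lambda>z. exp (\<i> * z)) has_field_derivative \<i>) (at 0)" by (auto intro!: derivative_eq_intros)
    then have "(cis has_vector_derivative \<i>) (at 0)"
      using has_vector_derivative_real_field[of "\<lambda>z. exp (\<i> * z)" \<i> 0] by (simp add: cis_conv_exp[abs_def])
    from tendsto_divide[OF difference_quotient_tendsto[OF D] difference_quotient_tendsto[OF this]]
    have "((\<lambda>u. ((F u - F 0) / of_real u) / ((cis u - 1) / of_real u)) \<longlongrightarrow> D / \<i>) (at 0)" by simp
    moreover have "\<forall>\<^sub>F u in at 0. ((F u - F 0) / of_real u) / ((cis u - 1) / of_real u) = g u"
      unfolding eventually_at_filter by (intro always_eventually) (auto simp: g_def)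
    ultimately have "(g \<longlongrightarrow> D / \<i>) (at 0)" by (rule Lim_transform_eventually)
    then show ?thesis by (simp add: g_def)
  qed
  have cg: "continuous_on {-pi..pi} g"
    unfolding continuous_on_def
  proof
    fix u assume u: "u \<in> {-pi..pi}"
    show "(g \<longlongrightarrow> g u) (at u within {-pi..pi})"
    proof (cases "u = 0")
      case True
      then show ?thesis using lim by (auto intro: tendsto_within_subset)
    next
      case False
      have "continuous (at u) F" using F by (simp add: continuous_on_eq_continuous_at)
      moreover have "continuous (at u) cis"
        using continuous_on_cis[OF continuous_on_id, of UNIV] by (simp add: continuous_on_eq_continuous_at)
      ultimately have "((\<lambda>u. (F u - F 0) / (cis u - 1)) \<longlongrightarrow> (F u - F 0) / (cis u - 1)) (at u)"
        using cis_neq_1[of u] False u by (intro tendsto_intros) (auto simp: continuous_at)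
      moreover have "\<forall>\<^sub>F x in at u. (F x - F 0) / (cis x - 1) = g x"
        unfolding eventually_at_filter
        by (rule eventually_mono[OF t1_space_nhds[OF False]]) (simp add: g_def)
      ultimately have "(g \<longlongrightarrow> (F u - F 0) / (cis u - 1)) (at u)" by (rule Lim_transform_eventually)
      then have "(g \<longlongrightarrow> g u) (at u)" using False by (simp add: g_def)
      then show ?thesis by (rule tendsto_within_subset) simp
    qed
  qed
  \<comment> \<open>Multiplication by \<open>cis u\<close> lowers the frequency index by one, whence
    the difference G (k - 1) - G k. The constant F 0 contributes only to the index 0.\<close>
  have ck: "2 * pi * c k = (if k = 0 then 2 * pi * F 0 else 0) + (G (k - 1) - G k)" for k
  proof -
    have Gk: "((\<lambda>u. g u * cis (- of_int k * u)) has_integral G k) {-pi..pi}" for k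
      unfolding G_def by (intro integrable_integral integrable_continuous_real continuous_intros cg)
    have "((\<lambda>u. F 0 * cis (of_int (- k) * u) + (g u * cis (- of_int (k - 1) * u) - g u * cis (- of_int k * u)))
      has_integral F 0 * (if - k = 0 then 2 * pi else 0) + (G (k - 1) - G k)) {-pi..pi}"
      by (intro has_integral_add has_integral_diff Gk has_integral_mult_right integral_cis_int)
    moreover have "F 0 * cis (of_int (- k) * u) + (g u * cis (- of_int (k - 1) * u) - g u * cis (- of_int k * u))
        = F u * cis (- of_int k * u)" if "u \<in> {-pi..pi}" for u
    proof -
      have "cis (- of_int (k - 1) * u) = cis u * cis (- of_int k * u)"
        by (simp add: cis_mult algebra_simps)
      then have "F 0 * cis (of_int (- k) * u) + (g u * cis (- of_int (k - 1) * u) - g u * cis (- of_int k * u))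
         = (F 0 + (cis u - 1) * g u) * cis (- of_int k * u)"
        by (simp add: algebra_simps)
      also have "F 0 + (cis u - 1) * g u = F u" unfolding eq[OF that, symmetric] by simp
      finally show ?thesis .
    qed
    ultimately have "((\<lambda>u. F u * cis (- of_int k * u)) has_integral
        F 0 * (if - k = 0 then 2 * pi else 0) + (G (k - 1) - G k)) {-pi..pi}"
      by (rule has_integral_eq_rhs[OF has_integral_eq[rotated]]) auto
    from integral_unique[OF this] show ?thesis unfolding c_def by simp
  qed
  have tel: "(\<Sum>k\<in>{- int K..int K}. 2 * pi * c k) = 2 * pi * F 0 + (G (- int K - 1) - G (int K))" for K
  proof (induction K)
    case 0
    then show ?case using ck[of 0] by simp
  next
    case (Suc K)
    have "{- int (Suc K)..int (Suc K)} = insert (- int K - 1) (insert (int K + 1) {- int K..int K})" by auto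
    then have "(\<Sum>k\<in>{- int (Suc K)..int (Suc K)}. 2 * pi * c k) =
        2 * pi * c (- int K - 1) + (2 * pi * c (int K + 1) + (\<Sum>k\<in>{- int K..int K}. 2 * pi * c k))"
      by simp
    also have "\<dots> = 2 * pi * F 0 + (G (- int (Suc K) - 1) - G (int (Suc K)))"
      unfolding Suc ck[of "- int K - 1"] ck[of "int K + 1"] by (simp add: algebra_simps)
    finally show ?case .
  qed
  have "(\<lambda>K. (2 * pi * F 0 + (G (- int K - 1) - G (int K))) / (2 * pi)) \<longlonglongrightarrow> (2 * pi * F 0 + (0 - 0)) / (2 * pi)"
    unfolding G_def
    by (intro tendsto_intros fourier_coefficients_tendsto_0 cg) (auto simp: inj_def)
  moreover have "(\<Sum>k\<in>{- int K..int K}. c k) = (2 * pi * F 0 + (G (- int K - 1) - G (int K))) / (2 * pi)" for K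
    using tel[of K] unfolding sum_distrib_left[symmetric] by (simp add: field_simps)
  ultimately show ?thesis by simp
qed

lemma ex_primitive:
  fixes f :: "real \<Rightarrow> complex"
  assumes "continuous_on UNIV f"
  shows "\<exists>P. \<forall>x. (P has_vector_derivative f x) (at x)"
proof -
  have "\<exists>P. \<forall>x::real. -\<infinity> < ereal x \<longrightarrow> ereal x < \<infinity> \<longrightarrow> (P has_vector_derivative f x) (at x)"
    by (rule einterval_antiderivative)
      (use assms in \<open>auto simp: continuous_on_eq_continuous_at\<close>)
  then show ?thesis by auto
qed

text \<open>For a primitive P of f, the difference P (x + T) - P x has derivative zero.\<close>

lemma integral_periodic:
  fixes f :: "real \<Rightarrow> complex"
  assumes f: "continuous_on UNIV f" and per: "\<And>x. f (x + T) = f x" and T: "T \<ge> 0"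
  shows "integral {a..a + T} f = integral {b..b + T} f"
proof -
  obtain P where P: "\<And>x. (P has_vector_derivative f x) (at x)" using ex_primitive[OF f] by blast
  have I: "integral {a..a + T} f = P (a + T) - P a" for a
    by (intro integral_unique fundamental_theorem_of_calculus)
      (use T in \<open>auto intro: has_vector_derivative_at_within P\<close>)
  have "((\<lambda>x. P (x + T) - P x) has_vector_derivative 0) (at x within UNIV)" for x
  proof -
    have *: "((\<lambda>x::real. x + T) has_vector_derivative 1) (at x)" by (auto intro!: derivative_eq_intros)
    have "((\<lambda>x. P (x + T)) has_vector_derivative 1 *\<^sub>R f (x + T)) (at x)"
      using vector_diff_chain_at[OF * P] by (simp add: o_def)
    from has_vector_derivative_diff[OF this P[of x]] show ?thesis by (simp add: per)
  qed
  then obtain c where "\<And>x. P (x + T) - P x = c"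
    using has_vector_derivative_zero_constant[of UNIV "\<lambda>x. P (x + T) - P x"] by auto
  then show ?thesis by (simp add: I)
qed

lemma shift_iterate:
  fixes f :: "real \<Rightarrow> complex"
  assumes "\<And>x. f (x + T) = cis \<theta> * f x"
  shows "f (x + T * of_int k) = cis (\<theta> * of_int k) * f x"
proof (induction k rule: int_induct[where k = 0])
  case (step1 i)
  have "f (x + T * of_int (i + 1)) = f (x + T * of_int i + T)" by (simp add: algebra_simps)
  also have "\<dots> = cis (\<theta> * of_int (i + 1)) * f x"
    unfolding assms step1 by (simp add: algebra_simps flip: cis_mult)
  finally show ?case .
next
  case (step2 i)
  have "cis \<theta> * f (x + T * of_int (i - 1)) = f (x + T * of_int (i - 1) + T)" by (simp add: assms)
  also have "\<dots> = f (x + T * of_int i)" by (simp add: algebra_simps)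
  also have "\<dots> = cis \<theta> * (cis (\<theta> * of_int (i - 1)) * f x)"
    unfolding step2 mult.assoc[symmetric] cis_mult by (simp add: algebra_simps)
  finally show ?case by (simp add: cis_neq_zero)
qed simp

section \<open>Smooth functions that are periodic in y and quasi-periodic in x, and their means in
  y\<close>

text \<open>These are smooth sections of a line bundle of degree -1 on the N-fold cover of the torus
  in the x-direction. The entry (0, 0) of a bundle map between Farey neighbours b/m and a/n is of
  this kind with N = n m: only after N periods do the indices modulo n and m return
  together.\<close>

definition theta_like :: "nat \<Rightarrow> (real \<times> real \<Rightarrow> complex) \<Rightarrow> bool" where
  "theta_like N r \<longleftrightarrow> smooth r \<and> (\<forall>x y. r (x, y + 2 * pi) = r (x, y)) \<and>
     (\<forall>x y. r (x + 2 * pi * real N, y) = cis (- y) * r (x, y))"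

text \<open>The zeroth Fourier coefficient in y. For a \<open>theta_like N\<close> function the k-th
  coefficient at x is the zeroth one at x + 2 pi N k, so this single function on the line retains
  everything.\<close>

definition mean_y :: "(real \<times> real \<Rightarrow> complex) \<Rightarrow> real \<Rightarrow> complex" where
  "mean_y r x = integral {-pi..pi} (\<lambda>y. r (x, y)) / (2 * pi)"

lemma continuous_slice: "smooth r \<Longrightarrow> continuous_on S (\<lambda>y. r (x, y))"
  by (rule continuous_on_compose2[where g = r and f = "\<lambda>y. (x, y)" and t = UNIV])
    (auto intro!: continuous_on_Pair continuous_on_const continuous_on_id simp: smooth_imp_continuous)

lemma has_integral_slice:
  "smooth r \<Longrightarrow> ((\<lambda>y. r (x, y)) has_integral 2 * pi * mean_y r x) {-pi..pi}"
  using integrable_integral[OF integrable_continuous_real[OF continuous_slice]]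
  by (simp add: mean_y_def)

lemma mean_y_add: "smooth r \<Longrightarrow> smooth s \<Longrightarrow> mean_y (\<lambda>p. r p + s p) x = mean_y r x + mean_y s x"
  using integral_unique[OF has_integral_add[OF has_integral_slice has_integral_slice], of r s x x]
  by (simp add: mean_y_def field_simps)

lemma mean_y_cmult: "mean_y (\<lambda>p. c * r p) x = c * mean_y r x"
  by (simp add: mean_y_def)

lemma mean_y_partial_y:
  assumes "smooth r" "\<And>x y. r (x, y + 2 * pi) = r (x, y)"
  shows "mean_y (partial_y r) x = 0"
proof -
  have "((\<lambda>y. partial_y r (x, y)) has_integral r (x, pi) - r (x, - pi)) {-pi..pi}"
    by (rule fundamental_theorem_of_calculus)
      (auto intro!: has_vector_derivative_at_within has_vector_derivative_partial_y
         smooth_imp_differentiable assms)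
  moreover have "r (x, pi) = r (x, - pi)" using assms(2)[of x "- pi"] by simp
  ultimately show ?thesis by (simp add: mean_y_def integral_unique)
qed

lemma mean_y_deriv:
  assumes "smooth r"
  shows "(mean_y r has_vector_derivative mean_y (partial_x r) x) (at x)"
proof -
  have "((\<lambda>x. integral (cbox (-pi) pi) (\<lambda>y. r (x, y))) has_vector_derivative
      integral (cbox (-pi) pi) (\<lambda>y. partial_x r (x, y))) (at x within UNIV)"
  proof (rule leibniz_rule_vector_derivative)
    show "((\<lambda>x. r (x, t)) has_vector_derivative partial_x r (x, t)) (at x within UNIV)" for x t
      by (rule has_vector_derivative_partial_x[OF smooth_imp_differentiable[OF assms]])
    show "(\<lambda>y. r (x, y)) integrable_on cbox (-pi) pi" for x
      using integrable_continuous_real[OF continuous_slice[OF assms]] by simp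
    show "continuous_on (UNIV \<times> cbox (- pi) pi) (\<lambda>(x, t). partial_x r (x, t))"
      using smooth_imp_continuous[OF smooth_partial_x[OF assms]]
      by (auto intro: continuous_on_subset simp: case_prod_beta')
  qed auto
  from has_vector_derivative_divide[OF this, of "2 * pi"] show ?thesis
    by (simp add: mean_y_def[abs_def])
qed

lemma theta_like_partial_x:
  assumes "theta_like N r"
  shows "theta_like N (partial_x r)"
proof -
  have sm: "smooth r" and d: "\<And>p. r differentiable (at p)"
    using assms smooth_imp_differentiable by (auto simp: theta_like_def)
  have "partial_x r (x, y + 2 * pi) = partial_x r (x, y)" for x y
  proof -
    have "(\<lambda>q. r (q + (0, 2 * pi))) = r" using assms by (auto simp: theta_like_def)
    then show ?thesis using partial_translate(2)[OF d, of "(0, 2 * pi)" "(x, y)"] by simp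
  qed
  moreover have "partial_x r (x + 2 * pi * real N, y) = cis (- y) * partial_x r (x, y)" for x y
  proof -
    have "(\<lambda>q. r (q + (2 * pi * real N, 0))) = (\<lambda>q. exp (0 * of_real (fst q) + (- \<i>) * of_real (snd q)) * r q)"
      using assms by (auto simp: theta_like_def cis_conv_exp)
    then have "partial_x r ((x, y) + (2 * pi * real N, 0)) =
       partial_x (\<lambda>q. exp (0 * of_real (fst q) + (- \<i>) * of_real (snd q)) * r q) (x, y)"
      using partial_translate(2)[OF d, of "(2 * pi * real N, 0)" "(x, y)"] by simp
    also have "\<dots> = cis (- y) * partial_x r (x, y)"
      using partial_mult(1)[OF partial_character(1) d, of 0 "- \<i>" "(x, y)"] partial_character(2)[of 0 "- \<i>" "(x, y)"]
      by (simp add: cis_conv_exp)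
    finally show ?thesis by simp
  qed
  ultimately show ?thesis using sm by (auto simp: theta_like_def intro: smooth_intros)
qed

text \<open>The factor cis (- y) depends on y, so \<open>partial_y\<close> alone breaks the
  quasi-periodicity; the term x r, which grows by 2 pi N per translation, repairs it. A y-derivative
  has mean zero, so on means the operator is multiplication by x.\<close>

definition nabla_y :: "nat \<Rightarrow> (real \<times> real \<Rightarrow> complex) \<Rightarrow> real \<times> real \<Rightarrow> complex" where
  "nabla_y N r p = of_real (fst p) * r p + (2 * pi * real N / \<i>) * partial_y r p"

lemma smooth_nabla_y: "smooth r \<Longrightarrow> smooth (nabla_y N r)"
  unfolding nabla_y_def[abs_def] by (intro smooth_intros smooth_fst)

lemma theta_like_nabla_y:
  assumes "theta_like N r"
  shows "theta_like N (nabla_y N r)"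
proof -
  have sm: "smooth r" and d: "\<And>p. r differentiable (at p)"
    using assms smooth_imp_differentiable by (auto simp: theta_like_def)
  have y: "r (x, y + 2 * pi) = r (x, y)" and x: "r (x + 2 * pi * real N, y) = cis (- y) * r (x, y)" for x y
    using assms by (auto simp: theta_like_def)
  have "partial_y r (x, y + 2 * pi) = partial_y r (x, y)" for x y
  proof -
    have "(\<lambda>q. r (q + (0, 2 * pi))) = r" by (auto simp: y)
    then show ?thesis using partial_translate(3)[OF d, of "(0, 2 * pi)" "(x, y)"] by simp
  qed
  moreover have px: "partial_y r (x + 2 * pi * real N, y) = cis (- y) * (partial_y r (x, y) - \<i> * r (x, y))" for x y
  proof -
    have "(\<lambda>q. r (q + (2 * pi * real N, 0))) = (\<lambda>q. exp (0 * of_real (fst q) + (- \<i>) * of_real (snd q)) * r q)"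
      by (auto simp: x cis_conv_exp)
    then have "partial_y r ((x, y) + (2 * pi * real N, 0)) =
       partial_y (\<lambda>q. exp (0 * of_real (fst q) + (- \<i>) * of_real (snd q)) * r q) (x, y)"
      using partial_translate(3)[OF d, of "(2 * pi * real N, 0)" "(x, y)"] by simp
    also have "\<dots> = cis (- y) * (partial_y r (x, y) - \<i> * r (x, y))"
      using partial_mult(2)[OF partial_character(1) d, of 0 "- \<i>" "(x, y)"] partial_character(3)[of 0 "- \<i>" "(x, y)"]
      by (simp add: cis_conv_exp algebra_simps)
    finally show ?thesis by simp
  qed
  moreover have "nabla_y N r (x + 2 * pi * real N, y) = cis (- y) * nabla_y N r (x, y)" for x y
    by (simp add: nabla_y_def px x) (simp add: field_simps)
  ultimately show ?thesis using sm by (auto simp: theta_like_def y nabla_y_def intro: smooth_nabla_y)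
qed

lemma mean_y_nabla_y:
  assumes "theta_like N r"
  shows "mean_y (nabla_y N r) x = of_real x * mean_y r x"
proof -
  have sm: "smooth r" using assms by (simp add: theta_like_def)
  have "mean_y (nabla_y N r) x = mean_y (\<lambda>p. of_real (fst p) * r p) x +
      mean_y (\<lambda>p. (2 * pi * real N / \<i>) * partial_y r p) x"
    unfolding nabla_y_def[abs_def] by (intro mean_y_add smooth_intros smooth_fst sm)
  also have "mean_y (\<lambda>p. (2 * pi * real N / \<i>) * partial_y r p) x = 0"
    unfolding mean_y_cmult using assms by (simp add: mean_y_partial_y theta_like_def)
  also have "mean_y (\<lambda>p. of_real (fst p) * r p) x = of_real x * mean_y r x"
    by (simp add: mean_y_def)
  finally show ?thesis by simp
qed

text \<open>The absolute value of r is doubly periodic, so its bound on a compact period rectangle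
  is global.\<close>

lemma theta_like_bounded:
  assumes "theta_like N r" "N \<ge> 1"
  shows "\<exists>B. \<forall>p. norm (r p) \<le> B"
proof -
  define K where "K = {0..2 * pi * real N} \<times> {0..2 * pi}"
  have "compact K" unfolding K_def by (intro compact_Times compact_Icc)
  moreover have "continuous_on K r"
    using assms(1) continuous_on_subset[OF smooth_imp_continuous subset_UNIV]
    by (simp add: theta_like_def)
  ultimately have "bounded (r ` K)" by (intro compact_imp_bounded compact_continuous_image)
  then obtain B where B: "\<And>p. p \<in> K \<Longrightarrow> norm (r p) \<le> B" unfolding bounded_iff by blast
  have red: "\<exists>k::int. 0 \<le> x + T * of_int k \<and> x + T * of_int k \<le> T" if "T > 0" for x T :: real
  proof -
    have "of_int \<lfloor>x / T\<rfloor> \<le> x / T" "x / T < of_int \<lfloor>x / T\<rfloor> + 1" by linarith+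
    then have "of_int \<lfloor>x / T\<rfloor> * T \<le> x" "x < (of_int \<lfloor>x / T\<rfloor> + 1) * T"
      using that by (simp_all only: pos_le_divide_eq pos_divide_less_eq)
    then have "0 \<le> x + T * of_int (- \<lfloor>x / T\<rfloor>)" "x + T * of_int (- \<lfloor>x / T\<rfloor>) \<le> T"
      by (simp_all add: algebra_simps)
    then show ?thesis by blast
  qed
  have "norm (r (x, y)) \<le> B" for x y
  proof -
    obtain k :: int where k: "0 \<le> x + 2 * pi * real N * of_int k" "x + 2 * pi * real N * of_int k \<le> 2 * pi * real N"
      using red[of "2 * pi * real N" x] assms(2) by auto
    obtain l :: int where l: "0 \<le> y + 2 * pi * of_int l" "y + 2 * pi * of_int l \<le> 2 * pi"
      using red[of "2 * pi" y] by auto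
    let ?x = "x + 2 * pi * real N * of_int k"
    have "r (?x, y) = cis (- y * of_int k) * r (x, y)"
      using shift_iterate[of "\<lambda>x. r (x, y)" "2 * pi * real N" "- y" x k] assms(1)
      by (simp add: theta_like_def)
    moreover have "r (?x, y + 2 * pi * of_int l) = r (?x, y)"
      using shift_iterate[of "\<lambda>y. r (?x, y)" "2 * pi" 0 y l] assms(1)
      by (simp add: theta_like_def)
    ultimately have "norm (r (x, y)) = norm (r (?x, y + 2 * pi * of_int l))"
      by (simp add: norm_mult)
    then show ?thesis using B[of "(?x, y + 2 * pi * of_int l)"] k l by (simp add: K_def)
  qed
  then show ?thesis by (metis surj_pair)
qed

lemma mean_y_bounded:
  assumes "theta_like N r" "N \<ge> 1"
  shows "\<exists>B. \<forall>x. norm (mean_y r x) \<le> B"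
proof -
  obtain B where B: "\<And>p. norm (r p) \<le> B" using theta_like_bounded[OF assms] by blast
  have sm: "smooth r" using assms by (simp add: theta_like_def)
  have "norm (mean_y r x) \<le> B" for x
  proof -
    have "norm (integral (cbox (-pi) pi) (\<lambda>y. r (x, y))) \<le> B * measure lborel (cbox (-pi) pi)"
      using B[of "(x, 0)"] norm_ge_zero[of "r (x, 0)"]
      by (intro integrable_bound integrable_continuous continuous_slice sm B) linarith
    then show ?thesis by (simp add: mean_y_def norm_divide field_simps)
  qed
  then show ?thesis by blast
qed

text \<open>Applying \<open>nabla_y\<close> twice multiplies the mean by x^2 and stays among
  theta-like functions, whose means are bounded. Hence each factor 1 + x^2 of the weight is absorbed
  by the bounds for r and for the new function.\<close>

lemma rapid_mean_y:
  assumes "theta_like N r" "N \<ge> 1"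
  shows "rapid (mean_y r)"
  unfolding rapid_def
proof
  fix a :: nat
  show "\<exists>B. \<forall>x. norm (mean_y r x) * (1 + x\<^sup>2) ^ a \<le> B"
    using assms(1)
  proof (induction a arbitrary: r)
    case 0
    then show ?case using mean_y_bounded assms(2) by simp
  next
    case (Suc a)
    define r' where "r' = nabla_y N (nabla_y N r)"
    have th: "theta_like N r'" unfolding r'_def by (intro theta_like_nabla_y Suc.prems)
    have r': "mean_y r' x = of_real (x\<^sup>2) * mean_y r x" for x
      by (simp add: r'_def mean_y_nabla_y[OF theta_like_nabla_y[OF Suc.prems]]
          mean_y_nabla_y[OF Suc.prems] power2_eq_square)
    obtain B C where B: "\<And>x. norm (mean_y r x) * (1 + x\<^sup>2) ^ a \<le> B"
      and C: "\<And>x. norm (mean_y r' x) * (1 + x\<^sup>2) ^ a \<le> C"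
      using Suc.IH[OF Suc.prems] Suc.IH[OF th] by blast
    have "norm (mean_y r x) * (1 + x\<^sup>2) ^ Suc a \<le> B + C" for x
      using add_mono[OF B[of x] C[of x]] by (simp add: r' norm_mult algebra_simps del: of_real_power)
    then show ?case by blast
  qed
qed

lemma schwartz_mean_y:
  assumes "theta_like N r" "N \<ge> 1"
  shows "schwartz (mean_y r)"
proof (rule schwartz_coinduct[where P = "\<lambda>h. \<exists>r. theta_like N r \<and> h = mean_y r"])
  fix h assume "\<exists>r. theta_like N r \<and> h = mean_y r"
  then obtain r where r: "theta_like N r" and h: "h = mean_y r" by blast
  have "\<forall>x. (h has_vector_derivative mean_y (partial_x r) x) (at x)"
    unfolding h using r mean_y_deriv by (auto simp: theta_like_def)
  then show "rapid h \<and> (\<exists>h'. (\<forall>x. (h has_vector_derivative h' x) (at x)) \<and> (\<exists>r. theta_like N r \<and> h' = mean_y r))"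
    using rapid_mean_y[OF r assms(2)] theta_like_partial_x[OF r] unfolding h by blast
qed (use assms in blast)

text \<open>This is the Fourier series of r (x, _) at y: its coefficient of index k is the mean at x
  + 2 pi N k, which is the Zak term of index s = N k. Symmetric partial sums converge to r by
  \<open>fourier_series_at_0\<close>, and absolute summability identifies their limit with the
  unordered sum.\<close>

theorem theta_like_eq_zak:
  assumes r: "theta_like N r" and N: "N \<ge> 1"
  shows "r p = zak (1 / real N) {s. int N dvd s} (mean_y r) p"
proof -
  obtain x y where p: "p = (x, y)" by fastforce
  have sm: "smooth r" using r by (simp add: theta_like_def)
  define F where "F u = r (x, y + u)" for u
  define c where "c k = integral {-pi..pi} (\<lambda>u. F u * cis (- of_int k * u)) / (2 * pi)" for k :: int
  have ck: "c k = cis (of_int k * y) * mean_y r (x + 2 * pi * real N * of_int k)" for k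
  proof -
    let ?f = "\<lambda>v. r (x, v) * cis (- of_int k * v)"
    have cf: "continuous_on UNIV ?f" by (intro continuous_intros continuous_slice sm)
    have rk: "?f v = r (x + 2 * pi * real N * of_int k, v)" for v
      using shift_iterate[of "\<lambda>x. r (x, v)" "2 * pi * real N" "- v" x k] r
      by (simp add: theta_like_def mult_ac)
    have "integral {-pi..pi} (\<lambda>u. F u * cis (- of_int k * u)) =
        integral {-pi..pi} (\<lambda>u. cis (of_int k * y) * (?f \<circ> (+) y) u)"
      unfolding F_def by (intro arg_cong[where f = "integral {-pi..pi}"] ext)
        (simp add: algebra_simps cis_mult)
    also have "\<dots> = cis (of_int k * y) * integral {-pi + y..-pi + y + 2 * pi} ?f"
    proof -
      have "pi + y = - pi + y + 2 * pi" by simp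
      then show ?thesis by (simp only: integral_mult_right integral_shift_Icc_real)
    qed
    also have "integral {-pi + y..-pi + y + 2 * pi} ?f = integral {-pi..-pi + 2 * pi} ?f"
    proof (rule integral_periodic[OF cf])
      fix v
      show "?f (v + 2 * pi) = ?f v" unfolding rk using r by (simp add: theta_like_def)
    qed simp
    also have "integral {-pi..-pi + 2 * pi} ?f = 2 * pi * mean_y r (x + 2 * pi * real N * of_int k)"
      unfolding rk by (simp add: mean_y_def)
    finally show ?thesis unfolding c_def by simp
  qed
  have "(F has_vector_derivative partial_y r (x, y)) (at 0)"
  proof -
    have *: "((\<lambda>u::real. y + u) has_vector_derivative 1) (at 0)" by (auto intro!: derivative_eq_intros)
    have "((\<lambda>t. r (x, t)) has_vector_derivative partial_y r (x, y)) (at (y + 0))"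
      using has_vector_derivative_partial_y[OF smooth_imp_differentiable[OF sm]] by simp
    from vector_diff_chain_at[OF * this] show ?thesis by (simp add: F_def[abs_def] o_def)
  qed
  moreover have "continuous_on UNIV F"
    unfolding F_def
    by (rule continuous_on_compose2[OF continuous_slice[OF sm, of UNIV x]]) (auto intro!: continuous_intros)
  ultimately have lim: "(\<lambda>K::nat. \<Sum>k\<in>{- int K..int K}. c k) \<longlonglongrightarrow> r p"
    using fourier_series_at_0[of F] by (simp add: c_def[abs_def] F_def p)
  have bij: "bij_betw (\<lambda>k. int N * k) UNIV {s. int N dvd s}"
    by (rule bij_betwI[where g = "\<lambda>s. s div int N"]) (use N in auto)
  have trm: "mean_y r (x + 2 * pi * of_int (int N * k)) * cis (1 / real N * of_int (int N * k) * y) = c k" for k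
    unfolding ck using N by (simp add: mult_ac)
  have "(\<lambda>s. mean_y r (x + 2 * pi * of_int s) * cis (1 / real N * of_int s * y)) summable_on {s. int N dvd s}"
    by (rule zak_summable[OF rapid_mean_y[OF r N]])
  then have "((\<lambda>s. mean_y r (x + 2 * pi * of_int s) * cis (1 / real N * of_int s * y)) has_sum
      zak (1 / real N) {s. int N dvd s} (mean_y r) p) {s. int N dvd s}"
    by (simp add: zak_def p)
  then have hs: "(c has_sum zak (1 / real N) {s. int N dvd s} (mean_y r) p) UNIV"
    using has_sum_reindex_bij_betw[OF bij, of "\<lambda>s. mean_y r (x + 2 * pi * of_int s) * cis (1 / real N * of_int s * y)"]
    by (simp only: trm)
  \<comment> \<open>Symmetric intervals eventually contain every finite set, so the unordered sum is
    also the limit of the symmetric partial sums.\<close>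
  have "filterlim (\<lambda>K::nat. {- int K..int K}) (finite_subsets_at_top UNIV) sequentially"
    unfolding filterlim_finite_subsets_at_top
  proof (intro allI impI)
    fix X :: "int set" assume X: "finite X \<and> X \<subseteq> UNIV"
    show "\<forall>\<^sub>F K in sequentially. finite {- int K..int K} \<and> X \<subseteq> {- int K..int K} \<and> {- int K..int K} \<subseteq> UNIV"
    proof (rule eventually_sequentiallyI[of "nat (\<Sum>x\<in>X. \<bar>x\<bar>)"])
      fix K assume K: "nat (\<Sum>x\<in>X. \<bar>x\<bar>) \<le> K"
      have "\<bar>x\<bar> \<le> int K" if "x \<in> X" for x
        using member_le_sum[OF that, of abs] X K by (simp add: nat_le_iff)
      then show "finite {- int K..int K} \<and> X \<subseteq> {- int K..int K} \<and> {- int K..int K} \<subseteq> UNIV"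
        by (force simp: abs_le_iff)
    qed
  qed
  from filterlim_compose[OF hs[unfolded has_sum_def] this]
  have "(\<lambda>K::nat. \<Sum>k\<in>{- int K..int K}. c k) \<longlonglongrightarrow> zak (1 / real N) {s. int N dvd s} (mean_y r) p" .
  with lim show ?thesis by (rule LIMSEQ_unique)
qed

section \<open>First order equations with Gaussian integrating factor\<close>

text \<open>The majorant C/(1 + t^2) has the bounded primitive C arctan t. Hence increments of P at
  infinity are small, and over any interval at most C pi.\<close>

lemma primitive_bound:
  fixes P f :: "real \<Rightarrow> complex"
  assumes P: "\<And>x. (P has_vector_derivative f x) (at x)"
    and f: "\<And>t. x \<le> t \<Longrightarrow> norm (f t) \<le> C / (1 + t\<^sup>2)" and xy: "x \<le> y"
  shows "norm (P y - P x) \<le> C * (arctan y - arctan x)"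
proof (cases "x = y")
  case False
  then have "x < y" using xy by simp
  then have "norm (P y - P x) \<le> C * arctan y - C * arctan x"
  proof (rule differentiable_bound_general)
    show "continuous_on {x..y} P"
      using P by (auto intro!: continuous_at_imp_continuous_on has_vector_derivative_continuous)
    show "continuous_on {x..y} (\<lambda>t. C * arctan t)" by (intro continuous_intros)
    show "((\<lambda>t. C * arctan t) has_vector_derivative C / (1 + t\<^sup>2)) (at t)" for t
      unfolding has_real_derivative_iff_has_vector_derivative[symmetric]
      by (auto intro!: derivative_eq_intros simp: field_simps add_nonneg_eq_0_iff)
    show "norm (f t) \<le> C / (1 + t\<^sup>2)" if "x < t" for t using f that by simp
  qed (use P in auto)
  then show ?thesis by (simp add: algebra_simps)
qed simp

lemma primitive_tendsto_at_top:
  fixes P f :: "real \<Rightarrow> complex"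
  assumes P: "\<And>x. (P has_vector_derivative f x) (at x)"
    and f: "\<And>t. norm (f t) \<le> C / (1 + t\<^sup>2)"
  shows "\<exists>L. (P \<longlongrightarrow> L) at_top"
proof -
  have C: "C \<ge> 0" using order_trans[OF norm_ge_zero f[of 0]] by simp
  have lt: "C * (arctan y - arctan x) \<le> C * (pi / 2 - arctan x)" for x y
    using arctan_ubound[of y] C by (intro mult_left_mono) auto
  have lim: "((\<lambda>x. C * (pi / 2 - arctan x)) \<longlongrightarrow> C * (pi / 2 - pi / 2)) at_top"
    by (intro tendsto_intros tendsto_arctan_at_top)
  have "Cauchy (\<lambda>n. P (real n))"
  proof (rule metric_CauchyI)
    fix e :: real assume "e > 0"
    then have "\<forall>\<^sub>F x in at_top. C * (pi / 2 - arctan x) < e"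
      using order_tendstoD(2)[OF lim, of e] by simp
    then obtain M where M: "\<And>x. x \<ge> M \<Longrightarrow> C * (pi / 2 - arctan x) < e"
      unfolding eventually_at_top_linorder by blast
    obtain N where N: "real N \<ge> M" using real_arch_simple by blast
    have *: "dist (P (real m)) (P (real n)) < e" if "N \<le> m" "m \<le> n" for m n
    proof -
      have "norm (P (real n) - P (real m)) \<le> C * (arctan (real n) - arctan (real m))"
        by (rule primitive_bound[OF P f]) (use that in simp)
      also have "\<dots> < e" using lt[of "real n" "real m"] M[of "real m"] N that by simp
      finally show ?thesis by (simp add: dist_norm norm_minus_commute)
    qed
    show "\<exists>N. \<forall>m\<ge>N. \<forall>n\<ge>N. dist (P (real m)) (P (real n)) < e"
    proof (intro exI allI impI)
      fix m n assume "N \<le> m" "N \<le> n"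
      then show "dist (P (real m)) (P (real n)) < e"
        using *[of m n] *[of n m] by (cases "m \<le> n") (auto simp: dist_commute)
    qed
  qed
  then obtain L where L: "(\<lambda>n. P (real n)) \<longlonglongrightarrow> L" by (meson Cauchy_convergent convergent_def)
  have b: "norm (P x - L) \<le> C * (pi / 2 - arctan x)" for x
  proof -
    have "(\<lambda>n. norm (P x - P (real n))) \<longlonglongrightarrow> norm (P x - L)" by (intro tendsto_intros L)
    moreover have "\<forall>\<^sub>F n in sequentially. norm (P x - P (real n)) \<le> C * (pi / 2 - arctan x)"
    proof (rule eventually_sequentiallyI[of "nat \<lceil>x\<rceil>"])
      fix n assume "nat \<lceil>x\<rceil> \<le> n"
      then have "x \<le> real n" by linarith
      then have "norm (P (real n) - P x) \<le> C * (arctan (real n) - arctan x)"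
        by (rule primitive_bound[OF P f])
      then show "norm (P x - P (real n)) \<le> C * (pi / 2 - arctan x)"
        using lt[of "real n" x] by (simp add: norm_minus_commute)
    qed
    ultimately show ?thesis by (rule tendsto_upperbound) simp
  qed
  have "((\<lambda>x. P x - L) \<longlongrightarrow> 0) at_top"
    by (rule Lim_null_comparison[OF always_eventually]) (use b lim in auto)
  then have "(P \<longlongrightarrow> L) at_top" by (rule LIM_zero_cancel)
  then show ?thesis by blast
qed

text \<open>The improper integral of f over the line, given through its primitive from minus
  infinity. That primitive is what the solution of the differential equation is made of.\<close>

definition has_total :: "(real \<Rightarrow> complex) \<Rightarrow> complex \<Rightarrow> bool" where
  "has_total f J \<longleftrightarrow> (\<exists>P. (\<forall>x. (P has_vector_derivative f x) (at x)) \<and>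
     (P \<longlongrightarrow> 0) at_bot \<and> (P \<longlongrightarrow> J) at_top)"

lemma has_total_diff_cmult:
  assumes "has_total f J" "has_total g K"
  shows "has_total (\<lambda>x. f x - c * g x) (J - c * K)"
proof -
  obtain P Q where P: "\<And>x. (P has_vector_derivative f x) (at x)" "(P \<longlongrightarrow> 0) at_bot" "(P \<longlongrightarrow> J) at_top"
    and Q: "\<And>x. (Q has_vector_derivative g x) (at x)" "(Q \<longlongrightarrow> 0) at_bot" "(Q \<longlongrightarrow> K) at_top"
    using assms unfolding has_total_def by blast
  have "((\<lambda>x. P x - c * Q x) \<longlongrightarrow> 0 - c * 0) at_bot" "((\<lambda>x. P x - c * Q x) \<longlongrightarrow> J - c * K) at_top"
    by (intro tendsto_intros P Q)+
  moreover have "((\<lambda>x. P x - c * Q x) has_vector_derivative f x - c * g x) (at x)" for x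
    by (intro has_vector_derivative_diff has_vector_derivative_mult_right P Q)
  ultimately show ?thesis unfolding has_total_def by auto
qed

lemma has_vector_derivative_reflect:
  fixes P :: "real \<Rightarrow> complex"
  assumes "\<And>x. (P has_vector_derivative f x) (at x)"
  shows "((\<lambda>x. P (- x)) has_vector_derivative - f (- x)) (at x)"
proof -
  have *: "((\<lambda>x::real. - x) has_vector_derivative - 1) (at x)" by (auto intro!: derivative_eq_intros)
  show ?thesis using vector_diff_chain_at[OF * assms] by (simp add: o_def)
qed

lemma ex_has_total:
  assumes f: "continuous_on UNIV f" and bd: "\<And>t. norm (f t) \<le> C / (1 + t\<^sup>2)"
  shows "\<exists>J. has_total f J"
proof -
  obtain P where P: "\<And>x. (P has_vector_derivative f x) (at x)" using ex_primitive[OF f] by blast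
  obtain L where L: "(P \<longlongrightarrow> L) at_top" using primitive_tendsto_at_top[OF P bd] by blast
  have "norm (- f (- t)) \<le> C / (1 + t\<^sup>2)" for t using bd[of "- t"] by simp
  from primitive_tendsto_at_top[OF has_vector_derivative_reflect[OF P] this]
  obtain M where "((\<lambda>x. P (- x)) \<longlongrightarrow> M) at_top" by blast
  then have M: "(P \<longlongrightarrow> M) at_bot" by (simp add: at_bot_mirror filterlim_filtermap)
  have "((\<lambda>x. P x - M) \<longlongrightarrow> M - M) at_bot" "((\<lambda>x. P x - M) \<longlongrightarrow> L - M) at_top"
    by (intro tendsto_intros L M)+
  moreover have "((\<lambda>x. P x - M) has_vector_derivative f x - 0) (at x)" for x
    by (intro has_vector_derivative_diff P has_vector_derivative_const)
  ultimately show ?thesis unfolding has_total_def by (intro exI[of _ "L - M"] exI[of _ "\<lambda>x. P x - M"]) simp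
qed

definition gauss :: "complex \<Rightarrow> complex \<Rightarrow> real \<Rightarrow> complex" where
  "gauss A B x = exp (A * (of_real x)\<^sup>2 + B * of_real x)"

lemma gauss_nonzero [simp]: "gauss A B x \<noteq> 0" by (simp add: gauss_def)

lemma gauss_deriv: "(gauss A B has_vector_derivative (2 * A * of_real x + B) * gauss A B x) (at x)"
  using gaussian_deriv[of 1 A B x] by (simp add: gauss_def[abs_def] mult.commute mult.left_commute add.commute)

lemma rapid_gauss: "Re A < 0 \<Longrightarrow> rapid (gauss A B)"
  using rapid_gaussian[of A B] by (simp add: gauss_def[abs_def])

lemma schwartz_gauss: "Re A < 0 \<Longrightarrow> schwartz (gauss A B)"
  using schwartz_gaussian[of A B] by (simp add: gauss_def[abs_def])

lemma schwartz_continuous: "schwartz h \<Longrightarrow> continuous_on UNIV h"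
  using schwartzD(3) has_vector_derivative_continuous
  by (blast intro: continuous_at_imp_continuous_on)

lemma ex_has_total_gauss:
  assumes "Re A < 0" "schwartz \<rho>"
  shows "\<exists>J. has_total (\<lambda>x. gauss A B x * \<rho> x) J"
proof -
  obtain C where C: "\<And>x. norm (gauss A B x) * (1 + x\<^sup>2) ^ 0 \<le> C"
    using rapid_gauss[OF assms(1)] unfolding rapid_def by meson
  obtain D where D: "\<And>x. norm (\<rho> x) * (1 + x\<^sup>2) ^ 1 \<le> D"
    using schwartzD(1)[OF assms(2)] unfolding rapid_def by meson
  show ?thesis
  proof (rule ex_has_total)
    show "continuous_on UNIV (\<lambda>x. gauss A B x * \<rho> x)"
      by (intro continuous_intros schwartz_continuous schwartz_gauss assms)
    fix t :: real
    have p: "1 + t\<^sup>2 > 0" by (simp add: add_pos_nonneg)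
    have "norm (gauss A B t) * (norm (\<rho> t) * (1 + t\<^sup>2)) \<le> C * D"
      using C[of t] D[of t] p order_trans[OF norm_ge_zero, of "gauss A B t" C] by (intro mult_mono) auto
    then show "norm (gauss A B t * \<rho> t) \<le> C * D / (1 + t\<^sup>2)"
      using p by (simp add: norm_mult field_simps)
  qed
qed

text \<open>Far to the right |gauss| decreases, so the tail of the integral is at most |gauss x|
  times a tail of rho. Dividing the primitive by the Gaussian therefore leaves a rapidly decreasing
  function. The extra exponent in \<open>Suc a\<close> supplies the integrable factor 1/(1 +
  t^2).\<close>

lemma gauss_primitive_decay:
  fixes P \<rho> :: "real \<Rightarrow> complex"
  assumes A: "Re A < 0" and \<rho>: "rapid \<rho>"
    and P: "\<And>x. (P has_vector_derivative gauss A B x * \<rho> x) (at x)" and L: "(P \<longlongrightarrow> 0) at_top"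
  shows "\<exists>K x1. \<forall>x\<ge>x1. norm (P x) * (1 + x\<^sup>2) ^ a \<le> K * norm (gauss A B x)"
proof -
  \<comment> \<open>Beyond x1 the slope 2 Re A x + Re B of the real part of the exponent is
    nonpositive.\<close>
  define x1 where "x1 = max 0 (Re B / (- 2 * Re A))"
  have x1: "x1 \<ge> 0" "2 * Re A * x1 + Re B \<le> 0"
  proof -
    have "Re B / (- 2 * Re A) \<le> x1" by (simp add: x1_def)
    then show "2 * Re A * x1 + Re B \<le> 0" using A by (simp add: field_simps)
  qed (simp add: x1_def)
  have mono: "norm (gauss A B t) \<le> norm (gauss A B x)" if "x1 \<le> x" "x \<le> t" for x t
  proof -
    have "Re A * (t + x) \<le> Re A * (2 * x1)" using A that by (intro mult_left_mono_neg) auto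
    then have "Re A * (t + x) + Re B \<le> 0" using x1 by simp
    then have "(t - x) * (Re A * (t + x) + Re B) \<le> 0" using that by (intro mult_nonneg_nonpos) auto
    then show ?thesis by (simp add: gauss_def norm_exp_eq_Re power2_eq_square algebra_simps)
  qed
  obtain K where K: "\<And>x. norm (\<rho> x) * (1 + x\<^sup>2) ^ Suc a \<le> K" using \<rho> unfolding rapid_def by meson
  have K0: "K \<ge> 0" using order_trans[OF mult_nonneg_nonneg[OF norm_ge_zero] K[of 0]] by simp
  have "norm (P x) * (1 + x\<^sup>2) ^ a \<le> (K * pi) * norm (gauss A B x)" if x: "x \<ge> x1" for x
  proof -
    define C where "C = norm (gauss A B x) * K / (1 + x\<^sup>2) ^ a"
    have p: "(1 + t\<^sup>2) ^ k > 0" for t :: real and k :: nat by (simp add: add_pos_nonneg)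
    have C0: "C \<ge> 0" unfolding C_def using K0 p[of x a] by (intro divide_nonneg_pos) auto
    have f: "norm (gauss A B t * \<rho> t) \<le> C / (1 + t\<^sup>2)" if t: "x \<le> t" for t
    proof -
      have xt: "(1 + x\<^sup>2) ^ a \<le> (1 + t\<^sup>2) ^ a" using x x1 t by (intro power_mono add_left_mono) auto
      have "norm (\<rho> t) * (1 + t\<^sup>2) * (1 + x\<^sup>2) ^ a \<le> norm (\<rho> t) * (1 + t\<^sup>2) * (1 + t\<^sup>2) ^ a"
        by (intro mult_left_mono xt) auto
      also have "\<dots> \<le> K" using K[of t] by (simp add: mult_ac)
      finally have "norm (\<rho> t) * (1 + t\<^sup>2) \<le> K / (1 + x\<^sup>2) ^ a" using p[of x a] by (simp add: pos_le_divide_eq)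
      then have "norm (gauss A B t) * (norm (\<rho> t) * (1 + t\<^sup>2)) \<le> norm (gauss A B x) * (K / (1 + x\<^sup>2) ^ a)"
        using mono[OF x t] by (intro mult_mono) auto
      then have "norm (gauss A B t * \<rho> t) * (1 + t\<^sup>2) \<le> C" by (simp add: C_def norm_mult mult_ac)
      then show ?thesis using p[of t 1] by (subst pos_le_divide_eq) auto
    qed
    have "norm (P x) \<le> C * pi"
    proof -
      have "((\<lambda>y. norm (P y - P x)) \<longlongrightarrow> norm (0 - P x)) at_top" by (intro tendsto_intros L)
      moreover have "\<forall>\<^sub>F y in at_top. norm (P y - P x) \<le> C * pi"
      proof (rule eventually_mono[OF eventually_ge_at_top[of x]])
        fix y assume "x \<le> y"
        then have "norm (P y - P x) \<le> C * (arctan y - arctan x)" by (intro primitive_bound[OF P f])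
        also have "\<dots> \<le> C * pi"
          using arctan_bounded[of x] arctan_bounded[of y] C0 by (intro mult_left_mono) auto
        finally show "norm (P y - P x) \<le> C * pi" .
      qed
      ultimately have "norm (0 - P x) \<le> C * pi" by (rule tendsto_upperbound) simp
      then show ?thesis by simp
    qed
    then have "norm (P x) * (1 + x\<^sup>2) ^ a \<le> C * pi * (1 + x\<^sup>2) ^ a"
      using p[of x a] by (intro mult_right_mono) auto
    also have "C * (1 + x\<^sup>2) ^ a = norm (gauss A B x) * K"
      unfolding C_def using p[of x a] less_imp_neq[OF p[of x a]] by (metis nonzero_eq_divide_eq)
    then have "C * pi * (1 + x\<^sup>2) ^ a = (K * pi) * norm (gauss A B x)" by (simp add: mult_ac)
    finally show ?thesis .
  qed
  then show ?thesis by blast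
qed

lemma rapid_compact_complement:
  fixes h :: "real \<Rightarrow> complex"
  assumes h: "continuous_on UNIV h"
    and r: "\<And>a::nat. \<exists>K x1. \<forall>x\<ge>x1. norm (h x) * (1 + x\<^sup>2) ^ a \<le> K"
    and l: "\<And>a::nat. \<exists>K x1. \<forall>x\<ge>x1. norm (h (- x)) * (1 + x\<^sup>2) ^ a \<le> K"
  shows "rapid h"
  unfolding rapid_def
proof
  fix a :: nat
  obtain K x1 where K: "\<And>x. x \<ge> x1 \<Longrightarrow> norm (h x) * (1 + x\<^sup>2) ^ a \<le> K" using r by blast
  obtain M x2 where M: "\<And>x. x \<ge> x2 \<Longrightarrow> norm (h (- x)) * (1 + x\<^sup>2) ^ a \<le> M" using l by blast
  have "continuous_on {- x2..x1} h" using continuous_on_subset[OF h] by blast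
  then have "continuous_on {- x2..x1} (\<lambda>x. norm (h x) * (1 + x\<^sup>2) ^ a)" by (intro continuous_intros)
  from compact_imp_bounded[OF compact_continuous_image[OF this compact_Icc]]
  obtain B where B: "\<And>x. x \<in> {- x2..x1} \<Longrightarrow> norm (norm (h x) * (1 + x\<^sup>2) ^ a) \<le> B"
    unfolding bounded_iff ball_simps by blast
  have "norm (h x) * (1 + x\<^sup>2) ^ a \<le> max K (max M B)" for x
  proof -
    consider "x \<ge> x1" | "- x \<ge> x2" | "x \<in> {- x2..x1}"
      unfolding atLeastAtMost_iff by linarith
    then show ?thesis
    proof cases
      case 1 then show ?thesis using K by (simp add: max.coboundedI1)
    next
      case 2 then show ?thesis using M[of "- x"] by simp
    next
      case 3 then show ?thesis using B[of x] by simp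
    qed
  qed
  then show "\<exists>B. \<forall>x. norm (h x) * (1 + x\<^sup>2) ^ a \<le> B" by blast
qed

lemma schwartz_poly:
  assumes "schwartz f"
  shows "schwartz (\<lambda>x. poly p (of_real x) * f x)"
proof (induction p)
  case 0
  then show ?case using schwartz_0 by simp
next
  case (pCons c p)
  have "(\<lambda>x. poly (pCons c p) (of_real x) * f x) =
      (\<lambda>x. of_real x * (poly p (of_real x) * f x) + c * f x)"
    by (simp add: algebra_simps)
  then show ?case using schwartz_times_x_add[OF pCons.IH schwartz_cmult[OF assms]] by simp
qed

lemma has_vector_derivative_poly:
  fixes p :: "complex poly"
  shows "((\<lambda>x. poly p (of_real x)) has_vector_derivative poly (pderiv p) (of_real x)) (at x)"
  by (rule has_vector_derivative_real_field) (rule poly_DERIV)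

text \<open>With \<open>w = gauss A B\<close> the equation reads \<open>(w * h)' = w * \<rho>\<close>; it is solvable among Schwartz
  functions because the total integral of the right-hand side vanishes.\<close>

theorem solve_gauss_ode:
  assumes A: "Re A < 0" and \<rho>: "schwartz \<rho>" and tot: "has_total (\<lambda>x. gauss A B x * \<rho> x) 0"
  shows "\<exists>h. schwartz h \<and> (\<forall>x. vderiv h x + (2 * A * of_real x + B) * h x = \<rho> x)"
proof -
  obtain P where P: "\<And>x. (P has_vector_derivative gauss A B x * \<rho> x) (at x)"
    "(P \<longlongrightarrow> 0) at_bot" "(P \<longlongrightarrow> 0) at_top"
    using tot unfolding has_total_def by blast
  define h where "h x = P x * gauss (- A) (- B) x" for x
  have inv: "gauss A B x * gauss (- A) (- B) x = 1" for x
    by (simp add: gauss_def flip: exp_add)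
  have hd: "(h has_vector_derivative \<rho> x - (2 * A * of_real x + B) * h x) (at x)" for x
  proof -
    have "(h has_vector_derivative P x * ((2 * (- A) * of_real x + (- B)) * gauss (- A) (- B) x) +
        gauss A B x * \<rho> x * gauss (- A) (- B) x) (at x)"
      unfolding h_def[abs_def] by (intro has_vector_derivative_mult P gauss_deriv)
    moreover have "gauss A B x * \<rho> x * gauss (- A) (- B) x = \<rho> x"
      using inv[of x] by (metis mult.assoc mult.commute mult_1)
    ultimately have "(h has_vector_derivative P x * ((2 * (- A) * of_real x + (- B)) * gauss (- A) (- B) x) + \<rho> x) (at x)"
      by simp
    then show ?thesis by (simp add: h_def algebra_simps)
  qed
  have nh: "norm (h x) * norm (gauss A B x) = norm (P x)" for x
    using inv[of x] by (simp add: h_def flip: norm_mult) (simp add: mult_ac)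
  have div: "norm (h x) * c \<le> K" if "norm (P x) * c \<le> K * norm (gauss A B x)" for x c K
  proof -
    have "(norm (h x) * c) * norm (gauss A B x) \<le> K * norm (gauss A B x)"
      using that nh[of x] by (simp add: mult_ac)
    then show ?thesis by simp
  qed
  have "rapid h"
  proof (rule rapid_compact_complement)
    show "continuous_on UNIV h"
      using hd has_vector_derivative_continuous by (blast intro: continuous_at_imp_continuous_on)
    fix a :: nat
    show "\<exists>K x1. \<forall>x\<ge>x1. norm (h x) * (1 + x\<^sup>2) ^ a \<le> K"
      using gauss_primitive_decay[OF A schwartzD(1)[OF \<rho>] P(1,3), of a] div by blast
    \<comment> \<open>The left tail is the right tail of the reflected problem, which keeps A,
      changes the sign of B and replaces the right-hand side by - \<rho> (- x).\<close>
    have r: "rapid (\<lambda>x. - \<rho> (- x))"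
      unfolding rapid_def
    proof
      fix a :: nat
      obtain C where "\<And>x. norm (\<rho> x) * (1 + x\<^sup>2) ^ a \<le> C" using schwartzD(1)[OF \<rho>] unfolding rapid_def by meson
      from this[of "- x" for x] show "\<exists>B. \<forall>x. norm (- \<rho> (- x)) * (1 + x\<^sup>2) ^ a \<le> B" by auto
    qed
    have "((\<lambda>x. P (- x)) has_vector_derivative gauss A (- B) x * (- \<rho> (- x))) (at x)" for x
      using has_vector_derivative_reflect[OF P(1), of x] by (simp add: gauss_def)
    moreover have "((\<lambda>x. P (- x)) \<longlongrightarrow> 0) at_top"
      using P(2) by (simp add: at_bot_mirror filterlim_filtermap)
    ultimately obtain K x1 where K: "\<And>x. x \<ge> x1 \<Longrightarrow> norm (P (- x)) * (1 + x\<^sup>2) ^ a \<le> K * norm (gauss A (- B) x)"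
      using gauss_primitive_decay[OF A r, of "\<lambda>x. P (- x)" "- B" a] by blast
    have g: "gauss A (- B) x = gauss A B (- x)" for x by (simp add: gauss_def)
    have "norm (h (- x)) * (1 + x\<^sup>2) ^ a \<le> K" if "x \<ge> x1" for x
      using K[OF that] unfolding g by (rule div)
    then show "\<exists>K x1. \<forall>x\<ge>x1. norm (h (- x)) * (1 + x\<^sup>2) ^ a \<le> K" by blast
  qed
  \<comment> \<open>Since h' = \<rho> - (2 A x + B) h, the functions p h + \<sigma> with p a
    polynomial and \<sigma> Schwartz are closed under differentiation.\<close>
  have "schwartz h"
  proof (rule schwartz_coinduct[where P = "\<lambda>u. \<exists>p \<sigma>. schwartz \<sigma> \<and> u = (\<lambda>x. poly p (of_real x) * h x + \<sigma> x)"])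
    fix u assume "\<exists>p \<sigma>. schwartz \<sigma> \<and> u = (\<lambda>x. poly p (of_real x) * h x + \<sigma> x)"
    then obtain p \<sigma> where \<sigma>: "schwartz \<sigma>" and u: "u = (\<lambda>x. poly p (of_real x) * h x + \<sigma> x)" by blast
    let ?p = "pderiv p - p * [:B, 2 * A:]" and ?s = "\<lambda>x. poly p (of_real x) * \<rho> x + vderiv \<sigma> x"
    have "rapid u" unfolding u by (intro rapid_add rapid_poly \<open>rapid h\<close> schwartzD(1)[OF \<sigma>])
    moreover have "(u has_vector_derivative poly ?p (of_real x) * h x + ?s x) (at x)" for x
    proof -
      have "(u has_vector_derivative (poly p (of_real x) * (\<rho> x - (2 * A * of_real x + B) * h x) +
          poly (pderiv p) (of_real x) * h x) + vderiv \<sigma> x) (at x)"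
        unfolding u by (intro has_vector_derivative_add has_vector_derivative_mult has_vector_derivative_poly hd schwartzD(3)[OF \<sigma>])
      then show ?thesis by (simp add: algebra_simps)
    qed
    moreover have "schwartz ?s" by (intro schwartz_add schwartz_poly \<rho> schwartzD(2)[OF \<sigma>])
    ultimately show "rapid u \<and> (\<exists>u'. (\<forall>x. (u has_vector_derivative u' x) (at x)) \<and>
        (\<exists>p \<sigma>. schwartz \<sigma> \<and> u' = (\<lambda>x. poly p (of_real x) * h x + \<sigma> x)))"
      by - (rule conjI, assumption, rule exI[of _ "\<lambda>x. poly ?p (of_real x) * h x + ?s x"], blast)
  next
    show "\<exists>p \<sigma>. schwartz \<sigma> \<and> h = (\<lambda>x. poly p (of_real x) * h x + \<sigma> x)"
      by (intro exI[of _ 1] exI[of _ "\<lambda>x. 0"]) (simp add: schwartz_0)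
  qed
  moreover have "vderiv h x + (2 * A * of_real x + B) * h x = \<rho> x" for x
    using vderivI[OF hd] by simp
  ultimately show ?thesis by blast
qed

text \<open>The integrating factor makes gauss times h constant. As h is bounded and the Gaussian
  decays, the constant is 0. This is what excludes maps of negative degree.\<close>

lemma bounded_gauss_ode_zero:
  assumes A: "Re A < 0" and h: "\<And>x. (h has_vector_derivative h' x) (at x)"
    and ode: "\<And>x. h' x + (2 * A * of_real x + B) * h x = 0" and bd: "\<And>x. norm (h x) \<le> C"
  shows "h x = 0"
proof -
  have "((\<lambda>x. gauss A B x * h x) has_vector_derivative 0) (at x within UNIV)" for x
  proof -
    have "((\<lambda>x. gauss A B x * h x) has_vector_derivative gauss A B x * h' x +
       (2 * A * of_real x + B) * gauss A B x * h x) (at x)"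
      by (intro has_vector_derivative_mult gauss_deriv h)
    moreover have "gauss A B x * h' x + (2 * A * of_real x + B) * gauss A B x * h x = 
        gauss A B x * (h' x + (2 * A * of_real x + B) * h x)" by (simp add: algebra_simps)
    ultimately show ?thesis by (simp add: ode)
  qed
  then obtain c where c: "\<And>x. gauss A B x * h x = c"
    using has_vector_derivative_zero_constant[of UNIV "\<lambda>x. gauss A B x * h x"] by auto
  obtain K where K: "\<And>x. norm (gauss A B x) * (1 + x\<^sup>2) ^ 1 \<le> K"
    using rapid_gauss[OF A] unfolding rapid_def by meson
  have "norm c * (1 + x\<^sup>2) \<le> K * C" for x
  proof -
    have "norm c * (1 + x\<^sup>2) = norm (gauss A B x) * (1 + x\<^sup>2) ^ 1 * norm (h x)"
      by (simp add: c[of x, symmetric] norm_mult)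
    also have "\<dots> \<le> K * C" 
      using K[of x] bd[of x] order_trans[OF mult_nonneg_nonneg K[of x]] by (intro mult_mono) auto
    finally show ?thesis .
  qed
  note le = this
  have "norm c = 0"
  proof (rule ccontr)
    assume "norm c \<noteq> 0"
    then have n: "norm c > 0" by simp
    \<comment> \<open>At this t the bound would read 1 + t^2 <= t.\<close>
    define t where "t = K * C / norm c"
    have "norm c * (1 + t\<^sup>2) \<le> norm c * t" using le[of t] n by (simp add: t_def)
    then have "1 + t\<^sup>2 \<le> t" using n by simp
    moreover have "0 \<le> (t - 1 / 2)\<^sup>2" by simp
    ultimately show False by (simp add: power2_eq_square algebra_simps)
  qed
  then show ?thesis using c[of x] by simp
qed

section \<open>Theta functions with too many zeros\<close>

text \<open>At a zero z0 of h the function f vanishes too and the zero of h is simple. Near z0 the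
  quotient therefore equals that of the two difference quotients (f z - f z0)/(z - z0) and (h z - h
  z0)/(z - z0), which are entire after filling in the derivatives, and the second one is nonzero at
  z0.\<close>

lemma ex_holomorphic_quotient:
  assumes f: "f holomorphic_on UNIV" and h: "h holomorphic_on UNIV"
    and z: "\<And>z. h z = 0 \<Longrightarrow> f z = 0 \<and> deriv h z \<noteq> 0"
  shows "\<exists>R. R holomorphic_on UNIV \<and> (\<forall>z. f z = R z * h z)"
proof -
  define R where "R z = (if h z = 0 then deriv f z / deriv h z else f z / h z)" for z
  have "R field_differentiable (at z0)" for z0
  proof -
    define F H where "F z = (if z = z0 then deriv f z0 else (f z - f z0) / (z - z0))"
      and "H z = (if z = z0 then deriv h z0 else (h z - h z0) / (z - z0))" for z
    have F: "F holomorphic_on UNIV" and H: "H holomorphic_on UNIV"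
      unfolding F_def[abs_def] H_def[abs_def] using f h by (auto intro: pole_lemma)
    show ?thesis
    proof (cases "h z0 = 0")
      case False
      have "open {z. h z \<noteq> 0}"
        using holomorphic_on_imp_continuous_on[OF h] by (intro open_Collect_neq) auto
      moreover have "(\<lambda>z. f z / h z) holomorphic_on {z. h z \<noteq> 0}"
        by (intro holomorphic_on_divide holomorphic_on_subset[OF f] holomorphic_on_subset[OF h]) auto
      then have "R holomorphic_on {z. h z \<noteq> 0}"
        by (rule holomorphic_transform) (simp add: R_def)
      ultimately show ?thesis using False by (auto simp: holomorphic_on_open field_differentiable_def)
    next
      case True
      note z0 = z[OF True]
      have "open {z. H z \<noteq> 0}"
        using holomorphic_on_imp_continuous_on[OF H] by (intro open_Collect_neq) auto
      moreover have "(\<lambda>z. F z / H z) holomorphic_on {z. H z \<noteq> 0}"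
        by (intro holomorphic_on_divide holomorphic_on_subset[OF F] holomorphic_on_subset[OF H]) auto
      then have "R holomorphic_on {z. H z \<noteq> 0}"
        by (rule holomorphic_transform) (use z0 True in \<open>auto simp: R_def F_def H_def split: if_splits\<close>)
      moreover have "z0 \<in> {z. H z \<noteq> 0}" using z0 by (simp add: H_def)
      ultimately show ?thesis by (auto simp: holomorphic_on_open field_differentiable_def)
    qed
  qed
  then have "R holomorphic_on UNIV" by (simp add: holomorphic_on_def)
  moreover have "f z = R z * h z" for z using z[of z] by (simp add: R_def)
  ultimately show ?thesis by blast
qed

section \<open>An entire theta function with prescribed simple zeros\<close>

text \<open>Euler's coefficients (-1)^k q^(k(k-1)/2) / ((1 - q) ... (1 - q^k)). The recursion
  results from comparing coefficients in P(W) = (1 - W) P(q W).\<close>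

fun euler_coeff :: "complex \<Rightarrow> nat \<Rightarrow> complex" where
  "euler_coeff q 0 = 1"
| "euler_coeff q (Suc k) = - (q ^ k) * euler_coeff q k / (1 - q ^ Suc k)"

text \<open>The sum of this series is the infinite product of the factors \<open>1 - q ^ k * W\<close>, but only the
  functional equation is needed.\<close>

definition euler_fun :: "complex \<Rightarrow> complex \<Rightarrow> complex" where
  "euler_fun q W = (\<Sum>k. euler_coeff q k * W ^ k)"

lemma power_neq_1:
  fixes q :: complex
  assumes q: "norm q < 1"
  shows "q ^ Suc k \<noteq> 1"
proof
  assume "q ^ Suc k = 1"
  then have "norm (q ^ Suc k) = 1" by (simp only: norm_one)
  then have "norm q ^ Suc k = 1" by (simp only: norm_power)
  moreover have "norm q * norm q ^ k \<le> norm q * 1"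
    using q by (intro mult_left_mono power_le_one) auto
  ultimately show False using q by simp
qed

text \<open>The ratio of consecutive terms is bounded by |W| |q|^k / (1 - |q|), which tends to 0, so
  the series converges for every W.\<close>

lemma summable_euler:
  assumes q: "norm q < 1"
  shows "summable (\<lambda>k. norm (euler_coeff q k * W ^ k))"
proof -
  have "(\<lambda>k. norm W / (1 - norm q) * norm q ^ k) \<longlonglongrightarrow> norm W / (1 - norm q) * 0"
    using q by (intro tendsto_intros LIMSEQ_power_zero) auto
  then have "\<forall>\<^sub>F k in sequentially. norm W / (1 - norm q) * norm q ^ k < 1 / 2"
    by (intro order_tendstoD(2)) auto
  then obtain N where N: "\<And>k. k \<ge> N \<Longrightarrow> norm W / (1 - norm q) * norm q ^ k < 1 / 2"
    unfolding eventually_sequentially by blast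
  show ?thesis
  proof (rule summable_ratio_test[of "1 / 2" N])
    fix k assume k: "k \<ge> N"
    have "1 - norm q \<le> 1 - norm q ^ Suc k"
      using q by (simp add: mult_left_le power_le_one)
    also have "\<dots> \<le> norm (1 - q ^ Suc k)"
      using norm_triangle_ineq2[of 1 "q ^ Suc k"] by (simp add: norm_power norm_mult)
    finally have d: "1 - norm q \<le> norm (1 - q ^ Suc k)" .
    have "norm (euler_coeff q (Suc k) * W ^ Suc k) =
        norm (euler_coeff q k * W ^ k) * (norm W * norm q ^ k / norm (1 - q ^ Suc k))"
      by (simp add: norm_mult norm_divide norm_power)
    also have "\<dots> \<le> norm (euler_coeff q k * W ^ k) * (norm W * norm q ^ k / (1 - norm q))"
      using d q by (intro mult_left_mono divide_left_mono mult_pos_pos) (auto intro: less_le_trans[of 0 "1 - norm q"])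
    also have "\<dots> \<le> norm (euler_coeff q k * W ^ k) * (1 / 2)"
      using N[OF k] by (intro mult_left_mono) auto
    finally show "norm (norm (euler_coeff q (Suc k) * W ^ Suc k)) \<le> 1 / 2 * norm (norm (euler_coeff q k * W ^ k))"
      by simp
  qed simp
qed

lemma euler_fun_functional:
  assumes q: "norm q < 1"
  shows "euler_fun q W = (1 - W) * euler_fun q (q * W)"
proof -
  have s: "summable (\<lambda>k. euler_coeff q k * W ^ k)" for W
    using summable_norm_cancel[OF summable_euler[OF q]] .
  have "euler_fun q W - euler_fun q (q * W) = (\<Sum>k. euler_coeff q k * W ^ k - euler_coeff q k * (q * W) ^ k)"
    unfolding euler_fun_def by (rule suminf_diff[OF s s])
  also have "\<dots> = (\<Sum>k. euler_coeff q (Suc k) * W ^ Suc k - euler_coeff q (Suc k) * (q * W) ^ Suc k)"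
    using suminf_split_head[OF summable_diff[OF s[of W] s[of "q * W"]]]
    by (simp del: euler_coeff.simps(2) power_Suc)
  also have "\<dots> = (\<Sum>k. (- W) * (euler_coeff q k * (q * W) ^ k))"
  proof (intro suminf_cong)
    fix k
    have n: "1 - q ^ Suc k \<noteq> 0" using power_neq_1[OF q, of k] by simp
    have "euler_coeff q (Suc k) * W ^ Suc k - euler_coeff q (Suc k) * (q * W) ^ Suc k =
        (euler_coeff q (Suc k) * (1 - q ^ Suc k)) * W ^ Suc k"
      by (simp add: power_mult_distrib algebra_simps del: euler_coeff.simps(2) power_Suc)
    also have "euler_coeff q (Suc k) * (1 - q ^ Suc k) = - (q ^ k) * euler_coeff q k"
      using n by (simp del: power_Suc)
    also have "\<dots> * W ^ Suc k = (- W) * (euler_coeff q k * (q * W) ^ k)"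
      by (simp add: power_mult_distrib)
    finally show "euler_coeff q (Suc k) * W ^ Suc k - euler_coeff q (Suc k) * (q * W) ^ Suc k = \<dots>" .
  qed
  also have "\<dots> = - W * euler_fun q (q * W)"
    unfolding euler_fun_def by (rule suminf_mult[OF s])
  finally show ?thesis by (simp add: algebra_simps)
qed

lemma euler_fun_0: "euler_fun q 0 = 1"
  unfolding euler_fun_def using powser_zero[of "euler_coeff q"] by simp

lemma euler_fun_holomorphic:
  assumes q: "norm q < 1"
  shows "euler_fun q holomorphic_on UNIV"
proof -
  have "(euler_fun q has_field_derivative (\<Sum>k. diffs (euler_coeff q) k * W ^ k)) (at W)" for W
    unfolding euler_fun_def[abs_def]
    by (rule termdiffs_strong_converges_everywhere) (rule summable_norm_cancel[OF summable_euler[OF q]])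
  then show ?thesis by (auto simp: holomorphic_on_def field_differentiable_def)
qed

lemma euler_fun_iterate:
  assumes q: "norm q < 1"
  shows "euler_fun q W = (\<Prod>i<k. 1 - q ^ i * W) * euler_fun q (q ^ k * W)"
proof (induction k)
  case (Suc k)
  show ?case unfolding Suc euler_fun_functional[OF q, of "q ^ k * W"] by (simp add: mult_ac)
qed simp

text \<open>If no factor 1 - q^k W vanishes, the functional equation carries the zero W to all
  points q^k W. These tend to 0, where the function is 1.\<close>

lemma euler_fun_zero_imp:
  assumes q: "norm q < 1" and W: "euler_fun q W = 0"
  shows "\<exists>k. q ^ k * W = 1"
proof (rule ccontr)
  assume n: "\<nexists>k. q ^ k * W = 1"
  have "(\<Prod>i<k. 1 - q ^ i * W) \<noteq> 0" for k using n by auto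
  then have z: "euler_fun q (q ^ k * W) = 0" for k
    using euler_fun_iterate[OF q, of W k] W by auto
  have "(\<lambda>k. q ^ k * W) \<longlonglongrightarrow> 0 * W" using q by (intro tendsto_intros LIMSEQ_power_zero)
  moreover have "continuous (at 0) (euler_fun q)"
    using holomorphic_on_imp_continuous_on[OF euler_fun_holomorphic[OF q]] by (simp add: continuous_on_eq_continuous_at)
  ultimately have "(\<lambda>k. euler_fun q (q ^ k * W)) \<longlonglongrightarrow> euler_fun q 0"
    using isCont_tendsto_compose[of 0 "euler_fun q"] by auto
  then have "(\<lambda>k. 0) \<longlonglongrightarrow> (1::complex)" by (simp add: z euler_fun_0)
  then show False using LIMSEQ_unique[OF tendsto_const] by fastforce
qed

lemma euler_fun_q_nonzero:
  assumes q: "norm q < 1"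
  shows "euler_fun q q \<noteq> 0"
  using euler_fun_zero_imp[OF q, of q] power_neq_1[OF q] by (metis power_Suc mult.commute)

lemma euler_fun_1:
  assumes q: "norm q < 1"
  shows "euler_fun q 1 = 0"
  using euler_fun_functional[OF q, of 1] by simp

text \<open>Adding T does not increase |R| above a certain height and does not decrease it below, so
  |R| is bounded everywhere by its maximum on one compact period rectangle at that height. By
  Liouville R is constant, and the transformation rule at two points forces the constant to be
  0.\<close>

lemma negative_degree_zero:
  fixes R :: "complex \<Rightarrow> complex"
  assumes R: "R holomorphic_on UNIV" and per: "\<And>z. R (z + of_real (2 * pi)) = R z"
    and quasi: "\<And>z. R (z + T) = c * exp (\<i> * of_nat d * z) * R z"
    and T: "Im T > 0" and c: "c \<noteq> 0" and d: "d > 0"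
  shows "R z = 0"
proof -
  \<comment> \<open>The height at which the multiplier c exp (i d z) has absolute value 1.\<close>
  define t0 where "t0 = ln (norm c) / real d"
  have nq: "norm (R (z + T)) = norm c * exp (- real d * Im z) * norm (R z)" for z
    by (simp add: quasi norm_mult norm_exp_eq_Re)
  have up: "norm (R (z + T)) \<le> norm (R z)" if "Im z \<ge> t0" for z
  proof -
    have "ln (norm c) - real d * Im z \<le> 0" using that d by (simp add: t0_def field_simps)
    then have "exp (ln (norm c) - real d * Im z) \<le> 1" by simp
    then have "norm c * exp (- real d * Im z) \<le> 1" using c by (simp add: exp_diff exp_minus field_simps)
    then show ?thesis unfolding nq using mult_right_mono[of _ 1 "norm (R z)"] by simp
  qed
  have down: "norm (R z) \<le> norm (R (z + T))" if "Im z \<le> t0" for z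
  proof -
    have "ln (norm c) - real d * Im z \<ge> 0" using that d by (simp add: t0_def field_simps)
    then have "exp (ln (norm c) - real d * Im z) \<ge> 1" by simp
    then have "norm c * exp (- real d * Im z) \<ge> 1" using c by (simp add: exp_diff exp_minus field_simps)
    then show ?thesis unfolding nq using mult_right_mono[of 1 _ "norm (R z)"] by simp
  qed
  define K where "K = cbox (Complex 0 t0) (Complex (2 * pi) (t0 + Im T))"
  have "bounded (R ` K)" unfolding K_def
    by (intro compact_imp_bounded compact_continuous_image compact_cbox
        holomorphic_on_imp_continuous_on holomorphic_on_subset[OF R]) simp
  then obtain B where B: "\<And>z. z \<in> K \<Longrightarrow> norm (R z) \<le> B" unfolding bounded_iff by auto
  have strip: "norm (R z) \<le> B" if z: "t0 \<le> Im z" "Im z \<le> t0 + Im T" for z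
  proof -
    define k where "k = - \<lfloor>Re z / (2 * pi)\<rfloor>"
    have "of_int \<lfloor>Re z / (2 * pi)\<rfloor> \<le> Re z / (2 * pi)" "Re z / (2 * pi) < of_int \<lfloor>Re z / (2 * pi)\<rfloor> + 1" by linarith+
    then have "of_int \<lfloor>Re z / (2 * pi)\<rfloor> * (2 * pi) \<le> Re z" "Re z < (of_int \<lfloor>Re z / (2 * pi)\<rfloor> + 1) * (2 * pi)"
      by (simp_all only: pos_le_divide_eq pos_divide_less_eq pi_gt_zero zero_less_mult_iff zero_less_numeral simp_thms)
    then have k: "0 \<le> Re z + 2 * pi * of_int k" "Re z + 2 * pi * of_int k \<le> 2 * pi"
      unfolding k_def by (simp_all add: algebra_simps)
    have "R (z + of_real (2 * pi * of_int k)) = R z" for k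
    proof (induction k rule: int_induct[where k = 0])
      case (step1 i)
      then show ?case using per[of "z + of_real (2 * pi * of_int i)"] by (simp add: algebra_simps)
    next
      case (step2 i)
      then show ?case using per[of "z + of_real (2 * pi * of_int (i - 1))"] by (simp add: algebra_simps)
    qed simp
    moreover have "z + of_real (2 * pi * of_int k) \<in> K"
      using k z unfolding K_def by (simp add: in_cbox_complex_iff)
    ultimately show ?thesis using B by metis
  qed
  have above: "t0 \<le> Im z \<Longrightarrow> Im z \<le> t0 + (real k + 1) * Im T \<Longrightarrow> norm (R z) \<le> B" for k z
  proof (induction k arbitrary: z)
    case 0
    then show ?case using strip by simp
  next
    case (Suc k)
    show ?case
    proof (cases "Im z \<le> t0 + Im T")
      case True
      then show ?thesis using strip Suc.prems by simp
    next
      case False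
      then have "norm (R (z - T)) \<le> B" using Suc.prems by (intro Suc.IH) (auto simp: algebra_simps)
      moreover have "norm (R z) \<le> norm (R (z - T))" using up[of "z - T"] False by simp
      ultimately show ?thesis by linarith
    qed
  qed
  have below: "t0 - real k * Im T \<le> Im z \<Longrightarrow> Im z \<le> t0 + Im T \<Longrightarrow> norm (R z) \<le> B" for k z
  proof (induction k arbitrary: z)
    case 0
    then show ?case using strip by simp
  next
    case (Suc k)
    show ?case
    proof (cases "Im z \<ge> t0")
      case True
      then show ?thesis using strip Suc.prems by simp
    next
      case False
      then have "norm (R (z + T)) \<le> B" using Suc.prems T by (intro Suc.IH) (auto simp: algebra_simps)
      moreover have "norm (R z) \<le> norm (R (z + T))" using down[of z] False by simp
      ultimately show ?thesis by linarith
    qed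
  qed
  have "norm (R z) \<le> B" for z
  proof (cases "Im z \<ge> t0")
    case True
    obtain k :: nat where "(Im z - t0) / Im T \<le> real k" using real_arch_simple by blast
    then have "Im z - t0 \<le> real k * Im T" using T by (simp add: pos_divide_le_eq)
    then show ?thesis using above[of z k] True T by (simp add: algebra_simps)
  next
    case False
    obtain k :: nat where "(t0 - Im z) / Im T \<le> real k" using real_arch_simple by blast
    then have "t0 - Im z \<le> real k * Im T" using T by (simp add: pos_divide_le_eq)
    then show ?thesis using below[of k z] False T by (simp add: algebra_simps)
  qed
  then have "bounded (range R)" unfolding bounded_iff by blast
  then obtain b where b: "\<And>z. R z = b" using Liouville_theorem[OF R] unfolding constant_on_def by blast
  have 1: "b = c * b" using quasi[of 0] by (simp only: b) simp
  \<comment> \<open>At z = 0 the exponential in the rule is 1, at z = pi/d it is -1, so b = c b = -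
    b.\<close>
  have "b = c * exp (\<i> * pi) * b" using quasi[of "of_real (pi / real d)"] d by (simp only: b) simp
  then have "b = - (c * b)" by simp
  then have "b = - b" unfolding 1[symmetric] .
  then have "b = 0" by simp
  then show ?thesis using b by simp
qed

text \<open>On the strip |Im z| <= r the factor exp (i s z) is at most exp (r |s|), so coefficients
  that beat every exponential give uniform convergence on unit discs.\<close>

lemma holomorphic_int_series:
  fixes a :: "int \<Rightarrow> complex"
  assumes a: "\<And>r. (\<lambda>s. norm (a s) * exp (r * \<bar>of_int s\<bar>)) summable_on UNIV"
  shows "(\<lambda>z. \<Sum>\<^sub>\<infinity>s. a s * exp (\<i> * of_int s * z)) holomorphic_on UNIV"
proof -
  define f where "f n z = a (int_decode n) * exp (\<i> * of_int (int_decode n) * z)" for n z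
  have le: "norm (a s * exp (\<i> * of_int s * z)) \<le> norm (a s) * exp (r * \<bar>of_int s\<bar>)" if "\<bar>Im z\<bar> \<le> r" for r s z
  proof -
    have "- (of_int s * Im z) \<le> \<bar>of_int s\<bar> * \<bar>Im z\<bar>" by (metis abs_ge_minus_self abs_mult)
    also have "\<dots> \<le> r * \<bar>of_int s\<bar>" using that by (simp add: mult.commute mult_right_mono)
    finally show ?thesis by (simp add: norm_mult norm_exp_eq_Re mult_left_mono)
  qed
  have sm: "summable (\<lambda>n. norm (a (int_decode n)) * exp (r * \<bar>of_int (int_decode n)\<bar>))" for r
  proof -
    have "(\<lambda>n. norm (a (int_decode n)) * exp (r * \<bar>of_int (int_decode n)\<bar>)) summable_on UNIV"
      using a[of r] summable_on_reindex_bij_betw[OF bij_int_decode, of "\<lambda>s. norm (a s) * exp (r * \<bar>of_int s\<bar>)"] by simp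
    then show ?thesis by (rule summable_on_imp_summable)
  qed
  have "(\<lambda>z. \<Sum>n. f n z) holomorphic_on UNIV"
  proof (rule holomorphic_uniform_sequence)
    show "(\<lambda>z. \<Sum>n<N. f n z) holomorphic_on UNIV" for N
      unfolding f_def by (intro holomorphic_intros)
    fix z0 :: complex
    have "uniform_limit (cball z0 1) (\<lambda>N z. \<Sum>n<N. f n z) (\<lambda>z. \<Sum>n. f n z) sequentially"
    proof (rule Weierstrass_m_test[where M = "\<lambda>n. norm (a (int_decode n)) * exp ((\<bar>Im z0\<bar> + 1) * \<bar>of_int (int_decode n)\<bar>)"])
      fix n z assume "z \<in> cball z0 1"
      then have "\<bar>Im (z0 - z)\<bar> \<le> 1" using abs_Im_le_cmod[of "z0 - z"] by (simp add: dist_norm)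
      then have "\<bar>Im z\<bar> \<le> \<bar>Im z0\<bar> + 1" by simp
      then show "norm (f n z) \<le> norm (a (int_decode n)) * exp ((\<bar>Im z0\<bar> + 1) * \<bar>of_int (int_decode n)\<bar>)"
        unfolding f_def by (rule le)
    qed (rule sm)
    then show "\<exists>d>0. cball z0 d \<subseteq> UNIV \<and> uniform_limit (cball z0 d) (\<lambda>N z. \<Sum>n<N. f n z) (\<lambda>z. \<Sum>n. f n z) sequentially"
      by (intro exI[of _ 1]) simp
  qed simp
  moreover have "(\<Sum>\<^sub>\<infinity>s. a s * exp (\<i> * of_int s * z)) = (\<Sum>n. f n z)" for z
  proof -
    have "(\<lambda>s. norm (a s * exp (\<i> * of_int s * z))) summable_on UNIV"
      by (rule Infinite_Sum.abs_summable_on_comparison_test'[OF a[of "\<bar>Im z\<bar>"]]) (rule le, simp)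
    from infsum_eq_suminf_int_decode[OF this] show ?thesis by (simp add: f_def)
  qed
  ultimately show ?thesis by simp
qed

text \<open>Multiply by the character of frequency - t and integrate the uniformly convergent series
  term by term; only 2 pi a t survives.\<close>

lemma fourier_series_unique_0:
  fixes a :: "int \<Rightarrow> complex"
  assumes a: "(\<lambda>s. norm (a s)) summable_on UNIV"
    and z: "\<And>u::real. (\<Sum>\<^sub>\<infinity>s. a s * cis (of_int s * u)) = 0"
  shows "a t = 0"
proof -
  define f where "f n u = a (int_decode n) * cis (of_int (int_decode n - t) * u)" for n u
  have sm: "summable (\<lambda>n. norm (a (int_decode n)))"
  proof -
    have "(\<lambda>n. norm (a (int_decode n))) summable_on UNIV"
      using a summable_on_reindex_bij_betw[OF bij_int_decode, of "\<lambda>s. norm (a s)"] by simp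
    then show ?thesis by (rule summable_on_imp_summable)
  qed
  have f0: "(\<Sum>n. f n u) = 0" for u
  proof -
    have "(\<lambda>s. norm (a s * cis (of_int s * u))) summable_on UNIV" using a by (simp add: norm_mult)
    from infsum_eq_suminf_int_decode[OF this] z[of u]
    have *: "(\<Sum>n. a (int_decode n) * cis (of_int (int_decode n) * u)) = 0" by simp
    have s: "summable (\<lambda>n. a (int_decode n) * cis (of_int (int_decode n) * u))"
      by (rule summable_norm_cancel) (simp add: norm_mult sm)
    have "f n u = cis (- of_int t * u) * (a (int_decode n) * cis (of_int (int_decode n) * u))" for n
      by (simp add: f_def cis_mult algebra_simps)
    then show ?thesis using suminf_mult[OF s, of "cis (- of_int t * u)"] * by simp
  qed
  have fi: "(f n has_integral a (int_decode n) * (if int_decode n - t = 0 then 2 * pi else 0)) {-pi..pi}" for n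
    unfolding f_def[abs_def] by (intro has_integral_mult_right integral_cis_int)
  have "uniform_limit (cbox (-pi) pi) (\<lambda>N u. \<Sum>n<N. f n u) (\<lambda>u. \<Sum>n. f n u) sequentially"
    by (rule Weierstrass_m_test[OF _ sm]) (simp add: f_def norm_mult)
  then have ul: "uniform_limit (cbox (-pi) pi) (\<lambda>N u. \<Sum>n<N. f n u) (\<lambda>u. 0) sequentially" by (simp add: f0)
  have hi: "((\<lambda>u. \<Sum>n<N. f n u) has_integral
      (\<Sum>n<N. a (int_decode n) * (if int_decode n - t = 0 then 2 * pi else 0))) (cbox (-pi) pi)" for N
    using has_integral_sum[of "{..<N}" f, OF _ fi] by simp
  obtain J where J: "((\<lambda>u. 0 :: complex) has_integral J) (cbox (-pi) pi)"
    "(\<lambda>N. \<Sum>n<N. a (int_decode n) * (if int_decode n - t = 0 then 2 * pi else 0)) \<longlonglongrightarrow> J"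
  proof -
    have cont: "continuous_on (cbox (-pi) pi) (\<lambda>u. \<Sum>n<N. f n u)" for N
      unfolding f_def by (intro continuous_intros)
    obtain I J where "\<And>N. ((\<lambda>u. \<Sum>n<N. f n u) has_integral I N) (cbox (-pi) pi)"
      and J: "((\<lambda>u. 0 :: complex) has_integral J) (cbox (-pi) pi)" "I \<longlonglongrightarrow> J"
      using uniform_limit_integral_cbox[OF ul cont sequentially_bot] by metis
    then have "I = (\<lambda>N. \<Sum>n<N. a (int_decode n) * (if int_decode n - t = 0 then 2 * pi else 0))"
      using has_integral_unique[OF _ hi] by blast
    then show ?thesis using that J by blast
  qed
  have "J = 0" using J(1) by simp
  have "(\<Sum>n<N. a (int_decode n) * (if int_decode n - t = 0 then 2 * pi else 0)) = a t * (2 * pi)"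
    if "N > int_encode t" for N
  proof -
    have "(\<Sum>n<N. a (int_decode n) * (if int_decode n - t = 0 then 2 * pi else 0)) =
      (\<Sum>n<N. if n = int_encode t then a t * (2 * pi) else 0)"
    proof (rule sum.cong[OF refl])
      fix n
      have "int_decode n - t = 0 \<longleftrightarrow> n = int_encode t" by (metis int_decode_inverse int_encode_inverse right_minus_eq)
      then show "a (int_decode n) * (if int_decode n - t = 0 then 2 * pi else 0) =
        (if n = int_encode t then a t * (2 * pi) else 0)" by auto
    qed
    then show ?thesis using that by simp
  qed
  then have "\<forall>\<^sub>F N in sequentially. (\<Sum>n<N. a (int_decode n) * (if int_decode n - t = 0 then 2 * pi else 0)) = a t * (2 * pi)"
    by (auto intro: eventually_mono[OF eventually_gt_at_top[of "int_encode t"]])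
  then have "(\<lambda>N. \<Sum>n<N. a (int_decode n) * (if int_decode n - t = 0 then 2 * pi else 0)) \<longlonglongrightarrow> a t * (2 * pi)"
    by (rule tendsto_eventually)
  from LIMSEQ_unique[OF this J(2)] \<open>J = 0\<close> show ?thesis by simp
qed

lemma exp_2pi_i_eq_1D: "exp (\<i> * of_nat M * z) = 1 \<Longrightarrow> M > 0 \<Longrightarrow> \<exists>l::int. z = of_real (2 * pi * of_int l / real M)"
proof -
  assume "exp (\<i> * of_nat M * z) = 1" and M: "M > 0"
  then obtain l :: int where l: "Re (\<i> * of_nat M * z) = 0" "Im (\<i> * of_nat M * z) = of_int (2 * l) * pi"
    by (auto simp: exp_eq_1)
  then have "z = of_real (2 * pi * of_int l / real M)" using M
    by (auto simp: complex_eq_iff field_simps)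
  then show ?thesis by blast
qed

text \<open>With W = exp (i M z) and q = exp (i M T) the function P(W) P(q/W), P =
  \<open>euler_fun q\<close>, is the product side of Jacobi's triple product up to a constant. It
  vanishes where W is an integral power of q, that is at M points modulo the periods 2 pi and
  T.\<close>

lemma theta_denominator:
  fixes T :: complex
  assumes M: "M > 0" and T: "Im T > 0"
  shows "\<exists>\<Theta>. \<Theta> holomorphic_on UNIV \<and> (\<forall>z. \<Theta> (z + of_real (2 * pi)) = \<Theta> z) \<and>
    (\<forall>z. \<Theta> z = - exp (\<i> * of_nat M * z) * \<Theta> (z + T)) \<and>
    (\<forall>z. \<Theta> z = 0 \<longrightarrow> deriv \<Theta> z \<noteq> 0 \<and>
       (\<exists>(k::int) (l::int). z = of_real (2 * pi * of_int l / real M) + of_int k * T))"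
proof -
  define q where "q = exp (\<i> * of_nat M * T)"
  have q: "norm q < 1" using M T by (simp add: q_def norm_exp_eq_Re)
  have q0: "q \<noteq> 0" by (simp add: q_def)
  define W where "W z = exp (\<i> * of_nat M * z)" for z
  have W0: "W z \<noteq> 0" for z by (simp add: W_def)
  have WT: "W (z + T) = q * W z" for z by (simp add: W_def q_def exp_add algebra_simps)
  have WkT: "W (z + of_nat k * T) = q ^ k * W z" for z k
    by (simp add: W_def q_def exp_add algebra_simps flip: exp_of_nat_mult)
  define P where "P = euler_fun q"
  have P: "P holomorphic_on S" for S unfolding P_def
    using euler_fun_holomorphic[OF q] holomorphic_on_subset by blast
  have PF: "P w = (1 - w) * P (q * w)" for w unfolding P_def by (rule euler_fun_functional[OF q])
  have P1: "P 1 = 0" unfolding P_def by (rule euler_fun_1[OF q])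
  define \<Theta> where "\<Theta> z = P (W z) * P (q / W z)" for z
  have Wh: "W holomorphic_on S" for S unfolding W_def[abs_def] by (intro holomorphic_intros)
  have comp: "(\<lambda>z. P (g z)) holomorphic_on UNIV" if "g holomorphic_on UNIV" for g
    using holomorphic_on_compose[OF that P] by (simp add: o_def)
  have hol: "\<Theta> holomorphic_on UNIV"
    unfolding \<Theta>_def[abs_def] using W0 by (intro holomorphic_on_mult comp holomorphic_on_divide Wh holomorphic_on_const) auto
  have quasi: "\<Theta> z = - W z * \<Theta> (z + T)" for z
  proof (cases "W z = 1")
    case True
    then show ?thesis using q0 by (simp add: \<Theta>_def WT P1)
  next
    case False
    have "\<Theta> (z + T) = P (q * W z) * P (1 / W z)" using q0 by (simp add: \<Theta>_def WT)
    also have "P (1 / W z) = (1 - 1 / W z) * P (q / W z)" using PF[of "1 / W z"] by simp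
    finally have "- W z * \<Theta> (z + T) = - (W z * (1 - 1 / W z)) * (P (q * W z) * P (q / W z))" by simp
    also have "- (W z * (1 - 1 / W z)) = 1 - W z" using W0[of z] by (simp add: field_simps)
    also have "(1 - W z) * (P (q * W z) * P (q / W z)) = \<Theta> z" by (simp add: \<Theta>_def PF[of "W z"])
    finally show ?thesis by simp
  qed
  have per: "\<Theta> (z + of_real (2 * pi)) = \<Theta> z" for z
  proof -
    have "exp (\<i> * of_nat M * (2 * pi)) = 1"
      unfolding exp_eq_1 by (auto intro!: exI[of _ "int M"])
    then have "W (z + of_real (2 * pi)) = W z" by (simp add: W_def distrib_left exp_add)
    then show ?thesis by (simp add: \<Theta>_def)
  qed
  \<comment> \<open>At W = 1 the factor 1 - W has a simple zero, and the remaining factors give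
    P(q)^2, which is nonzero.\<close>
  have d1: "deriv \<Theta> z \<noteq> 0" if z: "W z = 1" for z
  proof -
    define G where "G z = P (q * W z) * P (q / W z)" for z
    have "G holomorphic_on UNIV" unfolding G_def[abs_def] using W0
      by (intro holomorphic_on_mult comp holomorphic_on_divide Wh holomorphic_on_const) auto
    then have G: "(G has_field_derivative deriv G z) (at z)"
      using holomorphic_derivI[of G UNIV z] by simp
    have "\<Theta> = (\<lambda>z. (1 - W z) * G z)" by (auto simp: \<Theta>_def G_def PF[of "W _"])
    moreover have "((\<lambda>z. (1 - W z) * G z) has_field_derivative
        (1 - W z) * deriv G z + (- (\<i> * of_nat M * W z)) * G z) (at z)"
      unfolding W_def by (auto intro!: derivative_eq_intros G)
    ultimately have "deriv \<Theta> z = - (\<i> * of_nat M) * (P q * P q)"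
      using z by (simp add: DERIV_imp_deriv G_def)
    moreover have "P q \<noteq> 0" unfolding P_def by (rule euler_fun_q_nonzero[OF q])
    ultimately show ?thesis using M by simp
  qed
  \<comment> \<open>Differentiating the transformation rule at a zero: the derivative of the
    multiplier meets the value 0, so simplicity of zeros is transported along T.\<close>
  have dT: "deriv \<Theta> z = - W z * deriv \<Theta> (z + T)" if "\<Theta> (z + T) = 0" for z
  proof -
    have D: "(\<Theta> has_field_derivative deriv \<Theta> (z + T)) (at (z + T))"
      using holomorphic_derivI[OF hol] by simp
    have "((\<lambda>z. \<Theta> (z + T)) has_field_derivative deriv \<Theta> (z + T) * 1) (at z)"
      by (rule DERIV_chain2[where f = \<Theta> and g = "\<lambda>z. z + T", OF D]) (auto intro!: derivative_eq_intros)
    moreover have "(W has_field_derivative \<i> * of_nat M * W z) (at z)"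
      unfolding W_def[abs_def] by (auto intro!: derivative_eq_intros)
    ultimately have "((\<lambda>z. - W z * \<Theta> (z + T)) has_field_derivative
        - (\<i> * of_nat M * W z) * \<Theta> (z + T) + deriv \<Theta> (z + T) * 1 * (- W z)) (at z)"
      by (intro DERIV_mult DERIV_minus)
    moreover have "\<Theta> = (\<lambda>z. - W z * \<Theta> (z + T))" using quasi by blast
    ultimately show ?thesis using that by (simp add: DERIV_imp_deriv)
  qed
  have zT: "\<Theta> z = 0 \<longleftrightarrow> \<Theta> (z + T) = 0" for z using quasi[of z] W0[of z] by simp
  have step: "\<Theta> z = 0 \<and> deriv \<Theta> z \<noteq> 0 \<longleftrightarrow> \<Theta> (z + T) = 0 \<and> deriv \<Theta> (z + T) \<noteq> 0" for z
    using zT[of z] dT[of z] W0[of z] by auto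
  have steps: "\<Theta> z = 0 \<and> deriv \<Theta> z \<noteq> 0 \<longleftrightarrow> \<Theta> (z + of_nat k * T) = 0 \<and> deriv \<Theta> (z + of_nat k * T) \<noteq> 0" for z k
  proof (induction k)
    case (Suc k)
    have e: "z + of_nat (Suc k) * T = z + of_nat k * T + T" by (simp add: algebra_simps)
    show ?case unfolding e using Suc step[of "z + of_nat k * T"] by blast
  qed simp
  have "deriv \<Theta> z \<noteq> 0 \<and> (\<exists>(k::int) (l::int). z = of_real (2 * pi * of_int l / real M) + of_int k * T)"
    if z: "\<Theta> z = 0" for z
  proof -
    have W1: "\<Theta> z = 0" if "W z = 1" for z using that by (simp add: \<Theta>_def P1)
    \<comment> \<open>Zeros of the first factor have z + k T real with W = 1 there; zeros of the
      second factor are such points moved by (k + 1) T.\<close>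
    consider k where "q ^ k * W z = 1" | k where "q ^ k * (q / W z) = 1"
    proof -
      from z have "euler_fun q (W z) = 0 \<or> euler_fun q (q / W z) = 0"
        unfolding \<Theta>_def P_def by (simp only: mult_eq_0_iff)
      then show ?thesis using that euler_fun_zero_imp[OF q] by blast
    qed
    then show ?thesis
    proof cases
      case 1
      then have w: "W (z + of_nat k * T) = 1" by (simp add: WkT)
      then have "deriv \<Theta> z \<noteq> 0" using steps[of z k] W1[OF w] d1[OF w] by blast
      moreover obtain l :: int where "z + of_nat k * T = of_real (2 * pi * of_int l / real M)"
        using exp_2pi_i_eq_1D[OF w[unfolded W_def] M] by blast
      then have "z = of_real (2 * pi * of_int l / real M) + of_int (- int k) * T" by (simp add: algebra_simps)
      ultimately show ?thesis by blast
    next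
      case 2
      define y where "y = z - of_nat (Suc k) * T"
      have zy: "z = y + of_nat (Suc k) * T" by (simp add: y_def)
      have "W z = q ^ Suc k * W y" unfolding zy by (rule WkT)
      then have w: "W y = 1" using 2 W0[of z] q0 by (simp add: field_simps)
      then have "deriv \<Theta> z \<noteq> 0" using steps[of y "Suc k"] W1[OF w] d1[OF w] unfolding zy by blast
      moreover obtain l :: int where "y = of_real (2 * pi * of_int l / real M)"
        using exp_2pi_i_eq_1D[OF w[unfolded W_def] M] by blast
      then have "z = of_real (2 * pi * of_int l / real M) + of_int (int (Suc k)) * T" using zy by simp
      ultimately show ?thesis by blast
    qed
  qed
  then show ?thesis using hol per quasi unfolding W_def by blast
qed

text \<open>The factor exp (r |s|) only enlarges the linear coefficient to b = |Re B| + r; according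
  to the sign of s, the Gaussian with linear term b or - b is the majorant.\<close>

lemma gaussian_int_summable:
  assumes "Re A < 0"
  shows "(\<lambda>s::int. norm (exp (A * (of_int s)\<^sup>2 + B * of_int s)) * exp (r * \<bar>of_int s\<bar>)) summable_on UNIV"
proof -
  define c where "c = - Re A"
  define b where "b = \<bar>Re B\<bar> + r"
  have c: "c > 0" using assms by (simp add: c_def)
  have "rapid (\<lambda>x. exp (of_real (- c) * (of_real x)\<^sup>2 + of_real b * of_real x))"
    "rapid (\<lambda>x. exp (of_real (- c) * (of_real x)\<^sup>2 + of_real (- b) * of_real x))"
    by (rule rapid_gaussian; use c in simp)+
  then obtain C D where C: "\<And>x. norm (exp (of_real (- c) * (of_real x)\<^sup>2 + of_real b * of_real x :: complex)) * (1 + x\<^sup>2) ^ 1 \<le> C"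
    and D: "\<And>x. norm (exp (of_real (- c) * (of_real x)\<^sup>2 + of_real (- b) * of_real x :: complex)) * (1 + x\<^sup>2) ^ 1 \<le> D"
    unfolding rapid_def by metis
  have n: "norm (exp (of_real (- c) * (of_real x)\<^sup>2 + of_real t * of_real x :: complex)) = exp (- c * x\<^sup>2 + t * x)" for x t
    by (simp add: norm_exp_eq_Re power2_eq_square)
  have E: "exp (- c * x\<^sup>2 + b * \<bar>x\<bar>) * (1 + x\<^sup>2) \<le> max C D" for x
    using C[of x] D[of x] unfolding n by (cases "x \<ge> 0") auto
  show ?thesis
  proof (rule summable_on_comparison_test[OF summable_on_cmult_right[OF summable_on_inverse_square_int, of "max C D"]])
    fix s :: int
    let ?x = "of_int s :: real"
    have "Re B * ?x \<le> \<bar>Re B\<bar> * \<bar>?x\<bar>" by (metis abs_ge_self abs_mult)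
    then have "- c * ?x\<^sup>2 + Re B * ?x + r * \<bar>?x\<bar> \<le> - c * ?x\<^sup>2 + b * \<bar>?x\<bar>" by (simp add: b_def algebra_simps)
    moreover have "norm (exp (A * (of_int s)\<^sup>2 + B * of_int s)) * exp (r * \<bar>?x\<bar>) = exp (- c * ?x\<^sup>2 + Re B * ?x + r * \<bar>?x\<bar>)"
      unfolding norm_exp_eq_Re exp_add[symmetric] by (simp add: c_def power2_eq_square)
    ultimately have "norm (exp (A * (of_int s)\<^sup>2 + B * of_int s)) * exp (r * \<bar>?x\<bar>) \<le> exp (- c * ?x\<^sup>2 + b * \<bar>?x\<bar>)" by simp
    also have "\<dots> \<le> max C D * (1 / (1 + ?x\<^sup>2))"
      using E[of ?x] by (simp add: field_simps add_pos_nonneg)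
    finally show "norm (exp (A * (of_int s)\<^sup>2 + B * of_int s)) * exp (r * \<bar>?x\<bar>) \<le> max C D * (1 / (1 + ?x\<^sup>2))" .
  qed auto
qed

text \<open>The left-hand sides say that the theta function \<open>\<Sum>s. g s * v s * exp (\<i> s z)\<close> of degree
  \<open>n\<close> vanishes at the \<open>M > n\<close> points \<open>2 \<pi> l / M\<close>. Dividing by a theta function of degree
  \<open>M\<close> with exactly these simple zeros leaves an entire function of negative degree.\<close>

theorem theta_values_injective:
  fixes A B :: complex and v :: "int \<Rightarrow> complex"
  assumes A: "Re A < 0" and n: "0 < n" and M: "n < M"
    and per: "\<And>s. v (s + int n) = v s"
    and zero: "\<And>j. (\<Sum>\<^sub>\<infinity>s\<in>{s. s mod int M = j}. exp (A * (of_int s)\<^sup>2 + B * of_int s) * v s) = 0"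
  shows "v t = 0"
proof -
  define g where "g s = exp (A * (of_int s)\<^sup>2 + B * of_int s)" for s :: int
  obtain V where V: "\<And>s. norm (v s) \<le> V"
  proof -
    have red: "v s = v (s mod int n)" for s
    proof -
      have "v (r + int n * k) = v r" for r k
      proof (induction k rule: int_induct[where k = 0])
        case (step1 i)
        then show ?case using per[of "r + int n * i"] by (simp add: algebra_simps)
      next
        case (step2 i)
        then show ?case using per[of "r + int n * (i - 1)"] by (simp add: algebra_simps)
      qed simp
      from this[of "s mod int n" "s div int n"] show ?thesis by simp
    qed
    have "norm (v s) \<le> (\<Sum>j\<in>{0..<int n}. norm (v j))" for s
      using member_le_sum[of "s mod int n" "{0..<int n}" "\<lambda>j. norm (v j)"] n red[of s] by simp
    then show ?thesis by (rule that)
  qed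
  have sm: "(\<lambda>s. norm (g s * v s) * exp (r * \<bar>of_int s\<bar>)) summable_on UNIV" for r
  proof (rule summable_on_comparison_test[OF summable_on_cmult_left[OF gaussian_int_summable[OF A]]])
    fix s
    show "norm (g s * v s) * exp (r * \<bar>of_int s\<bar>) \<le> norm (exp (A * (of_int s)\<^sup>2 + B * of_int s)) * exp (r * \<bar>of_int s\<bar>) * V"
      using mult_left_mono[OF V[of s], of "norm (g s) * exp (r * \<bar>of_int s\<bar>)"]
      by (simp add: g_def norm_mult mult_ac)
  qed auto
  have sm0: "(\<lambda>s. norm (g s * v s)) summable_on S" for S
    using sm[of 0] summable_on_subset_banach[of "\<lambda>s. norm (g s * v s)" UNIV S] by simp
  define F where "F z = (\<Sum>\<^sub>\<infinity>s. g s * v s * exp (\<i> * of_int s * z))" for z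
  have hol: "F holomorphic_on UNIV" unfolding F_def[abs_def] by (rule holomorphic_int_series[OF sm])
  have F2pi: "F (z + of_real (2 * pi)) = F z" for z
  proof -
    have "exp (\<i> * of_int s * (2 * pi)) = 1" for s :: int
      unfolding exp_eq_1 by (auto intro!: exI[of _ s])
    then show ?thesis by (simp add: F_def distrib_left exp_add)
  qed
  \<comment> \<open>The shift from s to s + n produces exp (2 A n s) = exp (i s T); Re A < 0 puts T
    in the upper half plane.\<close>
  define T where "T = - 2 * \<i> * A * of_nat n"
  have T: "Im T > 0" using A n by (simp add: T_def mult_neg_pos)
  define C where "C = exp (A * (of_nat n)\<^sup>2 + B * of_nat n)"
  have FT: "F z = C * exp (\<i> * of_nat n * z) * F (z + T)" for z
  proof -
    have bij: "bij (\<lambda>s::int. s + int n)" by (rule bijI[OF injI]) (auto intro: surjI[of _ "\<lambda>s. s - int n"])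
    have "F z = (\<Sum>\<^sub>\<infinity>s. g (s + int n) * v (s + int n) * exp (\<i> * of_int (s + int n) * z))"
      unfolding F_def by (rule infsum_reindex_bij_betw[OF bij, symmetric])
    also have "\<dots> = (\<Sum>\<^sub>\<infinity>s. C * exp (\<i> * of_nat n * z) * (g s * v s * exp (\<i> * of_int s * (z + T))))"
    proof (intro infsum_cong)
      fix s :: int
      have "A * (of_int (s + int n))\<^sup>2 + B * of_int (s + int n) + \<i> * of_int (s + int n) * z =
        (A * (of_nat n)\<^sup>2 + B * of_nat n) + \<i> * of_nat n * z + (A * (of_int s)\<^sup>2 + B * of_int s) + \<i> * of_int s * (z + T)"
        by (simp add: T_def power2_eq_square algebra_simps)
      then have "g (s + int n) * exp (\<i> * of_int (s + int n) * z) =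
          C * exp (\<i> * of_nat n * z) * g s * exp (\<i> * of_int s * (z + T))"
        unfolding g_def C_def exp_add[symmetric] by simp
      then show "g (s + int n) * v (s + int n) * exp (\<i> * of_int (s + int n) * z) =
          C * exp (\<i> * of_nat n * z) * (g s * v s * exp (\<i> * of_int s * (z + T)))"
        unfolding per by (simp add: mult_ac)
    qed
    also have "\<dots> = C * exp (\<i> * of_nat n * z) * F (z + T)" unfolding F_def by (rule infsum_cmult_right')
    finally show ?thesis .
  qed
  have C0: "C \<noteq> 0" by (simp add: C_def)
  \<comment> \<open>At z = 2 pi l / M the exponential depends only on s modulo M, so F is a
    combination of the M sums that vanish by assumption.\<close>
  have Fl: "F (of_real (2 * pi * of_int l / real M)) = 0" for l :: int
  proof -
    let ?z = "complex_of_real (2 * pi * of_int l / real M)"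
    let ?f = "\<lambda>s. g s * v s * exp (\<i> * of_int s * ?z)"
    have e: "exp (\<i> * of_int s * ?z) = exp (\<i> * of_int (s mod int M) * ?z)" for s
    proof -
      have "of_int s = (of_int (s mod int M + int M * (s div int M)) :: complex)" by simp
      then have h: "of_int s = (of_int (s mod int M) + of_nat M * of_int (s div int M) :: complex)"
        by (simp only: of_int_add of_int_mult of_int_of_nat_eq)
      have alg: "\<i> * (r + of_nat M * d) * y = \<i> * r * y + \<i> * d * L" if "of_nat M * y = L" for y r d L :: complex
        using that by (auto simp: algebra_simps)
      have "of_nat M * ?z = of_int l * (2 * pi)" using M by simp
      then have "\<i> * of_int s * ?z = \<i> * of_int (s mod int M) * ?z + \<i> * of_int (s div int M) * (of_int l * (2 * pi))"
        unfolding h by (rule alg)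
      also have "\<dots> = \<i> * of_int (s mod int M) * ?z + \<i> * (of_int (s div int M * l) * (2 * pi))" by simp
      finally have "\<i> * of_int s * ?z = \<dots>" .
      moreover have "exp (\<i> * (of_int (s div int M * l) * (2 * pi))) = 1"
        unfolding exp_eq_1 by (auto intro!: exI[of _ "s div int M * l"])
      ultimately show ?thesis by (simp add: exp_add)
    qed
    have "(\<lambda>s. norm (?f s)) summable_on UNIV" using sm0 by (simp add: norm_mult norm_exp_eq_Re)
    then have s: "?f summable_on S" for S
      by (rule summable_on_subset_banach[OF abs_summable_summable]) simp
    have z: "infsum ?f {s. s mod int M = j} = 0" for j
    proof -
      have "infsum ?f {s. s mod int M = j} = (\<Sum>\<^sub>\<infinity>s\<in>{s. s mod int M = j}. g s * v s * exp (\<i> * of_int j * ?z))"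
        by (intro infsum_cong) (use e in auto)
      also have "\<dots> = 0" using zero[of j] by (simp add: infsum_cmult_left' g_def)
      finally show ?thesis .
    qed
    have "UNIV = (\<Union>j\<in>{0..<int M}. {s. s mod int M = j})" using M by auto
    then have "F ?z = infsum ?f (\<Union>j\<in>{0..<int M}. {s. s mod int M = j})" by (simp add: F_def)
    also have "\<dots> = (\<Sum>j\<in>{0..<int M}. infsum ?f {s. s mod int M = j})"
      by (rule sum_infsum[symmetric]) (use s in auto)
    finally show ?thesis using z by simp
  qed
  have FkT: "F z = 0 \<longleftrightarrow> F (z + T) = 0" for z using FT[of z] C0 by simp
  have Fzero: "F (of_real (2 * pi * of_int l / real M) + of_int k * T) = 0" for k l :: int
  proof (induction k rule: int_induct[where k = 0])
    case (step1 i)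
    then show ?case using FkT[of "of_real (2 * pi * of_int l / real M) + of_int i * T"] by (simp add: algebra_simps)
  next
    case (step2 i)
    then show ?case using FkT[of "of_real (2 * pi * of_int l / real M) + of_int (i - 1) * T"] by (simp add: algebra_simps)
  qed (use Fl in simp)
  have M0: "M > 0" using M by simp
  obtain \<Theta> where \<Theta>: "\<Theta> holomorphic_on UNIV" "\<And>z. \<Theta> (z + of_real (2 * pi)) = \<Theta> z"
    "\<And>z. \<Theta> z = - exp (\<i> * of_nat M * z) * \<Theta> (z + T)"
    "\<And>z. \<Theta> z = 0 \<Longrightarrow> deriv \<Theta> z \<noteq> 0"
    "\<And>z. \<Theta> z = 0 \<Longrightarrow> \<exists>(k::int) (l::int). z = of_real (2 * pi * of_int l / real M) + of_int k * T"
    using theta_denominator[OF M0 T] by metis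
  have "\<exists>R. R holomorphic_on UNIV \<and> (\<forall>z. F z = R z * \<Theta> z)"
  proof (rule ex_holomorphic_quotient[OF hol \<Theta>(1)])
    fix z assume z: "\<Theta> z = 0"
    obtain k l :: int where "z = of_real (2 * pi * of_int l / real M) + of_int k * T"
      using \<Theta>(5)[OF z] by blast
    then have "F z = 0" using Fzero by (simp only:)
    then show "F z = 0 \<and> deriv \<Theta> z \<noteq> 0" using \<Theta>(4)[OF z] by blast
  qed
  then obtain R where R: "R holomorphic_on UNIV" "\<And>z. F z = R z * \<Theta> z" by blast
  \<comment> \<open>Where X is nonzero, \<Theta> would vanish on a neighbourhood and so have
    derivative 0 at one of its zeros, but its zeros are simple.\<close>
  have cancel: "X z = 0" if X: "X holomorphic_on UNIV" and XT: "\<And>z. X z * \<Theta> z = 0" for X z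
  proof (rule ccontr)
    assume Xz: "X z \<noteq> 0"
    have o: "open {z. X z \<noteq> 0}"
      using holomorphic_on_imp_continuous_on[OF X] by (intro open_Collect_neq continuous_on_const) auto
    have d: "((\<lambda>z. 0) has_field_derivative 0) (at z)" by simp
    have z0: "0 = \<Theta> y" if "y \<in> {z. X z \<noteq> 0}" for y
      using XT[of y] that by simp
    have "z \<in> {z. X z \<noteq> 0}" using Xz by (simp only: mem_Collect_eq not_False_eq_True)
    from has_field_derivative_transform_within_open[OF d o this z0]
    have "(\<Theta> has_field_derivative 0) (at z)" .
    then have "deriv \<Theta> z = 0" by (rule DERIV_imp_deriv)
    moreover have "\<Theta> z = 0" using XT[of z] Xz by simp
    ultimately show False using \<Theta>(4) by blast
  qed
  have shift: "(\<lambda>z. R (z + c)) holomorphic_on UNIV" for c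
    using holomorphic_on_compose[of "\<lambda>z. z + c" UNIV R, OF _ holomorphic_on_subset[OF R(1)]]
    by (simp add: o_def holomorphic_on_add holomorphic_on_ident)
  have Rper: "R (z + of_real (2 * pi)) = R z" for z
  proof -
    have "(R (z + of_real (2 * pi)) - R z) * \<Theta> z = 0" for z
      using R(2)[of "z + of_real (2 * pi)"] R(2)[of z] F2pi[of z] \<Theta>(2)[of z] by (simp add: algebra_simps)
    from cancel[OF holomorphic_on_diff[OF shift R(1)] this] show ?thesis by simp
  qed
  \<comment> \<open>Dividing the rule of F, of degree n, by the rule of \<Theta>, of degree M, gives
    the quotient degree n - M < 0.\<close>
  have RT: "R (z + T) = (- (1 / C)) * exp (\<i> * of_nat (M - n) * z) * R z" for z
  proof -
    have "(R (z + T) * exp (\<i> * of_nat n * z) * C + exp (\<i> * of_nat M * z) * R z) * \<Theta> (z + T) = 0" for z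
    proof -
      have "C * exp (\<i> * of_nat n * z) * (R (z + T) * \<Theta> (z + T)) = R z * (- exp (\<i> * of_nat M * z) * \<Theta> (z + T))"
        using FT[of z] unfolding R(2)[of z] R(2)[of "z + T"] \<Theta>(3)[of z] by (rule sym)
      then have "C * exp (\<i> * of_nat n * z) * (R (z + T) * \<Theta> (z + T)) - R z * (- exp (\<i> * of_nat M * z) * \<Theta> (z + T)) = 0"
        by (simp only: right_minus_eq)
      then show ?thesis by (simp add: algebra_simps)
    qed
    then have "(R z * exp (\<i> * of_nat n * (z - T)) * C + exp (\<i> * of_nat M * (z - T)) * R (z - T)) * \<Theta> z = 0" for z
      by (metis diff_add_cancel)
    moreover have "(\<lambda>z. R z * exp (\<i> * of_nat n * (z - T)) * C + exp (\<i> * of_nat M * (z - T)) * R (z - T)) holomorphic_on UNIV"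
      using shift[of "- T"] by (intro holomorphic_intros R(1)) simp
    ultimately have "R z * exp (\<i> * of_nat n * (z - T)) * C + exp (\<i> * of_nat M * (z - T)) * R (z - T) = 0" for z
      using cancel by blast
    from this[of "z + T"] have "R (z + T) * exp (\<i> * of_nat n * z) * C = - (exp (\<i> * of_nat M * z) * R z)"
      by (simp add: add_eq_0_iff2)
    moreover have "exp (\<i> * of_nat M * z) = exp (\<i> * of_nat (M - n) * z) * exp (\<i> * of_nat n * z)"
      using M by (simp add: of_nat_diff algebra_simps flip: exp_add)
    ultimately have "exp (\<i> * of_nat n * z) * (R (z + T) * C) = exp (\<i> * of_nat n * z) * (- (exp (\<i> * of_nat (M - n) * z) * R z))"
      by (simp add: mult_ac)
    then have "R (z + T) * C = - (exp (\<i> * of_nat (M - n) * z) * R z)"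
      unfolding mult_left_cancel[OF exp_not_eq_zero] .
    then show ?thesis using C0 by (simp add: field_simps)
  qed
  have "R z = 0" for z
    by (rule negative_degree_zero[OF R(1) Rper RT T]) (use C0 M in auto)
  then have F0: "F z = 0" for z using R(2) by simp
  have "(\<Sum>\<^sub>\<infinity>s. g s * v s * cis (of_int s * u)) = 0" for u
    using F0[of "of_real u"] by (simp add: F_def cis_conv_exp mult.assoc)
  from fourier_series_unique_0[OF sm0 this] have "g t * v t = 0" .
  then show ?thesis by (simp add: g_def)
qed

section \<open>Bundle maps and the Dolbeault operator\<close>

hide_const (open) Determinants.det

section \<open>Smooth families of matrices, their inverses and adjoints\<close>

lemma smooth_matI:
  assumes "\<And>p. \<Phi> p \<in> carrier_mat n m" "\<And>i j. i < n \<Longrightarrow> j < m \<Longrightarrow> smooth (\<lambda>p. \<Phi> p $$ (i, j))"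
  shows "smooth_mat n m \<Phi>"
  using assms by (simp add: smooth_mat_def)

lemma smooth_matD:
  assumes "smooth_mat n m \<Phi>"
  shows "\<Phi> p \<in> carrier_mat n m" "i < n \<Longrightarrow> j < m \<Longrightarrow> smooth (\<lambda>p. \<Phi> p $$ (i, j))"
  using assms unfolding smooth_mat_def by blast+

lemma mult_mat_index:
  assumes "A \<in> carrier_mat n k" "B \<in> carrier_mat k m" "i < n" "j < m"
  shows "(A * B) $$ (i, j) = (\<Sum>l<k. A $$ (i, l) * B $$ (l, j))"
  using assms by (auto simp: scalar_prod_def atLeast0LessThan intro!: sum.cong)

lemma mult_mat_vec_index:
  assumes "A \<in> carrier_mat n k" "v \<in> carrier_vec k" "i < n"
  shows "vec_index (A *\<^sub>v v) i = (\<Sum>l<k. A $$ (i, l) * vec_index v l)"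
  using assms by (auto simp: scalar_prod_def atLeast0LessThan intro!: sum.cong)

lemma smooth_mat_mult:
  assumes "smooth_mat n k A" "smooth_mat k m B"
  shows "smooth_mat n m (\<lambda>p. A p * B p)"
proof (rule smooth_matI)
  show "A p * B p \<in> carrier_mat n m" for p
    using smooth_matD(1)[OF assms(1)] smooth_matD(1)[OF assms(2)] by (rule mult_carrier_mat)
  fix i j assume ij: "i < n" "j < m"
  have "(\<lambda>p. (A p * B p) $$ (i, j)) = (\<lambda>p. \<Sum>l<k. A p $$ (i, l) * B p $$ (l, j))"
    using mult_mat_index[OF smooth_matD(1)[OF assms(1)] smooth_matD(1)[OF assms(2)] ij] by blast
  moreover have "smooth (\<lambda>p. \<Sum>l<k. A p $$ (i, l) * B p $$ (l, j))"
    using ij by (intro smooth_intros smooth_matD[OF assms(1)] smooth_matD[OF assms(2)]) auto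
  ultimately show "smooth (\<lambda>p. (A p * B p) $$ (i, j))" by simp
qed

lemma smooth_det:
  assumes "smooth_mat n n A"
  shows "smooth (\<lambda>p. Determinant.det (A p))"
proof -
  have "(\<lambda>p. Determinant.det (A p)) =
      (\<lambda>p. \<Sum>\<pi>\<in>{\<pi>. \<pi> permutes {0..<n}}. signof \<pi> * (\<Prod>i = 0..<n. A p $$ (i, \<pi> i)))"
    using det_def'[OF smooth_matD(1)[OF assms]] by blast
  moreover have "smooth (\<lambda>p. \<Sum>\<pi>\<in>{\<pi>. \<pi> permutes {0..<n}}. signof \<pi> * (\<Prod>i = 0..<n. A p $$ (i, \<pi> i)))"
  proof (intro smooth_intros)
    fix \<pi> i assume "\<pi> \<in> {\<pi>. \<pi> permutes {0..<n}}" "i \<in> {0..<n}"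
    then show "smooth (\<lambda>p. A p $$ (i, \<pi> i))"
      using permutes_in_image[of \<pi> "{0..<n}" i] by (intro smooth_matD(2)[OF assms]) auto
  qed
  ultimately show ?thesis by simp
qed

text \<open>Cramer's rule: the entries of the inverse are cofactors, which are determinants of
  smooth families, divided by a determinant without zeros.\<close>

lemma smooth_mat_inverse:
  assumes A: "smooth_mat n n A" and d: "\<And>p. Determinant.det (A p) \<noteq> 0"
  shows "\<exists>B. smooth_mat n n B \<and> (\<forall>p. B p * A p = 1\<^sub>m n) \<and> (\<forall>p. A p * B p = 1\<^sub>m n)"
proof -
  define B where "B p = inverse (Determinant.det (A p)) \<cdot>\<^sub>m adj_mat (A p)" for p
  note Ac = smooth_matD(1)[OF A]
  note adj = adj_mat[OF Ac]
  have Bc: "B p \<in> carrier_mat n n" for p unfolding B_def using adj(1) by simp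
  have "smooth_mat n n B"
  proof (rule smooth_matI[OF Bc])
    fix i j assume ij: "i < n" "j < n"
    have "smooth (\<lambda>p. Determinant.det (mat_delete (A p) j i))"
    proof (rule smooth_det[where n = "n - 1"], rule smooth_matI)
      show "mat_delete (A p) j i \<in> carrier_mat (n - 1) (n - 1)" for p
        using mat_delete_carrier[OF Ac] .
      fix k l assume kl: "k < n - 1" "l < n - 1"
      have "(\<lambda>p. mat_delete (A p) j i $$ (k, l)) =
          (\<lambda>p. A p $$ (if k < j then k else Suc k, if l < i then l else Suc l))"
        using Ac kl unfolding mat_delete_def by (auto simp: carrier_matD[OF Ac])
      moreover have "smooth (\<lambda>p. A p $$ (if k < j then k else Suc k, if l < i then l else Suc l))"
        using kl ij by (intro smooth_matD(2)[OF A]) auto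
      ultimately show "smooth (\<lambda>p. mat_delete (A p) j i $$ (k, l))" by simp
    qed
    then have "smooth (\<lambda>p. inverse (Determinant.det (A p)) * ((-1) ^ (j + i) * Determinant.det (mat_delete (A p) j i)))"
      by (intro smooth_mult smooth_const smooth_inverse smooth_det[OF A] d)
    moreover have "(\<lambda>p. B p $$ (i, j)) =
       (\<lambda>p. inverse (Determinant.det (A p)) * ((-1) ^ (j + i) * Determinant.det (mat_delete (A p) j i)))"
      using ij Ac unfolding B_def adj_mat_def cofactor_def by (auto simp: carrier_matD[OF Ac])
    ultimately show "smooth (\<lambda>p. B p $$ (i, j))" by simp
  qed
  moreover have "B p * A p = 1\<^sub>m n" for p
  proof -
    have "B p * A p = inverse (Determinant.det (A p)) \<cdot>\<^sub>m (adj_mat (A p) * A p)"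
      unfolding B_def by (rule mult_smult_assoc_mat[OF adj(1) Ac])
    also have "\<dots> = 1\<^sub>m n" unfolding adj(3) using d[of p] by (auto intro!: eq_matI)
    finally show ?thesis .
  qed
  moreover have "A p * B p = 1\<^sub>m n" for p
    using mat_mult_left_right_inverse[OF Bc Ac] calculation(2) by blast
  ultimately show ?thesis by blast
qed

text \<open>The conjugate transpose. It yields smooth one-sided inverses of maps that are injective
  or surjective in every fibre, without choosing complements.\<close>

definition cadj :: "complex mat \<Rightarrow> complex mat" where
  "cadj A = Matrix.mat (dim_col A) (dim_row A) (\<lambda>(i, j). cnj (A $$ (j, i)))"

lemma cadj_carrier: "A \<in> carrier_mat n m \<Longrightarrow> cadj A \<in> carrier_mat m n"
  by (auto simp: cadj_def)

lemma cadj_index: "A \<in> carrier_mat n m \<Longrightarrow> i < m \<Longrightarrow> j < n \<Longrightarrow> cadj A $$ (i, j) = cnj (A $$ (j, i))"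
  by (auto simp: cadj_def)

lemma smooth_cadj:
  assumes "smooth_mat n m A"
  shows "smooth_mat m n (\<lambda>p. cadj (A p))"
  using smooth_matD[OF assms] cadj_carrier cadj_index
  by (intro smooth_matI) (auto intro!: smooth_cnj simp: cadj_index[OF smooth_matD(1)[OF assms]])

text \<open>Pairing the adjoint of A applied to A v with v gives the squared length of A v.\<close>

lemma cadj_mult_kernel:
  assumes A: "A \<in> carrier_mat n m" and v: "v \<in> carrier_vec m" and z: "(cadj A * A) *\<^sub>v v = 0\<^sub>v m"
  shows "A *\<^sub>v v = 0\<^sub>v n"
proof -
  define w where "w = A *\<^sub>v v"
  have w: "w \<in> carrier_vec n" unfolding w_def using A v by simp
  have "cadj A *\<^sub>v w = 0\<^sub>v m"
    unfolding w_def using assoc_mult_mat_vec[OF cadj_carrier[OF A] A v] z by simp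
  then have "(\<Sum>j<m. cnj (vec_index v j) * vec_index (cadj A *\<^sub>v w) j) = 0" by simp
  also have "(\<Sum>j<m. cnj (vec_index v j) * vec_index (cadj A *\<^sub>v w) j) =
      (\<Sum>j<m. \<Sum>i<n. cnj (vec_index v j) * (cnj (A $$ (i, j)) * vec_index w i))"
    using mult_mat_vec_index[OF cadj_carrier[OF A] w] cadj_index[OF A]
    by (intro sum.cong refl) (simp add: sum_distrib_left)
  also have "\<dots> = (\<Sum>i<n. \<Sum>j<m. cnj (vec_index v j) * (cnj (A $$ (i, j)) * vec_index w i))"
    by (rule sum.swap)
  also have "\<dots> = (\<Sum>i<n. cnj (vec_index w i) * vec_index w i)"
  proof (intro sum.cong refl)
    fix i assume "i \<in> {..<n}"
    then have "cnj (vec_index w i) = (\<Sum>j<m. cnj (vec_index v j) * cnj (A $$ (i, j)))"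
      unfolding w_def using mult_mat_vec_index[OF A v] by (simp add: mult.commute)
    then show "(\<Sum>j<m. cnj (vec_index v j) * (cnj (A $$ (i, j)) * vec_index w i)) = cnj (vec_index w i) * vec_index w i"
      by (simp add: sum_distrib_right mult.assoc)
  qed
  also have "\<dots> = of_real (\<Sum>i<n. (norm (vec_index w i))\<^sup>2)"
    unfolding of_real_sum complex_norm_square by (simp add: mult.commute)
  finally have "(\<Sum>i<n. (norm (vec_index w i))\<^sup>2) = 0" using of_real_eq_0_iff by blast
  then have "\<forall>i\<in>{..<n}. (norm (vec_index w i))\<^sup>2 = 0"
    by (subst (asm) sum_nonneg_eq_0_iff) auto
  then show ?thesis using w unfolding w_def[symmetric] by (intro eq_vecI) auto
qed

lemma smooth_left_inverse:
  assumes A: "smooth_mat n m A"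
    and inj: "\<And>p v. v \<in> carrier_vec m \<Longrightarrow> A p *\<^sub>v v = 0\<^sub>v n \<Longrightarrow> v = 0\<^sub>v m"
  shows "\<exists>B. smooth_mat m m B \<and> (\<forall>p. B p * (cadj (A p) * A p) = 1\<^sub>m m) \<and> (\<forall>p. (cadj (A p) * A p) * B p = 1\<^sub>m m)"
proof (rule smooth_mat_inverse)
  show "smooth_mat m m (\<lambda>p. cadj (A p) * A p)" by (rule smooth_mat_mult[OF smooth_cadj[OF A] A])
  fix p
  note Ac = smooth_matD(1)[OF A, of p]
  have c: "cadj (A p) * A p \<in> carrier_mat m m" using cadj_carrier[OF Ac] Ac by simp
  show "Determinant.det (cadj (A p) * A p) \<noteq> 0"
    unfolding det_0_iff_vec_prod_zero[OF c] using cadj_mult_kernel[OF Ac] inj by blast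
qed

section \<open>Factors of automorphy and bundle maps\<close>

text \<open>A well-formedness condition: the record type does not tie the sizes of the factors of
  automorphy to the rank.\<close>

definition same_rank :: "torus_bundle \<Rightarrow> bool" where
  "same_rank E \<longleftrightarrow> (\<forall>p. fac_x E p \<in> carrier_mat (rank E) (rank E)) \<and> (\<forall>p. fac_y E p \<in> carrier_mat (rank E) (rank E))"

lemma bundle_map_mult:
  assumes R: "same_rank E" "same_rank F" "same_rank G"
    and A: "bundle_map E F A" and B: "bundle_map F G B"
  shows "bundle_map E G (\<lambda>p. B p * A p)"
proof -
  have Ac: "A p \<in> carrier_mat (rank F) (rank E)" and Bc: "B p \<in> carrier_mat (rank G) (rank F)" for p
    using A B smooth_matD(1) unfolding bundle_map_def by blast+
  have key: "(b' * a') * e = g * (b * a)"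
    if "a' \<in> carrier_mat (rank F) (rank E)" "b' \<in> carrier_mat (rank G) (rank F)"
      "a \<in> carrier_mat (rank F) (rank E)" "b \<in> carrier_mat (rank G) (rank F)"
      "e \<in> carrier_mat (rank E) (rank E)" "f \<in> carrier_mat (rank F) (rank F)" "g \<in> carrier_mat (rank G) (rank G)"
      "a' * e = f * a" "b' * f = g * b" for a a' b b' e f g :: "complex mat"
  proof -
    have "(b' * a') * e = b' * (f * a)" using that by (simp add: assoc_mult_mat)
    also have "\<dots> = (g * b) * a" using that by (metis assoc_mult_mat)
    also have "\<dots> = g * (b * a)" using that by (simp add: assoc_mult_mat)
    finally show ?thesis .
  qed
  have fx: "fac_x X p \<in> carrier_mat (rank X) (rank X)" "fac_y X p \<in> carrier_mat (rank X) (rank X)"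
    if "same_rank X" for X p using that unfolding same_rank_def by blast+
  show ?thesis unfolding bundle_map_def
  proof (intro conjI allI)
    show "smooth_mat (rank G) (rank E) (\<lambda>p. B p * A p)"
      using A B smooth_mat_mult unfolding bundle_map_def by blast
    show "B (x + 2 * pi, y) * A (x + 2 * pi, y) * fac_x E (x, y) = fac_x G (x, y) * (B (x, y) * A (x, y))" for x y
      by (rule key[OF Ac Bc Ac Bc fx(1)[OF R(1)] fx(1)[OF R(2)] fx(1)[OF R(3)]])
        (use A[unfolded bundle_map_def] B[unfolded bundle_map_def] in blast)+
    show "B (x, y + 2 * pi) * A (x, y + 2 * pi) * fac_y E (x, y) = fac_y G (x, y) * (B (x, y) * A (x, y))" for x y
      by (rule key[OF Ac Bc Ac Bc fx(2)[OF R(1)] fx(2)[OF R(2)] fx(2)[OF R(3)]])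
        (use A[unfolded bundle_map_def] B[unfolded bundle_map_def] in blast)+
  qed
qed

lemma bundle_map_inverse:
  assumes R: "same_rank E" and A: "bundle_map E E A" and B: "smooth_mat (rank E) (rank E) B"
    and BA: "\<And>p. B p * A p = 1\<^sub>m (rank E)" and AB: "\<And>p. A p * B p = 1\<^sub>m (rank E)"
  shows "bundle_map E E B"
proof -
  have Ac: "A p \<in> carrier_mat (rank E) (rank E)" and Bc: "B p \<in> carrier_mat (rank E) (rank E)" for p
    using A B smooth_matD(1) unfolding bundle_map_def by blast+
  have key: "b' * f = f * b"
    if c: "a \<in> carrier_mat n n" "a' \<in> carrier_mat n n" "b \<in> carrier_mat n n" "b' \<in> carrier_mat n n" "f \<in> carrier_mat n n"
      and e: "a' * f = f * a" "b' * a' = 1\<^sub>m n" "a * b = 1\<^sub>m n" for a a' b b' f :: "complex mat" and n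
  proof -
    have fb: "f * b \<in> carrier_mat n n" using c by simp
    have "b' * f = b' * (f * (a * b))" unfolding e(3) right_mult_one_mat[OF c(5)] ..
    also have "f * (a * b) = a' * f * b" unfolding e(1) by (rule assoc_mult_mat[OF c(5,1,3), symmetric])
    also have "\<dots> = a' * (f * b)" by (rule assoc_mult_mat[OF c(2,5,3)])
    also have "b' * \<dots> = (b' * a') * (f * b)" by (rule assoc_mult_mat[OF c(4,2) fb, symmetric])
    also have "\<dots> = f * b" unfolding e(2) by (rule left_mult_one_mat[OF fb])
    finally show ?thesis .
  qed
  have fx: "fac_x E p \<in> carrier_mat (rank E) (rank E)" "fac_y E p \<in> carrier_mat (rank E) (rank E)" for p
    using R unfolding same_rank_def by blast+
  show ?thesis unfolding bundle_map_def
  proof (intro conjI allI B)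
    show "B (x + 2 * pi, y) * fac_x E (x, y) = fac_x E (x, y) * B (x, y)" for x y
      by (rule key[OF Ac Ac Bc Bc fx(1) _ BA AB]) (use A in \<open>simp add: bundle_map_def\<close>)
    show "B (x, y + 2 * pi) * fac_y E (x, y) = fac_y E (x, y) * B (x, y)" for x y
      by (rule key[OF Ac Ac Bc Bc fx(2) _ BA AB]) (use A in \<open>simp add: bundle_map_def\<close>)
  qed
qed

lemma E_bundle_simps [simp]:
  "rank (E_bundle \<tau> n a \<mu>) = n"
  "fac_x (E_bundle \<tau> n a \<mu>) (x, y) = cis (real_of_int a / real n * y) \<cdot>\<^sub>m shift_mat n"
  "fac_y (E_bundle \<tau> n a \<mu>) p = clock_pow n (- a)"
  by (simp_all add: E_bundle_def)

lemma shift_mat_carrier: "shift_mat n \<in> carrier_mat n n" by (simp add: shift_mat_def)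

lemma clock_pow_carrier: "clock_pow n k \<in> carrier_mat n n" by (simp add: clock_pow_def)

lemma same_rank_E_bundle: "same_rank (E_bundle \<tau> n a \<mu>)"
  by (simp add: same_rank_def shift_mat_carrier clock_pow_carrier split_paired_all)

lemma clock_entry: "(cis (2 * pi / real n) ^ i) powi k = cis (2 * pi * of_int k * real i / real n)"
  unfolding Complex.DeMoivre cis_power_int by (simp add: field_simps)

lemma shift_mat_mult:
  assumes A: "A \<in> carrier_mat n m" and i: "i < n" "j < m"
  shows "(shift_mat n * A) $$ (i, j) = A $$ ((i + 1) mod n, j)"
proof -
  have "(shift_mat n * A) $$ (i, j) = (\<Sum>l<n. if l = (i + 1) mod n then A $$ (l, j) else 0)"
    unfolding mult_mat_index[OF shift_mat_carrier A i] using i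
    by (intro sum.cong refl) (simp add: shift_mat_def)
  then show ?thesis using i by simp
qed

lemma mult_shift_mat:
  assumes A: "A \<in> carrier_mat m n" and i: "i < m" "j < n"
  shows "(A * shift_mat n) $$ (i, (j + 1) mod n) = A $$ (i, j)"
proof -
  have eq: "(j + 1) mod n = (l + 1) mod n \<longleftrightarrow> l = j" if "l < n" for l
    using that i by (cases "Suc l = n"; cases "Suc j = n") auto
  have "(A * shift_mat n) $$ (i, (j + 1) mod n) = (\<Sum>l<n. if l = j then A $$ (i, l) else 0)"
    unfolding mult_mat_index[OF A shift_mat_carrier i(1) mod_less_divisor[OF order.strict_trans1[OF le0 i(2)]]]
    by (intro sum.cong refl) (use i eq in \<open>simp add: shift_mat_def\<close>)
  then show ?thesis using i by simp
qed

lemma clock_pow_mult: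
  assumes A: "A \<in> carrier_mat n m" and i: "i < n" "j < m"
  shows "(clock_pow n k * A) $$ (i, j) = cis (2 * pi * of_int k * real i / real n) * A $$ (i, j)"
proof -
  have "(clock_pow n k * A) $$ (i, j) =
      (\<Sum>l<n. if l = i then cis (2 * pi * of_int k * real i / real n) * A $$ (l, j) else 0)"
    unfolding mult_mat_index[OF clock_pow_carrier A i] using i
    by (intro sum.cong refl) (auto simp: clock_pow_def clock_entry)
  then show ?thesis using i by simp
qed

lemma mult_clock_pow:
  assumes A: "A \<in> carrier_mat m n" and i: "i < m" "j < n"
  shows "(A * clock_pow n k) $$ (i, j) = A $$ (i, j) * cis (2 * pi * of_int k * real j / real n)"
proof -
  have "(A * clock_pow n k) $$ (i, j) =
      (\<Sum>l<n. if l = j then A $$ (i, l) * cis (2 * pi * of_int k * real j / real n) else 0)"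
    unfolding mult_mat_index[OF A clock_pow_carrier i] using i
    by (intro sum.cong refl) (auto simp: clock_pow_def clock_entry)
  then show ?thesis using i by simp
qed

lemma carrier_mat_eq_iff:
  assumes "A \<in> carrier_mat n m" "B \<in> carrier_mat n m"
  shows "A = B \<longleftrightarrow> (\<forall>i j. i < n \<longrightarrow> j < m \<longrightarrow> A $$ (i, j) = B $$ (i, j))"
  using carrier_matD[OF assms(1)] carrier_matD[OF assms(2)] by (simp add: mat_eq_iff)

lemma mod_Suc_surj: "l < n \<Longrightarrow> \<exists>j<n. l = (j + 1) mod (n::nat)"
  by (rule exI[of _ "(l + n - 1) mod n"]) (simp add: mod_Suc_eq)

text \<open>Entrywise, the shift matrices advance the row index modulo n and the column index modulo
  n' together, the clock matrices multiply by roots of unity, and the y-dependent factor sees only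
  the difference of the slopes.\<close>

lemma bundle_map_E_iff:
  "bundle_map (E_bundle \<tau> n' a' \<mu>') (E_bundle \<tau> n a \<mu>) \<Phi> \<longleftrightarrow> smooth_mat n n' \<Phi> \<and>
    (\<forall>x y i j. i < n \<longrightarrow> j < n' \<longrightarrow> \<Phi> (x + 2 * pi, y) $$ (i, j) =
       cis ((of_int a / real n - of_int a' / real n') * y) * \<Phi> (x, y) $$ ((i + 1) mod n, (j + 1) mod n')) \<and>
    (\<forall>x y i j. i < n \<longrightarrow> j < n' \<longrightarrow> \<Phi> (x, y + 2 * pi) $$ (i, j) =
       cis (2 * pi * (of_int a' * real j / real n' - of_int a * real i / real n)) * \<Phi> (x, y) $$ (i, j))"
proof (cases "smooth_mat n n' \<Phi>")
  case True
  note c = smooth_matD(1)[OF True]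
  have sc: "k \<cdot>\<^sub>m shift_mat l \<in> carrier_mat l l" for k l using shift_mat_carrier by simp
  have X: "\<Phi> (x + 2 * pi, y) * (cis (of_int a' / real n' * y) \<cdot>\<^sub>m shift_mat n') =
      cis (of_int a / real n * y) \<cdot>\<^sub>m shift_mat n * \<Phi> (x, y) \<longleftrightarrow>
    (\<forall>i j. i < n \<longrightarrow> j < n' \<longrightarrow> \<Phi> (x + 2 * pi, y) $$ (i, j) =
       cis ((of_int a / real n - of_int a' / real n') * y) * \<Phi> (x, y) $$ ((i + 1) mod n, (j + 1) mod n'))"
    (is "?L = ?R \<longleftrightarrow> ?P") for x y
  proof -
    let ?u = "cis (of_int a' / real n' * y)" and ?v = "cis (of_int a / real n * y)"
    have L: "?L = ?u \<cdot>\<^sub>m (\<Phi> (x + 2 * pi, y) * shift_mat n')"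
      by (rule mult_smult_distrib[OF c shift_mat_carrier])
    have R: "?R = ?v \<cdot>\<^sub>m (shift_mat n * \<Phi> (x, y))"
      by (rule mult_smult_assoc_mat[OF shift_mat_carrier c])
    have Lc: "\<Phi> (x + 2 * pi, y) * shift_mat n' \<in> carrier_mat n n'" and Rc: "shift_mat n * \<Phi> (x, y) \<in> carrier_mat n n'"
      by (rule mult_carrier_mat[OF c shift_mat_carrier], rule mult_carrier_mat[OF shift_mat_carrier c])
    \<comment> \<open>Entries are compared in column (j + 1) mod n', where right multiplication by
      the shift matrix gives the entry of column j; every column is of this form.\<close>
    have Li: "?L $$ (i, (j + 1) mod n') = ?u * \<Phi> (x + 2 * pi, y) $$ (i, j)"
      and Ri: "?R $$ (i, (j + 1) mod n') = ?v * \<Phi> (x, y) $$ ((i + 1) mod n, (j + 1) mod n')" if "i < n" "j < n'" for i j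
    proof -
      have j: "(j + 1) mod n' < n'" using that by (intro mod_less_divisor) simp
      have "?L $$ (i, (j + 1) mod n') = ?u * (\<Phi> (x + 2 * pi, y) * shift_mat n') $$ (i, (j + 1) mod n')"
        unfolding L by (rule index_smult_mat(1)) (use Lc that j in auto)
      also have "(\<Phi> (x + 2 * pi, y) * shift_mat n') $$ (i, (j + 1) mod n') = \<Phi> (x + 2 * pi, y) $$ (i, j)"
        by (rule mult_shift_mat[OF c that])
      finally show "?L $$ (i, (j + 1) mod n') = ?u * \<Phi> (x + 2 * pi, y) $$ (i, j)" .
      have "?R $$ (i, (j + 1) mod n') = ?v * (shift_mat n * \<Phi> (x, y)) $$ (i, (j + 1) mod n')"
        unfolding R by (rule index_smult_mat(1)) (use Rc that j in auto)
      also have "(shift_mat n * \<Phi> (x, y)) $$ (i, (j + 1) mod n') = \<Phi> (x, y) $$ ((i + 1) mod n, (j + 1) mod n')"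
        by (rule shift_mat_mult[OF c that(1) j])
      finally show "?R $$ (i, (j + 1) mod n') = ?v * \<Phi> (x, y) $$ ((i + 1) mod n, (j + 1) mod n')" .
    qed
    have uv: "?u * z = ?v * w \<longleftrightarrow> z = cis ((of_int a / real n - of_int a' / real n') * y) * w" for z w
    proof -
      have "?v = ?u * cis ((of_int a / real n - of_int a' / real n') * y)" by (simp add: cis_mult algebra_simps)
      then show ?thesis by (simp add: mult.assoc)
    qed
    show ?thesis
    proof
      assume "?L = ?R"
      then have "?u * \<Phi> (x + 2 * pi, y) $$ (i, j) = ?v * \<Phi> (x, y) $$ ((i + 1) mod n, (j + 1) mod n')"
        if "i < n" "j < n'" for i j using Li[OF that] Ri[OF that] by (simp only:)
      then show ?P unfolding uv by blast
    next
      assume P: ?P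
      have LRc: "?L \<in> carrier_mat n n'" "?R \<in> carrier_mat n n'" using Lc Rc unfolding L R by simp_all
      have "\<forall>i l. i < n \<longrightarrow> l < n' \<longrightarrow> ?L $$ (i, l) = ?R $$ (i, l)"
      proof (intro allI impI)
        fix i l assume il: "i < n" "l < n'"
        then obtain j where j: "j < n'" "l = (j + 1) mod n'" using mod_Suc_surj by blast
        show "?L $$ (i, l) = ?R $$ (i, l)"
          unfolding j(2) Li[OF il(1) j(1)] Ri[OF il(1) j(1)] uv using P il j by blast
      qed
      then show "?L = ?R" by (rule carrier_mat_eq_iff[OF LRc, THEN iffD2])
    qed
  qed
  have Y: "\<Phi> (x, y + 2 * pi) * clock_pow n' (- a') = clock_pow n (- a) * \<Phi> (x, y) \<longleftrightarrow>
    (\<forall>i j. i < n \<longrightarrow> j < n' \<longrightarrow> \<Phi> (x, y + 2 * pi) $$ (i, j) =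
       cis (2 * pi * (of_int a' * real j / real n' - of_int a * real i / real n)) * \<Phi> (x, y) $$ (i, j))"
    (is "?L = ?R \<longleftrightarrow> ?P") for x y
  proof -
    have Lc: "?L \<in> carrier_mat n n'" and Rc: "?R \<in> carrier_mat n n'"
      by (rule mult_carrier_mat[OF c clock_pow_carrier], rule mult_carrier_mat[OF clock_pow_carrier c])
    have uv: "z * cis (2 * pi * of_int (- a') * real j / real n') = cis (2 * pi * of_int (- a) * real i / real n) * w \<longleftrightarrow>
      z = cis (2 * pi * (of_int a' * real j / real n' - of_int a * real i / real n)) * w" (is "z * ?u = ?v * w \<longleftrightarrow> z = ?w * w") for z w i j
    proof -
      have "?v = ?u * ?w" by (simp add: cis_mult algebra_simps)
      then show ?thesis by (simp add: mult_ac)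
    qed
    have "?L = ?R \<longleftrightarrow> (\<forall>i j. i < n \<longrightarrow> j < n' \<longrightarrow> ?L $$ (i, j) = ?R $$ (i, j))"
      by (rule carrier_mat_eq_iff[OF Lc Rc])
    also have "\<dots> \<longleftrightarrow> ?P"
      by (intro all_cong1 imp_cong refl) (simp only: mult_clock_pow[OF c] clock_pow_mult[OF c] uv)
    finally show ?thesis .
  qed
  show ?thesis unfolding bundle_map_def E_bundle_simps X Y using True by blast
qed (simp add: bundle_map_def)

section \<open>The Dolbeault operator on entries and its form on the line\<close>

text \<open>The operator on one entry. For a section, \<delta> and \<kappa> are the slope and the
  parameter of the bundle; for a bundle map they are those of the target minus those of the
  source.\<close>

definition Dop :: "complex \<Rightarrow> real \<Rightarrow> complex \<Rightarrow> (real \<times> real \<Rightarrow> complex) \<Rightarrow> real \<times> real \<Rightarrow> complex" where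
  "Dop \<tau> \<delta> \<kappa> f p = 2 * delbar \<tau> f p -
     \<i> / (of_real pi * (cnj \<tau> - \<tau>)) * (of_real (\<delta> * fst p) + \<kappa>) * f p"

lemma smooth_Dop: "smooth f \<Longrightarrow> smooth (Dop \<tau> \<delta> \<kappa> f)"
proof -
  assume f: "smooth f"
  have "smooth (\<lambda>p. 2 * delbar \<tau> f p - \<i> / (of_real pi * (cnj \<tau> - \<tau>)) * (of_real \<delta> * of_real (fst p) + \<kappa>) * f p)"
    by (intro smooth_intros smooth_fst f)
  then show ?thesis by (simp add: Dop_def[abs_def])
qed

lemma delbar_sum:
  assumes "\<And>i. i \<in> I \<Longrightarrow> f i differentiable (at p)"
  shows "delbar \<tau> (\<lambda>q. \<Sum>i\<in>I. f i q) p = (\<Sum>i\<in>I. delbar \<tau> (f i) p)"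
  unfolding delbar_def using partial_sum[of I f p, OF assms]
  by (simp add: sum_divide_distrib sum_distrib_left sum_subtractf diff_divide_distrib)

lemma delbar_mult:
  assumes "f differentiable (at p)" "g differentiable (at p)"
  shows "delbar \<tau> (\<lambda>q. f q * g q) p = delbar \<tau> f p * g p + f p * delbar \<tau> g p"
  unfolding delbar_def using partial_mult[OF assms] by (simp add: add_divide_distrib diff_divide_distrib algebra_simps)

text \<open>The Leibniz rule for an entry of a matrix product: slopes and parameters of the factors
  add up.\<close>

lemma Dop_sum_mult:
  assumes "\<And>i. i \<in> I \<Longrightarrow> f i differentiable (at p)" "\<And>i. i \<in> I \<Longrightarrow> g i differentiable (at p)"
  shows "Dop \<tau> (\<delta> + \<delta>') (\<kappa> + \<kappa>') (\<lambda>q. \<Sum>i\<in>I. f i q * g i q) p =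
    (\<Sum>i\<in>I. Dop \<tau> \<delta> \<kappa> (f i) p * g i p) + (\<Sum>i\<in>I. f i p * Dop \<tau> \<delta>' \<kappa>' (g i) p)"
proof -
  have "delbar \<tau> (\<lambda>q. \<Sum>i\<in>I. f i q * g i q) p = (\<Sum>i\<in>I. delbar \<tau> (f i) p * g i p + f i p * delbar \<tau> (g i) p)"
    using assms by (subst delbar_sum) (auto intro!: sum.cong delbar_mult differentiable_mult)
  then have "Dop \<tau> (\<delta> + \<delta>') (\<kappa> + \<kappa>') (\<lambda>q. \<Sum>i\<in>I. f i q * g i q) p =
     (\<Sum>i\<in>I. 2 * (delbar \<tau> (f i) p * g i p + f i p * delbar \<tau> (g i) p) -
        \<i> / (of_real pi * (cnj \<tau> - \<tau>)) * (of_real ((\<delta> + \<delta>') * fst p) + (\<kappa> + \<kappa>')) * (f i p * g i p))"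
    by (simp only: Dop_def sum_distrib_left sum_subtractf)
  also have "\<dots> = (\<Sum>i\<in>I. Dop \<tau> \<delta> \<kappa> (f i) p * g i p + f i p * Dop \<tau> \<delta>' \<kappa>' (g i) p)"
  proof (intro sum.cong refl)
    fix i
    have alg: "2 * (u * g + f * v) - C * ((d + d') + (k + k')) * (f * g) = (2 * u - C * (d + k) * f) * g + f * (2 * v - C * (d' + k') * g)"
      for u v f g C d d' k k' :: complex by (simp add: algebra_simps)
    show "2 * (delbar \<tau> (f i) p * g i p + f i p * delbar \<tau> (g i) p) -
        \<i> / (of_real pi * (cnj \<tau> - \<tau>)) * (of_real ((\<delta> + \<delta>') * fst p) + (\<kappa> + \<kappa>')) * (f i p * g i p) =
       Dop \<tau> \<delta> \<kappa> (f i) p * g i p + f i p * Dop \<tau> \<delta>' \<kappa>' (g i) p"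
      unfolding Dop_def distrib_right[of \<delta> \<delta>'] of_real_add by (rule alg)
  qed
  finally show ?thesis by (simp add: sum.distrib)
qed

lemma Dop_add:
  assumes "f differentiable (at p)" "g differentiable (at p)"
  shows "Dop \<tau> \<delta> \<kappa> (\<lambda>q. f q + g q) p = Dop \<tau> \<delta> \<kappa> f p + Dop \<tau> \<delta> \<kappa> g p"
  unfolding Dop_def delbar_def using partial_add[OF assms] by (simp add: add_divide_distrib diff_divide_distrib algebra_simps)

lemma Dop_cmult:
  assumes "f differentiable (at p)"
  shows "Dop \<tau> \<delta> \<kappa> (\<lambda>q. c * f q) p = c * Dop \<tau> \<delta> \<kappa> f p"
proof -
  have "partial_x (\<lambda>q. c * f q) p = c * partial_x f p" "partial_y (\<lambda>q. c * f q) p = c * partial_y f p"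
    using partial_mult[of "\<lambda>q. c" p f] assms by simp_all
  then have "delbar \<tau> (\<lambda>q. c * f q) p = c * delbar \<tau> f p"
    by (simp add: delbar_def diff_divide_distrib algebra_simps)
  then show ?thesis by (simp add: Dop_def algebra_simps)
qed

text \<open>What \<open>Dop\<close> becomes under \<open>zak (- \<delta>)\<close>. The y-derivative
  yields multiplication of h by its argument minus the outer coordinate x, and the latter cancels
  the connection term \<delta> x, leaving an ordinary differential operator in h.\<close>

definition hop :: "complex \<Rightarrow> real \<Rightarrow> complex \<Rightarrow> (real \<Rightarrow> complex) \<Rightarrow> real \<Rightarrow> complex" where
  "hop \<tau> \<delta> \<kappa> h x = (2 * \<tau> * vderiv h x + \<i> / pi * (of_real (\<delta> * x) + \<kappa>) * h x) / (\<tau> - cnj \<tau>)"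

lemma Dop_zak:
  assumes h: "schwartz h"
  shows "Dop \<tau> \<delta> \<kappa> (zak (- \<delta>) A h) p = zak (- \<delta>) A (hop \<tau> \<delta> \<kappa> h) p"
proof -
  let ?Z = "zak (- \<delta>) A" and ?e = "\<tau> - cnj \<tau>"
  have r: "rapid h" "rapid (vderiv h)" using schwartzD(1) schwartzD(2) h by blast+
  have "hop \<tau> \<delta> \<kappa> h = (\<lambda>x. (2 * \<tau> / ?e) * vderiv h x + ((\<i> * \<delta> / (pi * ?e)) * (of_real x * h x) + (\<i> * \<kappa> / (pi * ?e)) * h x))"
    by (auto simp: hop_def fun_eq_iff add_divide_distrib algebra_simps)
  then have "?Z (hop \<tau> \<delta> \<kappa> h) p = (2 * \<tau> / ?e) * ?Z (vderiv h) p +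
      ((\<i> * \<delta> / (pi * ?e)) * ?Z (\<lambda>x. of_real x * h x) p + (\<i> * \<kappa> / (pi * ?e)) * ?Z h p)"
    using r by (simp only:) (simp only: zak_add zak_cmult rapid_add rapid_cmult rapid_times_x)
  moreover have "Dop \<tau> \<delta> \<kappa> (?Z h) p = (2 * \<tau> / ?e) * ?Z (vderiv h) p +
      ((\<i> * \<delta> / (pi * ?e)) * ?Z (\<lambda>x. of_real x * h x) p + (\<i> * \<kappa> / (pi * ?e)) * ?Z h p)"
  proof (cases "?e = 0")
    case True
    then show ?thesis by (simp add: Dop_def delbar_def)
  next
    case False
    have alg: "2 * ((\<tau> * a - \<i> * (- d) / (2 * P) * (b - x * c)) / e) - \<i> / (P * (- e)) * (d * x + k) * c =
       (2 * \<tau> / e) * a + ((\<i> * d / (P * e)) * b + (\<i> * k / (P * e)) * c)"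
      if "e \<noteq> 0" "P \<noteq> 0" for a b c d e x k P :: complex
      using that by (simp add: field_simps)
    have "cnj \<tau> - \<tau> = - ?e" by simp
    then show ?thesis
      unfolding Dop_def delbar_def zak_partials(2,3)[OF h]
      using alg[OF False, of pi "?Z (vderiv h) p" \<delta> "?Z (\<lambda>x. of_real x * h x) p" "fst p" "?Z h p" \<kappa>] by simp
  qed
  ultimately show ?thesis by simp
qed

text \<open>Pairs of residues reproduce the transformation law of bundle maps: a translation in x
  advances both residues by one, and the character in y is constant on each class.\<close>

definition zmat :: "nat \<Rightarrow> nat \<Rightarrow> real \<Rightarrow> (real \<Rightarrow> complex) \<Rightarrow> real \<times> real \<Rightarrow> complex mat" where
  "zmat n n' c h p = Matrix.mat n n' (\<lambda>(i, j). zak c {s. s mod int n = int i \<and> s mod int n' = int j} h p)"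

lemma zmat_carrier [simp]: "zmat n n' c h p \<in> carrier_mat n n'" by (simp add: zmat_def)

lemma zmat_index: "i < n \<Longrightarrow> j < n' \<Longrightarrow>
    zmat n n' c h p $$ (i, j) = zak c {s. s mod int n = int i \<and> s mod int n' = int j} h p"
  by (simp add: zmat_def)

lemma smooth_zmat: "schwartz h \<Longrightarrow> smooth_mat n n' (zmat n n' c h)"
  by (intro smooth_matI) (simp_all add: zmat_index smooth_zak)

lemma bundle_map_zmat:
  assumes h: "schwartz h" and c: "c = of_int a' / real n' - of_int a / real n"
  shows "bundle_map (E_bundle \<tau> n' a' \<mu>') (E_bundle \<tau> n a \<mu>) (zmat n n' c h)"
  unfolding bundle_map_E_iff
proof (intro conjI allI impI smooth_zmat h)
  fix x y :: real and i j assume ij: "i < n" "j < n'"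
  have m: "(s - 1) mod int k = int i \<longleftrightarrow> s mod int k = int ((i + 1) mod k)" if "i < k" for s k i
  proof -
    have "(s - 1) mod int k = int i \<longleftrightarrow> (s - 1) mod int k = int i mod int k" using that by simp
    also have "\<dots> \<longleftrightarrow> int k dvd (s - 1 - int i)" by (rule mod_eq_dvd_iff)
    also have "\<dots> \<longleftrightarrow> s mod int k = (int i + 1) mod int k"
      unfolding mod_eq_dvd_iff by (simp add: algebra_simps)
    finally show ?thesis by (simp add: zmod_int add.commute)
  qed
  have ij': "(i + 1) mod n < n" "(j + 1) mod n' < n'" using ij by (auto intro!: mod_less_divisor)
  show "zmat n n' c h (x + 2 * pi, y) $$ (i, j) =
      cis ((of_int a / real n - of_int a' / real n') * y) * zmat n n' c h (x, y) $$ ((i + 1) mod n, (j + 1) mod n')"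
    unfolding zmat_index[OF ij] zmat_index[OF ij']
    using zak_shift_x[of "{s. s mod int n = int i \<and> s mod int n' = int j}"
        "{s. s mod int n = int ((i + 1) mod n) \<and> s mod int n' = int ((j + 1) mod n')}" c h x y] m ij
    by (simp add: c)
  show "zmat n n' c h (x, y + 2 * pi) $$ (i, j) =
      cis (2 * pi * (of_int a' * real j / real n' - of_int a * real i / real n)) * zmat n n' c h (x, y) $$ (i, j)"
    unfolding zmat_index[OF ij]
  proof (rule zak_shift_y)
    fix s assume s: "s \<in> {s. s mod int n = int i \<and> s mod int n' = int j}"
    \<comment> \<open>Because s/k is an integer plus i/k, an integral multiple of s/k depends modulo
      1 only on the residue i.\<close>
    have q: "of_int s / real k = of_int (s div int k) + real i / real k" if "s mod int k = int i" "i < k" for k i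
    proof -
      have "of_int s = of_int (int k * (s div int k) + s mod int k)" by simp
      also have "\<dots> = (real k * of_int (s div int k) + real i :: real)" unfolding that(1) by simp
      finally have "of_int s = (real k * of_int (s div int k) + real i :: real)" .
      then show ?thesis using that(2) by (simp add: field_simps)
    qed
    have "2 * pi * c * of_int s = 2 * pi * (of_int a' * (of_int s / real n') - of_int a * (of_int s / real n))"
      by (simp add: c algebra_simps)
    also have "\<dots> = 2 * pi * (of_int a' * real j / real n' - of_int a * real i / real n) +
        2 * pi * of_int (a' * (s div int n') - a * (s div int n))"
      using s ij q[of n i] q[of n' j] by (simp add: algebra_simps)
    finally show "cis (2 * pi * c * of_int s) = cis (2 * pi * (of_int a' * real j / real n' - of_int a * real i / real n))"
      by (simp only: flip: cis_mult) simp
  qed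
qed

section \<open>Gaussian maps between the bundles\<close>

lemma zak_shift_int:
  assumes "\<And>s. s - t \<in> A \<longleftrightarrow> s \<in> B"
  shows "zak c A h (x + 2 * pi * of_int t, y) = cis (- c * of_int t * y) * zak c B h (x, y)"
proof -
  have "s + t \<in> B" if "s \<in> A" for s using assms[of "s + t"] that by simp
  then have bij: "bij_betw (\<lambda>s. s - t) B A"
    using assms by (intro bij_betwI[where g = "\<lambda>s. s + t"]) auto
  have "zak c A h (x + 2 * pi * of_int t, y) =
    (\<Sum>\<^sub>\<infinity>s\<in>B. h (x + 2 * pi * of_int t + 2 * pi * of_int (s - t)) * cis (c * of_int (s - t) * y))"
    unfolding zak_def by (simp only: fst_conv snd_conv infsum_reindex_bij_betw[OF bij, symmetric])
  also have "\<dots> = (\<Sum>\<^sub>\<infinity>s\<in>B. cis (- c * of_int t * y) * (h (x + 2 * pi * of_int s) * cis (c * of_int s * y)))"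
    by (intro infsum_cong) (simp add: algebra_simps cis_mult)
  also have "\<dots> = cis (- c * of_int t * y) * zak c B h (x, y)"
    unfolding zak_def by (simp add: infsum_cmult_right')
  finally show ?thesis .
qed

lemma bezout_residues_iff:
  fixes a b :: int
  assumes "b * int n - a * int m = 1"
  shows "s mod int n = t mod int n \<and> s mod int m = t mod int m \<longleftrightarrow> int (n * m) dvd s - t"
proof -
  have "coprime (int n) (int m)"
  proof (rule coprimeI)
    fix c assume "c dvd int n" "c dvd int m"
    then have "c dvd b * int n - a * int m" by (intro dvd_diff dvd_mult)
    then show "is_unit c" using assms by simp
  qed
  then have "int n dvd s - t \<and> int m dvd s - t \<longleftrightarrow> int (n * m) dvd s - t"
    using divides_mult[of "int n" "s - t" "int m"] dvd_mult_left[of "int n" "int m"] dvd_mult_right[of "int n" "int m"]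
    by auto
  then show ?thesis by (simp only: mod_eq_dvd_iff)
qed

lemma bezout_residues_ex:
  fixes a b :: int
  assumes bz: "b * int n - a * int m = 1" and ij: "i < n" "j < m"
  shows "\<exists>t::nat. t mod n = i \<and> t mod m = j"
proof -
  \<comment> \<open>By Bezout - a m is 1 modulo n and 0 modulo m, and b n is 0 modulo n and 1 modulo
    m.\<close>
  define s where "s = int i * (- a * int m) + int j * (b * int n)"
  define t where "t = s mod (int n * int m)"
  have t: "t \<ge> 0" "int (nat t) = t" using ij by (auto simp: t_def)
  have "s = int i + int n * (b * (int j - int i))"
  proof -
    have h: "- a * int m = 1 - b * int n" using bz by simp
    show ?thesis unfolding s_def h by (simp add: algebra_simps)
  qed
  then have "s mod int n = int i" using ij by simp
  moreover have "s = int j + int m * (a * (int j - int i))"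
  proof -
    have h: "b * int n = 1 + a * int m" using bz by simp
    show ?thesis unfolding s_def h by (simp add: algebra_simps)
  qed
  then have "s mod int m = int j" using ij by simp
  moreover have "t mod int n = s mod int n" "t mod int m = s mod int m"
    unfolding t_def by (simp_all add: mod_mod_cancel)
  ultimately have "int (nat t mod n) = int i" "int (nat t mod m) = int j"
    unfolding zmod_int t(2) by simp_all
  then show ?thesis by (intro exI[of _ "nat t"]) simp
qed

lemma bezout_slope:
  fixes a b :: int
  assumes "b * int n - a * int m = 1" "n \<ge> 1" "m \<ge> 1"
  shows "of_int a / real n - of_int b / real m = - (1 / real (n * m))"
proof -
  have "of_int b * real n - of_int a * real m = of_int (b * int n - a * int m)" by simp
  also have "\<dots> = 1" unfolding assms(1) by simp
  finally show ?thesis using assms(2,3) by (simp add: field_simps)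
qed

text \<open>Moving t periods in x carries the entry (0, 0) to (t mod n, t mod m), and by the Chinese
  remainder theorem every entry is reached, so this one entry determines the map. After n m periods
  it returns with the factor cis (- y), and \<open>theta_like_eq_zak\<close> applies.\<close>

theorem bundle_map_eq_zmat:
  fixes a b :: int
  assumes n: "n \<ge> 1" "m \<ge> 1" and bz: "b * int n - a * int m = 1"
    and \<psi>: "bundle_map (E_bundle \<tau> m b \<nu>) (E_bundle \<tau> n a \<mu>) \<psi>"
  defines "r \<equiv> \<lambda>p. \<psi> p $$ (0, 0)"
  shows "theta_like (n * m) r" "\<psi> p = zmat n m (1 / real (n * m)) (mean_y r) p"
proof -
  let ?N = "n * m"
  have N: "?N \<ge> 1" using n by simp
  note sl = bezout_slope[OF bz n]
  have sm: "smooth_mat n m \<psi>"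
    and xs: "\<And>x y i j. i < n \<Longrightarrow> j < m \<Longrightarrow> \<psi> (x + 2 * pi, y) $$ (i, j) =
       cis (- (1 / real ?N) * y) * \<psi> (x, y) $$ ((i + 1) mod n, (j + 1) mod m)"
    and ys: "\<And>x y i j. i < n \<Longrightarrow> j < m \<Longrightarrow> \<psi> (x, y + 2 * pi) $$ (i, j) =
       cis (2 * pi * (of_int b * real j / real m - of_int a * real i / real n)) * \<psi> (x, y) $$ (i, j)"
    using \<psi> unfolding bundle_map_E_iff sl by blast+
  have it: "r (x + 2 * pi * real t, y) = cis (- (real t / real ?N) * y) * \<psi> (x, y) $$ (t mod n, t mod m)" for t x y
  proof (induction t arbitrary: x)
    case 0
    then show ?case using n by (simp add: r_def)
  next
    case (Suc t)
    have tl: "t mod n < n" "t mod m < m" using n by auto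
    have "r (x + 2 * pi * real (Suc t), y) = r ((x + 2 * pi) + 2 * pi * real t, y)" by (simp add: algebra_simps)
    also have "\<dots> = cis (- (real t / real ?N) * y) * (cis (- (1 / real ?N) * y) * \<psi> (x, y) $$ ((t mod n + 1) mod n, (t mod m + 1) mod m))"
      unfolding Suc xs[OF tl] ..
    also have "\<dots> = cis (- (real (Suc t) / real ?N) * y) * \<psi> (x, y) $$ (Suc t mod n, Suc t mod m)"
      unfolding mult.assoc[symmetric] cis_mult by (simp add: mod_Suc_eq add_divide_distrib algebra_simps)
    finally show ?case .
  qed
  show th: "theta_like ?N r"
    unfolding theta_like_def
  proof (intro conjI allI)
    show "smooth r" unfolding r_def using smooth_matD(2)[OF sm, of 0 0] n by simp
    show "r (x, y + 2 * pi) = r (x, y)" for x y unfolding r_def using ys[of 0 0 x y] n by simp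
    show "r (x + 2 * pi * real ?N, y) = cis (- y) * r (x, y)" for x y
      using it[of x ?N y] n by (simp add: r_def)
  qed
  show "\<psi> p = zmat n m (1 / real ?N) (mean_y r) p"
  proof (rule carrier_mat_eq_iff[OF smooth_matD(1)[OF sm] zmat_carrier, THEN iffD2], intro allI impI)
    fix i j assume ij: "i < n" "j < m"
    obtain x y where p: "p = (x, y)" by fastforce
    obtain t where t: "t mod n = i" "t mod m = j" using bezout_residues_ex[OF bz ij] by blast
    let ?Z = "zak (1 / real ?N) {s. s mod int n = int i \<and> s mod int m = int j} (mean_y r) (x, y)"
    have "zak (1 / real ?N) {s. int ?N dvd s} (mean_y r) (x + 2 * pi * of_int (int t), y) =
        cis (- (1 / real ?N) * of_int (int t) * y) * ?Z"
    proof (rule zak_shift_int)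
      fix s
      have "int i = int t mod int n" "int j = int t mod int m" unfolding t[symmetric] by (simp_all add: zmod_int)
      then show "s - int t \<in> {s. int ?N dvd s} \<longleftrightarrow> s \<in> {s. s mod int n = int i \<and> s mod int m = int j}"
        using bezout_residues_iff[OF bz, of s "int t"] by simp
    qed
    then have "r (x + 2 * pi * real t, y) = cis (- (real t / real ?N) * y) * ?Z"
      using theta_like_eq_zak[OF th N, of "(x + 2 * pi * real t, y)"] by simp
    then have "cis (- (real t / real ?N) * y) * \<psi> (x, y) $$ (i, j) = cis (- (real t / real ?N) * y) * ?Z"
      using it[of x t y] t by metis
    then have "\<psi> (x, y) $$ (i, j) = ?Z" using mult_left_cancel[OF cis_neq_zero] by blast
    then show "\<psi> p $$ (i, j) = zmat n m (1 / real ?N) (mean_y r) p $$ (i, j)"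
      unfolding zmat_index[OF ij] p .
  qed
qed

lemma Re_imag_divide:
  assumes "Im \<tau> > 0"
  shows "Re (\<i> * of_real d / \<tau>) = d * Im \<tau> / (norm \<tau>)\<^sup>2"
proof -
  have "Re (\<i> * of_real d / \<tau>) = d * Im \<tau> / ((Re \<tau>)\<^sup>2 + (Im \<tau>)\<^sup>2)" by (simp add: Re_divide)
  then show ?thesis by (simp add: cmod_power2)
qed

text \<open>The place where Im \<tau> > 0 fixes the sign: for a negative slope difference the
  integrating factor decays. Applied to - d it shows that for a positive difference the reciprocal
  Gaussian decays.\<close>

lemma Re_gauss_coefficient:
  fixes \<tau> :: complex
  assumes \<tau>: "Im \<tau> > 0" and d: "d < 0"
  shows "Re (\<i> * of_real d / (4 * pi * \<tau>)) < 0"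
proof -
  have "\<tau> \<noteq> 0" using \<tau> by auto
  then have n: "(norm \<tau>)\<^sup>2 > 0" by simp
  have "\<i> * of_real d / (4 * pi * \<tau>) = \<i> * of_real (d / (4 * pi)) / \<tau>" by simp
  then have "Re (\<i> * of_real d / (4 * pi * \<tau>)) = d / (4 * pi) * Im \<tau> / (norm \<tau>)\<^sup>2"
    using Re_imag_divide[OF \<tau>, of "d / (4 * pi)"] by simp
  also have "\<dots> < 0" using \<tau> d n by (intro divide_neg_pos mult_neg_pos divide_neg_pos) auto
  finally show ?thesis .
qed

lemma hop_eq:
  fixes \<tau> \<kappa> :: complex
  assumes "Im \<tau> > 0"
  shows "hop \<tau> \<delta> \<kappa> h x = 2 * \<tau> / (\<tau> - cnj \<tau>) *
    (vderiv h x + (2 * (\<i> * of_real \<delta> / (4 * pi * \<tau>)) * of_real x + \<i> * \<kappa> / (2 * pi * \<tau>)) * h x)"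
proof -
  have "\<tau> \<noteq> 0" "\<tau> - cnj \<tau> \<noteq> 0" using assms by (auto simp: complex_eq_iff)
  then show ?thesis by (simp add: hop_def field_simps)
qed

lemma hop_solve:
  fixes \<tau> \<kappa> :: complex
  assumes \<tau>: "Im \<tau> > 0" and d: "\<delta> < 0" and \<rho>: "schwartz \<rho>"
    and tot: "has_total (\<lambda>x. gauss (\<i> * of_real \<delta> / (4 * pi * \<tau>)) (\<i> * \<kappa> / (2 * pi * \<tau>)) x * \<rho> x) 0"
  shows "\<exists>h. schwartz h \<and> hop \<tau> \<delta> \<kappa> h = \<rho>"
proof -
  define k where "k = (\<tau> - cnj \<tau>) / (2 * \<tau>)"
  have nz: "\<tau> \<noteq> 0" "\<tau> - cnj \<tau> \<noteq> 0" using \<tau> by (auto simp: complex_eq_iff)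
  let ?w = "gauss (\<i> * of_real \<delta> / (4 * pi * \<tau>)) (\<i> * \<kappa> / (2 * pi * \<tau>))"
  \<comment> \<open>The normalising constant k is moved into the integrand by writing k f as f - (1
    - k) f.\<close>
  have "has_total (\<lambda>x. ?w x * \<rho> x - (1 - k) * (?w x * \<rho> x)) (0 - (1 - k) * 0)"
    by (rule has_total_diff_cmult[OF tot tot])
  moreover have "(\<lambda>x. ?w x * \<rho> x - (1 - k) * (?w x * \<rho> x)) = (\<lambda>x. ?w x * (k * \<rho> x))"
    by (simp add: fun_eq_iff algebra_simps)
  ultimately have "has_total (\<lambda>x. ?w x * (k * \<rho> x)) 0" by simp
  from solve_gauss_ode[OF Re_gauss_coefficient[OF \<tau> d] schwartz_cmult[OF \<rho>] this]
  obtain h where h: "schwartz h" and eq: "\<And>x. vderiv h x + (2 * (\<i> * of_real \<delta> / (4 * pi * \<tau>)) * of_real x + \<i> * \<kappa> / (2 * pi * \<tau>)) * h x = k * \<rho> x"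
    by blast
  have "hop \<tau> \<delta> \<kappa> h x = \<rho> x" for x
    unfolding hop_eq[OF \<tau>] eq using nz by (simp add: k_def)
  then show ?thesis using h by blast
qed

text \<open>The reciprocal of the integrating factor solves the homogeneous equation. For \<delta> >
  0 it decays and gives a holomorphic map.\<close>

lemma hop_gauss:
  fixes \<tau> \<kappa> :: complex
  assumes \<tau>: "Im \<tau> > 0"
  shows "hop \<tau> \<delta> \<kappa> (gauss (- (\<i> * of_real \<delta> / (4 * pi * \<tau>))) (- (\<i> * \<kappa> / (2 * pi * \<tau>)))) x = 0"
  unfolding hop_eq[OF \<tau>] vderivI[OF gauss_deriv] by (simp add: algebra_simps)

text \<open>Passing to the mean in y intertwines the two operators because a y-derivative of a
  periodic function has mean zero.\<close>

lemma mean_y_Dop: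
  fixes \<tau> \<kappa> :: complex
  assumes r: "theta_like N r" and \<tau>: "Im \<tau> > 0"
  shows "mean_y (Dop \<tau> \<delta> \<kappa> r) x = hop \<tau> \<delta> \<kappa> (mean_y r) x"
proof -
  have sm: "smooth r" using r by (simp add: theta_like_def)
  let ?e = "\<tau> - cnj \<tau>"
  have e: "?e \<noteq> 0" using \<tau> by (auto simp: complex_eq_iff)
  have alg: "2 * ((\<tau> * a - b) / e) - \<i> / (P * (- e)) * c * r = (2 * \<tau> / e) * a + ((- 2 / e) * b + (\<i> / (P * e)) * c * r)"
    if "e \<noteq> 0" "P \<noteq> 0" for a b c e r P :: complex using that by (simp add: field_simps)
  have ce: "cnj \<tau> - \<tau> = - ?e" by simp
  have "Dop \<tau> \<delta> \<kappa> r = (\<lambda>p. (2 * \<tau> / ?e) * partial_x r p + ((- 2 / ?e) * partial_y r p +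
      (\<i> / (pi * ?e)) * (of_real (\<delta> * fst p) + \<kappa>) * r p))"
    unfolding Dop_def[abs_def] delbar_def ce by (rule ext) (rule alg[OF e], simp)
  moreover have "mean_y (\<lambda>p. (\<i> / (pi * ?e)) * (of_real (\<delta> * fst p) + \<kappa>) * r p) x =
      (\<i> / (pi * ?e)) * (of_real (\<delta> * x) + \<kappa>) * mean_y r x"
    by (simp add: mean_y_def)
  moreover have "smooth (\<lambda>p. (\<i> / (pi * ?e)) * (of_real (\<delta> * fst p) + \<kappa>) * r p)"
    unfolding of_real_mult by (intro smooth_intros smooth_fst sm)
  ultimately have "mean_y (Dop \<tau> \<delta> \<kappa> r) x = (2 * \<tau> / ?e) * mean_y (partial_x r) x +
      ((- 2 / ?e) * mean_y (partial_y r) x + (\<i> / (pi * ?e)) * (of_real (\<delta> * x) + \<kappa>) * mean_y r x)"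
    by (simp only: mean_y_add smooth_intros sm mean_y_cmult)
  moreover have "mean_y (partial_y r) x = 0" using r by (intro mean_y_partial_y) (auto simp: theta_like_def)
  moreover have "vderiv (mean_y r) x = mean_y (partial_x r) x" using vderivI[OF mean_y_deriv[OF sm]] by simp
  moreover have "(2 * \<tau> / e) * X + ((- 2 / e) * 0 + (\<i> / (P * e)) * c * m) = (2 * \<tau> * X + \<i> / P * c * m) / e"
    if "e \<noteq> 0" "P \<noteq> 0" for X m c e P :: complex using that by (simp add: field_simps)
  ultimately show ?thesis using e by (simp only: hop_def) simp
qed

text \<open>Holomorphy is asked only of the entry (0, 0), which determines the map. Its mean is a
  bounded solution of a homogeneous equation whose nonzero solutions grow.\<close>

theorem holomorphic_negative_degree_zero:
  fixes a b :: int and \<tau> \<kappa> :: complex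
  assumes \<tau>: "Im \<tau> > 0" and n: "n \<ge> 1" "m \<ge> 1" and bz: "b * int n - a * int m = 1"
    and \<psi>: "bundle_map (E_bundle \<tau> m b \<nu>) (E_bundle \<tau> n a \<mu>) \<psi>"
    and hol: "\<And>p. Dop \<tau> (of_int a / real n - of_int b / real m) \<kappa> (\<lambda>q. \<psi> q $$ (0, 0)) p = 0"
  shows "\<psi> p = 0\<^sub>m n m"
proof -
  define r where "r = (\<lambda>p. \<psi> p $$ (0, 0))"
  have th: "theta_like (n * m) r" and \<psi>z: "\<psi> p = zmat n m (1 / real (n * m)) (mean_y r) p"
    using bundle_map_eq_zmat[OF n bz \<psi>] unfolding r_def by blast+
  let ?\<delta> = "of_int a / real n - of_int b / real m"
  have d: "?\<delta> < 0" using n unfolding bezout_slope[OF bz n] by simp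
  have "hop \<tau> ?\<delta> \<kappa> (mean_y r) x = 0" for x
    unfolding mean_y_Dop[OF th \<tau>, symmetric] using hol by (simp add: mean_y_def r_def)
  then have ode: "vderiv (mean_y r) x + (2 * (\<i> * of_real ?\<delta> / (4 * pi * \<tau>)) * of_real x + \<i> * \<kappa> / (2 * pi * \<tau>)) * mean_y r x = 0" for x
  proof -
    have "\<tau> \<noteq> 0" "\<tau> - cnj \<tau> \<noteq> 0" using \<tau> by (auto simp: complex_eq_iff)
    then have "2 * \<tau> / (\<tau> - cnj \<tau>) \<noteq> 0" by simp
    then show ?thesis using \<open>hop \<tau> ?\<delta> \<kappa> (mean_y r) x = 0\<close> unfolding hop_eq[OF \<tau>] by (simp only: mult_eq_0_iff) blast
  qed
  have N: "n * m \<ge> 1" using n by simp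
  obtain C where C: "\<And>x. norm (mean_y r x) \<le> C" using mean_y_bounded[OF th N] by blast
  have z: "mean_y r x = 0" for x
    by (rule bounded_gauss_ode_zero[OF Re_gauss_coefficient[OF \<tau> d] schwartzD(3)[OF schwartz_mean_y[OF th N]] ode C])
  show ?thesis
    unfolding \<psi>z by (rule eq_matI) (simp_all add: zmat_def zak_def z)
qed

text \<open>At a fixed point p, row i of the product is a nonzero constant times the sum over s = i
  modulo M of a Gaussian in s times the entry of v at s mod n. If all M sums vanish,
  \<open>theta_values_injective\<close> with n < M applies.\<close>

lemma zmat_gauss_injective:
  assumes A: "Re A < 0" and n: "0 < n" "n < M" and v: "v \<in> carrier_vec n"
    and z: "zmat M n c (gauss A B) p *\<^sub>v v = 0\<^sub>v M"
  shows "v = 0\<^sub>v n"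
proof -
  obtain x y where p: "p = (x, y)" by fastforce
  \<comment> \<open>The coefficients of s^2 and s in A (x + 2 pi s)^2 + B (x + 2 pi s) + i c s
    y.\<close>
  let ?A = "4 * pi\<^sup>2 * A" and ?B = "2 * pi * (2 * A * of_real x + B) + \<i> * c * y"
  let ?S = "\<lambda>j k. {s. s mod int M = int j \<and> s mod int n = int k}"
  define V where "V s = vec_index v (nat (s mod int n))" for s
  let ?f = "\<lambda>s. gauss A B (x + 2 * pi * of_int s) * cis (c * of_int s * y)"
  have f: "?f s = gauss A B x * exp (?A * (of_int s)\<^sup>2 + ?B * of_int s)" for s
    unfolding gauss_def cis_conv_exp exp_add[symmetric]
    by (rule arg_cong[where f = exp]) (simp add: power2_eq_square algebra_simps)
  have sm: "?f summable_on S" for S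
    by (rule zak_summable[OF rapid_gauss[OF A]])
  have Re: "Re ?A < 0" using A by (simp add: mult_pos_neg power2_eq_square)
  have zero: "(\<Sum>\<^sub>\<infinity>s\<in>{s. s mod int M = j}. exp (?A * (of_int s)\<^sup>2 + ?B * of_int s) * V s) = 0" for j
  proof (cases "0 \<le> j \<and> j < int M")
    case False
    then have "{s. s mod int M = j} = {}" using n by auto
    then show ?thesis by simp
  next
    case True
    then obtain i where i: "j = int i" "i < M" using nonneg_int_cases by (metis of_nat_less_iff)
    have "0 = vec_index (zmat M n c (gauss A B) p *\<^sub>v v) i" using z i by simp
    also have "\<dots> = (\<Sum>k<n. zmat M n c (gauss A B) p $$ (i, k) * vec_index v k)"
      by (rule mult_mat_vec_index[OF zmat_carrier v i(2)])
    also have "\<dots> = (\<Sum>k<n. infsum (\<lambda>s. ?f s * V s) (?S i k))"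
    proof (intro sum.cong refl)
      fix k assume k: "k \<in> {..<n}"
      have "infsum (\<lambda>s. ?f s * V s) (?S i k) = infsum (\<lambda>s. ?f s * vec_index v k) (?S i k)"
        by (intro infsum_cong) (simp add: V_def)
      then show "zmat M n c (gauss A B) p $$ (i, k) * vec_index v k = infsum (\<lambda>s. ?f s * V s) (?S i k)"
        using k i by (simp add: zmat_index zak_def p infsum_cmult_left')
    qed
    also have "\<dots> = infsum (\<lambda>s. ?f s * V s) (\<Union>k\<in>{..<n}. ?S i k)"
    proof (rule sum_infsum)
      fix k assume k: "k \<in> {..<n}"
      have "(\<lambda>s. ?f s * vec_index v k) summable_on ?S i k" by (rule summable_on_cmult_left[OF sm])
      then show "(\<lambda>s. ?f s * V s) summable_on ?S i k"
        by (rule summable_on_cong[THEN iffD1, rotated]) (simp add: V_def)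
    qed auto
    also have "(\<Union>k\<in>{..<n}. ?S i k) = {s. s mod int M = j}"
    proof
      show "{s. s mod int M = j} \<subseteq> (\<Union>k\<in>{..<n}. ?S i k)"
      proof
        fix s assume "s \<in> {s. s mod int M = j}"
        moreover have "s mod int n = int (nat (s mod int n))" "nat (s mod int n) < n" using n by (auto simp: nat_less_iff)
        ultimately show "s \<in> (\<Union>k\<in>{..<n}. ?S i k)" using i by blast
      qed
    qed (use i in auto)
    also have "infsum (\<lambda>s. ?f s * V s) {s. s mod int M = j} =
        gauss A B x * (\<Sum>\<^sub>\<infinity>s\<in>{s. s mod int M = j}. exp (?A * (of_int s)\<^sup>2 + ?B * of_int s) * V s)"
      unfolding infsum_cmult_right'[symmetric] by (intro infsum_cong) (subst f, rule mult.assoc)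
    finally show ?thesis by simp
  qed
  have "V t = 0" for t
    by (rule theta_values_injective[OF Re n _ zero]) (simp add: V_def)
  then have "vec_index v k = 0" if "k < n" for k
    using that spec[of "\<lambda>t. V t = 0" "int k"] by (simp add: V_def)
  then show ?thesis using v by (intro eq_vecI) auto
qed

lemma infsum_product_abs:
  fixes f :: "'a \<Rightarrow> complex" and g :: "'b \<Rightarrow> complex"
  assumes f: "(\<lambda>x. norm (f x)) summable_on A" and g: "(\<lambda>x. norm (g x)) summable_on B"
  shows "(\<lambda>(x, y). f x * g y) summable_on A \<times> B"
    and "infsum f A * infsum g B = infsum (\<lambda>(x, y). f x * g y) (A \<times> B)"
proof -
  have "(\<lambda>(x, y). norm (f x) * norm (g y)) summable_on A \<times> B"
  proof (rule summable_on_SigmaI)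
    show "((\<lambda>y. case (x, y) of (x, y) \<Rightarrow> norm (f x) * norm (g y)) has_sum norm (f x) * infsum (\<lambda>y. norm (g y)) B) B" for x
      using has_sum_cmult_right[OF has_sum_infsum[OF g]] by simp
    show "(\<lambda>x. norm (f x) * infsum (\<lambda>y. norm (g y)) B) summable_on A"
      by (rule summable_on_cmult_left[OF f])
  qed auto
  then have "(\<lambda>z. norm (case z of (x, y) \<Rightarrow> f x * g y)) summable_on A \<times> B"
    by (simp add: case_prod_unfold norm_mult)
  then show s: "(\<lambda>(x, y). f x * g y) summable_on A \<times> B" by (rule abs_summable_summable)
  have "infsum (\<lambda>(x, y). f x * g y) (A \<times> B) = infsum (\<lambda>x. infsum (\<lambda>y. f x * g y) B) A"
    using infsum_Sigma_banach[OF s] by simp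
  also have "\<dots> = infsum f A * infsum g B"
    by (simp add: infsum_cmult_right' infsum_cmult_left')
  finally show "infsum f A * infsum g B = infsum (\<lambda>(x, y). f x * g y) (A \<times> B)" ..
qed

text \<open>Here P stands for pi, T for \<tau>, and (S, S') is moved along the direction (m, - n),
  where x and y drop out of the change. As k is reflected about c/2, the change of the quadratic
  part cancels the contribution of - P c in the linear part, and only i P e d from the component P T
  d remains.\<close>

lemma gauss_composite_exponent:
  fixes m n M x y S S' e k c d P T \<mu> \<nu> \<eta> :: complex
  assumes nz: "m \<noteq> 0" "n \<noteq> 0" "M \<noteq> 0" "P \<noteq> 0" "T \<noteq> 0" and M: "M = m + n"
    and \<eta>: "\<eta> - \<mu> - \<nu> = - (P * c) + P * T * d" and e: "e = 2 * k - c" and S': "S' = S + M * k"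
  defines "Q \<equiv> \<lambda>u u'. - (\<i> * (1 / (m * M)) / (4 * P * T)) * (x + 2 * P * u)\<^sup>2 +
        - (\<i> * (\<nu> / m - \<eta> / M) / (2 * P * T)) * (x + 2 * P * u) + \<i> * (- (1 / (m * M)) * u * y) +
        (- (\<i> * (1 / (n * M)) / (4 * P * T)) * (x + 2 * P * u')\<^sup>2 +
        - (\<i> * (\<eta> / M - \<mu> / n) / (2 * P * T)) * (x + 2 * P * u') + \<i> * (- (1 / (n * M)) * u' * y))"
  shows "Q (S + m * e) (S' - n * e) - Q S S' = - (\<i> * P * (d * (c - 2 * k)))"
proof -
  define X where "X = x + 2 * P * S"
  define X' where "X' = x + 2 * P * S'"
  have q1: "(1 / (m * M)) * ((X + 2 * P * m * e)\<^sup>2 - X\<^sup>2) = (4 * P * e * X + 4 * P\<^sup>2 * m * e\<^sup>2) / M"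
    using nz by (simp add: field_simps power2_eq_square)
  have q2: "(1 / (n * M)) * ((X' - 2 * P * n * e)\<^sup>2 - X'\<^sup>2) = (- 4 * P * e * X' + 4 * P\<^sup>2 * n * e\<^sup>2) / M"
    using nz by (simp add: field_simps power2_eq_square)
  have q3: "(4 * P * e * X + 4 * P\<^sup>2 * m * e\<^sup>2) + (- 4 * P * e * X' + 4 * P\<^sup>2 * n * e\<^sup>2) = M * (- 4 * P\<^sup>2 * e * c)"
    unfolding X_def X'_def S' e M by (simp add: algebra_simps power2_eq_square)
  have q: "(1 / (m * M)) * ((X + 2 * P * m * e)\<^sup>2 - X\<^sup>2) + (1 / (n * M)) * ((X' - 2 * P * n * e)\<^sup>2 - X'\<^sup>2) = - 4 * P\<^sup>2 * e * c"
    unfolding q1 q2 add_divide_distrib[symmetric] q3 using nz by simp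
  have l1: "(\<nu> / m - \<eta> / M) * (2 * P * m * e) = 2 * P * e * (\<nu> - m * (\<eta> / M))" using nz(1) by (simp add: field_simps)
  have l2: "(\<eta> / M - \<mu> / n) * (2 * P * n * e) = 2 * P * e * (n * (\<eta> / M) - \<mu>)" using nz(2) by (simp add: field_simps)
  have "m * (\<eta> / M) + n * (\<eta> / M) = \<eta>" using nz(3) unfolding distrib_right[symmetric] M[symmetric] by simp
  then have l3: "(\<nu> - m * (\<eta> / M)) - (n * (\<eta> / M) - \<mu>) = - (\<eta> - \<mu> - \<nu>)" by (simp add: algebra_simps)
  have l: "(\<nu> / m - \<eta> / M) * (2 * P * m * e) - (\<eta> / M - \<mu> / n) * (2 * P * n * e) = - 2 * P * e * (- (P * c) + P * T * d)"
    unfolding l1 l2 right_diff_distrib[symmetric] l3 \<eta> by (simp add: algebra_simps)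
  have y0: "(1 / (m * M)) * (m * e) * y - (1 / (n * M)) * (n * e) * y = 0" using nz by simp
  have "Q (S + m * e) (S' - n * e) - Q S S' =
      - (\<i> / (4 * P * T)) * ((1 / (m * M)) * ((X + 2 * P * m * e)\<^sup>2 - X\<^sup>2) + (1 / (n * M)) * ((X' - 2 * P * n * e)\<^sup>2 - X'\<^sup>2))
      - (\<i> / (2 * P * T)) * ((\<nu> / m - \<eta> / M) * (2 * P * m * e) - (\<eta> / M - \<mu> / n) * (2 * P * n * e))
      - \<i> * ((1 / (m * M)) * (m * e) * y - (1 / (n * M)) * (n * e) * y)"
  proof -
    have gen: "(- (\<i> * a1 / q) * v1\<^sup>2 + - (\<i> * b1 / r) * v1 + \<i> * (- a1 * (S + m * e) * y) +
          (- (\<i> * a2 / q) * v2\<^sup>2 + - (\<i> * b2 / r) * v2 + \<i> * (- a2 * (S' - n * e) * y))) -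
        (- (\<i> * a1 / q) * X\<^sup>2 + - (\<i> * b1 / r) * X + \<i> * (- a1 * S * y) +
          (- (\<i> * a2 / q) * X'\<^sup>2 + - (\<i> * b2 / r) * X' + \<i> * (- a2 * S' * y))) =
        - (\<i> / q) * (a1 * (v1\<^sup>2 - X\<^sup>2) + a2 * (v2\<^sup>2 - X'\<^sup>2)) - (\<i> / r) * (b1 * w1 - b2 * w2) -
          \<i> * (a1 * (m * e) * y - a2 * (n * e) * y)"
      if "v1 = X + w1" "v2 = X' - w2" for a1 a2 b1 b2 q r v1 v2 w1 w2
      unfolding that by (simp add: divide_inverse algebra_simps)
    have v: "x + 2 * P * (S + m * e) = X + 2 * P * m * e" "x + 2 * P * (S' - n * e) = X' - 2 * P * n * e"
      unfolding X_def X'_def by (simp_all add: algebra_simps)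
    show ?thesis unfolding Q_def v X_def[symmetric] X'_def[symmetric] by (rule gen) (rule refl)+
  qed
  also have "\<dots> = - (\<i> / (4 * P * T)) * (- 4 * P\<^sup>2 * e * c) - (\<i> / (2 * P * T)) * (- 2 * P * e * (- (P * c) + P * T * d))"
    unfolding q l y0 by simp
  also have "\<dots> = \<i> * P * e * d" using nz by (simp add: field_simps power2_eq_square)
  finally show ?thesis unfolding e by (simp add: algebra_simps)
qed

text \<open>The summands of the matrix entries of \<open>\<beta> \<alpha>\<close> are indexed by pairs \<open>(s, s')\<close> with \<open>s' - s = M k\<close>;
  the involution \<open>k \<mapsto> c - k\<close> that fixes \<open>n s + m s'\<close> changes the sign of each summand when
  \<open>\<eta> - \<mu> - \<nu> = - \<pi> c + \<pi> \<tau> d\<close> with \<open>c\<close> and \<open>d\<close> odd.\<close>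

theorem zmat_gauss_composite_zero:
  fixes c d :: int and \<tau> \<mu> \<nu> \<eta> :: complex
  assumes \<tau>: "Im \<tau> > 0" and n: "n \<ge> 1" "m \<ge> 1" and M: "M = m + n"
    and odd: "odd c" "odd d" and \<eta>: "\<eta> - \<mu> - \<nu> = - (of_real pi * of_int c) + of_real pi * \<tau> * of_int d"
  defines "g1 \<equiv> gauss (- (\<i> * of_real (1 / real (n * M)) / (4 * pi * \<tau>))) (- (\<i> * (\<eta> / of_nat M - \<mu> / of_nat n) / (2 * pi * \<tau>)))"
    and "g2 \<equiv> gauss (- (\<i> * of_real (1 / real (m * M)) / (4 * pi * \<tau>))) (- (\<i> * (\<nu> / of_nat m - \<eta> / of_nat M) / (2 * pi * \<tau>)))"
  shows "zmat m M (- (1 / real (m * M))) g2 p * zmat M n (- (1 / real (n * M))) g1 p = 0\<^sub>m m n"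
proof (rule eq_matI)
  obtain x y where p: "p = (x, y)" by fastforce
  have \<tau>0: "\<tau> \<noteq> 0" using \<tau> by auto
  have M0: "M \<ge> 1" using n M by simp
  have pos: "- (1 / real (n * M)) < 0" "- (1 / real (m * M)) < 0" using n M0 by simp_all
  have r1: "rapid g1" unfolding g1_def
    by (rule rapid_gauss) (use Re_gauss_coefficient[OF \<tau> pos(1)] in simp)
  have r2: "rapid g2" unfolding g2_def
    by (rule rapid_gauss) (use Re_gauss_coefficient[OF \<tau> pos(2)] in simp)
  define F where "F s = g2 (x + 2 * pi * of_int s) * cis (- (1 / real (m * M)) * of_int s * y)" for s :: int
  define G where "G s = g1 (x + 2 * pi * of_int s) * cis (- (1 / real (n * M)) * of_int s * y)" for s :: int
  have sF: "(\<lambda>s. norm (F s)) summable_on S" for S unfolding F_def by (rule zak_abs_summable[OF r2])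
  have sG: "(\<lambda>s. norm (G s)) summable_on S" for S unfolding G_def by (rule zak_abs_summable[OF r1])
  fix j l assume "j < dim_row (0\<^sub>m m n :: complex mat)" "l < dim_col (0\<^sub>m m n :: complex mat)"
  then have jl: "j < m" "l < n" by simp_all
  let ?A = "\<lambda>k. {s. s mod int m = int j \<and> s mod int M = int k}"
  let ?B = "\<lambda>k. {s. s mod int M = int k \<and> s mod int n = int l}"
  define P where "P = (\<Union>k\<in>{..<M}. ?A k \<times> ?B k)"
  \<comment> \<open>Summing over the intermediate index k leaves only the condition that s and s'
    agree modulo M.\<close>
  have P: "(s, s') \<in> P \<longleftrightarrow> s mod int m = int j \<and> s' mod int n = int l \<and> s mod int M = s' mod int M" for s s'
  proof -
    have "s' mod int M = int (nat (s' mod int M))" "nat (s' mod int M) \<in> {..<M}" using M0 by (auto simp: nat_less_iff)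
    then have "\<exists>k\<in>{..<M}. s' mod int M = int k" by blast
    then show ?thesis unfolding P_def by auto
  qed
  have "(zmat m M (- (1 / real (m * M))) g2 p * zmat M n (- (1 / real (n * M))) g1 p) $$ (j, l) =
      (\<Sum>k<M. infsum F (?A k) * infsum G (?B k))"
    unfolding mult_mat_index[OF zmat_carrier zmat_carrier jl]
    by (intro sum.cong refl) (simp only: zmat_index jl lessThan_iff zak_def p F_def[abs_def] G_def[abs_def] fst_conv snd_conv)
  also have "\<dots> = (\<Sum>k<M. infsum (\<lambda>(s, s'). F s * G s') (?A k \<times> ?B k))"
    by (simp only: infsum_product_abs(2)[OF sF sG])
  also have "\<dots> = infsum (\<lambda>(s, s'). F s * G s') P"
    unfolding P_def by (rule sum_infsum) (auto intro: infsum_product_abs(1)[OF sF sG])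
  finally have sum: "(zmat m M (- (1 / real (m * M))) g2 p * zmat M n (- (1 / real (n * M))) g1 p) $$ (j, l) =
      infsum (\<lambda>(s, s'). F s * G s') P" .
  define K where "K = (\<lambda>(s, s'). (s' - s) div int M)"
  \<comment> \<open>Adding a multiple of m to s and subtracting a multiple of n from s' preserves
    the residues s mod m and s' mod n that fix the matrix entry.\<close>
  define \<phi> where "\<phi> = (\<lambda>z. (fst z + int m * (2 * K z - c), snd z - int n * (2 * K z - c)))"
  have K: "s' = s + int M * K (s, s')" if "(s, s') \<in> P" for s s'
  proof -
    have "int M dvd s' - s" using that P mod_eq_dvd_iff by metis
    then show ?thesis by (simp add: K_def)
  qed
  have \<phi>P: "\<phi> z \<in> P \<and> K (\<phi> z) = c - K z" if z: "z \<in> P" for z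
  proof -
    obtain s s' where ss: "z = (s, s')" by fastforce
    define k where "k = K z"
    have s': "s' = s + int M * k" using K z ss k_def by simp
    have \<phi>: "\<phi> z = (s + int m * (2 * k - c), s' - int n * (2 * k - c))" by (simp add: \<phi>_def ss k_def)
    have diff: "(s' - int n * (2 * k - c)) - (s + int m * (2 * k - c)) = int M * (c - k)"
      unfolding s' M by (simp add: algebra_simps)
    then have Kc: "K (\<phi> z) = c - k" unfolding \<phi> K_def using M0 by simp
    have "(s + int m * (2 * k - c)) mod int M = (s' - int n * (2 * k - c)) mod int M"
      using diff mod_eq_dvd_iff[of "s' - int n * (2 * k - c)" "int M" "s + int m * (2 * k - c)"] by simp
    moreover have "(s + int m * (2 * k - c)) mod int m = int j" using z ss P by simp
    moreover have "(s' - int n * (2 * k - c)) mod int n = int l"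
      using z ss P mod_diff_right_eq[of s' "int n * (2 * k - c)" "int n"] by simp
    ultimately show ?thesis unfolding \<phi> P using Kc \<phi> k_def by simp
  qed
  have inv: "\<phi> (\<phi> z) = z" if "z \<in> P" for z
  proof -
    have "K (\<phi> z) = c - K z" using \<phi>P[OF that] by blast
    then show ?thesis by (simp add: \<phi>_def[of] prod_eq_iff) (simp add: \<phi>_def algebra_simps)
  qed
  have bij: "bij_betw \<phi> P P"
    by (rule bij_betwI[where g = \<phi>]) (use \<phi>P inv in auto)
  have neg: "(case \<phi> z of (s, s') \<Rightarrow> F s * G s') = - (case z of (s, s') \<Rightarrow> F s * G s')" if z: "z \<in> P" for z
  proof -
    obtain s s' where ss: "z = (s, s')" by fastforce
    define k where "k = K z"
    have s': "s' = s + int M * k" using K z ss k_def by simp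
    define e where "e = 2 * k - c"
    have \<phi>: "\<phi> z = (s + int m * e, s' - int n * e)" by (simp add: \<phi>_def ss k_def e_def)
    define Q where "Q u u' = - (\<i> * of_real (1 / real (m * M)) / (4 * pi * \<tau>)) * (of_real (x + 2 * pi * of_int u))\<^sup>2 +
        - (\<i> * (\<nu> / of_nat m - \<eta> / of_nat M) / (2 * pi * \<tau>)) * of_real (x + 2 * pi * of_int u) +
        \<i> * of_real (- (1 / real (m * M)) * of_int u * y) +
        (- (\<i> * of_real (1 / real (n * M)) / (4 * pi * \<tau>)) * (of_real (x + 2 * pi * of_int u'))\<^sup>2 +
        - (\<i> * (\<eta> / of_nat M - \<mu> / of_nat n) / (2 * pi * \<tau>)) * of_real (x + 2 * pi * of_int u') +
        \<i> * of_real (- (1 / real (n * M)) * of_int u' * y))" for u u' :: int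
    have FG: "F u * G u' = exp (Q u u')" for u u'
      unfolding F_def G_def g1_def g2_def gauss_def cis_conv_exp exp_add[symmetric] Q_def ..
    have "Q (s + int m * e) (s' - int n * e) - Q s s' = - (\<i> * pi * of_int (d * (c - 2 * k)))"
    proof -
      have nz: "of_nat m \<noteq> (0::complex)" "of_nat n \<noteq> (0::complex)" "of_nat M \<noteq> (0::complex)" "of_real pi \<noteq> (0::complex)"
        using n M0 by auto
      have h: "of_nat M = of_nat m + (of_nat n :: complex)" "of_int e = 2 * of_int k - (of_int c :: complex)"
        "of_int s' = of_int s + of_nat M * (of_int k :: complex)" unfolding M e_def s' by simp_all
      show ?thesis
        using gauss_composite_exponent[OF nz \<tau>0 h(1) \<eta> h(2,3), of "of_real x" "of_real y"]
        unfolding Q_def by simp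
    qed
    then have "Q (s + int m * e) (s' - int n * e) = Q s s' + - (\<i> * pi * of_int (d * (c - 2 * k)))"
      by (simp add: algebra_simps)
    then have "exp (Q (s + int m * e) (s' - int n * e)) = exp (Q s s') * exp (- (\<i> * pi * of_int (d * (c - 2 * k))))"
      by (simp only: exp_add)
    also have "exp (- (\<i> * pi * of_int (d * (c - 2 * k)))) = cis (pi * of_int (- (d * (c - 2 * k))))"
      unfolding cis_conv_exp by (simp add: mult.assoc)
    also have "\<dots> = -1"
    proof -
      have "odd (- (d * (c - 2 * k)))" using odd by simp
      then obtain z where z: "- (d * (c - 2 * k)) = 2 * z + 1" by (rule oddE)
      have "cis (pi * of_int (2 * z + 1)) = cis (2 * pi * of_int z) * cis pi" unfolding cis_mult by (simp add: algebra_simps)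
      also have "\<dots> = -1" by (simp add: cis_multiple_2pi)
      finally show ?thesis unfolding z .
    qed
    finally have "exp (Q (s + int m * e) (s' - int n * e)) = - exp (Q s s')" by simp
    then show ?thesis unfolding \<phi> unfolding ss prod.case FG .
  qed
  have "infsum (\<lambda>(s, s'). F s * G s') P = infsum (\<lambda>z. case \<phi> z of (s, s') \<Rightarrow> F s * G s') P"
    by (rule infsum_reindex_bij_betw[OF bij, symmetric])
  also have "\<dots> = infsum (\<lambda>z. - (case z of (s, s') \<Rightarrow> F s * G s')) P"
    by (rule infsum_cong) (rule neg)
  also have "\<dots> = - infsum (\<lambda>(s, s'). F s * G s') P" by (rule infsum_uminus)
  finally have "infsum (\<lambda>(s, s'). F s * G s') P = 0" by simp
  then show "(zmat m M (- (1 / real (m * M))) g2 p * zmat M n (- (1 / real (n * M))) g1 p) $$ (j, l) = 0\<^sub>m m n $$ (j, l)"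
    unfolding sum using jl by simp
qed (simp_all add: zmat_def)

section \<open>The Dolbeault operator on bundle maps\<close>

definition Dmat :: "complex \<Rightarrow> real \<Rightarrow> complex \<Rightarrow> (real \<times> real \<Rightarrow> complex mat) \<Rightarrow> real \<times> real \<Rightarrow> complex mat" where
  "Dmat \<tau> \<delta> \<kappa> \<Phi> p = Matrix.mat (dim_row (\<Phi> p)) (dim_col (\<Phi> p)) (\<lambda>(i, j). Dop \<tau> \<delta> \<kappa> (\<lambda>q. \<Phi> q $$ (i, j)) p)"

lemma Dmat_carrier: "\<Phi> p \<in> carrier_mat n m \<Longrightarrow> Dmat \<tau> \<delta> \<kappa> \<Phi> p \<in> carrier_mat n m"
  by (auto simp: Dmat_def)

lemma Dmat_index: "\<Phi> p \<in> carrier_mat n m \<Longrightarrow> i < n \<Longrightarrow> j < m \<Longrightarrow>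
    Dmat \<tau> \<delta> \<kappa> \<Phi> p $$ (i, j) = Dop \<tau> \<delta> \<kappa> (\<lambda>q. \<Phi> q $$ (i, j)) p"
  by (auto simp: Dmat_def)

lemma smooth_Dmat:
  assumes "smooth_mat n m \<Phi>"
  shows "smooth_mat n m (Dmat \<tau> \<delta> \<kappa> \<Phi>)"
proof (rule smooth_matI)
  show "Dmat \<tau> \<delta> \<kappa> \<Phi> p \<in> carrier_mat n m" for p by (rule Dmat_carrier[OF smooth_matD(1)[OF assms]])
  fix i j assume ij: "i < n" "j < m"
  show "smooth (\<lambda>p. Dmat \<tau> \<delta> \<kappa> \<Phi> p $$ (i, j))"
    unfolding Dmat_index[OF smooth_matD(1)[OF assms] ij] by (rule smooth_Dop[OF smooth_matD(2)[OF assms ij]])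
qed

lemma Dmat_mult:
  assumes A: "smooth_mat n k A" and B: "smooth_mat k m B"
  shows "Dmat \<tau> (\<delta> + \<delta>') (\<kappa> + \<kappa>') (\<lambda>q. A q * B q) p = Dmat \<tau> \<delta> \<kappa> A p * B p + A p * Dmat \<tau> \<delta>' \<kappa>' B p"
proof -
  note Ac = smooth_matD(1)[OF A] and Bc = smooth_matD(1)[OF B]
  have ABc: "A q * B q \<in> carrier_mat n m" for q by (rule mult_carrier_mat[OF Ac Bc])
  have c1: "Dmat \<tau> \<delta> \<kappa> A p * B p \<in> carrier_mat n m" by (rule mult_carrier_mat[OF Dmat_carrier[OF Ac] Bc])
  have c2: "A p * Dmat \<tau> \<delta>' \<kappa>' B p \<in> carrier_mat n m" by (rule mult_carrier_mat[OF Ac Dmat_carrier[OF Bc]])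
  show ?thesis
  proof (rule carrier_mat_eq_iff[OF Dmat_carrier[where \<Phi> = "\<lambda>q. A q * B q", OF ABc] add_carrier_mat[OF c2], THEN iffD2], intro allI impI)
    fix i j assume ij: "i < n" "j < m"
    have "Dmat \<tau> (\<delta> + \<delta>') (\<kappa> + \<kappa>') (\<lambda>q. A q * B q) p $$ (i, j) =
        Dop \<tau> (\<delta> + \<delta>') (\<kappa> + \<kappa>') (\<lambda>q. \<Sum>l\<in>{..<k}. A q $$ (i, l) * B q $$ (l, j)) p"
      by (simp only: Dmat_index[where \<Phi> = "\<lambda>q. A q * B q", OF ABc ij] mult_mat_index[OF Ac Bc ij])
    also have "\<dots> = (\<Sum>l<k. Dop \<tau> \<delta> \<kappa> (\<lambda>q. A q $$ (i, l)) p * B p $$ (l, j)) +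
        (\<Sum>l<k. A p $$ (i, l) * Dop \<tau> \<delta>' \<kappa>' (\<lambda>q. B q $$ (l, j)) p)"
      by (rule Dop_sum_mult) (use smooth_imp_differentiable[OF smooth_matD(2)[OF A]] smooth_imp_differentiable[OF smooth_matD(2)[OF B]] ij in auto)
    also have "\<dots> = (Dmat \<tau> \<delta> \<kappa> A p * B p) $$ (i, j) + (A p * Dmat \<tau> \<delta>' \<kappa>' B p) $$ (i, j)"
      unfolding mult_mat_index[OF Dmat_carrier[OF Ac] Bc ij] mult_mat_index[OF Ac Dmat_carrier[OF Bc] ij]
      by (simp add: Dmat_index[OF Ac] Dmat_index[OF Bc] ij)
    also have "\<dots> = (Dmat \<tau> \<delta> \<kappa> A p * B p + A p * Dmat \<tau> \<delta>' \<kappa>' B p) $$ (i, j)"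
      by (rule index_add_mat(1)[symmetric]) (use c2 ij in auto)
    finally show "Dmat \<tau> (\<delta> + \<delta>') (\<kappa> + \<kappa>') (\<lambda>q. A q * B q) p $$ (i, j) =
      (Dmat \<tau> \<delta> \<kappa> A p * B p + A p * Dmat \<tau> \<delta>' \<kappa>' B p) $$ (i, j)" .
  qed
qed

lemma Dmat_add:
  assumes A: "smooth_mat n m A" and B: "smooth_mat n m B"
  shows "Dmat \<tau> \<delta> \<kappa> (\<lambda>q. A q + B q) p = Dmat \<tau> \<delta> \<kappa> A p + Dmat \<tau> \<delta> \<kappa> B p"
proof -
  note Ac = smooth_matD(1)[OF A] and Bc = smooth_matD(1)[OF B]
  have c: "A q + B q \<in> carrier_mat n m" for q by (rule add_carrier_mat[OF Bc])
  show ?thesis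
  proof (rule carrier_mat_eq_iff[OF Dmat_carrier[where \<Phi> = "\<lambda>q. A q + B q", OF c] add_carrier_mat[OF Dmat_carrier[OF Bc]], THEN iffD2], intro allI impI)
    fix i j assume ij: "i < n" "j < m"
    have "(A q + B q) $$ (i, j) = A q $$ (i, j) + B q $$ (i, j)" for q
      by (rule index_add_mat(1)) (use Bc[of q] ij in auto)
    then have "Dmat \<tau> \<delta> \<kappa> (\<lambda>q. A q + B q) p $$ (i, j) = Dmat \<tau> \<delta> \<kappa> A p $$ (i, j) + Dmat \<tau> \<delta> \<kappa> B p $$ (i, j)"
      by (simp only: Dmat_index[where \<Phi> = "\<lambda>q. A q + B q", OF c ij] Dmat_index[OF Ac ij] Dmat_index[OF Bc ij]
        Dop_add smooth_imp_differentiable[OF smooth_matD(2)[OF A ij]] smooth_imp_differentiable[OF smooth_matD(2)[OF B ij]])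
    also have "\<dots> = (Dmat \<tau> \<delta> \<kappa> A p + Dmat \<tau> \<delta> \<kappa> B p) $$ (i, j)"
      by (rule index_add_mat(1)[symmetric]) (use Dmat_carrier[of B p n m \<tau> \<delta> \<kappa>, OF Bc] ij in auto)
    finally show "Dmat \<tau> \<delta> \<kappa> (\<lambda>q. A q + B q) p $$ (i, j) = (Dmat \<tau> \<delta> \<kappa> A p + Dmat \<tau> \<delta> \<kappa> B p) $$ (i, j)" .
  qed
qed

lemma smooth_mat_add:
  assumes A: "smooth_mat n m A" and B: "smooth_mat n m B"
  shows "smooth_mat n m (\<lambda>q. A q + B q)"
proof (rule smooth_matI)
  note Ac = smooth_matD(1)[OF A] and Bc = smooth_matD(1)[OF B]
  show "A q + B q \<in> carrier_mat n m" for q by (rule add_carrier_mat[OF Bc])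
  fix i j assume ij: "i < n" "j < m"
  have "(A q + B q) $$ (i, j) = A q $$ (i, j) + B q $$ (i, j)" for q
    by (rule index_add_mat(1)) (use Bc[of q] ij in auto)
  then show "smooth (\<lambda>q. (A q + B q) $$ (i, j))"
    using smooth_add[OF smooth_matD(2)[OF A ij] smooth_matD(2)[OF B ij]] by simp
qed

lemma smult_mat_index: "A \<in> carrier_mat n m \<Longrightarrow> i < n \<Longrightarrow> j < m \<Longrightarrow> (c \<cdot>\<^sub>m A) $$ (i, j) = c * A $$ (i, j)"
  by auto

lemma smooth_mat_smult:
  assumes A: "smooth_mat n m A"
  shows "smooth_mat n m (\<lambda>q. c \<cdot>\<^sub>m A q)"
proof (rule smooth_matI)
  note Ac = smooth_matD(1)[OF A]
  show "c \<cdot>\<^sub>m A q \<in> carrier_mat n m" for q using Ac by simp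
  fix i j assume ij: "i < n" "j < m"
  show "smooth (\<lambda>q. (c \<cdot>\<^sub>m A q) $$ (i, j))"
    unfolding smult_mat_index[OF Ac ij] by (rule smooth_mult[OF smooth_const smooth_matD(2)[OF A ij]])
qed

lemma Dmat_smult:
  assumes A: "smooth_mat n m A"
  shows "Dmat \<tau> \<delta> \<kappa> (\<lambda>q. c \<cdot>\<^sub>m A q) p = c \<cdot>\<^sub>m Dmat \<tau> \<delta> \<kappa> A p"
proof -
  note Ac = smooth_matD(1)[OF A]
  have cc: "c \<cdot>\<^sub>m A q \<in> carrier_mat n m" for q using Ac by simp
  show ?thesis
  proof (rule carrier_mat_eq_iff[OF Dmat_carrier[where \<Phi> = "\<lambda>q. c \<cdot>\<^sub>m A q", OF cc] smult_carrier_mat[OF Dmat_carrier[OF Ac]], THEN iffD2], intro allI impI)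
    fix i j assume ij: "i < n" "j < m"
    show "Dmat \<tau> \<delta> \<kappa> (\<lambda>q. c \<cdot>\<^sub>m A q) p $$ (i, j) = (c \<cdot>\<^sub>m Dmat \<tau> \<delta> \<kappa> A p) $$ (i, j)"
      unfolding Dmat_index[where \<Phi> = "\<lambda>q. c \<cdot>\<^sub>m A q", OF cc ij] smult_mat_index[OF Ac ij]
        smult_mat_index[OF Dmat_carrier[OF Ac] ij] Dmat_index[OF Ac ij]
      by (rule Dop_cmult[OF smooth_imp_differentiable[OF smooth_matD(2)[OF A ij]]])
  qed
qed

lemma Dmat_const:
  assumes "C \<in> carrier_mat n m" and "C = 0\<^sub>m n m \<or> \<delta> = 0 \<and> \<kappa> = 0"
  shows "Dmat \<tau> \<delta> \<kappa> (\<lambda>q. C) p = 0\<^sub>m n m"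
  by (rule eq_matI) (use assms in \<open>auto simp: Dmat_def Dop_def delbar_def\<close>)

text \<open>Under x to x + 2 pi the connection term \<delta> x grows by 2 pi \<delta>, which exactly
  compensates the y-derivative of \<open>cis (\<delta> * y)\<close>.\<close>

lemma Dop_shift_x:
  assumes f: "smooth f" and g: "smooth g" and \<tau>: "Im \<tau> > 0"
    and h: "\<And>x y. f (x + 2 * pi, y) = cis (\<delta> * y) * g (x, y)"
  shows "Dop \<tau> \<delta> \<kappa> f (x + 2 * pi, y) = cis (\<delta> * y) * Dop \<tau> \<delta> \<kappa> g (x, y)"
proof -
  let ?u = "\<lambda>q::real \<times> real. exp (0 * of_real (fst q) + (\<i> * \<delta>) * of_real (snd q))"
  have eq: "(\<lambda>q. f (q + (2 * pi, 0))) = (\<lambda>q. ?u q * g q)"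
    using h by (simp add: fun_eq_iff cis_conv_exp mult.assoc)
  have e: "\<tau> - cnj \<tau> \<noteq> 0" using \<tau> by (auto simp: complex_eq_iff)
  have px: "partial_x f (x + 2 * pi, y) = cis (\<delta> * y) * partial_x g (x, y)"
    using partial_translate(2)[of f "(2 * pi, 0)" "(x, y)", OF smooth_imp_differentiable[OF f]]
    unfolding eq partial_mult(1)[OF partial_character(1) smooth_imp_differentiable[OF g]] partial_character
    by (simp add: cis_conv_exp mult.assoc)
  have py: "partial_y f (x + 2 * pi, y) = cis (\<delta> * y) * partial_y g (x, y) + \<i> * \<delta> * cis (\<delta> * y) * g (x, y)"
    using partial_translate(3)[of f "(2 * pi, 0)" "(x, y)", OF smooth_imp_differentiable[OF f]]
    unfolding eq partial_mult(2)[OF partial_character(1) smooth_imp_differentiable[OF g]] partial_character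
    by (simp add: cis_conv_exp mult.assoc)
  have alg: "2 * ((t * (c * gx) - (c * gy + \<i> * d * c * g)) / e) - \<i> / (P * (- e)) * (d * (x + 2 * P) + k) * (c * g) =
      c * (2 * ((t * gx - gy) / e) - \<i> / (P * (- e)) * (d * x + k) * g)"
    if "e \<noteq> 0" "P \<noteq> 0" for t c gx gy d g e P x k :: complex using that by (simp add: field_simps)
  have ce: "cnj \<tau> - \<tau> = - (\<tau> - cnj \<tau>)" by simp
  show ?thesis
    unfolding Dop_def delbar_def px py h ce
    using alg[OF e, of pi \<tau> "cis (\<delta> * y)" "partial_x g (x, y)" "partial_y g (x, y)" \<delta> "g (x, y)" x \<kappa>] by simp
qed

lemma Dop_shift_y:
  assumes f: "smooth f" and h: "\<And>x y. f (x, y + 2 * pi) = z * f (x, y)"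
  shows "Dop \<tau> \<delta> \<kappa> f (x, y + 2 * pi) = z * Dop \<tau> \<delta> \<kappa> f (x, y)"
proof -
  have eq: "(\<lambda>q. f (q + (0, 2 * pi))) = (\<lambda>q. z * f q)"
    using h by (simp add: fun_eq_iff)
  have px: "partial_x f (x, y + 2 * pi) = z * partial_x f (x, y)"
    using partial_translate(2)[of f "(0, 2 * pi)" "(x, y)", OF smooth_imp_differentiable[OF f]]
    unfolding eq partial_mult(1)[OF smooth_imp_differentiable[OF smooth_const] smooth_imp_differentiable[OF f]] by simp
  have py: "partial_y f (x, y + 2 * pi) = z * partial_y f (x, y)"
    using partial_translate(3)[of f "(0, 2 * pi)" "(x, y)", OF smooth_imp_differentiable[OF f]]
    unfolding eq partial_mult(2)[OF smooth_imp_differentiable[OF smooth_const] smooth_imp_differentiable[OF f]] by simp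
  have alg: "2 * ((t * (z * a) - z * b) / e) - C * (z * g) = z * (2 * ((t * a - b) / e) - C * g)" for t a b e C g :: complex
    by (simp add: divide_inverse algebra_simps)
  show ?thesis unfolding Dop_def delbar_def px py h fst_conv by (rule alg)
qed

lemma bundle_map_Dmat:
  assumes \<tau>: "Im \<tau> > 0" and \<Phi>: "bundle_map (E_bundle \<tau> n' a' \<mu>') (E_bundle \<tau> n a \<mu>) \<Phi>"
    and d: "\<delta> = of_int a / real n - of_int a' / real n'"
  shows "bundle_map (E_bundle \<tau> n' a' \<mu>') (E_bundle \<tau> n a \<mu>) (Dmat \<tau> \<delta> \<kappa> \<Phi>)"
proof -
  have sm: "smooth_mat n n' \<Phi>"
    and xs: "\<And>x y i j. i < n \<Longrightarrow> j < n' \<Longrightarrow> \<Phi> (x + 2 * pi, y) $$ (i, j) =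
       cis (\<delta> * y) * \<Phi> (x, y) $$ ((i + 1) mod n, (j + 1) mod n')"
    and ys: "\<And>x y i j. i < n \<Longrightarrow> j < n' \<Longrightarrow> \<Phi> (x, y + 2 * pi) $$ (i, j) =
       cis (2 * pi * (of_int a' * real j / real n' - of_int a * real i / real n)) * \<Phi> (x, y) $$ (i, j)"
    using \<Phi> unfolding bundle_map_E_iff d by blast+
  note c = smooth_matD(1)[OF sm] and s = smooth_matD(2)[OF sm]
  show ?thesis
    unfolding bundle_map_E_iff d[symmetric]
  proof (intro conjI allI impI)
    show "smooth_mat n n' (Dmat \<tau> \<delta> \<kappa> \<Phi>)" by (rule smooth_Dmat[OF sm])
    fix x y i j assume ij: "i < n" "j < n'"
    then have ij': "(i + 1) mod n < n" "(j + 1) mod n' < n'" by (auto intro: mod_less_divisor)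
    show "Dmat \<tau> \<delta> \<kappa> \<Phi> (x + 2 * pi, y) $$ (i, j) = cis (\<delta> * y) * Dmat \<tau> \<delta> \<kappa> \<Phi> (x, y) $$ ((i + 1) mod n, (j + 1) mod n')"
      unfolding Dmat_index[OF c ij] Dmat_index[OF c ij'] by (rule Dop_shift_x[OF s[OF ij] s[OF ij'] \<tau> xs[OF ij]])
    show "Dmat \<tau> \<delta> \<kappa> \<Phi> (x, y + 2 * pi) $$ (i, j) =
       cis (2 * pi * (of_int a' * real j / real n' - of_int a * real i / real n)) * Dmat \<tau> \<delta> \<kappa> \<Phi> (x, y) $$ (i, j)"
      unfolding Dmat_index[OF c ij] by (rule Dop_shift_y[OF s[OF ij] ys[OF ij]])
  qed
qed

text \<open>The factors of automorphy are unitary, so adjoints of bundle maps are bundle maps in the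
  opposite direction.\<close>

lemma bundle_map_cadj:
  assumes \<Phi>: "bundle_map (E_bundle \<tau> n' a' \<mu>') (E_bundle \<tau> n a \<mu>) \<Phi>"
  shows "bundle_map (E_bundle \<tau> n a \<mu>) (E_bundle \<tau> n' a' \<mu>') (\<lambda>p. cadj (\<Phi> p))"
proof -
  have sm: "smooth_mat n n' \<Phi>"
    and xs: "\<And>x y i j. i < n \<Longrightarrow> j < n' \<Longrightarrow> \<Phi> (x + 2 * pi, y) $$ (i, j) =
       cis ((of_int a / real n - of_int a' / real n') * y) * \<Phi> (x, y) $$ ((i + 1) mod n, (j + 1) mod n')"
    and ys: "\<And>x y i j. i < n \<Longrightarrow> j < n' \<Longrightarrow> \<Phi> (x, y + 2 * pi) $$ (i, j) =
       cis (2 * pi * (of_int a' * real j / real n' - of_int a * real i / real n)) * \<Phi> (x, y) $$ (i, j)"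
    using \<Phi> unfolding bundle_map_E_iff by blast+
  note ci = cadj_index[OF smooth_matD(1)[OF sm]]
  show ?thesis
    unfolding bundle_map_E_iff
  proof (intro conjI allI impI)
    show "smooth_mat n' n (\<lambda>p. cadj (\<Phi> p))" by (rule smooth_cadj[OF sm])
    fix x y j i assume ij: "j < n'" "i < n"
    then have ij': "(i + 1) mod n < n" "(j + 1) mod n' < n'" by (auto intro: mod_less_divisor)
    show "cadj (\<Phi> (x + 2 * pi, y)) $$ (j, i) = cis ((of_int a' / real n' - of_int a / real n) * y) *
        cadj (\<Phi> (x, y)) $$ ((j + 1) mod n', (i + 1) mod n)"
      unfolding ci[OF ij] ci[OF ij'(2,1)] xs[OF ij(2,1)] by (simp add: cis_cnj algebra_simps)
    show "cadj (\<Phi> (x, y + 2 * pi)) $$ (j, i) = cis (2 * pi * (of_int a * real i / real n - of_int a' * real j / real n')) *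
        cadj (\<Phi> (x, y)) $$ (j, i)"
      unfolding ci[OF ij] ys[OF ij(2,1)] by (simp add: cis_cnj algebra_simps)
  qed
qed

lemma bundle_map_add:
  assumes A: "bundle_map (E_bundle \<tau> n' a' \<mu>') (E_bundle \<tau> n a \<mu>) A"
    and B: "bundle_map (E_bundle \<tau> n' a' \<mu>') (E_bundle \<tau> n a \<mu>) B"
  shows "bundle_map (E_bundle \<tau> n' a' \<mu>') (E_bundle \<tau> n a \<mu>) (\<lambda>p. A p + B p)"
proof -
  have sA: "smooth_mat n n' A" and sB: "smooth_mat n n' B" using A B unfolding bundle_map_E_iff by blast+
  have ix: "(A q + B q) $$ (i, j) = A q $$ (i, j) + B q $$ (i, j)" if "i < n" "j < n'" for q i j
    by (rule index_add_mat(1)) (use smooth_matD(1)[OF sB, of q] that in auto)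
  have md: "(i + 1) mod n < n" if "i < n" for i n :: nat using that by (auto intro: mod_less_divisor)
  show ?thesis
    using A B smooth_mat_add[OF sA sB] unfolding bundle_map_E_iff by (simp add: ix md distrib_left)
qed

lemma bundle_map_smult:
  assumes A: "bundle_map (E_bundle \<tau> n' a' \<mu>') (E_bundle \<tau> n a \<mu>) A"
  shows "bundle_map (E_bundle \<tau> n' a' \<mu>') (E_bundle \<tau> n a \<mu>) (\<lambda>p. c \<cdot>\<^sub>m A p)"
proof -
  have sA: "smooth_mat n n' A" using A unfolding bundle_map_E_iff by blast+
  have md: "(i + 1) mod n < n" if "i < n" for i n :: nat using that by (auto intro: mod_less_divisor)
  show ?thesis
    using A smooth_mat_smult[OF sA, of c] unfolding bundle_map_E_iff
    by (simp add: smult_mat_index[OF smooth_matD(1)[OF sA]] md)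
qed

lemma smooth_vecD:
  assumes "smooth_vec n s"
  shows "s p \<in> carrier_vec n" "i < n \<Longrightarrow> smooth (\<lambda>p. vec_index (s p) i)"
  using assms unfolding smooth_vec_def by blast+

lemma smooth_mat_mult_vec:
  assumes A: "smooth_mat n m A" and s: "smooth_vec m s"
  shows "smooth_vec n (\<lambda>p. A p *\<^sub>v s p)"
  unfolding smooth_vec_def
proof (intro conjI allI impI)
  show "A p *\<^sub>v s p \<in> carrier_vec n" for p
    by (rule mult_mat_vec_carrier[OF smooth_matD(1)[OF A] smooth_vecD(1)[OF s]])
  fix i assume i: "i < n"
  show "smooth (\<lambda>p. vec_index (A p *\<^sub>v s p) i)"
    unfolding mult_mat_vec_index[OF smooth_matD(1)[OF A] smooth_vecD(1)[OF s] i]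
    using i by (intro smooth_intros smooth_matD(2)[OF A] smooth_vecD(2)[OF s]) auto
qed

lemma hol_op_carrier: "s p \<in> carrier_vec n \<Longrightarrow> hol_op (E_bundle \<tau> n a \<mu>) s p \<in> carrier_vec n"
  by (cases p) (auto simp: E_bundle_def delbar_vec_def)

lemma hol_op_index:
  assumes "s p \<in> carrier_vec n" "i < n"
  shows "vec_index (hol_op (E_bundle \<tau> n a \<mu>) s p) i = Dop \<tau> (of_int a / real n) (\<mu> / of_nat n) (\<lambda>q. vec_index (s q) i) p"
  using assms by (cases p) (auto simp: E_bundle_def delbar_vec_def Dop_def)

text \<open>The Leibniz rule for a map applied to a section: slope and parameter of the target split
  into the differences, which act on \<Phi>, and those of the source, which act on s.\<close>

lemma hol_op_mult:
  assumes \<Phi>: "smooth_mat n n' \<Phi>" and s: "smooth_vec n' s"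
  shows "hol_op (E_bundle \<tau> n a \<mu>) (\<lambda>q. \<Phi> q *\<^sub>v s q) p =
    Dmat \<tau> (of_int a / real n - of_int a' / real n') (\<mu> / of_nat n - \<mu>' / of_nat n') \<Phi> p *\<^sub>v s p +
    \<Phi> p *\<^sub>v hol_op (E_bundle \<tau> n' a' \<mu>') s p" (is "?L = ?R1 + ?R2")
proof -
  note c = smooth_matD(1)[OF \<Phi>] and sc = smooth_vecD(1)[OF s]
  note h = hol_op_carrier[of s p n' \<tau> a' \<mu>', OF sc]
  have c1: "?R1 \<in> carrier_vec n" by (rule mult_mat_vec_carrier[OF Dmat_carrier[OF c] sc])
  have c2: "?R2 \<in> carrier_vec n" by (rule mult_mat_vec_carrier[OF c h])
  have cm: "\<Phi> q *\<^sub>v s q \<in> carrier_vec n" for q by (rule mult_mat_vec_carrier[OF c sc])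
  have cL: "?L \<in> carrier_vec n" by (rule hol_op_carrier[where s = "\<lambda>q. \<Phi> q *\<^sub>v s q", OF cm])
  show ?thesis
  proof (rule eq_vecI)
    show "dim_vec ?L = dim_vec (?R1 + ?R2)" by (simp only: carrier_vecD[OF cL] index_add_vec(2) carrier_vecD[OF c2])
    fix i assume "i < dim_vec (?R1 + ?R2)"
    then have i: "i < n" by (simp only: index_add_vec(2) carrier_vecD[OF c2])
    have "vec_index ?L i = Dop \<tau> (of_int a / real n) (\<mu> / of_nat n) (\<lambda>q. \<Sum>l<n'. \<Phi> q $$ (i, l) * vec_index (s q) l) p"
      unfolding hol_op_index[where s = "\<lambda>q. \<Phi> q *\<^sub>v s q", OF cm i] mult_mat_vec_index[OF c sc i] ..
    also have "\<dots> = Dop \<tau> ((of_int a / real n - of_int a' / real n') + of_int a' / real n')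
        ((\<mu> / of_nat n - \<mu>' / of_nat n') + \<mu>' / of_nat n') (\<lambda>q. \<Sum>l<n'. \<Phi> q $$ (i, l) * vec_index (s q) l) p"
      by simp
    also have "\<dots> = (\<Sum>l<n'. Dop \<tau> (of_int a / real n - of_int a' / real n') (\<mu> / of_nat n - \<mu>' / of_nat n') (\<lambda>q. \<Phi> q $$ (i, l)) p * vec_index (s p) l) +
        (\<Sum>l<n'. \<Phi> p $$ (i, l) * Dop \<tau> (of_int a' / real n') (\<mu>' / of_nat n') (\<lambda>q. vec_index (s q) l) p)"
      by (rule Dop_sum_mult) (use smooth_imp_differentiable[OF smooth_matD(2)[OF \<Phi> i]] smooth_imp_differentiable[OF smooth_vecD(2)[OF s]] in auto)
    also have "\<dots> = vec_index ?R1 i + vec_index ?R2 i"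
      unfolding mult_mat_vec_index[OF Dmat_carrier[OF c] sc i] mult_mat_vec_index[OF c h i]
      by (simp add: Dmat_index[OF c] i hol_op_index[OF sc])
    also have "\<dots> = vec_index (?R1 + ?R2) i" by (rule index_add_vec(1)[symmetric]) (simp only: carrier_vecD[OF c2] i)
    finally show "vec_index ?L i = vec_index (?R1 + ?R2) i" .
  qed
qed

lemma hol_op_add:
  assumes s: "smooth_vec n s" and t: "smooth_vec n t"
  shows "hol_op (E_bundle \<tau> n a \<mu>) (\<lambda>q. s q + t q) p = hol_op (E_bundle \<tau> n a \<mu>) s p + hol_op (E_bundle \<tau> n a \<mu>) t p"
proof -
  note sc = smooth_vecD(1)[OF s] and tc = smooth_vecD(1)[OF t]
  have c: "s q + t q \<in> carrier_vec n" for q using sc tc by simp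
  note h = hol_op_carrier[of _ p n \<tau> a \<mu>]
  show ?thesis
  proof (rule eq_vecI)
    show "dim_vec (hol_op (E_bundle \<tau> n a \<mu>) (\<lambda>q. s q + t q) p) = dim_vec (hol_op (E_bundle \<tau> n a \<mu>) s p + hol_op (E_bundle \<tau> n a \<mu>) t p)"
      using h[of "\<lambda>q. s q + t q"] h[of t] c tc by auto
    fix i assume "i < dim_vec (hol_op (E_bundle \<tau> n a \<mu>) s p + hol_op (E_bundle \<tau> n a \<mu>) t p)"
    then have i: "i < n" using h[of t] tc by auto
    have "vec_index (s q + t q) i = vec_index (s q) i + vec_index (t q) i" for q using carrier_vecD[OF tc[of q]] i by (intro index_add_vec(1)) simp
    then show "vec_index (hol_op (E_bundle \<tau> n a \<mu>) (\<lambda>q. s q + t q) p) i =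
        vec_index (hol_op (E_bundle \<tau> n a \<mu>) s p + hol_op (E_bundle \<tau> n a \<mu>) t p) i"
      using h[of t] tc i
      by (simp add: hol_op_index[where s = "\<lambda>q. s q + t q", OF c i] hol_op_index[OF sc i] hol_op_index[OF tc i]
        Dop_add smooth_imp_differentiable[OF smooth_vecD(2)[OF s i]] smooth_imp_differentiable[OF smooth_vecD(2)[OF t i]])
  qed
qed

lemma ext1_trivialI:
  assumes f: "bundle_map (E_bundle \<tau> m b \<nu>) (E_bundle \<tau> n a \<mu>) f"
    and D: "\<And>p. Dmat \<tau> (of_int a / real n - of_int b / real m) (\<mu> / of_nat n - \<nu> / of_nat m) f p = \<psi> p"
  shows "ext1_trivial (E_bundle \<tau> m b \<nu>) (E_bundle \<tau> n a \<mu>) \<psi>"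
  unfolding ext1_trivial_def
proof (intro exI[of _ f] conjI ballI allI)
  have sm: "smooth_mat n m f" using f unfolding bundle_map_E_iff by blast
  fix s p assume "s \<in> sections (E_bundle \<tau> m b \<nu>)"
  then have s: "smooth_vec m s" by (simp add: sections_def)
  have c1: "\<psi> p *\<^sub>v s p \<in> carrier_vec n"
    unfolding D[symmetric] by (rule mult_mat_vec_carrier[OF Dmat_carrier[OF smooth_matD(1)[OF sm]] smooth_vecD(1)[OF s]])
  have c2: "f p *\<^sub>v hol_op (E_bundle \<tau> m b \<nu>) s p \<in> carrier_vec n"
    by (rule mult_mat_vec_carrier[OF smooth_matD(1)[OF sm] hol_op_carrier[OF smooth_vecD(1)[OF s]]])
  show "\<psi> p *\<^sub>v s p = hol_op (E_bundle \<tau> n a \<mu>) (\<lambda>q. f q *\<^sub>v s q) p - f p *\<^sub>v hol_op (E_bundle \<tau> m b \<nu>) s p"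
  proof -
    have "v + w - w = v" if "v \<in> carrier_vec n" "w \<in> carrier_vec n" for v w :: "complex vec"
      using that by (intro eq_vecI) auto
    from this[OF c1 c2] show ?thesis unfolding hol_op_mult[OF sm s, of \<tau> a \<mu> p b \<nu>] D by simp
  qed
qed (rule f)

section \<open>Maps out of a mapping cone\<close>

text \<open>A map out of a mapping cone is written this way: A is its restriction to the subbundle,
  B its component on the other summand.\<close>

definition hcat :: "complex mat \<Rightarrow> complex mat \<Rightarrow> complex mat" where
  "hcat A B = Matrix.mat (dim_row A) (dim_col A + dim_col B)
     (\<lambda>(i, j). if j < dim_col A then A $$ (i, j) else B $$ (i, j - dim_col A))"

lemma hcat_carrier: "A \<in> carrier_mat M n \<Longrightarrow> B \<in> carrier_mat M m \<Longrightarrow> hcat A B \<in> carrier_mat M (n + m)"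
  by (auto simp: hcat_def)

lemma hcat_index:
  assumes "A \<in> carrier_mat M n" "B \<in> carrier_mat M m" "i < M"
  shows "j < n \<Longrightarrow> hcat A B $$ (i, j) = A $$ (i, j)" "j < m \<Longrightarrow> hcat A B $$ (i, n + j) = B $$ (i, j)"
  using assms by (auto simp: hcat_def)

lemma sum_lessThan_add: "(\<Sum>l<n + m. f l) = (\<Sum>l<n. f l) + (\<Sum>l<(m::nat). f (n + l) :: complex)"
  by (induction m) (simp_all add: add.assoc)

lemma less_add_cases:
  assumes "(j::nat) < n + m"
  obtains "j < n" | k where "j = n + k" "k < m"
proof (cases "j < n")
  case False
  then show ?thesis using that(2)[of "j - n"] assms by simp
qed (use that in blast)

lemma hcat_mult_vec:
  assumes A: "A \<in> carrier_mat M n" and B: "B \<in> carrier_mat M m" and v: "v \<in> carrier_vec (n + m)"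
  shows "hcat A B *\<^sub>v v = A *\<^sub>v vec_first v n + B *\<^sub>v vec_last v m"
proof (rule eq_vecI)
  note c2 = mult_mat_vec_carrier[OF B vec_last_carrier[of v m]]
  show "dim_vec (hcat A B *\<^sub>v v) = dim_vec (A *\<^sub>v vec_first v n + B *\<^sub>v vec_last v m)"
    using A B by (simp add: hcat_def)
  fix i assume "i < dim_vec (A *\<^sub>v vec_first v n + B *\<^sub>v vec_last v m)"
  then have i: "i < M" using B by simp
  have "vec_index (hcat A B *\<^sub>v v) i = (\<Sum>l<n. A $$ (i, l) * vec_index v l) + (\<Sum>l<m. B $$ (i, l) * vec_index v (n + l))"
    unfolding mult_mat_vec_index[OF hcat_carrier[OF A B] v i] sum_lessThan_add
    by (simp add: hcat_index[OF A B i])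
  also have "\<dots> = vec_index (A *\<^sub>v vec_first v n) i + vec_index (B *\<^sub>v vec_last v m) i"
    unfolding mult_mat_vec_index[OF A vec_first_carrier i] mult_mat_vec_index[OF B vec_last_carrier i]
    using v by (simp add: vec_first_def vec_last_def)
  also have "\<dots> = vec_index (A *\<^sub>v vec_first v n + B *\<^sub>v vec_last v m) i"
    by (rule index_add_vec(1)[symmetric]) (simp only: carrier_vecD[OF c2] i)
  finally show "vec_index (hcat A B *\<^sub>v v) i = vec_index (A *\<^sub>v vec_first v n + B *\<^sub>v vec_last v m) i" .
qed

lemma hcat_mult_block_diag:
  assumes A: "A \<in> carrier_mat M n" and B: "B \<in> carrier_mat M m" and P: "P \<in> carrier_mat n n" and Q: "Q \<in> carrier_mat m m"
  shows "hcat A B * four_block_mat P (0\<^sub>m n m) (0\<^sub>m m n) Q = hcat (A * P) (B * Q)"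
proof -
  let ?F = "four_block_mat P (0\<^sub>m n m) (0\<^sub>m m n) Q"
  have F: "?F \<in> carrier_mat (n + m) (n + m)" using P Q by simp
  note AP = mult_carrier_mat[OF A P] and BQ = mult_carrier_mat[OF B Q]
  have Fi: "l < n \<Longrightarrow> j < n \<Longrightarrow> ?F $$ (l, j) = P $$ (l, j)" "l < n \<Longrightarrow> k < m \<Longrightarrow> ?F $$ (l, n + k) = 0"
    "l' < m \<Longrightarrow> j < n \<Longrightarrow> ?F $$ (n + l', j) = 0" "l' < m \<Longrightarrow> k < m \<Longrightarrow> ?F $$ (n + l', n + k) = Q $$ (l', k)" for l j l' k
    using P Q by auto
  show ?thesis
  proof (rule carrier_mat_eq_iff[OF mult_carrier_mat[OF hcat_carrier[OF A B] F] hcat_carrier[OF AP BQ], THEN iffD2], intro allI impI)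
    fix i j assume i: "i < M" and j: "j < n + m"
    show "(hcat A B * ?F) $$ (i, j) = hcat (A * P) (B * Q) $$ (i, j)"
      unfolding mult_mat_index[OF hcat_carrier[OF A B] F i j] sum_lessThan_add
      by (rule less_add_cases[OF j])
        (simp_all add: hcat_index[OF A B i] hcat_index[OF AP BQ i] Fi mult_mat_index[OF A P i] mult_mat_index[OF B Q i] del: index_mult_mat)
  qed
qed

lemma mult_hcat:
  assumes G: "G \<in> carrier_mat K M" and A: "A \<in> carrier_mat M n" and B: "B \<in> carrier_mat M m"
  shows "G * hcat A B = hcat (G * A) (G * B)"
proof -
  note GA = mult_carrier_mat[OF G A] and GB = mult_carrier_mat[OF G B]
  show ?thesis
  proof (rule carrier_mat_eq_iff[OF mult_carrier_mat[OF G hcat_carrier[OF A B]] hcat_carrier[OF GA GB], THEN iffD2], intro allI impI)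
    fix i j assume i: "i < K" and j: "j < n + m"
    show "(G * hcat A B) $$ (i, j) = hcat (G * A) (G * B) $$ (i, j)"
      unfolding mult_mat_index[OF G hcat_carrier[OF A B] i j]
      by (rule less_add_cases[OF j])
        (simp_all add: hcat_index[OF A B] hcat_index[OF GA GB i] mult_mat_index[OF G A i] mult_mat_index[OF G B i] del: index_mult_mat)
  qed
qed

lemma smooth_hcat:
  assumes A: "smooth_mat M n A" and B: "smooth_mat M m B"
  shows "smooth_mat M (n + m) (\<lambda>p. hcat (A p) (B p))"
proof (rule smooth_matI)
  note Ac = smooth_matD(1)[OF A] and Bc = smooth_matD(1)[OF B]
  show "hcat (A p) (B p) \<in> carrier_mat M (n + m)" for p by (rule hcat_carrier[OF Ac Bc])
  fix i j assume i: "i < M" and j: "j < n + m"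
  show "smooth (\<lambda>p. hcat (A p) (B p) $$ (i, j))"
    by (rule less_add_cases[OF j])
      (simp_all add: hcat_index[OF Ac Bc i] smooth_matD(2)[OF A i] smooth_matD(2)[OF B i])
qed

lemma bundle_map_hcat:
  assumes R: "same_rank E" "same_rank F" "same_rank H"
    and A: "bundle_map F H A" and B: "bundle_map E H B"
  shows "bundle_map (mapping_cone E F \<psi>) H (\<lambda>p. hcat (A p) (B p))"
proof -
  have sA: "smooth_mat (rank H) (rank F) A" and sB: "smooth_mat (rank H) (rank E) B"
    using A B unfolding bundle_map_def by blast+
  note Ac = smooth_matD(1)[OF sA] and Bc = smooth_matD(1)[OF sB]
  have fx: "fac_x X p \<in> carrier_mat (rank X) (rank X)" "fac_y X p \<in> carrier_mat (rank X) (rank X)"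
    if "same_rank X" for X p using that unfolding same_rank_def by blast+
  have key: "hcat a' b' * four_block_mat f (0\<^sub>m (rank F) (rank E)) (0\<^sub>m (rank E) (rank F)) e = h * hcat a b"
    if "a' \<in> carrier_mat (rank H) (rank F)" "b' \<in> carrier_mat (rank H) (rank E)"
      "a \<in> carrier_mat (rank H) (rank F)" "b \<in> carrier_mat (rank H) (rank E)"
      "f \<in> carrier_mat (rank F) (rank F)" "e \<in> carrier_mat (rank E) (rank E)" "h \<in> carrier_mat (rank H) (rank H)"
      "a' * f = h * a" "b' * e = h * b" for a a' b b' e f h
    using hcat_mult_block_diag[OF that(1,2,5,6)] mult_hcat[OF that(7,3,4)] that(8,9) by simp
  show ?thesis
    unfolding bundle_map_def mapping_cone_def torus_bundle.simps
  proof (intro conjI allI)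
    show "smooth_mat (rank H) (rank F + rank E) (\<lambda>p. hcat (A p) (B p))" by (rule smooth_hcat[OF sA sB])
    fix x y
    show "hcat (A (x + 2 * pi, y)) (B (x + 2 * pi, y)) *
        four_block_mat (fac_x F (x, y)) (0\<^sub>m (rank F) (rank E)) (0\<^sub>m (rank E) (rank F)) (fac_x E (x, y)) =
        fac_x H (x, y) * hcat (A (x, y)) (B (x, y))"
      by (rule key[OF Ac Bc Ac Bc fx(1)[OF R(2)] fx(1)[OF R(1)] fx(1)[OF R(3)]])
        (use A[unfolded bundle_map_def] B[unfolded bundle_map_def] in blast)+
    show "hcat (A (x, y + 2 * pi)) (B (x, y + 2 * pi)) *
        four_block_mat (fac_y F (x, y)) (0\<^sub>m (rank F) (rank E)) (0\<^sub>m (rank E) (rank F)) (fac_y E (x, y)) =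
        fac_y H (x, y) * hcat (A (x, y)) (B (x, y))"
      by (rule key[OF Ac Bc Ac Bc fx(2)[OF R(2)] fx(2)[OF R(1)] fx(2)[OF R(3)]])
        (use A[unfolded bundle_map_def] B[unfolded bundle_map_def] in blast)+
  qed
qed

lemma mult_mat_zero_vec: "(A :: complex mat) \<in> carrier_mat n m \<Longrightarrow> A *\<^sub>v 0\<^sub>v m = 0\<^sub>v n"
  by (rule eq_vecI) (auto simp: mult_mat_vec_index)

lemma smult_one_mult_vec: "w \<in> carrier_vec m \<Longrightarrow> (c \<cdot>\<^sub>m 1\<^sub>m m) *\<^sub>v w = (c :: complex) \<cdot>\<^sub>v w"
proof (rule eq_vecI)
  assume w: "w \<in> carrier_vec m"
  fix i assume "i < dim_vec (c \<cdot>\<^sub>v w)"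
  then have i: "i < m" using w by simp
  have "vec_index ((c \<cdot>\<^sub>m 1\<^sub>m m) *\<^sub>v w) i = (\<Sum>l<m. (if l = i then c * vec_index w l else 0))"
    unfolding mult_mat_vec_index[OF smult_carrier_mat[OF one_carrier_mat] w i]
    using i by (intro sum.cong) auto
  then show "vec_index ((c \<cdot>\<^sub>m 1\<^sub>m m) *\<^sub>v w) i = vec_index (c \<cdot>\<^sub>v w) i" using i w by simp
qed simp

lemma zero_mat_mult_vec: "u \<in> carrier_vec n \<Longrightarrow> 0\<^sub>m m n *\<^sub>v u = (0\<^sub>v m :: complex Matrix.vec)"
  by (rule eq_vecI) (auto simp: mult_mat_vec_index)

text \<open>If A u + B w = 0, applying T kills the first term and gives c w = 0; then A u = 0, and
  the left inverse S gives u = 0.\<close>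

lemma hcat_det_nonzero:
  fixes A B S T :: "complex mat"
  assumes A: "A \<in> carrier_mat (n + m) n" and B: "B \<in> carrier_mat (n + m) m"
    and S: "S \<in> carrier_mat n (n + m)" and T: "T \<in> carrier_mat m (n + m)"
    and SA: "S * A = 1\<^sub>m n" and TA: "T * A = 0\<^sub>m m n" and TB: "T * B = c \<cdot>\<^sub>m 1\<^sub>m m" and c: "c \<noteq> 0"
  shows "Determinant.det (hcat A B) \<noteq> 0"
proof
  assume "Determinant.det (hcat A B) = 0"
  then obtain v where v: "v \<in> carrier_vec (n + m)" "v \<noteq> 0\<^sub>v (n + m)" "hcat A B *\<^sub>v v = 0\<^sub>v (n + m)"
    using det_0_iff_vec_prod_zero[OF hcat_carrier[OF A B]] by blast
  define u where "u = vec_first v n"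
  define w where "w = vec_last v m"
  have u: "u \<in> carrier_vec n" and w: "w \<in> carrier_vec m" and vuw: "v = u @\<^sub>v w"
    using vec_first_last_append[OF v(1)] by (simp_all add: u_def w_def)
  have z: "A *\<^sub>v u + B *\<^sub>v w = 0\<^sub>v (n + m)" using v(3) unfolding hcat_mult_vec[OF A B v(1)] u_def w_def .
  note Au = mult_mat_vec_carrier[OF A u] and Bw = mult_mat_vec_carrier[OF B w]
  have "T *\<^sub>v (A *\<^sub>v u + B *\<^sub>v w) = T *\<^sub>v (A *\<^sub>v u) + T *\<^sub>v (B *\<^sub>v w)"
    by (rule mult_add_distrib_mat_vec[OF T Au Bw])
  also have "\<dots> = c \<cdot>\<^sub>v w"
    unfolding assoc_mult_mat_vec[OF T A u, symmetric] assoc_mult_mat_vec[OF T B w, symmetric] TA TB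
    smult_one_mult_vec[OF w] zero_mat_mult_vec[OF u] using w by simp
  finally have cw: "c \<cdot>\<^sub>v w = 0\<^sub>v m" unfolding z mult_mat_zero_vec[OF T] by simp
  then have "c * vec_index w i = 0" if "i < m" for i
  proof -
    have "vec_index (c \<cdot>\<^sub>v w) i = c * vec_index w i" by (rule index_smult_vec(1)) (use that w in simp)
    then show ?thesis unfolding cw using that by simp
  qed
  then have w0: "w = 0\<^sub>v m" using c w by (intro eq_vecI) auto
  have "A *\<^sub>v u = 0\<^sub>v (n + m)" using z right_zero_vec[OF Au] unfolding w0 mult_mat_zero_vec[OF B] by simp
  then have "S *\<^sub>v (A *\<^sub>v u) = 0\<^sub>v n" using mult_mat_zero_vec[OF S] by simp
  then have "u = 0\<^sub>v n" unfolding assoc_mult_mat_vec[OF S A u, symmetric] SA using u by simp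
  then have "v = 0\<^sub>v (n + m)" unfolding vuw w0 by (intro eq_vecI) auto
  then show False using v(2) by simp
qed

lemma det_nonzero_inverse:
  fixes A :: "complex mat"
  assumes A: "A \<in> carrier_mat k k" and d: "Determinant.det A \<noteq> 0"
  obtains I where "I \<in> carrier_mat k k" "A * I = 1\<^sub>m k" "I * A = 1\<^sub>m k"
  using det_non_zero_imp_unit[OF A d, of "()"] that unfolding Units_def by (auto simp: ring_mat_def)

lemma invertible_mat_of_det:
  fixes A :: "complex mat"
  assumes A: "A \<in> carrier_mat k k" and d: "Determinant.det A \<noteq> 0"
  shows "invertible_mat A"
proof -
  obtain I where I: "I \<in> carrier_mat k k" "A * I = 1\<^sub>m k" "I * A = 1\<^sub>m k" using det_nonzero_inverse[OF A d] .
  have "square_mat A" using A by simp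
  moreover have "inverts_mat A I" "inverts_mat I A" using A I unfolding inverts_mat_def by auto
  ultimately show ?thesis unfolding invertible_mat_def by blast
qed

text \<open>Exactness in the middle: the columns of A and B together form a basis, and T reads off
  the B-component. So a column killed by T lies in the image of A, where S inverts A.\<close>

lemma exact_factor:
  fixes A B S T X :: "complex mat"
  assumes A: "A \<in> carrier_mat (n + m) n" and B: "B \<in> carrier_mat (n + m) m"
    and S: "S \<in> carrier_mat n (n + m)" and T: "T \<in> carrier_mat m (n + m)" and X: "X \<in> carrier_mat (n + m) k"
    and SA: "S * A = 1\<^sub>m n" and TA: "T * A = 0\<^sub>m m n" and TB: "T * B = 1\<^sub>m m" and TX: "T * X = 0\<^sub>m m k"
  shows "A * (S * X) = X"
proof -
  note H = hcat_carrier[OF A B]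
  have "T * B = 1 \<cdot>\<^sub>m 1\<^sub>m m" unfolding TB by auto
  then have "Determinant.det (hcat A B) \<noteq> 0" using hcat_det_nonzero[OF A B S T SA TA] by simp
  then obtain I where I: "I \<in> carrier_mat (n + m) (n + m)" "hcat A B * I = 1\<^sub>m (n + m)"
    using det_nonzero_inverse[OF H] by blast
  have cols: "A *\<^sub>v (S *\<^sub>v x) = x" if x: "x \<in> carrier_vec (n + m)" and Tx: "T *\<^sub>v x = 0\<^sub>v m" for x
  proof -
    define u where "u = vec_first (I *\<^sub>v x) n"
    define w where "w = vec_last (I *\<^sub>v x) m"
    have u: "u \<in> carrier_vec n" and w: "w \<in> carrier_vec m" by (simp_all add: u_def w_def)
    note Au = mult_mat_vec_carrier[OF A u] and Bw = mult_mat_vec_carrier[OF B w]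
    have "x = hcat A B *\<^sub>v (I *\<^sub>v x)" unfolding assoc_mult_mat_vec[OF H I(1) x, symmetric] I(2) using x by simp
    then have xuw: "x = A *\<^sub>v u + B *\<^sub>v w"
      unfolding u_def w_def using hcat_mult_vec[OF A B mult_mat_vec_carrier[OF I(1) x]] by simp
    have "T *\<^sub>v (A *\<^sub>v u + B *\<^sub>v w) = T *\<^sub>v (A *\<^sub>v u) + T *\<^sub>v (B *\<^sub>v w)"
      by (rule mult_add_distrib_mat_vec[OF T Au Bw])
    also have "\<dots> = w"
      unfolding assoc_mult_mat_vec[OF T A u, symmetric] assoc_mult_mat_vec[OF T B w, symmetric] TA TB zero_mat_mult_vec[OF u] using w by simp
    finally have "w = 0\<^sub>v m" using Tx xuw by simp
    then have xu: "x = A *\<^sub>v u" using xuw right_zero_vec[OF Au] mult_mat_zero_vec[OF B] by simp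
    have "S *\<^sub>v (A *\<^sub>v u) = u" unfolding assoc_mult_mat_vec[OF S A u, symmetric] SA using u by simp
    then show ?thesis unfolding xu by simp
  qed
  note SX = mult_carrier_mat[OF S X]
  note AS = mult_carrier_mat[OF A SX]
  show ?thesis
  proof (rule mat_col_eqI)
    fix j assume "j < dim_col X"
    then have j: "j < k" using X by simp
    have x: "col X j \<in> carrier_vec (n + m)" using col_carrier_vec[OF j X] .
    have "T *\<^sub>v col X j = col (T * X) j" by (rule col_mult2[OF T X j, symmetric])
    also have "\<dots> = 0\<^sub>v m" unfolding TX by (rule col_zero[OF j])
    finally have "T *\<^sub>v col X j = 0\<^sub>v m" .
    from cols[OF x this] show "col (A * (S * X)) j = col X j"
      unfolding col_mult2[OF A SX j] col_mult2[OF S X j] .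
  qed (simp_all only: carrier_matD[OF AS] carrier_matD[OF X])
qed

lemma vec_first_append: "v \<in> carrier_vec n \<Longrightarrow> vec_first (v @\<^sub>v w) n = v"
  by (auto simp: vec_first_def)

lemma vec_last_append: "w \<in> carrier_vec m \<Longrightarrow> vec_last (v @\<^sub>v w) m = w"
  by (auto simp: vec_last_def)

lemma smooth_vec_first:
  assumes "smooth_vec (n + m) s"
  shows "smooth_vec n (\<lambda>p. vec_first (s p) n)"
  unfolding smooth_vec_def
proof (intro conjI allI impI)
  fix i assume i: "i < n"
  then have "(\<lambda>p. vec_index (vec_first (s p) n) i) = (\<lambda>p. vec_index (s p) i)" by (simp add: vec_first_def)
  then show "smooth (\<lambda>p. vec_index (vec_first (s p) n) i)" using smooth_vecD(2)[OF assms, of i] i by simp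
qed simp

lemma smooth_vec_last:
  assumes "smooth_vec (n + m) s"
  shows "smooth_vec m (\<lambda>p. vec_last (s p) m)"
  unfolding smooth_vec_def
proof (intro conjI allI impI)
  fix i assume i: "i < m"
  then have "(\<lambda>p. vec_index (vec_last (s p) m) i) = (\<lambda>p. vec_index (s p) (n + i))"
    using carrier_vecD[OF smooth_vecD(1)[OF assms]] by (simp add: vec_last_def)
  then show "smooth (\<lambda>p. vec_index (vec_last (s p) m) i)" using smooth_vecD(2)[OF assms, of "n + i"] i by simp
qed simp

lemma hol_op_hcat:
  assumes A: "smooth_mat M n A" and B: "smooth_mat M m B" and s: "smooth_vec (n + m) s"
  shows "hol_op (E_bundle \<tau> M h \<eta>) (\<lambda>q. hcat (A q) (B q) *\<^sub>v s q) p =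
    (Dmat \<tau> (of_int h / real M - of_int a / real n) (\<eta> / of_nat M - \<mu> / of_nat n) A p *\<^sub>v vec_first (s p) n +
      A p *\<^sub>v hol_op (E_bundle \<tau> n a \<mu>) (\<lambda>q. vec_first (s q) n) p) +
    (Dmat \<tau> (of_int h / real M - of_int b / real m) (\<eta> / of_nat M - \<nu> / of_nat m) B p *\<^sub>v vec_last (s p) m +
      B p *\<^sub>v hol_op (E_bundle \<tau> m b \<nu>) (\<lambda>q. vec_last (s q) m) p)"
  unfolding hcat_mult_vec[OF smooth_matD(1)[OF A] smooth_matD(1)[OF B] smooth_vecD(1)[OF s]]
    hol_op_add[OF smooth_mat_mult_vec[OF A smooth_vec_first[OF s]] smooth_mat_mult_vec[OF B smooth_vec_last[OF s]]]
    hol_op_mult[OF A smooth_vec_first[OF s], of \<tau> h \<eta> p a \<mu>] hol_op_mult[OF B smooth_vec_last[OF s], of \<tau> h \<eta> p b \<nu>] ..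

text \<open>Intertwining with the upper triangular operator of the cone splits into two conditions:
  A is holomorphic, and the failure of B to be holomorphic is A \<psi>, which matches the
  off-diagonal entry.\<close>

theorem mapping_cone_isomorphicI:
  assumes M: "M = n + m"
    and A: "bundle_map (E_bundle \<tau> n a \<mu>) (E_bundle \<tau> M h \<eta>) A"
    and B: "bundle_map (E_bundle \<tau> m b \<nu>) (E_bundle \<tau> M h \<eta>) B"
    and \<psi>: "bundle_map (E_bundle \<tau> m b \<nu>) (E_bundle \<tau> n a \<mu>) \<psi>"
    and DA: "\<And>p. Dmat \<tau> (of_int h / real M - of_int a / real n) (\<eta> / of_nat M - \<mu> / of_nat n) A p = 0\<^sub>m M n"
    and DB: "\<And>p. Dmat \<tau> (of_int h / real M - of_int b / real m) (\<eta> / of_nat M - \<nu> / of_nat m) B p = A p * \<psi> p"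
    and inv: "\<And>p. Determinant.det (hcat (A p) (B p)) \<noteq> 0"
  shows "hol_isomorphic (mapping_cone (E_bundle \<tau> m b \<nu>) (E_bundle \<tau> n a \<mu>) \<psi>) (E_bundle \<tau> M h \<eta>)"
  unfolding hol_isomorphic_def
proof (intro exI[of _ "\<lambda>p. hcat (A p) (B p)"] conjI ballI allI)
  let ?F = "E_bundle \<tau> n a \<mu>" and ?E = "E_bundle \<tau> m b \<nu>" and ?H = "E_bundle \<tau> M h \<eta>"
  show "bundle_map (mapping_cone ?E ?F \<psi>) ?H (\<lambda>p. hcat (A p) (B p))"
    by (rule bundle_map_hcat[OF same_rank_E_bundle same_rank_E_bundle same_rank_E_bundle A B])
  have sA: "smooth_mat M n A" and sB: "smooth_mat M m B" and sP: "smooth_mat n m \<psi>"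
    using A B \<psi> unfolding bundle_map_E_iff by blast+
  note Ac = smooth_matD(1)[OF sA] and Bc = smooth_matD(1)[OF sB] and Pc = smooth_matD(1)[OF sP]
  show "invertible_mat (hcat (A p) (B p))" for p
    by (rule invertible_mat_of_det[OF hcat_carrier[OF Ac[unfolded M] Bc[unfolded M]] inv])
  fix s p assume "s \<in> sections (mapping_cone ?E ?F \<psi>)"
  then have s: "smooth_vec (n + m) s" by (simp add: sections_def mapping_cone_def)
  let ?s1 = "\<lambda>q. vec_first (s q) n" and ?s2 = "\<lambda>q. vec_last (s q) m"
  note c1 = hol_op_carrier[of ?s1 p n \<tau> a \<mu>, OF vec_first_carrier] and c2 = hol_op_carrier[of ?s2 p m \<tau> b \<nu>, OF vec_last_carrier]
  note c3 = mult_mat_vec_carrier[OF Pc vec_last_carrier, of p]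
  note c4 = add_carrier_vec[OF c1 c3]
  have c5: "(hol_op ?F ?s1 p + \<psi> p *\<^sub>v ?s2 p) @\<^sub>v hol_op ?E ?s2 p \<in> carrier_vec (n + m)"
    by (rule append_carrier_vec[OF c4 c2])
  have "hol_op ?H (\<lambda>q. hcat (A q) (B q) *\<^sub>v s q) p =
      (0\<^sub>m M n *\<^sub>v ?s1 p + A p *\<^sub>v hol_op ?F ?s1 p) + (A p * \<psi> p *\<^sub>v ?s2 p + B p *\<^sub>v hol_op ?E ?s2 p)"
    unfolding hol_op_hcat[OF sA sB s, of \<tau> h \<eta> p a \<mu> b \<nu>] DA DB ..
  also have "0\<^sub>m M n *\<^sub>v ?s1 p = 0\<^sub>v M" by (rule zero_mat_mult_vec[OF vec_first_carrier])
  also have "0\<^sub>v M + A p *\<^sub>v hol_op ?F ?s1 p = A p *\<^sub>v hol_op ?F ?s1 p"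
    by (rule left_zero_vec[OF mult_mat_vec_carrier[OF Ac c1]])
  also have "A p * \<psi> p *\<^sub>v ?s2 p = A p *\<^sub>v (\<psi> p *\<^sub>v ?s2 p)"
    by (rule assoc_mult_mat_vec[OF Ac Pc vec_last_carrier])
  also have "A p *\<^sub>v hol_op ?F ?s1 p + (A p *\<^sub>v (\<psi> p *\<^sub>v ?s2 p) + B p *\<^sub>v hol_op ?E ?s2 p) =
      (A p *\<^sub>v hol_op ?F ?s1 p + A p *\<^sub>v (\<psi> p *\<^sub>v ?s2 p)) + B p *\<^sub>v hol_op ?E ?s2 p"
    by (rule assoc_add_vec[symmetric]) (rule mult_mat_vec_carrier[OF Ac c1] mult_mat_vec_carrier[OF Ac c3] mult_mat_vec_carrier[OF Bc c2])+
  also have "A p *\<^sub>v hol_op ?F ?s1 p + A p *\<^sub>v (\<psi> p *\<^sub>v ?s2 p) = A p *\<^sub>v (hol_op ?F ?s1 p + \<psi> p *\<^sub>v ?s2 p)"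
    by (rule mult_add_distrib_mat_vec[OF Ac c1 c3, symmetric])
  also have "\<dots> + B p *\<^sub>v hol_op ?E ?s2 p = hcat (A p) (B p) *\<^sub>v ((hol_op ?F ?s1 p + \<psi> p *\<^sub>v ?s2 p) @\<^sub>v hol_op ?E ?s2 p)"
    unfolding hcat_mult_vec[OF Ac Bc c5] vec_first_append[OF c4] vec_last_append[OF c2] ..
  finally show "hol_op ?H (\<lambda>q. hcat (A q) (B q) *\<^sub>v s q) p = hcat (A p) (B p) *\<^sub>v hol_op (mapping_cone ?E ?F \<psi>) s p"
    by (simp only: mapping_cone_def torus_bundle.simps E_bundle_simps)
qed

section \<open>Identification of the cone\<close>

lemma cadj_cadj: "cadj (cadj A) = A"
  by (rule eq_matI) (auto simp: cadj_def)

lemma cadj_mult: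
  assumes A: "A \<in> carrier_mat n k" and B: "B \<in> carrier_mat k m"
  shows "cadj (A * B) = cadj B * cadj A"
proof -
  note AB = mult_carrier_mat[OF A B]
  show ?thesis
  proof (rule carrier_mat_eq_iff[OF cadj_carrier[OF AB] mult_carrier_mat[OF cadj_carrier[OF B] cadj_carrier[OF A]], THEN iffD2], intro allI impI)
    fix i j assume ij: "i < m" "j < n"
    show "cadj (A * B) $$ (i, j) = (cadj B * cadj A) $$ (i, j)"
      unfolding cadj_index[OF AB ij] mult_mat_index[OF A B ij(2,1)]
        mult_mat_index[OF cadj_carrier[OF B] cadj_carrier[OF A] ij]
      by (simp add: cadj_index[OF A] cadj_index[OF B] ij mult.commute)
  qed
qed

lemma cadj_one: "cadj (1\<^sub>m n) = 1\<^sub>m n"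
  by (rule eq_matI) (auto simp: cadj_def)

text \<open>The left inverse is the adjoint of A followed by the inverse of the adjoint of A times
  A. This formula is canonical, hence smooth and compatible with the factors of automorphy.\<close>

lemma bundle_map_left_inverse:
  assumes A: "bundle_map (E_bundle \<tau> n' a' \<mu>') (E_bundle \<tau> n a \<mu>) A"
    and inj: "\<And>p v. v \<in> carrier_vec n' \<Longrightarrow> A p *\<^sub>v v = 0\<^sub>v n \<Longrightarrow> v = 0\<^sub>v n'"
  shows "\<exists>S. bundle_map (E_bundle \<tau> n a \<mu>) (E_bundle \<tau> n' a' \<mu>') S \<and> (\<forall>p. S p * A p = 1\<^sub>m n')"
proof -
  let ?E = "E_bundle \<tau> n a \<mu>" and ?E' = "E_bundle \<tau> n' a' \<mu>'"
  have sA: "smooth_mat n n' A" using A unfolding bundle_map_E_iff by blast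
  note Ac = smooth_matD(1)[OF sA]
  obtain B where B: "smooth_mat n' n' B" "\<And>p. B p * (cadj (A p) * A p) = 1\<^sub>m n'" "\<And>p. (cadj (A p) * A p) * B p = 1\<^sub>m n'"
  proof -
    have "\<exists>B. smooth_mat n' n' B \<and> (\<forall>p. B p * (cadj (A p) * A p) = 1\<^sub>m n') \<and> (\<forall>p. (cadj (A p) * A p) * B p = 1\<^sub>m n')"
      by (rule smooth_left_inverse[OF sA]) (rule inj)
    then show thesis using that by blast
  qed
  note ad = bundle_map_cadj[OF A]
  have sym: "bundle_map ?E' ?E' (\<lambda>p. cadj (A p) * A p)"
    by (rule bundle_map_mult[OF same_rank_E_bundle same_rank_E_bundle same_rank_E_bundle A ad])
  have "bundle_map ?E' ?E' B"
    by (rule bundle_map_inverse[OF same_rank_E_bundle sym]) (simp_all only: E_bundle_simps B)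
  then have "bundle_map ?E ?E' (\<lambda>p. B p * cadj (A p))"
    by (rule bundle_map_mult[OF same_rank_E_bundle same_rank_E_bundle same_rank_E_bundle ad])
  moreover have "(B p * cadj (A p)) * A p = 1\<^sub>m n'" for p
    unfolding assoc_mult_mat[OF smooth_matD(1)[OF B(1)] cadj_carrier[OF Ac] Ac] by (rule B(2))
  ultimately show ?thesis by blast
qed

lemma Dmat_zmat:
  assumes h: "schwartz h"
  shows "Dmat \<tau> \<delta> \<kappa> (zmat n n' (- \<delta>) h) p = zmat n n' (- \<delta>) (hop \<tau> \<delta> \<kappa> h) p"
proof (rule carrier_mat_eq_iff[OF Dmat_carrier[OF zmat_carrier] zmat_carrier, THEN iffD2], intro allI impI)
  fix i j assume ij: "i < n" "j < n'"
  show "Dmat \<tau> \<delta> \<kappa> (zmat n n' (- \<delta>) h) p $$ (i, j) = zmat n n' (- \<delta>) (hop \<tau> \<delta> \<kappa> h) p $$ (i, j)"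
    unfolding Dmat_index[where \<Phi> = "zmat n n' (- \<delta>) h", OF zmat_carrier ij] zmat_index[OF ij] by (rule Dop_zak[OF h])
qed

lemma zmat_zero: "zmat n n' c (\<lambda>x. 0) p = 0\<^sub>m n n'"
  by (rule eq_matI) (auto simp: zmat_def zak_def)

lemma zmat_add_cmult:
  assumes f: "schwartz f" and g: "schwartz g"
  shows "zmat n n' c (\<lambda>x. f x + k * g x) p = zmat n n' c f p + k \<cdot>\<^sub>m zmat n n' c g p"
proof -
  note kg = schwartz_cmult[OF g, of k]
  have eq: "zak c A (\<lambda>x. f x + k * g x) p = zak c A f p + k * zak c A g p" for A
    unfolding zak_add[OF schwartzD(1)[OF f] schwartzD(1)[OF kg]] by (simp add: zak_cmult)
  show ?thesis
    by (rule eq_matI) (auto simp: zmat_def eq)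
qed

text \<open>Surjectivity of \<beta> is proved as injectivity of its adjoint. Conjugating the vector
  turns the adjoint into the transpose, and the transpose of a \<open>zmat\<close> is again a
  \<open>zmat\<close>, because its two residue conditions play symmetric roles.\<close>

lemma zmat_conj_transpose_injective:
  assumes A: "Re A < 0" and n: "0 < m" "m < M" and v: "v \<in> carrier_vec m"
    and z: "cadj (zmat m M c (gauss A B) p) *\<^sub>v v = 0\<^sub>v M"
  shows "v = 0\<^sub>v m"
proof -
  define w where "w = Matrix.vec m (\<lambda>i. cnj (vec_index v i))"
  have w: "w \<in> carrier_vec m" by (simp add: w_def)
  have "zmat M m c (gauss A B) p *\<^sub>v w = 0\<^sub>v M"
  proof (rule eq_vecI)
    fix i assume "i < dim_vec (0\<^sub>v M :: complex Matrix.vec)"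
    then have i: "i < M" by simp
    have "vec_index (cadj (zmat m M c (gauss A B) p) *\<^sub>v v) i = 0" unfolding z using i by simp
    then have "(\<Sum>l<m. cnj (zmat m M c (gauss A B) p $$ (l, i)) * vec_index v l) = 0"
      unfolding mult_mat_vec_index[OF cadj_carrier[OF zmat_carrier] v i] by (simp add: cadj_index[OF zmat_carrier i])
    then have "cnj (\<Sum>l<m. cnj (zmat m M c (gauss A B) p $$ (l, i)) * vec_index v l) = 0" by simp
    then have "(\<Sum>l<m. zmat m M c (gauss A B) p $$ (l, i) * cnj (vec_index v l)) = 0" by simp
    moreover have "zmat m M c (gauss A B) p $$ (l, i) = zmat M m c (gauss A B) p $$ (i, l)" if "l < m" for l
      unfolding zmat_index[OF that i] zmat_index[OF i that] by (simp only: conj_commute)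
    ultimately show "vec_index (zmat M m c (gauss A B) p *\<^sub>v w) i = vec_index (0\<^sub>v M) i"
      unfolding mult_mat_vec_index[OF zmat_carrier w i] using i by (simp add: w_def)
  qed (simp add: zmat_def)
  then have w0: "w = 0\<^sub>v m" by (rule zmat_gauss_injective[OF A n w])
  have "cnj (vec_index v i) = 0" if "i < m" for i
    using arg_cong[OF w0, of "\<lambda>w. vec_index w i"] that by (simp add: w_def)
  then show ?thesis using v by (intro eq_vecI) auto
qed

text \<open>The extensions by \<open>\<psi>\<close> and by the class \<open>\<psi>\<^sub>0\<close> of the exact sequence built from \<open>\<alpha>\<close> and \<open>\<beta>\<close> are
  proportional modulo coboundaries, since the obstruction to solving \<open>D f = \<psi> - c \<psi>\<^sub>0\<close> is one integral.\<close>

theorem mapping_cone_isomorphic: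
  fixes \<tau> \<mu> \<nu> \<eta> :: complex and a b c d :: int
  assumes \<tau>: "Im \<tau> > 0" and n: "n \<ge> 1" "m \<ge> 1" and bz: "b * int n - a * int m = 1"
    and \<psi>: "bundle_map (E_bundle \<tau> m b \<nu>) (E_bundle \<tau> n a \<mu>) \<psi>"
    and nt: "\<not> ext1_trivial (E_bundle \<tau> m b \<nu>) (E_bundle \<tau> n a \<mu>) \<psi>"
    and odd: "odd c" "odd d" and \<eta>: "\<eta> - \<mu> - \<nu> = - (of_real pi * of_int c) + of_real pi * \<tau> * of_int d"
    and M: "M = n + m"
  shows "hol_isomorphic (mapping_cone (E_bundle \<tau> m b \<nu>) (E_bundle \<tau> n a \<mu>) \<psi>) (E_bundle \<tau> M (a + b) \<eta>)"
proof -
  let ?F = "E_bundle \<tau> n a \<mu>" and ?E = "E_bundle \<tau> m b \<nu>" and ?H = "E_bundle \<tau> M (a + b) \<eta>"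
  note sr = same_rank_E_bundle
  have M1: "M \<ge> 1" and nM: "0 < n" "n < M" and mM: "0 < m" "m < M" using n M by auto
  \<comment> \<open>The mediant is a Farey neighbour of both outer slopes, so everything proved for
    neighbours applies to \<alpha>, to \<beta> and to maps backwards.\<close>
  have bz1: "(a + b) * int n - a * int M = 1" and bz2: "b * int M - (a + b) * int m = 1"
    using bz M by (simp_all add: algebra_simps)
  let ?d1 = "of_int (a + b) / real M - of_int a / real n" and ?k1 = "\<eta> / of_nat M - \<mu> / of_nat n"
  let ?d2 = "of_int (a + b) / real M - of_int b / real m" and ?k2 = "\<eta> / of_nat M - \<nu> / of_nat m"
  let ?d2' = "of_int b / real m - of_int (a + b) / real M" and ?k2' = "\<nu> / of_nat m - \<eta> / of_nat M"
  let ?d = "of_int a / real n - of_int b / real m" and ?k = "\<mu> / of_nat n - \<nu> / of_nat m"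
  have d1: "?d1 = 1 / real (n * M)" using bezout_slope[OF bz1 n(1) M1] by linarith
  have d2': "?d2' = 1 / real (m * M)" using bezout_slope[OF bz2 M1 n(2)] unfolding mult.commute[of M m] by linarith
  have d: "?d = - (1 / real (n * m))" by (rule bezout_slope[OF bz n])
  have dneg: "?d < 0" unfolding d using n by simp
  have pos: "- (1 / real (n * M)) < 0" "- (1 / real (m * M)) < 0" using n M1 by simp_all
  let ?A1 = "- (\<i> * of_real (1 / real (n * M)) / (4 * pi * \<tau>))" and ?A2 = "- (\<i> * of_real (1 / real (m * M)) / (4 * pi * \<tau>))"
  have A1: "Re ?A1 < 0" using Re_gauss_coefficient[OF \<tau> pos(1)] by simp
  have A2: "Re ?A2 < 0" using Re_gauss_coefficient[OF \<tau> pos(2)] by simp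
  define g1 where "g1 = gauss ?A1 (- (\<i> * ?k1 / (2 * pi * \<tau>)))"
  define g2 where "g2 = gauss ?A2 (- (\<i> * ?k2' / (2 * pi * \<tau>)))"
  have s1: "schwartz g1" and s2: "schwartz g2" unfolding g1_def g2_def by (rule schwartz_gauss[OF A1], rule schwartz_gauss[OF A2])
  define \<alpha> where "\<alpha> = zmat M n (- (1 / real (n * M))) g1"
  define \<beta> where "\<beta> = zmat m M (- (1 / real (m * M))) g2"
  have ba: "\<beta> p * \<alpha> p = 0\<^sub>m m n" for p
    unfolding \<alpha>_def \<beta>_def g1_def g2_def
    by (rule zmat_gauss_composite_zero[OF \<tau> n _ odd \<eta>]) (simp add: M)
  have \<alpha>: "bundle_map ?F ?H \<alpha>" unfolding \<alpha>_def by (rule bundle_map_zmat[OF s1]) (use d1 in linarith)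
  have \<beta>: "bundle_map ?H ?E \<beta>" unfolding \<beta>_def by (rule bundle_map_zmat[OF s2]) (use d2' in linarith)
  have D\<alpha>: "Dmat \<tau> ?d1 ?k1 \<alpha> p = 0\<^sub>m M n" for p
  proof -
    have "hop \<tau> (1 / real (n * M)) ?k1 g1 = (\<lambda>x. 0)" unfolding g1_def using hop_gauss[OF \<tau>] by blast
    then show ?thesis unfolding \<alpha>_def d1 Dmat_zmat[OF s1] by (simp only: zmat_zero)
  qed
  have D\<beta>: "Dmat \<tau> ?d2' ?k2' \<beta> p = 0\<^sub>m m M" for p
  proof -
    have "hop \<tau> (1 / real (m * M)) ?k2' g2 = (\<lambda>x. 0)" unfolding g2_def using hop_gauss[OF \<tau>] by blast
    then show ?thesis unfolding \<beta>_def d2' Dmat_zmat[OF s2] by (simp only: zmat_zero)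
  qed
  obtain \<sigma> where \<sigma>: "bundle_map ?H ?F \<sigma>" "\<And>p. \<sigma> p * \<alpha> p = 1\<^sub>m n"
    using bundle_map_left_inverse[OF \<alpha>] zmat_gauss_injective[OF A1 nM] unfolding \<alpha>_def g1_def by blast
  \<comment> \<open>S is a left inverse of the adjoint of \<beta>, so its adjoint \<gamma>0 is a
    smooth right inverse of \<beta>.\<close>
  obtain S where S: "bundle_map ?H ?E S" "\<And>p. S p * cadj (\<beta> p) = 1\<^sub>m m"
    using bundle_map_left_inverse[OF bundle_map_cadj[OF \<beta>]] zmat_conj_transpose_injective[OF A2 mM] unfolding \<beta>_def g2_def by blast
  define \<gamma>0 where "\<gamma>0 = (\<lambda>p. cadj (S p))"
  have \<gamma>0: "bundle_map ?E ?H \<gamma>0" unfolding \<gamma>0_def by (rule bundle_map_cadj[OF S(1)])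
  have sm: "smooth_mat M n \<alpha>" "smooth_mat m M \<beta>" "smooth_mat n M \<sigma>" "smooth_mat M m \<gamma>0" "smooth_mat m M S"
    using \<alpha> \<beta> \<sigma>(1) \<gamma>0 S(1) unfolding bundle_map_E_iff by blast+
  note C = smooth_matD(1)[OF sm(1)] smooth_matD(1)[OF sm(2)] smooth_matD(1)[OF sm(3)] smooth_matD(1)[OF sm(4)]
  have bg: "\<beta> p * \<gamma>0 p = 1\<^sub>m m" for p
    using cadj_mult[OF smooth_matD(1)[OF sm(5)] cadj_carrier[OF C(2)], of p p]
    unfolding S(2) cadj_one cadj_cadj \<gamma>0_def by simp
  define X where "X = Dmat \<tau> ?d2 ?k2 \<gamma>0"
  have X: "bundle_map ?E ?H X" unfolding X_def by (rule bundle_map_Dmat[OF \<tau> \<gamma>0 refl])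
  have Xc: "X p \<in> carrier_mat M m" for p unfolding X_def by (rule Dmat_carrier[OF C(4)])
  \<comment> \<open>Differentiate \<beta> \<gamma>0 = 1 with D \<beta> = 0. So X = D \<gamma>0 takes
    values in the kernel of \<beta>, the image of \<alpha>, and \<psi>0 is its preimage: the
    obstruction to \<gamma>0 being holomorphic.\<close>
  have bX: "\<beta> p * X p = 0\<^sub>m m m" for p
  proof -
    have "Dmat \<tau> (?d2' + ?d2) (?k2' + ?k2) (\<lambda>q. \<beta> q * \<gamma>0 q) p = 0\<^sub>m m m"
      unfolding bg by (rule Dmat_const) auto
    then have "Dmat \<tau> ?d2' ?k2' \<beta> p * \<gamma>0 p + \<beta> p * X p = 0\<^sub>m m m" unfolding Dmat_mult[OF sm(2,4)] X_def .
    then show ?thesis unfolding D\<beta> left_mult_zero_mat[OF C(4)] left_add_zero_mat[OF mult_carrier_mat[OF C(2) Xc]] .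
  qed
  define \<psi>0 where "\<psi>0 = (\<lambda>p. \<sigma> p * X p)"
  have \<psi>0: "bundle_map ?E ?F \<psi>0" unfolding \<psi>0_def by (rule bundle_map_mult[OF sr sr sr X \<sigma>(1)])
  have a\<psi>0: "\<alpha> p * \<psi>0 p = X p" for p
    unfolding \<psi>0_def
    by (rule exact_factor[OF C(1)[unfolded M] C(4)[unfolded M] C(3)[unfolded M] C(2)[unfolded M] Xc[unfolded M] \<sigma>(2) ba bg bX])
  have smp: "smooth_mat n m \<psi>" "smooth_mat n m \<psi>0" using \<psi> \<psi>0 unfolding bundle_map_E_iff by blast+
  define \<rho> where "\<rho> = mean_y (\<lambda>p. \<psi> p $$ (0, 0))"
  define \<rho>0 where "\<rho>0 = mean_y (\<lambda>p. \<psi>0 p $$ (0, 0))"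
  have N: "n * m \<ge> 1" using n by simp
  have \<rho>: "schwartz \<rho>" "\<And>p. \<psi> p = zmat n m (- ?d) \<rho> p"
    using bundle_map_eq_zmat[OF n bz \<psi>] schwartz_mean_y[OF _ N] unfolding \<rho>_def d minus_minus by blast+
  have \<rho>0: "schwartz \<rho>0" "\<And>p. \<psi>0 p = zmat n m (- ?d) \<rho>0 p"
    using bundle_map_eq_zmat[OF n bz \<psi>0] schwartz_mean_y[OF _ N] unfolding \<rho>0_def d minus_minus by blast+
  let ?w = "gauss (\<i> * of_real ?d / (4 * pi * \<tau>)) (\<i> * ?k / (2 * pi * \<tau>))"
  obtain J where J: "has_total (\<lambda>x. ?w x * \<rho> x) J" using ex_has_total_gauss[OF Re_gauss_coefficient[OF \<tau> dneg] \<rho>(1)] by blast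
  obtain J0 where J0: "has_total (\<lambda>x. ?w x * \<rho>0 x) J0" using ex_has_total_gauss[OF Re_gauss_coefficient[OF \<tau> dneg] \<rho>0(1)] by blast
  have dd: "?d1 + ?d = ?d2" "?k1 + ?k = ?k2" by simp_all
  have primitive: "\<exists>f. bundle_map ?E ?F f \<and> (\<forall>p. Dmat \<tau> ?d ?k f p = zmat n m (- ?d) r p)"
    if r: "schwartz r" "has_total (\<lambda>x. ?w x * r x) 0" for r
  proof -
    obtain h where h: "schwartz h" "hop \<tau> ?d ?k h = r" using hop_solve[OF \<tau> dneg r] by blast
    have "bundle_map ?E ?F (zmat n m (- ?d) h)" by (rule bundle_map_zmat[OF h(1)]) simp
    moreover have "Dmat \<tau> ?d ?k (zmat n m (- ?d) h) p = zmat n m (- ?d) r p" for p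
      using Dmat_zmat[OF h(1), of \<tau> ?d ?k n m p] unfolding h(2) .
    ultimately show ?thesis by blast
  qed
  have D\<alpha>f: "Dmat \<tau> ?d2 ?k2 (\<lambda>q. \<alpha> q * f q) p = \<alpha> p * Dmat \<tau> ?d ?k f p" if f: "smooth_mat n m f" for f p
    using Dmat_mult[OF sm(1) f, of \<tau> ?d1 ?d ?k1 ?k p]
    unfolding dd D\<alpha> left_mult_zero_mat[OF smooth_matD(1)[OF f]]
      left_add_zero_mat[OF mult_carrier_mat[OF C(1) Dmat_carrier[OF smooth_matD(1)[OF f]]]] .
  have ba0: "\<beta> p * (\<alpha> p * f p) = 0\<^sub>m m m" if f: "smooth_mat n m f" for f p
    unfolding assoc_mult_mat[OF C(2) C(1) smooth_matD(1)[OF f], symmetric] ba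
    by (rule left_mult_zero_mat[OF smooth_matD(1)[OF f]])
  \<comment> \<open>If the integral vanished, \<psi>0 = D f would be solvable, and \<gamma>0 -
    \<alpha> f would be a holomorphic splitting of \<beta>. Such a map has negative degree, hence is
    zero, contradicting \<beta> \<gamma> = 1.\<close>
  have J0nz: "J0 \<noteq> 0"
  proof
    assume "J0 = 0"
    then obtain f where f: "bundle_map ?E ?F f" "\<And>p. Dmat \<tau> ?d ?k f p = \<psi>0 p"
      using primitive[OF \<rho>0(1)] J0 unfolding \<rho>0(2) by blast
    have sf: "smooth_mat n m f" using f(1) unfolding bundle_map_E_iff by blast
    have af: "bundle_map ?E ?H (\<lambda>q. \<alpha> q * f q)" by (rule bundle_map_mult[OF sr sr sr f(1) \<alpha>])
    have saf: "smooth_mat M m (\<lambda>q. \<alpha> q * f q)" by (rule smooth_mat_mult[OF sm(1) sf])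
    note afc = smooth_matD(1)[OF saf]
    define \<gamma> where "\<gamma> = (\<lambda>q. \<gamma>0 q + (-1) \<cdot>\<^sub>m (\<alpha> q * f q))"
    have \<gamma>: "bundle_map ?E ?H \<gamma>" unfolding \<gamma>_def by (rule bundle_map_add[OF \<gamma>0 bundle_map_smult[OF af]])
    have D\<gamma>: "Dmat \<tau> ?d2 ?k2 \<gamma> p = 0\<^sub>m M m" for p
    proof -
      have "Dmat \<tau> ?d2 ?k2 \<gamma> p = X p + (-1) \<cdot>\<^sub>m X p"
        unfolding \<gamma>_def Dmat_add[OF sm(4) smooth_mat_smult[OF saf]] Dmat_smult[OF saf] D\<alpha>f[OF sf] f(2) a\<psi>0 X_def ..
      also have "\<dots> = 0\<^sub>m M m" by (rule eq_matI) (use Xc[of p] in auto)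
      finally show ?thesis .
    qed
    have sg: "smooth_mat M m \<gamma>" using \<gamma> unfolding bundle_map_E_iff by blast
    have "\<gamma> p = 0\<^sub>m M m" for p
    proof (rule holomorphic_negative_degree_zero[OF \<tau> M1 n(2) bz2 \<gamma>])
      fix p
      have M0: "0 < M" using M1 by simp
      have "Dmat \<tau> ?d2 ?k2 \<gamma> p $$ (0, 0) = 0" unfolding D\<gamma> using M1 n by simp
      then show "Dop \<tau> ?d2 ?k2 (\<lambda>q. \<gamma> q $$ (0, 0)) p = 0"
        unfolding Dmat_index[where \<Phi> = \<gamma>, OF smooth_matD(1)[OF sg] M0 mM(1)] .
    qed
    then have "\<beta> (0, 0) * \<gamma> (0, 0) = 0\<^sub>m m m" using C(2)[of "(0, 0)"] by simp
    moreover have "\<beta> (0, 0) * \<gamma> (0, 0) = 1\<^sub>m m + (-1) \<cdot>\<^sub>m 0\<^sub>m m m"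
      unfolding \<gamma>_def mult_add_distrib_mat[OF C(2) C(4) smult_carrier_mat[OF afc]] mult_smult_distrib[OF C(2) afc] bg ba0[OF sf] ..
    ultimately have "(1\<^sub>m m + (-1) \<cdot>\<^sub>m 0\<^sub>m m m :: complex mat) $$ (0, 0) = 0\<^sub>m m m $$ (0, 0)" by simp
    then show False using n by simp
  qed
  \<comment> \<open>With this ratio the integral attached to \<psi> - k \<psi>0 vanishes, so this
    difference is a coboundary D f.\<close>
  define k where "k = J / J0"
  have "has_total (\<lambda>x. ?w x * \<rho> x - k * (?w x * \<rho>0 x)) (J - k * J0)" by (rule has_total_diff_cmult[OF J J0])
  moreover have "(\<lambda>x. ?w x * \<rho> x - k * (?w x * \<rho>0 x)) = (\<lambda>x. ?w x * (\<rho> x + (- k) * \<rho>0 x))" by (simp add: algebra_simps)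
  moreover have "J - k * J0 = 0" using J0nz by (simp add: k_def)
  ultimately have "has_total (\<lambda>x. ?w x * (\<rho> x + (- k) * \<rho>0 x)) 0" by simp
  then obtain f where f: "bundle_map ?E ?F f" "\<And>p. Dmat \<tau> ?d ?k f p = zmat n m (- ?d) (\<lambda>x. \<rho> x + (- k) * \<rho>0 x) p"
    using primitive[OF schwartz_add[OF \<rho>(1) schwartz_cmult[OF \<rho>0(1)]]] by blast
  have Df: "Dmat \<tau> ?d ?k f p = \<psi> p + (- k) \<cdot>\<^sub>m \<psi>0 p" for p
    unfolding f(2) zmat_add_cmult[OF \<rho>(1) \<rho>0(1)] \<rho>(2)[symmetric] \<rho>0(2)[symmetric] ..
  \<comment> \<open>For k = 0 the form \<psi> itself would be the coboundary D f.\<close>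
  have k: "k \<noteq> 0"
  proof
    assume "k = 0"
    have "\<psi> p + (- k) \<cdot>\<^sub>m \<psi>0 p = \<psi> p" for p
      by (rule eq_matI) (use smooth_matD(1)[OF smp(1), of p] smooth_matD(1)[OF smp(2), of p] \<open>k = 0\<close> in auto)
    then show False using ext1_trivialI[OF f(1), of \<psi>] Df nt by simp
  qed
  have sf: "smooth_mat n m f" using f(1) unfolding bundle_map_E_iff by blast
  have af: "bundle_map ?E ?H (\<lambda>q. \<alpha> q * f q)" by (rule bundle_map_mult[OF sr sr sr f(1) \<alpha>])
  have saf: "smooth_mat M m (\<lambda>q. \<alpha> q * f q)" by (rule smooth_mat_mult[OF sm(1) sf])
  note afc = smooth_matD(1)[OF saf]
  \<comment> \<open>Chosen so that D \<gamma> = k \<alpha> \<psi>0 + \<alpha> (\<psi> - k \<psi>0) =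
    \<alpha> \<psi>, while \<beta> \<gamma> = k keeps \<alpha> and \<gamma> independent.\<close>
  define \<gamma> where "\<gamma> = (\<lambda>q. k \<cdot>\<^sub>m \<gamma>0 q + \<alpha> q * f q)"
  have \<gamma>: "bundle_map ?E ?H \<gamma>" unfolding \<gamma>_def by (rule bundle_map_add[OF bundle_map_smult[OF \<gamma>0] af])
  have sg: "smooth_mat M m \<gamma>" using \<gamma> unfolding bundle_map_E_iff by blast
  have D\<gamma>: "Dmat \<tau> ?d2 ?k2 \<gamma> p = \<alpha> p * \<psi> p" for p
  proof -
    note Pc = smooth_matD(1)[OF smp(1), of p] and P0c = smooth_matD(1)[OF smp(2), of p]
    have "Dmat \<tau> ?d2 ?k2 \<gamma> p = k \<cdot>\<^sub>m X p + (\<alpha> p * \<psi> p + (- k) \<cdot>\<^sub>m X p)"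
      unfolding \<gamma>_def Dmat_add[OF smooth_mat_smult[OF sm(4)] saf] Dmat_smult[OF sm(4)] D\<alpha>f[OF sf] Df
        mult_add_distrib_mat[OF C(1) Pc smult_carrier_mat[OF P0c]] mult_smult_distrib[OF C(1) P0c] a\<psi>0 X_def ..
    also have "\<dots> = \<alpha> p * \<psi> p"
    proof -
      have "k \<cdot>\<^sub>m x + (y + (- k) \<cdot>\<^sub>m x) = y" if "x \<in> carrier_mat M m" "y \<in> carrier_mat M m" for x y :: "complex mat"
        by (rule eq_matI) (use that in auto)
      from this[OF Xc mult_carrier_mat[OF C(1) Pc]] show ?thesis .
    qed
    finally show ?thesis .
  qed
  have "\<beta> p * \<gamma> p = k \<cdot>\<^sub>m 1\<^sub>m m" for p
  proof -
    have "\<beta> p * \<gamma> p = k \<cdot>\<^sub>m 1\<^sub>m m + 0\<^sub>m m m"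
      unfolding \<gamma>_def mult_add_distrib_mat[OF C(2) smult_carrier_mat[OF C(4)] afc] mult_smult_distrib[OF C(2) C(4)] bg ba0[OF sf] ..
    then show ?thesis by simp
  qed
  then have "Determinant.det (hcat (\<alpha> p) (\<gamma> p)) \<noteq> 0" for p
    by (rule hcat_det_nonzero[OF C(1)[unfolded M] smooth_matD(1)[OF sg, unfolded M] C(3)[unfolded M] C(2)[unfolded M] \<sigma>(2) ba _ k])
  then show ?thesis by (rule mapping_cone_isomorphicI[OF M \<alpha> \<gamma> \<psi> D\<alpha> D\<gamma>])
qed

section \<open>Determinants of maps out of the cone\<close>

lemma delbar_const: "delbar \<tau> (\<lambda>q. c) p = 0"
  by (simp add: delbar_def)

lemma delbar_cmult:
  assumes "f differentiable (at p)"
  shows "delbar \<tau> (\<lambda>q. c * f q) p = c * delbar \<tau> f p"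
  using delbar_mult[of "\<lambda>q. c" p f \<tau>] assms by (simp add: delbar_const)

lemma delbar_prod:
  assumes "finite I" "\<And>i. i \<in> I \<Longrightarrow> smooth (f i)"
  shows "delbar \<tau> (\<lambda>q. \<Prod>i\<in>I. f i q) p = (\<Sum>k\<in>I. delbar \<tau> (f k) p * (\<Prod>i\<in>I - {k}. f i p))"
  using assms
proof (induction I rule: finite_induct)
  case (insert j I)
  have sm: "smooth (f j)" "smooth (\<lambda>q. \<Prod>i\<in>I. f i q)" using insert.prems by (auto intro: smooth_prod)
  have eq: "(\<Prod>i\<in>insert j I - {k}. f i p) = f j p * (\<Prod>i\<in>I - {k}. f i p)" if "k \<in> I" for k
  proof -
    have "insert j I - {k} = insert j (I - {k})" using insert.hyps that by auto
    then show ?thesis using insert.hyps by simp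
  qed
  have "delbar \<tau> (\<lambda>q. f j q * (\<Prod>i\<in>I. f i q)) p =
      delbar \<tau> (f j) p * (\<Prod>i\<in>I. f i p) + f j p * (\<Sum>k\<in>I. delbar \<tau> (f k) p * (\<Prod>i\<in>I - {k}. f i p))"
    unfolding delbar_mult[OF smooth_imp_differentiable[OF sm(1)] smooth_imp_differentiable[OF sm(2)]]
    using insert by simp
  also have "\<dots> = (\<Sum>k\<in>insert j I. delbar \<tau> (f k) p * (\<Prod>i\<in>insert j I - {k}. f i p))"
    using insert.hyps by (simp add: eq sum_distrib_left mult.left_commute)
  finally show ?case using insert.hyps by simp
qed (simp add: delbar_const)

text \<open>A permutation other than the identity moves at least two indices. After one factor of
  its product is differentiated, an off-diagonal entry of the unit matrix still remains, so only the
  trace survives.\<close>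

lemma delbar_det_at_one:
  assumes \<Psi>: "smooth_mat n n \<Psi>" and one: "\<Psi> p = 1\<^sub>m n"
  shows "delbar \<tau> (\<lambda>q. Determinant.det (\<Psi> q)) p = (\<Sum>k<n. delbar \<tau> (\<lambda>q. \<Psi> q $$ (k, k)) p)"
proof -
  let ?P = "{\<pi>. \<pi> permutes {0..<n}}"
  have im: "\<pi> i < n" if "\<pi> \<in> ?P" "i \<in> {0..<n}" for \<pi> i
    using that permutes_in_image[of \<pi> "{0..<n}" i] by auto
  have s: "smooth (\<lambda>q. \<Psi> q $$ (i, \<pi> i))" if "\<pi> \<in> ?P" "i \<in> {0..<n}" for \<pi> i
    using im[OF that] that by (intro smooth_matD(2)[OF \<Psi>]) auto
  have sp: "smooth (\<lambda>q. \<Prod>i = 0..<n. \<Psi> q $$ (i, \<pi> i))" if "\<pi> \<in> ?P" for \<pi>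
    using s[OF that] by (intro smooth_prod) auto
  have summand: "delbar \<tau> (\<lambda>q. \<Prod>i = 0..<n. \<Psi> q $$ (i, \<pi> i)) p = (if \<pi> = id then (\<Sum>k<n. delbar \<tau> (\<lambda>q. \<Psi> q $$ (k, k)) p) else 0)"
    if \<pi>: "\<pi> \<in> ?P" for \<pi>
  proof -
    have d: "delbar \<tau> (\<lambda>q. \<Prod>i = 0..<n. \<Psi> q $$ (i, \<pi> i)) p =
        (\<Sum>k = 0..<n. delbar \<tau> (\<lambda>q. \<Psi> q $$ (k, \<pi> k)) p * (\<Prod>i\<in>{0..<n} - {k}. \<Psi> p $$ (i, \<pi> i)))"
      by (rule delbar_prod) (use s[OF \<pi>] in auto)
    show ?thesis
    proof (cases "\<pi> = id")
      case True
      have "(\<Prod>i\<in>{0..<n} - {k}. \<Psi> p $$ (i, i)) = 1" for k unfolding one by (rule prod.neutral) auto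
      then show ?thesis unfolding d using True by (simp add: atLeast0LessThan)
    next
      case False
      have "(\<Prod>i\<in>{0..<n} - {k}. \<Psi> p $$ (i, \<pi> i)) = 0" if k: "k \<in> {0..<n}" for k
      proof -
        have "\<exists>i\<in>{0..<n} - {k}. \<pi> i \<noteq> i"
        proof (rule ccontr)
          assume "\<not> ?thesis"
          then have f: "\<pi> i = i" if "i \<noteq> k" for i
            using that \<pi> permutes_not_in[of \<pi> "{0..<n}" i] by (cases "i \<in> {0..<n}") auto
          have "\<pi> k = k"
          proof (rule ccontr)
            assume "\<pi> k \<noteq> k"
            then have "\<pi> (\<pi> k) = \<pi> k" by (rule f)
            then show False using \<pi> permutes_inj[of \<pi> "{0..<n}"] \<open>\<pi> k \<noteq> k\<close> by (auto dest: injD)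
          qed
          then show False using False f by (metis eq_id_iff)
        qed
        then obtain i where i: "i \<in> {0..<n} - {k}" "\<pi> i \<noteq> i" by blast
        then have "\<Psi> p $$ (i, \<pi> i) = 0" unfolding one using im[OF \<pi>, of i] by simp
        then show ?thesis using i(1) by (intro prod_zero) auto
      qed
      then have "(\<Sum>k = 0..<n. delbar \<tau> (\<lambda>q. \<Psi> q $$ (k, \<pi> k)) p * (\<Prod>i\<in>{0..<n} - {k}. \<Psi> p $$ (i, \<pi> i))) = 0"
        by (intro sum.neutral) simp
      then show ?thesis unfolding d using False by simp
    qed
  qed
  have fin: "finite ?P" by (rule finite_permutations) simp
  have "delbar \<tau> (\<lambda>q. Determinant.det (\<Psi> q)) p =
      delbar \<tau> (\<lambda>q. \<Sum>\<pi>\<in>?P. signof \<pi> * (\<Prod>i = 0..<n. \<Psi> q $$ (i, \<pi> i))) p"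
    by (rule arg_cong[where f = "\<lambda>f. delbar \<tau> f p"]) (rule ext, rule det_def'[OF smooth_matD(1)[OF \<Psi>]])
  also have "\<dots> = (\<Sum>\<pi>\<in>?P. delbar \<tau> (\<lambda>q. signof \<pi> * (\<Prod>i = 0..<n. \<Psi> q $$ (i, \<pi> i))) p)"
    by (rule delbar_sum) (intro smooth_imp_differentiable smooth_mult smooth_const sp)
  also have "\<dots> = (\<Sum>\<pi>\<in>?P. if \<pi> = id then (\<Sum>k<n. delbar \<tau> (\<lambda>q. \<Psi> q $$ (k, k)) p) else 0)"
  proof (rule sum.cong[OF refl])
    fix \<pi> assume \<pi>: "\<pi> \<in> ?P"
    show "delbar \<tau> (\<lambda>q. signof \<pi> * (\<Prod>i = 0..<n. \<Psi> q $$ (i, \<pi> i))) p =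
        (if \<pi> = id then (\<Sum>k<n. delbar \<tau> (\<lambda>q. \<Psi> q $$ (k, k)) p) else 0)"
      unfolding delbar_cmult[OF smooth_imp_differentiable[OF sp[OF \<pi>]]] summand[OF \<pi>] by simp
  qed
  also have "\<dots> = (\<Sum>k<n. delbar \<tau> (\<lambda>q. \<Psi> q $$ (k, k)) p)"
    using permutes_id[of "{0..<n}"] by (simp add: sum.delta[OF fin])
  finally show ?thesis .
qed

text \<open>Jacobi's formula, reduced to the unit matrix: I is the inverse of \<Phi> at the one
  point p, kept constant in q, and det \<Phi> q = det \<Phi> p * det (I \<Phi> q).\<close>

lemma delbar_det:
  assumes \<Phi>: "smooth_mat n n \<Phi>" and I: "I \<in> carrier_mat n n" "I * \<Phi> p = 1\<^sub>m n"
  shows "delbar \<tau> (\<lambda>q. Determinant.det (\<Phi> q)) p =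
    Determinant.det (\<Phi> p) * (\<Sum>k<n. \<Sum>l<n. I $$ (k, l) * delbar \<tau> (\<lambda>q. \<Phi> q $$ (l, k)) p)"
proof -
  note c = smooth_matD(1)[OF \<Phi>]
  have sI: "smooth_mat n n (\<lambda>q. I)" by (rule smooth_matI) (auto simp: I(1) smooth_const)
  have s: "smooth_mat n n (\<lambda>q. I * \<Phi> q)" by (rule smooth_mat_mult[OF sI \<Phi>])
  have PI: "\<Phi> p * I = 1\<^sub>m n" by (rule mat_mult_left_right_inverse[OF I(1) c I(2)])
  have e: "Determinant.det (\<Phi> q) = Determinant.det (\<Phi> p) * Determinant.det (I * \<Phi> q)" for q
  proof -
    have "\<Phi> p * (I * \<Phi> q) = 1\<^sub>m n * \<Phi> q" unfolding assoc_mult_mat[OF c I(1) c, symmetric] PI ..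
    also have "\<dots> = \<Phi> q" by (rule left_mult_one_mat[OF c])
    finally have "Determinant.det (\<Phi> q) = Determinant.det (\<Phi> p * (I * \<Phi> q))" by (rule arg_cong[OF sym])
    also have "\<dots> = Determinant.det (\<Phi> p) * Determinant.det (I * \<Phi> q)" by (rule det_mult[OF c mult_carrier_mat[OF I(1) c]])
    finally show ?thesis .
  qed
  have "delbar \<tau> (\<lambda>q. Determinant.det (\<Phi> q)) p = delbar \<tau> (\<lambda>q. Determinant.det (\<Phi> p) * Determinant.det (I * \<Phi> q)) p"
    by (rule arg_cong[where f = "\<lambda>f. delbar \<tau> f p"]) (rule ext, rule e)
  also have "\<dots> = Determinant.det (\<Phi> p) * (\<Sum>k<n. delbar \<tau> (\<lambda>q. (I * \<Phi> q) $$ (k, k)) p)"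
    unfolding delbar_cmult[OF smooth_imp_differentiable[OF smooth_det[OF s]]] delbar_det_at_one[OF s I(2)] ..
  also have "(\<Sum>k<n. delbar \<tau> (\<lambda>q. (I * \<Phi> q) $$ (k, k)) p) = (\<Sum>k<n. \<Sum>l<n. I $$ (k, l) * delbar \<tau> (\<lambda>q. \<Phi> q $$ (l, k)) p)"
  proof (rule sum.cong[OF refl])
    fix k assume "k \<in> {..<n}"
    then have k: "k < n" by simp
    have d: "(\<lambda>q. \<Phi> q $$ (l, k)) differentiable (at p)" if "l < n" for l
      by (rule smooth_imp_differentiable[OF smooth_matD(2)[OF \<Phi> that k]])
    have "delbar \<tau> (\<lambda>q. \<Sum>l\<in>{..<n}. I $$ (k, l) * \<Phi> q $$ (l, k)) p = (\<Sum>l<n. delbar \<tau> (\<lambda>q. I $$ (k, l) * \<Phi> q $$ (l, k)) p)"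
      by (rule delbar_sum) (intro differentiable_mult differentiable_const d, simp)
    then show "delbar \<tau> (\<lambda>q. (I * \<Phi> q) $$ (k, k)) p = (\<Sum>l<n. I $$ (k, l) * delbar \<tau> (\<lambda>q. \<Phi> q $$ (l, k)) p)"
      unfolding mult_mat_index[OF I(1) c k k] by (simp add: delbar_cmult[OF d])
  qed
  finally show ?thesis .
qed

section \<open>Determinants of the factors of automorphy\<close>

lemma det_shift_mat:
  assumes "n \<ge> 1"
  shows "Determinant.det (shift_mat n) = (-1) ^ (n - 1)"
proof -
  obtain k where n: "n = Suc k" using assms by (cases n) auto
  have del: "mat_delete (shift_mat n) k 0 = 1\<^sub>m k"
  proof (rule eq_matI)
    fix i j assume "i < dim_row (1\<^sub>m k :: complex mat)" "j < dim_col (1\<^sub>m k :: complex mat)"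
    then have ij: "i < k" "j < k" by simp_all
    then show "mat_delete (shift_mat n) k 0 $$ (i, j) = 1\<^sub>m k $$ (i, j)"
      by (auto simp: mat_delete_def shift_mat_def n)
  qed (simp_all add: mat_delete_def shift_mat_def n)
  have "Determinant.det (shift_mat n) = (\<Sum>i<n. shift_mat n $$ (i, 0) * cofactor (shift_mat n) i 0)"
    by (rule laplace_expansion_column[OF shift_mat_carrier]) (simp add: n)
  also have "\<dots> = (\<Sum>i<n. if i = k then cofactor (shift_mat n) i 0 else 0)"
  proof (rule sum.cong[OF refl])
    fix i assume "i \<in> {..<n}"
    then show "shift_mat n $$ (i, 0) * cofactor (shift_mat n) i 0 = (if i = k then cofactor (shift_mat n) i 0 else 0)"
      by (cases "i = k") (auto simp: shift_mat_def n mod_Suc)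
  qed
  also have "\<dots> = (-1) ^ (n - 1)" by (simp add: n cofactor_def del[unfolded n])
  finally show ?thesis .
qed

lemma det_clock_pow:
  assumes "n \<ge> 1"
  shows "Determinant.det (clock_pow n k) = cis (pi * of_int k * (real n - 1))"
proof -
  have p: "(\<Prod>i = 0..<N. cis (t * real i)) = cis (t * (real N * (real N - 1) / 2))" for t N
    by (induction N) (simp_all add: cis_mult field_simps)
  have "Determinant.det (clock_pow n k) = prod_list (diag_mat (clock_pow n k))"
    by (rule det_upper_triangular[OF _ clock_pow_carrier]) (auto simp: upper_triangular_def clock_pow_def)
  also have "\<dots> = (\<Prod>i = 0..<n. cis ((2 * pi * of_int k / real n) * real i))"
    unfolding prod_list_diag_prod by (intro prod.cong) (auto simp: clock_pow_def clock_entry)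
  also have "\<dots> = cis ((2 * pi * of_int k / real n) * (real n * (real n - 1) / 2))" by (rule p)
  also have "(2 * pi * of_int k / real n) * (real n * (real n - 1) / 2) = pi * of_int k * (real n - 1)" using assms by simp
  finally show ?thesis .
qed

lemma det_fac:
  assumes "n \<ge> 1"
  shows "Determinant.det (fac_x (E_bundle \<tau> n a \<mu>) (x, y)) = cis (of_int a * y) * (-1) ^ (n - 1)"
    and "Determinant.det (fac_y (E_bundle \<tau> n a \<mu>) (x, y)) = cis (- (pi * of_int a * (real n - 1)))"
proof -
  have "real n * (of_int a / real n * y) = of_int a * y" using assms by simp
  then have "cis (of_int a / real n * y) ^ n = cis (of_int a * y)" by (simp only: Complex.DeMoivre)
  then show "Determinant.det (fac_x (E_bundle \<tau> n a \<mu>) (x, y)) = cis (of_int a * y) * (-1) ^ (n - 1)"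
    using shift_mat_carrier[of n] by (simp add: det_shift_mat[OF assms])
  show "Determinant.det (fac_y (E_bundle \<tau> n a \<mu>) (x, y)) = cis (- (pi * of_int a * (real n - 1)))"
    by (simp add: det_clock_pow[OF assms])
qed

text \<open>The signs arise because the shift matrix of size \<open>k\<close> has determinant \<open>(- 1) ^ (k - 1)\<close>, and because
  \<open>a m + b n = 2 a m + 1\<close> is odd.\<close>

lemma det_cone_map_antiperiodic:
  fixes a b :: int
  assumes n: "n \<ge> 1" "m \<ge> 1" and bz: "b * int n - a * int m = 1" and M: "M = n + m"
    and \<Phi>: "bundle_map (mapping_cone (E_bundle \<tau> m b \<nu>) (E_bundle \<tau> n a \<mu>) \<psi>) (E_bundle \<tau> M (a + b) \<eta>) \<Phi>"
  shows "Determinant.det (\<Phi> (x + 2 * pi, y)) = - Determinant.det (\<Phi> (x, y))"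
    and "Determinant.det (\<Phi> (x, y + 2 * pi)) = - Determinant.det (\<Phi> (x, y))"
proof -
  let ?F = "E_bundle \<tau> n a \<mu>" and ?E = "E_bundle \<tau> m b \<nu>" and ?H = "E_bundle \<tau> M (a + b) \<eta>"
  have M1: "M \<ge> 1" using n M by simp
  have sm: "smooth_mat M (n + m) \<Phi>" using \<Phi> by (simp add: bundle_map_def mapping_cone_def)
  have c: "\<Phi> p \<in> carrier_mat M M" for p using smooth_matD(1)[OF sm, of p] M by simp
  have fc: "fac_x (E_bundle \<tau> k d \<kappa>) p \<in> carrier_mat k k" "fac_y (E_bundle \<tau> k d \<kappa>) p \<in> carrier_mat k k" for k d \<kappa> p
    using same_rank_E_bundle[of \<tau> k d \<kappa>] unfolding same_rank_def E_bundle_simps(1) by blast+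
  have key: "Determinant.det X * (Determinant.det f * Determinant.det e) = Determinant.det h * Determinant.det Y"
    if "X * four_block_mat f (0\<^sub>m n m) (0\<^sub>m m n) e = h * Y" "X \<in> carrier_mat M M" "Y \<in> carrier_mat M M"
      "f \<in> carrier_mat n n" "e \<in> carrier_mat m m" "h \<in> carrier_mat M M" for X Y f e h :: "complex mat"
  proof -
    have fb: "four_block_mat f (0\<^sub>m n m) (0\<^sub>m m n) e \<in> carrier_mat M M" using that M by simp
    have "Determinant.det (four_block_mat f (0\<^sub>m n m) (0\<^sub>m m n) e) = Determinant.det f * Determinant.det e"
      by (rule det_four_block_mat_lower_left_zero[OF that(4) zero_carrier_mat refl that(5)])
    then show ?thesis using arg_cong[OF that(1), of Determinant.det] det_mult[OF that(2) fb] det_mult[OF that(6,3)] by simp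
  qed
  have X: "\<Phi> (x + 2 * pi, y) * four_block_mat (fac_x ?F (x, y)) (0\<^sub>m n m) (0\<^sub>m m n) (fac_x ?E (x, y)) = fac_x ?H (x, y) * \<Phi> (x, y)"
    and Y: "\<Phi> (x, y + 2 * pi) * four_block_mat (fac_y ?F (x, y)) (0\<^sub>m n m) (0\<^sub>m m n) (fac_y ?E (x, y)) = fac_y ?H (x, y) * \<Phi> (x, y)"
    using \<Phi> unfolding bundle_map_def mapping_cone_def torus_bundle.simps E_bundle_simps(1) by blast+
  have "Determinant.det (\<Phi> (x + 2 * pi, y)) * (cis (of_int a * y) * (-1) ^ (n - 1) * (cis (of_int b * y) * (-1) ^ (m - 1))) =
      cis (of_int (a + b) * y) * (-1) ^ (M - 1) * Determinant.det (\<Phi> (x, y))"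
    using key[OF X c c fc(1) fc(1) fc(1)] unfolding det_fac[OF n(1)] det_fac[OF n(2)] det_fac[OF M1] .
  moreover have "cis (of_int (a + b) * y) = cis (of_int a * y) * cis (of_int b * y)" by (simp add: cis_mult algebra_simps)
  moreover have "(-1 :: complex) ^ (M - 1) = - ((-1) ^ (n - 1) * (-1) ^ (m - 1))"
  proof -
    have "M - 1 = Suc ((n - 1) + (m - 1))" using n M by simp
    then show ?thesis by (simp add: power_add)
  qed
  ultimately have "(cis (of_int a * y) * cis (of_int b * y) * ((-1) ^ (n - 1) * (-1) ^ (m - 1))) * Determinant.det (\<Phi> (x + 2 * pi, y)) =
      (cis (of_int a * y) * cis (of_int b * y) * ((-1) ^ (n - 1) * (-1) ^ (m - 1))) * (- Determinant.det (\<Phi> (x, y)))"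
    by (simp add: mult_ac)
  moreover have "cis (of_int a * y) * cis (of_int b * y) * ((-1) ^ (n - 1) * (-1) ^ (m - 1)) \<noteq> (0 :: complex)" by simp
  ultimately show "Determinant.det (\<Phi> (x + 2 * pi, y)) = - Determinant.det (\<Phi> (x, y))" using mult_left_cancel by blast
  have e: "Determinant.det (\<Phi> (x, y + 2 * pi)) * (cis (- (pi * of_int a * (real n - 1))) * cis (- (pi * of_int b * (real m - 1)))) =
      cis (- (pi * of_int (a + b) * (real M - 1))) * Determinant.det (\<Phi> (x, y))"
    using key[OF Y c c fc(2) fc(2) fc(2)] unfolding det_fac[OF n(1)] det_fac[OF n(2)] det_fac[OF M1] .
  let ?t = "- (pi * of_int a * (real n - 1)) + - (pi * of_int b * (real m - 1))"
  have "of_int b * real n - of_int a * real m = (1 :: real)"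
    using arg_cong[OF bz, of real_of_int] by simp
  then have bz': "of_int b * real n = 1 + of_int a * real m" by simp
  have "of_int (a + b) * (real M - 1) = of_int a * (real n - 1) + of_int b * (real m - 1) + of_int a * real m + of_int b * real n"
    unfolding M by (simp add: algebra_simps)
  also have "\<dots> = of_int a * (real n - 1) + of_int b * (real m - 1) + 1 + 2 * (of_int a * real m)" unfolding bz' by simp
  finally have "- (pi * of_int (a + b) * (real M - 1)) = - pi * (of_int a * (real n - 1) + of_int b * (real m - 1) + 1 + 2 * (of_int a * real m))"
    by (simp only: mult.assoc mult_minus_left)
  also have "\<dots> = (?t + 2 * pi * of_int (- (a * int m))) + - pi" by (simp add: algebra_simps)
  finally have "cis (- (pi * of_int (a + b) * (real M - 1))) = cis ?t * cis (2 * pi * of_int (- (a * int m))) * cis (- pi)"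
    by (simp only: cis_mult)
  also have "\<dots> = - cis ?t" by (subst cis_multiple_2pi) (simp_all add: complex_eq_iff)
  finally have "cis ?t * Determinant.det (\<Phi> (x, y + 2 * pi)) = cis ?t * (- Determinant.det (\<Phi> (x, y)))"
    using e unfolding cis_mult by (simp add: mult_ac)
  then show "Determinant.det (\<Phi> (x, y + 2 * pi)) = - Determinant.det (\<Phi> (x, y))"
    using mult_left_cancel[OF cis_neq_zero] by blast
qed

lemma exponential_ode:
  fixes r :: "real \<Rightarrow> complex"
  assumes "\<And>x. (r has_vector_derivative l * r x) (at x)"
  shows "r x = r 0 * exp (l * of_real x)"
proof -
  have "((\<lambda>x. r x * exp (- l * of_real x)) has_vector_derivative 0) (at x)" for x
  proof -
    have "((\<lambda>z. exp (- l * z)) has_field_derivative exp (- l * of_real x) * (- l)) (at (of_real x))"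
      by (auto intro!: derivative_eq_intros)
    then have "((\<lambda>x. exp (- l * of_real x)) has_vector_derivative exp (- l * of_real x) * (- l)) (at x)"
      by (rule has_vector_derivative_real_field)
    from has_vector_derivative_mult[OF assms this]
    have "((\<lambda>x. r x * exp (- l * of_real x)) has_vector_derivative
      r x * (exp (- l * of_real x) * (- l)) + l * r x * exp (- l * of_real x)) (at x)" .
    moreover have "r x * (exp (- l * of_real x) * (- l)) + l * r x * exp (- l * of_real x) = 0" by (simp only: mult_minus_right mult_ac) simp
    ultimately show ?thesis by (simp only:)
  qed
  then have d: "((\<lambda>x. r x * exp (- l * of_real x)) has_derivative (\<lambda>h. 0)) (at x within UNIV)" for x
    unfolding has_vector_derivative_def scaleR_zero_right .
  have "\<exists>c. \<forall>x\<in>UNIV. r x * exp (- l * of_real x) = c"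
    by (rule has_derivative_zero_constant[OF convex_UNIV d])
  then obtain c where c: "\<And>x. r x * exp (- l * of_real x) = c" by blast
  have "r x * exp (- l * of_real x) = r 0 * exp (- l * of_real 0)" unfolding c ..
  also have "\<dots> = r 0" by simp
  finally have c0: "r x * exp (- l * of_real x) = r 0" .
  have "r x = r x * (exp (- l * of_real x) * exp (l * of_real x))" unfolding exp_add[symmetric] by simp
  also have "\<dots> = r 0 * exp (l * of_real x)" unfolding mult.assoc[symmetric] c0 ..
  finally show ?thesis .
qed

text \<open>Multiplying g by a half-integer character makes it periodic, and its mean in y then
  satisfies m' = (\<theta>/\<tau>) m. A nonzero mean that is 2 pi-periodic in x forces
  \<theta>/\<tau> to be an integral multiple of i.\<close>

lemma antiperiodic_parameter:
  fixes \<tau> \<kappa> :: complex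
  assumes \<tau>: "Im \<tau> > 0" and g: "smooth g" and nz: "g (0, 0) \<noteq> 0"
    and px: "\<And>x y. g (x + 2 * pi, y) = - g (x, y)" and py: "\<And>x y. g (x, y + 2 * pi) = - g (x, y)"
    and ode: "\<And>p. \<tau> * partial_x g p - partial_y g p = - (\<i> * \<kappa> / (2 * of_real pi)) * g p"
  shows "\<exists>k l::int. \<kappa> = 2 * of_real pi * (of_int k + 1 / 2) - 2 * of_real pi * \<tau> * (of_int l + 1 / 2)"
proof -
  have \<tau>0: "\<tau> \<noteq> 0" using \<tau> by auto
  \<comment> \<open>Collects the constant of the equation and the derivatives of the character with
    exponents -1/2 in x and -(k + 1/2) in y.\<close>
  define \<theta> where "\<theta> k = - (\<i> * \<kappa> / (2 * of_real pi)) - \<i> * \<tau> / 2 + \<i> * (of_int k + 1 / 2)" for k :: int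
  define e where "e k = (\<lambda>q::real \<times> real. exp ((- \<i> / 2) * of_real (fst q) + (- \<i> * (of_int k + 1 / 2)) * of_real (snd q)))" for k :: int
  define G where "G k = (\<lambda>q. g q * e k q)" for k
  have de: "e k differentiable (at p)" "partial_x (e k) p = (- \<i> / 2) * e k p" "partial_y (e k) p = (- \<i> * (of_int k + 1 / 2)) * e k p" for k p
    unfolding e_def by (rule partial_character)+
  have se: "smooth (e k)" for k unfolding e_def by (rule smooth_character)
  have sG: "smooth (G k)" for k unfolding G_def by (rule smooth_mult[OF g se])
  have eqG: "\<tau> * partial_x (G k) p = partial_y (G k) p + \<theta> k * G k p" for k p
  proof -
    have alg: "t * (g * (a * e) + gx * e) = (g * (b * e) + gy * e) + ((t * gx - gy) * e + (t * a - b) * (g * e))"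
      for t g a e gx b gy :: complex by (simp add: algebra_simps)
    have "\<tau> * partial_x (G k) p = partial_y (G k) p + ((\<tau> * partial_x g p - partial_y g p) * e k p +
        (\<tau> * (- \<i> / 2) - (- \<i> * (of_int k + 1 / 2))) * (g p * e k p))"
      unfolding G_def partial_mult[OF smooth_imp_differentiable[OF g] de(1)] de(2,3) by (rule alg)
    also have "(\<tau> * partial_x g p - partial_y g p) * e k p + (\<tau> * (- \<i> / 2) - (- \<i> * (of_int k + 1 / 2))) * (g p * e k p) = \<theta> k * G k p"
      unfolding ode \<theta>_def G_def by (simp add: algebra_simps)
    finally show ?thesis .
  qed
  have e2x: "e k (x + 2 * pi, y) = - e k (x, y)" for k x y
  proof -
    have "e k (x + 2 * pi, y) = e k (x, y) * exp (- (\<i> * of_real pi))"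
      unfolding e_def exp_add[symmetric] by (rule arg_cong[where f = exp]) (simp add: algebra_simps)
    then show ?thesis by (simp add: exp_minus)
  qed
  have e2y: "e k (x, y + 2 * pi) = - e k (x, y)" for k x y
  proof -
    have "e k (x, y + 2 * pi) = e k (x, y) * (cis (2 * pi * of_int (- k)) * cis (- pi))"
      unfolding e_def cis_mult cis_conv_exp exp_add[symmetric] by (rule arg_cong[where f = exp]) (simp add: algebra_simps)
    also have "\<dots> = - e k (x, y)" by (subst cis_multiple_2pi) (simp_all add: complex_eq_iff)
    finally show ?thesis .
  qed
  have Gx: "G k (x + 2 * pi, y) = G k (x, y)" and Gy: "G k (x, y + 2 * pi) = G k (x, y)" for k x y
    unfolding G_def px py e2x e2y by simp_all
  have exp_r: "mean_y (G k) x = mean_y (G k) 0 * exp (\<theta> k / \<tau> * of_real x)" for k x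
  proof (rule exponential_ode)
    fix x
    have "\<tau> * mean_y (partial_x (G k)) x = mean_y (\<lambda>p. \<tau> * partial_x (G k) p) x" by (simp only: mean_y_cmult)
    also have "\<dots> = mean_y (partial_y (G k)) x + \<theta> k * mean_y (G k) x"
      unfolding eqG by (simp only: mean_y_add[OF smooth_partial_y[OF sG] smooth_mult[OF smooth_const sG]] mean_y_cmult)
    also have "mean_y (partial_y (G k)) x = 0" by (rule mean_y_partial_y[OF sG Gy])
    finally have "mean_y (partial_x (G k)) x = \<theta> k / \<tau> * mean_y (G k) x" using \<tau>0 by (simp add: field_simps)
    then show "(mean_y (G k) has_vector_derivative \<theta> k / \<tau> * mean_y (G k) x) (at x)" using mean_y_deriv[OF sG, of k x] by simp
  qed
  \<comment> \<open>If all these means vanished at x = 0, so would all Fourier coefficients of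
    \<open>G 0 (0, _)\<close>, and the Fourier series at 0 would give g (0, 0) = 0.\<close>
  obtain k where k: "mean_y (G k) 0 \<noteq> 0"
  proof (rule ccontr)
    assume "\<not> thesis"
    with that have z: "mean_y (G k) 0 = 0" for k by blast
    let ?F = "\<lambda>u. G 0 (0, u)"
    have cont: "continuous_on UNIV ?F" by (rule continuous_slice[OF sG])
    have der: "(?F has_vector_derivative partial_y (G 0) (0, 0)) (at 0)"
      by (rule has_vector_derivative_partial_y[OF smooth_imp_differentiable[OF sG]])
    have "G 0 (0, u) * cis (- of_int k * u) = G k (0, u)" for k u
      unfolding G_def e_def cis_conv_exp mult.assoc exp_add[symmetric] by (simp add: algebra_simps)
    then have "integral {-pi..pi} (\<lambda>u. ?F u * cis (- of_int k * u)) / (2 * pi) = 0" for k :: int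
      using z[of k] by (simp only: mean_y_def)
    then have "(\<lambda>K::nat. 0) \<longlonglongrightarrow> ?F 0" using fourier_series_at_0[OF cont der] by (simp only: sum.neutral_const)
    then have "?F 0 = 0" using LIMSEQ_unique[OF tendsto_const] by metis
    then show False using nz by (simp add: G_def e_def)
  qed
  have "mean_y (G k) (2 * pi) = mean_y (G k) 0" unfolding mean_y_def using Gx[of k 0] by simp
  then have e1: "exp (\<theta> k / \<tau> * of_real (2 * pi)) = 1" using exp_r[of k "2 * pi"] k by simp
  define w where "w = \<theta> k / \<tau>"
  obtain l :: int where l: "Re (w * of_real (2 * pi)) = 0" "Im (w * of_real (2 * pi)) = of_int (2 * l) * pi"
    using e1 unfolding w_def exp_eq_1 by blast
  have "w = \<i> * of_int l" using l by (simp add: complex_eq_iff)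
  then have "\<theta> k / \<tau> = \<i> * of_int l" unfolding w_def .
  then have "\<theta> k = \<i> * of_int l * \<tau>" using \<tau>0 by (simp add: field_simps)
  then have "\<i> * (- (\<kappa> / (2 * of_real pi)) - \<tau> / 2 + (of_int k + 1 / 2)) = \<i> * (of_int l * \<tau>)"
    unfolding \<theta>_def by (simp add: algebra_simps)
  then have "- (\<kappa> / (2 * of_real pi)) - \<tau> / 2 + (of_int k + 1 / 2) = of_int l * \<tau>" by simp
  then have K: "\<kappa> / (2 * of_real pi) = (of_int k + 1 / 2) - \<tau> * (of_int l + 1 / 2)" by (simp add: algebra_simps)
  have "\<kappa> = 2 * of_real pi * (\<kappa> / (2 * of_real pi))" by simp
  then have "\<kappa> = 2 * of_real pi * ((of_int k + 1 / 2) - \<tau> * (of_int l + 1 / 2))" unfolding K .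
  then show ?thesis by (intro exI[of _ k] exI[of _ l]) (simp add: algebra_simps)
qed

section \<open>Sections and the trace of the connection\<close>

text \<open>\<open>E_bundle \<tau> 1 0 0\<close> is the trivial line bundle, and maps out of it are
  sections. This way \<open>bundle_map_zmat\<close> also supplies sections.\<close>

lemma section_of_map:
  assumes "bundle_map (E_bundle \<tau> 1 0 0) (E_bundle \<tau> n a \<mu>) A"
  shows "(\<lambda>q. col (A q) 0) \<in> sections (E_bundle \<tau> n a \<mu>)"
proof -
  let ?E = "E_bundle \<tau> n a \<mu>"
  have sm: "smooth_mat n 1 A" using assms unfolding bundle_map_E_iff by blast
  note c = smooth_matD(1)[OF sm]
  have "shift_mat 1 = 1\<^sub>m 1" "clock_pow 1 0 = 1\<^sub>m 1" by (auto simp: shift_mat_def clock_pow_def)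
  then have f1: "fac_x (E_bundle \<tau> 1 0 0) (x, y) = 1\<^sub>m 1" "fac_y (E_bundle \<tau> 1 0 0) (x, y) = 1\<^sub>m 1" for x y
    by (auto simp: smult_mat_def)
  have fc: "fac_x ?E p \<in> carrier_mat n n" "fac_y ?E p \<in> carrier_mat n n" for p
    using same_rank_E_bundle[of \<tau> n a \<mu>] unfolding same_rank_def E_bundle_simps(1) by blast+
  have e: "A (x + 2 * pi, y) = fac_x ?E (x, y) * A (x, y)" "A (x, y + 2 * pi) = fac_y ?E (x, y) * A (x, y)" for x y
    using assms right_mult_one_mat[OF c] unfolding bundle_map_def f1 by metis+
  have "col (A (x + 2 * pi, y)) 0 = fac_x ?E (x, y) *\<^sub>v col (A (x, y)) 0" for x y
    unfolding e(1) by (rule col_mult2[OF fc(1) c]) simp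
  moreover have "col (A (x, y + 2 * pi)) 0 = fac_y ?E (x, y) *\<^sub>v col (A (x, y)) 0" for x y
    unfolding e(2) by (rule col_mult2[OF fc(2) c]) simp
  moreover have "smooth_vec n (\<lambda>q. col (A q) 0)"
    unfolding smooth_vec_def
  proof (intro conjI allI impI)
    show "col (A p) 0 \<in> carrier_vec n" for p using col_dim[of "A p" 0] c[of p] by (metis carrier_matD(1))
    fix j assume j: "j < n"
    have "vec_index (col (A p) 0) j = A p $$ (j, 0)" for p using c[of p] j by (intro index_col) auto
    then show "smooth (\<lambda>p. vec_index (col (A p) 0) j)" using smooth_matD(2)[OF sm j, of 0] by simp
  qed
  ultimately show ?thesis unfolding sections_def E_bundle_simps(1) by blast
qed

lemma section_smooth: "s \<in> sections (E_bundle \<tau> n a \<mu>) \<Longrightarrow> smooth_vec n s"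
  unfolding sections_def E_bundle_simps(1) by blast

text \<open>Test with Gaussians carrying a phase u. Up to a nonzero factor K u, the vanishing sums
  form a Fourier series in u, and the coefficient of index s is a nonzero multiple of v at s mod
  n.\<close>

lemma gauss_zak_separate:
  assumes n: "n \<ge> 1"
    and z: "\<And>h. schwartz h \<Longrightarrow> (\<Sum>j<n. v j * zak c {s. s mod int n = int j} h p) = 0"
    and j: "j < n"
  shows "v j = 0"
proof -
  obtain x y where p: "p = (x, y)" by fastforce
  define V where "V s = v (nat (s mod int n))" for s
  define a where "a s = exp (- 4 * (of_real pi)\<^sup>2 * (of_int s)\<^sup>2) * cis (c * of_int s * y) * V s" for s
  \<comment> \<open>The linear coefficient 2 x cancels the cross term of (x + 2 pi s)^2, and the
    phase u/(2 pi) turns into the character cis (s u).\<close>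
  define h where "h u = gauss (-1) (2 * of_real x + \<i> * of_real u / (2 * of_real pi))" for u :: real
  define f where "f u s = h u (x + 2 * pi * of_int s) * cis (c * of_int s * y)" for u s
  define K where "K u = exp ((of_real x)\<^sup>2 + \<i> * of_real u * of_real x / (2 * of_real pi))" for u :: real
  have rh: "rapid (h u)" and sh: "schwartz (h u)" for u unfolding h_def by (rule rapid_gauss, simp, rule schwartz_gauss, simp)
  have fV: "f u s * V s = K u * (a s * cis (of_int s * u))" for u s
  proof -
    have "(-1) * (of_real (x + 2 * pi * of_int s))\<^sup>2 + (2 * of_real x + \<i> * of_real u / (2 * of_real pi)) * of_real (x + 2 * pi * of_int s) =
        ((of_real x)\<^sup>2 + \<i> * of_real u * of_real x / (2 * of_real pi)) + (- 4 * (of_real pi)\<^sup>2 * (of_int s)\<^sup>2 + \<i> * of_real (of_int s * u))"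
      by (simp add: power2_eq_square field_simps)
    then have "h u (x + 2 * pi * of_int s) = K u * (exp (- 4 * (of_real pi)\<^sup>2 * (of_int s)\<^sup>2) * cis (of_int s * u))"
      unfolding h_def gauss_def K_def cis_conv_exp exp_add[symmetric] by (rule arg_cong)
    then show ?thesis unfolding f_def a_def by (simp only: mult_ac)
  qed
  have sf: "f u summable_on S" for u S unfolding f_def by (rule zak_summable[OF rh])
  have K: "K u \<noteq> 0" for u by (simp add: K_def)
  have U: "(\<Union>k\<in>{..<n}. {s. s mod int n = int k}) = UNIV"
  proof -
    have "s \<in> (\<Union>k\<in>{..<n}. {s. s mod int n = int k})" for s
    proof -
      have "s mod int n = int (nat (s mod int n))" "nat (s mod int n) \<in> {..<n}" using n by (auto simp: nat_less_iff)
      then show ?thesis by blast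
    qed
    then show ?thesis by blast
  qed
  have "a (int j) = 0"
  proof (rule fourier_series_unique_0)
    have "(\<lambda>s. norm (f 0 s)) summable_on UNIV" unfolding f_def by (rule zak_abs_summable[OF rh])
    then have s: "(\<lambda>s. ((\<Sum>i<n. norm (v i)) / norm (K 0)) * norm (f 0 s)) summable_on UNIV" by (rule summable_on_cmult_right)
    have "norm (a s) \<le> ((\<Sum>i<n. norm (v i)) / norm (K 0)) * norm (f 0 s)" for s
    proof -
      have "a s = f 0 s * V s / K 0" unfolding fV using K[of 0] by simp
      then have "norm (a s) = norm (V s) / norm (K 0) * norm (f 0 s)" by (simp add: norm_mult norm_divide)
      moreover have "norm (V s) \<le> (\<Sum>i<n. norm (v i))"
        unfolding V_def by (rule member_le_sum) (use n in \<open>auto simp: nat_less_iff\<close>)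
      ultimately show ?thesis by (simp add: divide_right_mono mult_right_mono)
    qed
    then show "(\<lambda>s. norm (a s)) summable_on UNIV" by (intro Infinite_Sum.abs_summable_on_comparison_test'[OF s]) blast
    fix u
    have "0 = (\<Sum>k<n. v k * zak c {s. s mod int n = int k} (h u) p)" using z[OF sh] by simp
    also have "\<dots> = (\<Sum>k<n. infsum (\<lambda>s. f u s * V s) {s. s mod int n = int k})"
    proof (intro sum.cong refl)
      fix k assume k: "k \<in> {..<n}"
      have "infsum (\<lambda>s. f u s * V s) {s. s mod int n = int k} = infsum (\<lambda>s. f u s * v k) {s. s mod int n = int k}"
        by (intro infsum_cong) (simp add: V_def)
      also have "\<dots> = infsum (f u) {s. s mod int n = int k} * v k" by (rule infsum_cmult_left')
      also have "infsum (f u) {s. s mod int n = int k} = zak c {s. s mod int n = int k} (h u) p"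
        by (simp add: zak_def p f_def[abs_def])
      finally show "v k * zak c {s. s mod int n = int k} (h u) p = infsum (\<lambda>s. f u s * V s) {s. s mod int n = int k}"
        by (simp only: mult.commute)
    qed
    also have "\<dots> = infsum (\<lambda>s. f u s * V s) (\<Union>k\<in>{..<n}. {s. s mod int n = int k})"
    proof (rule sum_infsum)
      fix k assume k: "k \<in> {..<n}"
      have "(\<lambda>s. f u s * v k) summable_on {s. s mod int n = int k}" by (rule summable_on_cmult_left[OF sf])
      then show "(\<lambda>s. f u s * V s) summable_on {s. s mod int n = int k}"
        by (rule summable_on_cong[THEN iffD1, rotated]) (simp add: V_def)
    qed auto
    also have "infsum (\<lambda>s. f u s * V s) (\<Union>k\<in>{..<n}. {s. s mod int n = int k}) = K u * (\<Sum>\<^sub>\<infinity>s. a s * cis (of_int s * u))"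
      unfolding fV U by (rule infsum_cmult_right')
    finally show "(\<Sum>\<^sub>\<infinity>s. a s * cis (of_int s * u)) = 0" using K[of u] by simp
  qed
  then show ?thesis using j by (simp add: a_def V_def)
qed

text \<open>The values of global sections at a point span the fibre. This turns conditions tested on
  sections, as in \<open>hol_isomorphic\<close>, into identities of matrices.\<close>

lemma sections_separate:
  assumes n: "n \<ge> 1" and A: "A \<in> carrier_mat M n"
    and z: "\<And>s. s \<in> sections (E_bundle \<tau> n a \<mu>) \<Longrightarrow> A *\<^sub>v s p = 0\<^sub>v M"
  shows "A = 0\<^sub>m M n"
proof (rule carrier_mat_eq_iff[OF A zero_carrier_mat, THEN iffD2], intro allI impI)
  fix i j assume i: "i < M" and j: "j < n"
  let ?c = "of_int 0 / real 1 - of_int a / real n"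
  have "A $$ (i, j) = 0"
  proof (rule gauss_zak_separate[OF n _ j, of "\<lambda>l. A $$ (i, l)" ?c p])
    fix h assume h: "schwartz h"
    let ?s = "\<lambda>q. col (zmat n 1 ?c h q) 0"
    have s: "?s \<in> sections (E_bundle \<tau> n a \<mu>)" by (rule section_of_map[OF bundle_map_zmat[OF h refl]])
    have c: "?s p \<in> carrier_vec n" by (simp add: zmat_def)
    have ix: "vec_index (?s p) l = zak ?c {s. s mod int n = int l} h p" if "l < n" for l
      using that by (simp add: zmat_def)
    have "vec_index (A *\<^sub>v ?s p) i = 0" unfolding z[OF s] using i by simp
    then have "(\<Sum>l<n. A $$ (i, l) * vec_index (?s p) l) = 0" unfolding mult_mat_vec_index[OF A c i] .
    moreover have "(\<Sum>l<n. A $$ (i, l) * zak ?c {s. s mod int n = int l} h p) = (\<Sum>l<n. A $$ (i, l) * vec_index (?s p) l)"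
      by (intro sum.cong refl) (simp only: ix lessThan_iff)
    ultimately show "(\<Sum>l<n. A $$ (i, l) * zak ?c {s. s mod int n = int l} h p) = 0" by simp
  qed
  then show "A $$ (i, j) = 0\<^sub>m M n $$ (i, j)" using i j by simp
qed

lemma append_section:
  assumes R: "same_rank E" "same_rank F" and u: "u \<in> sections F" and w: "w \<in> sections E"
  shows "(\<lambda>q. u q @\<^sub>v w q) \<in> sections (mapping_cone E F \<psi>)"
proof -
  have su: "smooth_vec (rank F) u" and sw: "smooth_vec (rank E) w" using u w by (simp_all add: sections_def)
  note uc = smooth_vecD(1)[OF su] and wc = smooth_vecD(1)[OF sw]
  have fc: "fac_x X p \<in> carrier_mat (rank X) (rank X)" "fac_y X p \<in> carrier_mat (rank X) (rank X)"
    if "same_rank X" for X p using that unfolding same_rank_def by blast+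
  have "smooth_vec (rank F + rank E) (\<lambda>q. u q @\<^sub>v w q)"
    unfolding smooth_vec_def
  proof (intro conjI allI impI)
    show "u p @\<^sub>v w p \<in> carrier_vec (rank F + rank E)" for p by (rule append_carrier_vec[OF uc wc])
    fix j assume j: "j < rank F + rank E"
    have ix: "vec_index (u p @\<^sub>v w p) j = (if j < rank F then vec_index (u p) j else vec_index (w p) (j - rank F))" for p
      using carrier_vecD[OF uc[of p]] carrier_vecD[OF wc[of p]] j by simp
    show "smooth (\<lambda>p. vec_index (u p @\<^sub>v w p) j)"
      unfolding ix using smooth_vecD(2)[OF su, of j] smooth_vecD(2)[OF sw, of "j - rank F"] j by (cases "j < rank F") auto
  qed
  moreover have "u (x + 2 * pi, y) = fac_x F (x, y) *\<^sub>v u (x, y)" "u (x, y + 2 * pi) = fac_y F (x, y) *\<^sub>v u (x, y)"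
    "w (x + 2 * pi, y) = fac_x E (x, y) *\<^sub>v w (x, y)" "w (x, y + 2 * pi) = fac_y E (x, y) *\<^sub>v w (x, y)" for x y
    using u w unfolding sections_def by blast+
  ultimately show ?thesis
    unfolding sections_def mapping_cone_def torus_bundle.simps
    by (simp add: mult_mat_vec_split[OF fc(1)[OF R(2)] fc(1)[OF R(1)] uc wc] mult_mat_vec_split[OF fc(2)[OF R(2)] fc(2)[OF R(1)] uc wc])
qed

lemma zero_section: "(\<lambda>q. 0\<^sub>v n) \<in> sections (E_bundle \<tau> n a \<mu>)"
proof -
  have fc: "fac_x (E_bundle \<tau> n a \<mu>) p \<in> carrier_mat n n" "fac_y (E_bundle \<tau> n a \<mu>) p \<in> carrier_mat n n" for p
    using same_rank_E_bundle[of \<tau> n a \<mu>] unfolding same_rank_def E_bundle_simps(1) by blast+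
  show ?thesis
    unfolding sections_def E_bundle_simps(1)
    by (simp add: mult_mat_zero_vec[OF fc(1)] mult_mat_zero_vec[OF fc(2)] smooth_vec_def smooth_const del: E_bundle_simps)
qed

text \<open>Converse to \<open>mapping_cone_isomorphicI\<close>: sections (u, 0) isolate the
  condition on A, sections (0, w) the one on B, and the fibres are spanned by such values.\<close>

lemma mapping_cone_map_holomorphicD:
  assumes n: "n \<ge> 1" "m \<ge> 1"
    and sA: "smooth_mat M n A" and sB: "smooth_mat M m B" and sP: "smooth_mat n m \<psi>"
    and hol: "\<And>s p. s \<in> sections (mapping_cone (E_bundle \<tau> m b \<nu>) (E_bundle \<tau> n a \<mu>) \<psi>) \<Longrightarrow>
      hol_op (E_bundle \<tau> M h \<eta>) (\<lambda>q. hcat (A q) (B q) *\<^sub>v s q) p =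
      hcat (A p) (B p) *\<^sub>v hol_op (mapping_cone (E_bundle \<tau> m b \<nu>) (E_bundle \<tau> n a \<mu>) \<psi>) s p"
  shows "Dmat \<tau> (of_int h / real M - of_int a / real n) (\<eta> / of_nat M - \<mu> / of_nat n) A p = 0\<^sub>m M n"
    and "Dmat \<tau> (of_int h / real M - of_int b / real m) (\<eta> / of_nat M - \<nu> / of_nat m) B p = A p * \<psi> p"
proof -
  let ?F = "E_bundle \<tau> n a \<mu>" and ?E = "E_bundle \<tau> m b \<nu>"
  let ?DA = "Dmat \<tau> (of_int h / real M - of_int a / real n) (\<eta> / of_nat M - \<mu> / of_nat n) A p"
  let ?DB = "Dmat \<tau> (of_int h / real M - of_int b / real m) (\<eta> / of_nat M - \<nu> / of_nat m) B p"
  note Ac = smooth_matD(1)[OF sA] and Bc = smooth_matD(1)[OF sB] and Pc = smooth_matD(1)[OF sP]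
  note DAc = Dmat_carrier[OF Ac] and DBc = Dmat_carrier[OF Bc]
  have key: "?DA *\<^sub>v u p + ?DB *\<^sub>v w p = A p *\<^sub>v (\<psi> p *\<^sub>v w p)" if u: "u \<in> sections ?F" and w: "w \<in> sections ?E" for u w
  proof -
    let ?s = "\<lambda>q. u q @\<^sub>v w q"
    have s: "?s \<in> sections (mapping_cone ?E ?F \<psi>)" by (rule append_section[OF same_rank_E_bundle same_rank_E_bundle u w])
    then have ss: "smooth_vec (n + m) ?s" by (simp add: sections_def mapping_cone_def)
    have uc: "u q \<in> carrier_vec n" and wc: "w q \<in> carrier_vec m" for q
      using smooth_vecD(1)[OF section_smooth[OF u]] smooth_vecD(1)[OF section_smooth[OF w]] .
    have first: "(\<lambda>q. vec_first (?s q) n) = u" and last: "(\<lambda>q. vec_last (?s q) m) = w"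
      by (rule ext, rule vec_first_append[OF uc], rule ext, rule vec_last_append[OF wc])
    note c1 = hol_op_carrier[of u p n \<tau> a \<mu>, OF uc] and c2 = hol_op_carrier[of w p m \<tau> b \<nu>, OF wc]
    note c3 = mult_mat_vec_carrier[OF Pc wc, of p]
    note c4 = add_carrier_vec[OF c1 c3]
    have c5: "(hol_op ?F u p + \<psi> p *\<^sub>v w p) @\<^sub>v hol_op ?E w p \<in> carrier_vec (n + m)" by (rule append_carrier_vec[OF c4 c2])
    have cone: "hol_op (mapping_cone ?E ?F \<psi>) ?s p = (hol_op ?F u p + \<psi> p *\<^sub>v w p) @\<^sub>v hol_op ?E w p"
      unfolding mapping_cone_def torus_bundle.simps E_bundle_simps(1) first vec_last_append[OF wc] ..
    have "(?DA *\<^sub>v u p + A p *\<^sub>v hol_op ?F u p) + (?DB *\<^sub>v w p + B p *\<^sub>v hol_op ?E w p) =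
        A p *\<^sub>v (hol_op ?F u p + \<psi> p *\<^sub>v w p) + B p *\<^sub>v hol_op ?E w p"
      using hol[OF s, of p]
      unfolding hol_op_hcat[OF sA sB ss, of \<tau> h \<eta> p a \<mu> b \<nu>] cone hcat_mult_vec[OF Ac Bc c5] vec_first_append[OF c4] vec_last_append[OF c2]
        first last vec_first_append[OF uc] vec_last_append[OF wc] .
    also have "A p *\<^sub>v (hol_op ?F u p + \<psi> p *\<^sub>v w p) = A p *\<^sub>v hol_op ?F u p + A p *\<^sub>v (\<psi> p *\<^sub>v w p)"
      by (rule mult_add_distrib_mat_vec[OF Ac c1 c3])
    finally have e: "(?DA *\<^sub>v u p + A p *\<^sub>v hol_op ?F u p) + (?DB *\<^sub>v w p + B p *\<^sub>v hol_op ?E w p) =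
        (A p *\<^sub>v hol_op ?F u p + A p *\<^sub>v (\<psi> p *\<^sub>v w p)) + B p *\<^sub>v hol_op ?E w p" .
    have cancel: "x + y = z" if "(x + k) + (y + l) = (k + z) + l" "x \<in> carrier_vec M" "y \<in> carrier_vec M" "z \<in> carrier_vec M"
      "k \<in> carrier_vec M" "l \<in> carrier_vec M" for x y z k l :: "complex Matrix.vec"
    proof (rule eq_vecI)
      fix i assume "i < dim_vec z"
      then have i: "i < M" using that(4) by simp
      have "vec_index ((x + k) + (y + l)) i = vec_index ((k + z) + l) i" unfolding that(1) ..
      then show "vec_index (x + y) i = vec_index z i" using that(2-6) i by simp
    qed (use that in simp)
    show ?thesis
      by (rule cancel[OF e mult_mat_vec_carrier[OF DAc uc] mult_mat_vec_carrier[OF DBc wc] mult_mat_vec_carrier[OF Ac c3]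
        mult_mat_vec_carrier[OF Ac c1] mult_mat_vec_carrier[OF Bc c2]])
  qed
  have z1: "X *\<^sub>v 0\<^sub>v m = 0\<^sub>v M" "Y *\<^sub>v 0\<^sub>v n = 0\<^sub>v M" if "X \<in> carrier_mat M m" "Y \<in> carrier_mat M n" for X Y :: "complex mat"
    using that by (simp_all add: mult_mat_zero_vec)
  show DA: "?DA = 0\<^sub>m M n"
  proof (rule sections_separate[OF n(1) DAc])
    fix u assume u: "u \<in> sections ?F"
    have uc: "u p \<in> carrier_vec n" by (rule smooth_vecD(1)[OF section_smooth[OF u]])
    show "?DA *\<^sub>v u p = 0\<^sub>v M"
      using key[OF u zero_section] right_zero_vec[OF mult_mat_vec_carrier[OF DAc uc]]
      by (simp only: mult_mat_zero_vec[OF Pc] mult_mat_zero_vec[OF Ac] mult_mat_zero_vec[OF DBc])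
  qed
  have AP: "A p * \<psi> p \<in> carrier_mat M m" by (rule mult_carrier_mat[OF Ac Pc])
  have "?DB - A p * \<psi> p = 0\<^sub>m M m"
  proof (rule sections_separate[OF n(2) minus_carrier_mat[OF AP]])
    fix w assume w: "w \<in> sections ?E"
    have wc: "w p \<in> carrier_vec m" by (rule smooth_vecD(1)[OF section_smooth[OF w]])
    have "?DB *\<^sub>v w p = A p *\<^sub>v (\<psi> p *\<^sub>v w p)"
      using key[OF zero_section w] left_zero_vec[OF mult_mat_vec_carrier[OF DBc wc]]
      by (simp only: mult_mat_zero_vec[OF DAc])
    also have "\<dots> = (A p * \<psi> p) *\<^sub>v w p" by (rule assoc_mult_mat_vec[OF Ac Pc wc, symmetric])
    finally have e: "?DB *\<^sub>v w p = (A p * \<psi> p) *\<^sub>v w p" .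
    show "(?DB - A p * \<psi> p) *\<^sub>v w p = 0\<^sub>v M"
      unfolding minus_mult_distrib_mat_vec[OF DBc AP wc] e
      by (rule minus_cancel_vec[OF mult_mat_vec_carrier[OF AP wc]])
  qed
  then have d: "(?DB - A p * \<psi> p) $$ (i, j) = 0" if "i < M" "j < m" for i j using that by simp
  show "?DB = A p * \<psi> p"
  proof (rule carrier_mat_eq_iff[OF DBc AP, THEN iffD2], intro allI impI)
    fix i j assume ij: "i < M" "j < m"
    have "(?DB - A p * \<psi> p) $$ (i, j) = ?DB $$ (i, j) - (A p * \<psi> p) $$ (i, j)"
      by (rule index_minus_mat(1)) (use AP ij in auto)
    then show "?DB $$ (i, j) = (A p * \<psi> p) $$ (i, j)" using d[OF ij] by simp
  qed
qed

text \<open>A diagonal entry of the inverse of \<Phi> times the derivative of \<Phi>: f is a row of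
  the inverse, v the corresponding column of \<Phi>, and r a column of A \<psi> or zero.\<close>

lemma weighted_row_sum:
  fixes c :: complex
  assumes d: "\<And>l. l < M \<Longrightarrow> 2 * d l = c * v l + r l" and v: "(\<Sum>l<M. f l * v l) = 1" and r: "(\<Sum>l<M. f l * r l) = 0"
  shows "2 * (\<Sum>l<(M::nat). f l * d l) = c"
proof -
  have "2 * (\<Sum>l<M. f l * d l) = (\<Sum>l<M. c * (f l * v l) + f l * r l)"
    unfolding sum_distrib_left
  proof (intro sum.cong refl)
    fix l assume "l \<in> {..<M}"
    then have "2 * d l = c * v l + r l" using d by simp
    then have "f l * (2 * d l) = f l * (c * v l + r l)" by simp
    then show "2 * (f l * d l) = c * (f l * v l) + f l * r l" by (simp add: algebra_simps)
  qed
  also have "\<dots> = c" unfolding sum.distrib sum_distrib_left[symmetric] v r by simp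
  finally show ?thesis .
qed

text \<open>The connection matrix of the cone relative to the target is block triangular, so the extension
  class drops out of its trace.\<close>

theorem mapping_cone_isomorphic_parameter:
  fixes \<tau> \<mu> \<nu> \<eta> :: complex and a b :: int
  assumes \<tau>: "Im \<tau> > 0" and n: "n \<ge> 1" "m \<ge> 1" and bz: "b * int n - a * int m = 1" and M: "M = n + m"
    and \<psi>: "bundle_map (E_bundle \<tau> m b \<nu>) (E_bundle \<tau> n a \<mu>) \<psi>"
    and iso: "hol_isomorphic (mapping_cone (E_bundle \<tau> m b \<nu>) (E_bundle \<tau> n a \<mu>) \<psi>) (E_bundle \<tau> M (a + b) \<eta>)"
  shows "\<exists>k l::int. \<eta> - \<mu> - \<nu> = 2 * of_real pi * (of_int k + 1 / 2) - 2 * of_real pi * \<tau> * (of_int l + 1 / 2)"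
proof -
  let ?cone = "mapping_cone (E_bundle \<tau> m b \<nu>) (E_bundle \<tau> n a \<mu>) \<psi>" and ?H = "E_bundle \<tau> M (a + b) \<eta>"
  obtain \<Phi> where \<Phi>: "bundle_map ?cone ?H \<Phi>" and inv: "\<And>p. invertible_mat (\<Phi> p)"
    and hol: "\<And>s p. s \<in> sections ?cone \<Longrightarrow> hol_op ?H (\<lambda>q. \<Phi> q *\<^sub>v s q) p = \<Phi> p *\<^sub>v hol_op ?cone s p"
    using iso unfolding hol_isomorphic_def by blast
  have sm: "smooth_mat M (n + m) \<Phi>" using \<Phi> by (simp add: bundle_map_def mapping_cone_def)
  have smM: "smooth_mat M M \<Phi>" using sm M by simp
  note c = smooth_matD(1)[OF sm] and cM = smooth_matD(1)[OF smM]
  have M1: "M \<ge> 1" using n M by simp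
  define A where "A p = Matrix.mat M n (\<lambda>(i, j). \<Phi> p $$ (i, j))" for p
  define B where "B p = Matrix.mat M m (\<lambda>(i, j). \<Phi> p $$ (i, n + j))" for p
  have Ac: "A p \<in> carrier_mat M n" and Bc: "B p \<in> carrier_mat M m" for p by (simp_all add: A_def B_def)
  have sA: "smooth_mat M n A"
    by (rule smooth_matI[OF Ac]) (use smooth_matD(2)[OF sm] in \<open>simp add: A_def\<close>)
  have sB: "smooth_mat M m B"
    by (rule smooth_matI[OF Bc]) (use smooth_matD(2)[OF sm] in \<open>simp add: B_def\<close>)
  have sP: "smooth_mat n m \<psi>" using \<psi> unfolding bundle_map_E_iff by blast
  have eq: "\<Phi> p = hcat (A p) (B p)" for p
  proof (rule carrier_mat_eq_iff[OF c hcat_carrier[OF Ac Bc], THEN iffD2], intro allI impI)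
    fix i j assume i: "i < M" and j: "j < n + m"
    show "\<Phi> p $$ (i, j) = hcat (A p) (B p) $$ (i, j)"
      by (rule less_add_cases[OF j]) (simp_all add: hcat_index[OF Ac Bc i], simp_all add: A_def B_def i)
  qed
  have eqf: "\<Phi> = (\<lambda>p. hcat (A p) (B p))" using eq by blast
  let ?d1 = "of_int (a + b) / real M - of_int a / real n" and ?k1 = "\<eta> / of_nat M - \<mu> / of_nat n"
  let ?d2 = "of_int (a + b) / real M - of_int b / real m" and ?k2 = "\<eta> / of_nat M - \<nu> / of_nat m"
  note D = mapping_cone_map_holomorphicD[OF n sA sB sP hol[unfolded eq]]
  have DA: "Dmat \<tau> ?d1 ?k1 A p = 0\<^sub>m M n" and DB: "Dmat \<tau> ?d2 ?k2 B p = A p * \<psi> p" for p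
    by (rule D(1), assumption, rule D(2), assumption)
  define C where "C = \<i> / (of_real pi * (cnj \<tau> - \<tau>))"
  define g where "g p = Determinant.det (\<Phi> p)" for p
  have inverse: "\<exists>I. I \<in> carrier_mat M M \<and> I * \<Phi> p = 1\<^sub>m M" for p
  proof -
    obtain I where "inverts_mat (\<Phi> p) I" "inverts_mat I (\<Phi> p)" using inv[of p] unfolding invertible_mat_def by blast
    then have e: "\<Phi> p * I = 1\<^sub>m M" "I * \<Phi> p = 1\<^sub>m (dim_row I)" using cM[of p] unfolding inverts_mat_def by auto
    have "dim_col I = M" using arg_cong[OF e(1), of dim_col] by simp
    moreover have "dim_row I = M" using arg_cong[OF e(2), of dim_col] cM[of p] by simp
    ultimately show ?thesis using e(2) by auto
  qed
  have sg: "smooth g" unfolding g_def[abs_def] by (rule smooth_det[OF smM])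
  have gnz: "g p \<noteq> 0" for p
  proof -
    obtain I where I: "I \<in> carrier_mat M M" "I * \<Phi> p = 1\<^sub>m M" using inverse by blast
    have "Determinant.det I * g p = 1" unfolding g_def det_mult[OF I(1) cM, symmetric] I(2) by simp
    then show ?thesis by auto
  qed
  have dg: "2 * delbar \<tau> g p = C * (\<eta> - \<mu> - \<nu>) * g p" for p
  proof -
    obtain I where I: "I \<in> carrier_mat M M" "I * \<Phi> p = 1\<^sub>m M" using inverse by blast
    note IA = mult_carrier_mat[OF I(1) Ac[of p]] and IB = mult_carrier_mat[OF I(1) Bc[of p]]
    have one: "hcat (I * A p) (I * B p) = 1\<^sub>m M" using I(2) unfolding eq mult_hcat[OF I(1) Ac Bc] .
    have a_ij: "(I * A p) $$ (i, j) = 1\<^sub>m M $$ (i, j)" if "i < M" "j < n" for i j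
      using hcat_index(1)[OF IA IB that] unfolding one by simp
    have b_ij: "(I * B p) $$ (i, j) = 1\<^sub>m M $$ (i, n + j)" if "i < M" "j < m" for i j
      using hcat_index(2)[OF IA IB that] unfolding one by simp
    let ?c1 = "C * (of_real (?d1 * fst p) + ?k1)" and ?c2 = "C * (of_real (?d2 * fst p) + ?k2)"
    have row1: "2 * (\<Sum>l<M. I $$ (k, l) * delbar \<tau> (\<lambda>q. \<Phi> q $$ (l, k)) p) = ?c1" if k: "k < n" for k
    proof (rule weighted_row_sum[where v = "\<lambda>l. A p $$ (l, k)" and r = "\<lambda>l. 0"])
      have kM: "k < M" using k M by simp
      fix l assume l: "l < M"
      have "Dmat \<tau> ?d1 ?k1 A p $$ (l, k) = 0" unfolding DA using l k by simp
      then have "Dop \<tau> ?d1 ?k1 (\<lambda>q. A q $$ (l, k)) p = 0" unfolding Dmat_index[where \<Phi> = A, OF Ac l k] .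
      then show "2 * delbar \<tau> (\<lambda>q. \<Phi> q $$ (l, k)) p = ?c1 * A p $$ (l, k) + 0"
        unfolding eq hcat_index(1)[OF Ac Bc l k] Dop_def C_def by simp
    next
      have kM: "k < M" using k M by simp
      show "(\<Sum>l<M. I $$ (k, l) * A p $$ (l, k)) = 1"
        unfolding mult_mat_index[OF I(1) Ac kM k, symmetric] a_ij[OF kM k] using kM by simp
    qed simp
    have row2: "2 * (\<Sum>l<M. I $$ (n + k, l) * delbar \<tau> (\<lambda>q. \<Phi> q $$ (l, n + k)) p) = ?c2" if k: "k < m" for k
    proof (rule weighted_row_sum[where v = "\<lambda>l. B p $$ (l, k)" and r = "\<lambda>l. (A p * \<psi> p) $$ (l, k)"])
      fix l assume l: "l < M"
      have "Dmat \<tau> ?d2 ?k2 B p $$ (l, k) = (A p * \<psi> p) $$ (l, k)" unfolding DB ..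
      then have "Dop \<tau> ?d2 ?k2 (\<lambda>q. B q $$ (l, k)) p = (A p * \<psi> p) $$ (l, k)" unfolding Dmat_index[where \<Phi> = B, OF Bc l k] .
      then show "2 * delbar \<tau> (\<lambda>q. \<Phi> q $$ (l, n + k)) p = ?c2 * B p $$ (l, k) + (A p * \<psi> p) $$ (l, k)"
        unfolding eq hcat_index(2)[OF Ac Bc l k] Dop_def C_def by (simp only: diff_eq_eq add.commute)
    next
      have kM: "n + k < M" using k M by simp
      show "(\<Sum>l<M. I $$ (n + k, l) * B p $$ (l, k)) = 1"
        unfolding mult_mat_index[OF I(1) Bc kM k, symmetric] b_ij[OF kM k] using kM by simp
      note Pc = smooth_matD(1)[OF sP, of p]
      \<comment> \<open>The rows of I with index at least n annihilate A, hence also A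
        \<psi>.\<close>
      have "(\<Sum>l<M. I $$ (n + k, l) * (A p * \<psi> p) $$ (l, k)) = ((I * A p) * \<psi> p) $$ (n + k, k)"
        unfolding assoc_mult_mat[OF I(1) Ac Pc] mult_mat_index[OF I(1) mult_carrier_mat[OF Ac Pc] kM k] ..
      also have "\<dots> = (\<Sum>j<n. (I * A p) $$ (n + k, j) * \<psi> p $$ (j, k))" by (rule mult_mat_index[OF IA Pc kM k])
      also have "\<dots> = 0"
      proof (rule sum.neutral, rule ballI)
        fix j assume "j \<in> {..<n}"
        then have j: "j < n" by simp
        show "(I * A p) $$ (n + k, j) * \<psi> p $$ (j, k) = 0" unfolding a_ij[OF kM j] using kM j M by simp
      qed
      finally show "(\<Sum>l<M. I $$ (n + k, l) * (A p * \<psi> p) $$ (l, k)) = 0" .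
    qed
    define F where "F k = (\<Sum>l<M. I $$ (k, l) * delbar \<tau> (\<lambda>q. \<Phi> q $$ (l, k)) p)" for k
    have "2 * (\<Sum>k<n + m. F k) = (\<Sum>k<n. 2 * F k) + (\<Sum>k<m. 2 * F (n + k))"
      by (simp only: sum_lessThan_add distrib_left sum_distrib_left)
    also have "(\<Sum>k<n. 2 * F k) = (\<Sum>k<n. ?c1)" unfolding F_def by (intro sum.cong refl row1) simp
    also have "(\<Sum>k<m. 2 * F (n + k)) = (\<Sum>k<m. ?c2)" unfolding F_def by (intro sum.cong refl row2) simp
    also have "(\<Sum>k<n. C * (of_real (d1 * t) + k1)) + (\<Sum>k<m. C * (of_real (d2 * t) + k2)) =
        C * (of_real ((real n * d1 + real m * d2) * t) + (of_nat n * k1 + of_nat m * k2))" for d1 d2 t :: real and k1 k2 :: complex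
      by (simp add: algebra_simps)
    \<comment> \<open>Degrees add: (a + b) - a - b = 0, so the trace does not depend on x.\<close>
    also have "real n * ?d1 + real m * ?d2 = 0"
    proof -
      have "real n * ?d1 + real m * ?d2 = real M * (of_int (a + b) / real M) - (of_int a + of_int b)"
        using n unfolding M of_nat_add by (simp add: right_diff_distrib distrib_right add_divide_distrib)
      then show ?thesis using M1 by simp
    qed
    also have "of_nat n * ?k1 + of_nat m * ?k2 = \<eta> - \<mu> - \<nu>"
    proof -
      have "of_nat n * ?k1 + of_nat m * ?k2 = of_nat M * (\<eta> / of_nat M) - \<mu> - \<nu>"
        using n unfolding M of_nat_add by (simp add: right_diff_distrib distrib_right add_divide_distrib)
      then show ?thesis using M1 by simp
    qed
    finally have tr: "2 * (\<Sum>k<M. \<Sum>l<M. I $$ (k, l) * delbar \<tau> (\<lambda>q. \<Phi> q $$ (l, k)) p) = C * (\<eta> - \<mu> - \<nu>)" unfolding M[symmetric] F_def by simp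
    have "2 * delbar \<tau> g p = g p * (2 * (\<Sum>k<M. \<Sum>l<M. I $$ (k, l) * delbar \<tau> (\<lambda>q. \<Phi> q $$ (l, k)) p))"
      unfolding g_def[abs_def] delbar_det[OF smM I] by simp
    then show ?thesis unfolding tr by simp
  qed
  have e: "\<tau> - cnj \<tau> \<noteq> 0" using \<tau> by (auto simp: complex_eq_iff)
  have ode: "\<tau> * partial_x g p - partial_y g p = - (\<i> * (\<eta> - \<mu> - \<nu>) / (2 * of_real pi)) * g p" for p
  proof -
    have alg: "t = - (\<i> * k / (2 * P)) * G" if "2 * (t / e) = \<i> / (P * (- e)) * k * G" "e \<noteq> 0" "P \<noteq> 0" for t e P k G :: complex
    proof -
      have "t = e / 2 * (2 * (t / e))" using that(2) by simp
      also have "\<dots> = - (\<i> * k / (2 * P)) * G" unfolding that(1) using that(2,3) by (simp add: field_simps)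
      finally show ?thesis .
    qed
    have ce: "cnj \<tau> - \<tau> = - (\<tau> - cnj \<tau>)" by simp
    show ?thesis by (rule alg[OF dg[of p, unfolded delbar_def C_def ce] e]) simp
  qed
  show ?thesis
    by (rule antiperiodic_parameter[OF \<tau> sg gnz _ _ ode])
      (simp_all only: g_def det_cone_map_antiperiodic[OF n bz M \<Phi>])
qed

theorem mainTheorem2:
  fixes \<tau> \<mu> \<nu> \<eta> :: complex and n m :: nat and a b :: int
    and \<psi> :: "real \<times> real \<Rightarrow> complex mat"
  assumes "Im \<tau> > 0"
    and "n \<ge> 1" and "m \<ge> 1"
    and "b * int n - a * int m = 1"
    and "bundle_map (E_bundle \<tau> m b \<nu>) (E_bundle \<tau> n a \<mu>) \<psi>"
    and "\<not> ext1_trivial (E_bundle \<tau> m b \<nu>) (E_bundle \<tau> n a \<mu>) \<psi>"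
  shows "hol_isomorphic (mapping_cone (E_bundle \<tau> m b \<nu>) (E_bundle \<tau> n a \<mu>) \<psi>)
           (E_bundle \<tau> (m + n) (a + b) \<eta>) \<longleftrightarrow>
         (\<exists>k l :: int. \<eta> = \<mu> + \<nu> + of_real pi + of_real pi * \<tau>
                            + 2 * of_real pi * (of_int k + of_int l * \<tau>))"
proof
  assume "hol_isomorphic (mapping_cone (E_bundle \<tau> m b \<nu>) (E_bundle \<tau> n a \<mu>) \<psi>) (E_bundle \<tau> (m + n) (a + b) \<eta>)"
  then obtain k l :: int where kl: "\<eta> - \<mu> - \<nu> = 2 * of_real pi * (of_int k + 1 / 2) - 2 * of_real pi * \<tau> * (of_int l + 1 / 2)"
    using mapping_cone_isomorphic_parameter[OF assms(1-4) add.commute assms(5)] by blast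
  have "\<eta> = \<mu> + \<nu> + (\<eta> - \<mu> - \<nu>)" by simp
  \<comment> \<open>The index - l - 1 comes from - (l + 1/2) = 1/2 + (- l - 1).\<close>
  also have "\<dots> = \<mu> + \<nu> + of_real pi + of_real pi * \<tau> + 2 * of_real pi * (of_int k + of_int (- l - 1) * \<tau>)"
    unfolding kl by (simp add: algebra_simps)
  finally show "\<exists>k l :: int. \<eta> = \<mu> + \<nu> + of_real pi + of_real pi * \<tau> + 2 * of_real pi * (of_int k + of_int l * \<tau>)" by blast
next
  assume "\<exists>k l :: int. \<eta> = \<mu> + \<nu> + of_real pi + of_real pi * \<tau> + 2 * of_real pi * (of_int k + of_int l * \<tau>)"
  then obtain k l :: int where kl: "\<eta> = \<mu> + \<nu> + of_real pi + of_real pi * \<tau> + 2 * of_real pi * (of_int k + of_int l * \<tau>)" by blast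
  \<comment> \<open>The odd integers c = - (1 + 2 k) and d = 1 + 2 l put the parameter in the form
    required by \<open>mapping_cone_isomorphic\<close>.\<close>
  have "\<eta> - \<mu> - \<nu> = - (of_real pi * of_int (- (1 + 2 * k))) + of_real pi * \<tau> * of_int (1 + 2 * l)"
    unfolding kl by (simp add: algebra_simps)
  then show "hol_isomorphic (mapping_cone (E_bundle \<tau> m b \<nu>) (E_bundle \<tau> n a \<mu>) \<psi>) (E_bundle \<tau> (m + n) (a + b) \<eta>)"
    by (rule mapping_cone_isomorphic[OF assms(1-6), rotated 2]) (simp_all add: add.commute)
qed

end
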